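(* Let $f:\mathcal I\to\mathbb{C}$ be multiplicative with $|f(\mathfrak a)|\le1$ for all $\mathfrak a$. Let $J=[\theta_1,\theta_2)\subset[0,\pi/2)$ and $\delta_J=|J|/(\pi/2)$. For $m\in\mathbb{Z}$ and $x\ge3$ set \[ M_m(x):=\min_{|t|\le\log x}\ \sum_{\mathrm{N}\mathfrak p\le x}\frac{1-\Re\bigl(f(\mathfrak p)\lambda_m(\mathfrak p)(\mathrm{N}\mathfrak p)^{-it}\bigr)}{\mathrm{N}\mathfrak p} \] (sum over prime ideals of $\mathbb{Z}[i]$). Assume $\lim_{x\to\infty}M_m(x)=+\infty$ for every integer $m\ne0$. Then \[ \sum_{\substack{\mathrm{N}\mathfrak a\le x\\ \arg(\mathfrak a)\in J}} f(\mathfrak a)=\delta_J\sum_{\mathrm{N}\mathfrak a\le x}f(\mathfrak a)+o(x)\qquad(x\to\infty). \] If in addition $\lim_{x\to\infty}M_0(x)=+\infty$, then $\sum_{\mathrm{N}\mathfrak a\le x}f(\mathfrak a)=o(x)$ and hence $\sum_{\mathrm{N}\mathfrak a\le x,\ \arg(\mathfrak a)\in J}f(\mathfrak a)=o(x)$.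
   Context: $\mathcal I$ is the set of nonzero ideals of $\mathbb{Z}[i]$, $\mathrm{N}$ the ideal norm; $f$ multiplicative means $f(\mathbb{Z}[i])=1$ and $f(\mathfrak a\mathfrak b)=f(\mathfrak a)f(\mathfrak b)$ for coprime $\mathfrak a,\mathfrak b$. For each $\mathfrak a\in\mathcal I$, let $z_{\mathfrak a}$ be its unique generator with $0\le\arg z_{\mathfrak a}<\pi/2$; set $\arg(\mathfrak a):=\arg z_{\mathfrak a}$ and $\lambda_m(\mathfrak a):=e^{4im\arg(\mathfrak a)}$ for $m\in\mathbb{Z}$ (a completely multiplicative function on ideals). *)

theory Defs
  imports
    "HOL-Analysis.Analysis"
    "HOL-Algebra.Ideal_Product"
    "HOL-Algebra.QuotRing"
    "HOL-Library.Landau_Symbols"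
begin

definition gauss_ring :: "complex ring" where
  "gauss_ring = \<lparr>carrier = {z. Re z \<in> \<int> \<and> Im z \<in> \<int>}, mult = (*), one = 1, zero = 0, add = (+)\<rparr>"

definition nonzero_ideals :: "complex set set" where
  "nonzero_ideals = {I. ideal I gauss_ring \<and> I \<noteq> {\<zero>\<^bsub>gauss_ring\<^esub>}}"

text \<open>The zero ideal is a prime ideal of the domain \<open>\<int>[i]\<close> for the library; the sums over
  primes range over nonzero prime ideals only.\<close>

definition prime_ideals :: "complex set set" where
  "prime_ideals = {P \<in> nonzero_ideals. primeideal P gauss_ring}"

definition ideal_norm :: "complex set \<Rightarrow> nat" where
  "ideal_norm I = card (carrier (gauss_ring Quot I))"

definition coprime_ideals :: "complex set \<Rightarrow> complex set \<Rightarrow> bool" where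
  "coprime_ideals I J \<longleftrightarrow> I <+>\<^bsub>gauss_ring\<^esub> J = carrier gauss_ring"

definition multiplicative_on_ideals :: "(complex set \<Rightarrow> complex) \<Rightarrow> bool" where
  "multiplicative_on_ideals f \<longleftrightarrow>
     f (carrier gauss_ring) = 1 \<and>
     (\<forall>I\<in>nonzero_ideals. \<forall>J\<in>nonzero_ideals.
        coprime_ideals I J \<longrightarrow> f (ideal_prod gauss_ring I J) = f I * f J)"

text \<open>\<^const>\<open>Arg\<close> takes values in \<open>(-\<pi>, \<pi>]\<close>, so the condition below selects the generator in
  the quarter plane \<open>0 \<le> arg z < \<pi>/2\<close>.  It is used for nonzero ideals only.\<close>

definition ideal_gen :: "complex set \<Rightarrow> complex" where
  "ideal_gen I = (THE z. z \<in> carrier gauss_ring \<and> cgenideal gauss_ring z = I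
                         \<and> 0 \<le> Arg z \<and> Arg z < pi / 2)"

definition ideal_arg :: "complex set \<Rightarrow> real" where
  "ideal_arg I = Arg (ideal_gen I)"

definition ideal_lambda :: "int \<Rightarrow> complex set \<Rightarrow> complex" where
  "ideal_lambda m I = exp (4 * \<i> * of_int m * of_real (ideal_arg I))"

definition pretentious_sum :: "(complex set \<Rightarrow> complex) \<Rightarrow> int \<Rightarrow> real \<Rightarrow> real \<Rightarrow> real" where
  "pretentious_sum f m x t =
     (\<Sum>P | P \<in> prime_ideals \<and> real (ideal_norm P) \<le> x.
        (1 - Re (f P * ideal_lambda m P * of_nat (ideal_norm P) powr (- (\<i> * of_real t))))
          / real (ideal_norm P))"

definition min_distance :: "(complex set \<Rightarrow> complex) \<Rightarrow> int \<Rightarrow> real \<Rightarrow> real" where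
  "min_distance f m x = (INF t\<in>{t. \<bar>t\<bar> \<le> ln x}. pretentious_sum f m x t)"

text \<open>The infimum is a minimum.\<close>

lemma min_distance_attained:
  assumes "x \<ge> 1"
  shows "\<exists>t. \<bar>t\<bar> \<le> ln x \<and> min_distance f m x = pretentious_sum f m x t
             \<and> (\<forall>s. \<bar>s\<bar> \<le> ln x \<longrightarrow> pretentious_sum f m x t \<le> pretentious_sum f m x s)"
proof -
  have S: "{t. \<bar>t\<bar> \<le> ln x} = {- ln x..ln x}" by auto
  have pw: "continuous_on A (\<lambda>t. (of_nat n :: complex) powr (- (\<i> * of_real t)))" for n :: nat and A
    by (cases "n = 0") (auto simp: powr_def intro!: continuous_intros)
  have "continuous_on {- ln x..ln x} (pretentious_sum f m x)"
    unfolding pretentious_sum_def divide_inverse by (intro continuous_intros pw)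
  then obtain t where t: "t \<in> {- ln x..ln x}"
    and le: "\<forall>s\<in>{- ln x..ln x}. pretentious_sum f m x t \<le> pretentious_sum f m x s"
    using continuous_attains_inf[of "{- ln x..ln x}" "pretentious_sum f m x"] assms by auto
  have "min_distance f m x = pretentious_sum f m x t"
    unfolding min_distance_def S using t le
    by (intro cInf_eq_minimum) auto
  then show ?thesis using t le S by blast
qed

lemma domain_gauss_ring: "domain gauss_ring"
proof -
  have "cring gauss_ring"
  proof (rule cringI)
    show "abelian_group gauss_ring"
    proof (rule abelian_groupI)
      fix z assume "z \<in> carrier gauss_ring"
      then show "\<exists>y\<in>carrier gauss_ring. y \<oplus>\<^bsub>gauss_ring\<^esub> z = \<zero>\<^bsub>gauss_ring\<^esub>"
        by (intro bexI[of _ "- z"]) (auto simp: gauss_ring_def)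
    qed (auto simp: gauss_ring_def)
    show "comm_monoid gauss_ring"
      by (rule comm_monoidI) (auto simp: gauss_ring_def)
  qed (auto simp: gauss_ring_def algebra_simps)
  then show ?thesis
    by (rule domain.intro) (unfold_locales, auto simp: gauss_ring_def)
qed


lemma nonzero_idealsD:
  assumes "I \<in> nonzero_ideals"
  shows "ideal I gauss_ring"
    and "I \<subseteq> carrier gauss_ring"
    and "0 \<in> I"
    and "\<And>a b. a \<in> I \<Longrightarrow> b \<in> I \<Longrightarrow> a + b \<in> I"
    and "\<And>a b. a \<in> I \<Longrightarrow> b \<in> carrier gauss_ring \<Longrightarrow> b * a \<in> I"
    and "\<And>a. a \<in> I \<Longrightarrow> - a \<in> I"
    and "\<exists>a\<in>I. a \<noteq> 0"
proof -
  show I: "ideal I gauss_ring" using assms by (simp add: nonzero_ideals_def)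
  then interpret ideal I gauss_ring .
  have sel [simp]: "mult gauss_ring = (*)" "add gauss_ring = (+)" "zero gauss_ring = 0"
    by (auto simp: gauss_ring_def)
  show "I \<subseteq> carrier gauss_ring" by (rule a_subset)
  show z: "0 \<in> I" using additive_subgroup.zero_closed[OF is_additive_subgroup] by simp
  show "a + b \<in> I" if "a \<in> I" "b \<in> I" for a b using additive_subgroup.a_closed[OF is_additive_subgroup that] by simp
  show m: "b * a \<in> I" if "a \<in> I" "b \<in> carrier gauss_ring" for a b
    using I_l_closed[OF that] by simp
  show "- a \<in> I" if "a \<in> I" for a
    using m[OF that, of "- 1"] by (simp add: gauss_ring_def)
  show "\<exists>a\<in>I. a \<noteq> 0" using assms z by (auto simp: nonzero_ideals_def)
qed

lemma cgenideal_gauss_ring: "cgenideal gauss_ring z = {x * z | x. x \<in> carrier gauss_ring}"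
  by (simp add: cgenideal_def gauss_ring_def)

lemma gauss_ring_closed:
  assumes "a \<in> carrier gauss_ring" "b \<in> carrier gauss_ring"
  shows "a * b \<in> carrier gauss_ring" "a + b \<in> carrier gauss_ring" "- a \<in> carrier gauss_ring"
    and "\<i> \<in> carrier gauss_ring" "1 \<in> carrier gauss_ring" "of_nat n \<in> carrier gauss_ring"
  using assms by (auto simp: gauss_ring_def)

lemma gauss_ring_norm_int:
  assumes "c \<in> carrier gauss_ring"
  shows "\<exists>k::int. (cmod c)\<^sup>2 = of_int k"
proof -
  obtain u v :: int where uv: "Re c = of_int u" "Im c = of_int v"
    using assms by (auto simp: gauss_ring_def elim!: Ints_cases)
  have "(cmod c)\<^sup>2 = of_int (u\<^sup>2 + v\<^sup>2)" by (simp add: cmod_power2 uv)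
  then show ?thesis by blast
qed

lemma gauss_ring_units:
  assumes "a \<in> carrier gauss_ring" "b \<in> carrier gauss_ring" "a * b = 1"
  shows "a \<in> {1, - 1, \<i>, - \<i>}"
proof -
  obtain k l :: int where k: "(cmod a)\<^sup>2 = of_int k" and l: "(cmod b)\<^sup>2 = of_int l"
    using gauss_ring_norm_int assms by meson
  have "(cmod a)\<^sup>2 * (cmod b)\<^sup>2 = 1"
    using assms(3) by (metis norm_mult norm_one power_mult_distrib power_one)
  then have "k * l = 1" unfolding k l by (metis of_int_eq_1_iff of_int_mult)
  moreover have "k \<ge> 0" using k by (metis of_int_0_le_iff zero_le_power2)
  ultimately have "k = 1" by (auto simp: zmult_eq_1_iff)
  obtain u v :: int where uv: "Re a = of_int u" "Im a = of_int v"
    using assms(1) by (auto simp: gauss_ring_def elim!: Ints_cases)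
  have "u\<^sup>2 + v\<^sup>2 = 1"
    using k \<open>k = 1\<close> unfolding cmod_power2 uv by (simp flip: of_int_power of_int_add)
  then have "u\<^sup>2 \<le> 1" "v\<^sup>2 \<le> 1" by (smt (verit) zero_le_power2)+
  then have "u \<in> {-1, 0, 1}" "v \<in> {-1, 0, 1}"
    by (auto simp: abs_square_le_1)
  then show ?thesis using \<open>u\<^sup>2 + v\<^sup>2 = 1\<close> uv by (auto simp: complex_eq_iff)
qed

lemma Arg_quarter_iff:
  assumes "z \<noteq> 0"
  shows "0 \<le> Arg z \<and> Arg z < pi / 2 \<longleftrightarrow> 0 < Re z \<and> 0 \<le> Im z"
  using assms Arg_Re_pos[of z] Arg_less_0[of z] by auto

text \<open>The generator selected by \<^const>\<open>ideal_gen\<close> exists and is unique.\<close>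

lemma ideal_gen_unique:
  assumes "I \<in> nonzero_ideals"
  shows "\<exists>!z. z \<in> carrier gauss_ring \<and> cgenideal gauss_ring z = I \<and> 0 \<le> Arg z \<and> Arg z < pi / 2"
proof -
  note I = nonzero_idealsD[OF assms]
  define N where "N w = nat \<lfloor>(cmod w)\<^sup>2\<rfloor>" for w
  obtain w where w: "w \<in> I" "w \<noteq> 0" and min: "\<And>v. v \<in> I \<Longrightarrow> v \<noteq> 0 \<Longrightarrow> N w \<le> N v"
    using ex_has_least_nat[of "\<lambda>w. w \<in> I \<and> w \<noteq> 0" _ N] I(7) by blast
  have N: "real (N c) = (cmod c)\<^sup>2" if "c \<in> carrier gauss_ring" for c
  proof -
    obtain k :: int where "(cmod c)\<^sup>2 = of_int k" using gauss_ring_norm_int \<open>c \<in> carrier gauss_ring\<close> by blast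
    moreover from this have "k \<ge> 0" by (metis of_int_0_le_iff zero_le_power2)
    ultimately show ?thesis by (simp add: N_def)
  qed
  have gen: "\<exists>q\<in>carrier gauss_ring. v = q * w" if v: "v \<in> I" for v
  proof -
    define q where "q = Complex (of_int (round (Re (v / w)))) (of_int (round (Im (v / w))))"
    have q: "q \<in> carrier gauss_ring" by (simp add: q_def gauss_ring_def)
    have "v + (- q) * w \<in> I" by (rule I(4)[OF v I(5)[OF w(1) gauss_ring_closed(3)[OF q q]]])
    then have r: "v - q * w \<in> I" by simp
    have "\<bar>Re (v / w - q)\<bar> \<le> 1 / 2" "\<bar>Im (v / w - q)\<bar> \<le> 1 / 2"
      unfolding q_def using of_int_round_abs_le[of "Re (v / w)"] of_int_round_abs_le[of "Im (v / w)"]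
      by (simp_all add: abs_minus_commute)
    then have "(Re (v / w - q))\<^sup>2 \<le> (1 / 2)\<^sup>2" "(Im (v / w - q))\<^sup>2 \<le> (1 / 2)\<^sup>2"
      by (simp_all add: abs_le_square_iff[symmetric])
    then have "(cmod (v / w - q))\<^sup>2 < 1" unfolding cmod_power2 by (simp add: power2_eq_square)
    moreover have "v - q * w = (v / w - q) * w" using w(2) by (simp add: field_simps)
    ultimately have "(cmod (v - q * w))\<^sup>2 < (cmod w)\<^sup>2"
      using w(2) by (simp add: norm_mult power_mult_distrib)
    moreover have "v - q * w \<in> carrier gauss_ring" "w \<in> carrier gauss_ring" using r w(1) I(2) by auto
    ultimately have "real (N (v - q * w)) < real (N w)" by (simp add: N)
    then have "N (v - q * w) < N w" by simp
    then have "v - q * w = 0" using min[OF r] by auto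
    then show ?thesis using q by auto
  qed
  have wc: "w \<in> carrier gauss_ring" using w I(2) by blast
  define P where "P z \<longleftrightarrow> z \<in> carrier gauss_ring \<and> cgenideal gauss_ring z = I
    \<and> 0 \<le> Arg z \<and> Arg z < pi / 2" for z
  have P: "P z \<longleftrightarrow> z \<in> I \<and> (\<exists>q\<in>carrier gauss_ring. w = q * z) \<and> 0 < Re z \<and> 0 \<le> Im z" for z
  proof
    assume "P z"
    then have eq: "{x * z | x. x \<in> carrier gauss_ring} = I"
      and A: "0 \<le> Arg z" "Arg z < pi / 2" by (auto simp: P_def cgenideal_gauss_ring)
    have "z = 1 * z" by simp
    then have "z \<in> I" using eq gauss_ring_closed(5)[OF wc wc] by blast
    moreover have "\<exists>q\<in>carrier gauss_ring. w = q * z" using eq w(1) by blast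
    ultimately show "z \<in> I \<and> (\<exists>q\<in>carrier gauss_ring. w = q * z) \<and> 0 < Re z \<and> 0 \<le> Im z"
      using Arg_quarter_iff[of z] A w(2) by auto
  next
    assume z: "z \<in> I \<and> (\<exists>q\<in>carrier gauss_ring. w = q * z) \<and> 0 < Re z \<and> 0 \<le> Im z"
    then obtain q where q: "q \<in> carrier gauss_ring" "w = q * z" by blast
    have "cgenideal gauss_ring z = I"
    proof
      show "cgenideal gauss_ring z \<subseteq> I" using z I(5) by (auto simp: cgenideal_gauss_ring)
      show "I \<subseteq> cgenideal gauss_ring z"
      proof
        fix v assume "v \<in> I"
        then obtain p where p: "p \<in> carrier gauss_ring" "v = p * w" using gen by blast
        then have "v = (p * q) * z" using q by simp
        then show "v \<in> cgenideal gauss_ring z"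
          using gauss_ring_closed(1)[OF p(1) q(1)] by (auto simp: cgenideal_gauss_ring)
      qed
    qed
    moreover have "z \<noteq> 0" using z by auto
    ultimately show "P z" using z I(2) Arg_quarter_iff[of z] by (auto simp: P_def)
  qed
  have "\<exists>z. P z"
  proof -
    have "0 < Re (1 * w) \<and> 0 \<le> Im (1 * w) \<or> 0 < Re (- 1 * w) \<and> 0 \<le> Im (- 1 * w)
      \<or> 0 < Re (\<i> * w) \<and> 0 \<le> Im (\<i> * w) \<or> 0 < Re (- \<i> * w) \<and> 0 \<le> Im (- \<i> * w)"
      using w(2) by (auto simp: complex_eq_iff)
    then have "\<exists>u\<in>{1, - 1, \<i>, - \<i>}. 0 < Re (u * w) \<and> 0 \<le> Im (u * w)" by blast
    then obtain u where u: "u \<in> {1, - 1, \<i>, - \<i>}" "0 < Re (u * w)" "0 \<le> Im (u * w)" by blast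
    have uc: "u \<in> carrier gauss_ring" "cnj u \<in> carrier gauss_ring" "w = cnj u * (u * w)"
      using u(1) by (auto simp: gauss_ring_def)
    then show ?thesis unfolding P using u I(5)[OF w(1)] by blast
  qed
  moreover have "y = z" if "P y" "P z" for y z
  proof -
    from that have *: "0 < Re z" "0 \<le> Im z" "0 < Re y" "0 \<le> Im y" and yz: "y \<in> I" "z \<in> I"
      unfolding P by auto
    have "y \<in> cgenideal gauss_ring z" "z \<in> cgenideal gauss_ring y"
      using that yz unfolding P_def by auto
    then obtain a b where ab: "a \<in> carrier gauss_ring" "b \<in> carrier gauss_ring" "y = a * z" "z = b * y"
      unfolding cgenideal_gauss_ring by blast
    have "a * b * y = y" using ab(3,4) by (metis mult.assoc)
    moreover have "y \<noteq> 0" using * by auto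
    ultimately have "a * b = 1" by simp
    then have "a \<in> {1, - 1, \<i>, - \<i>}" using gauss_ring_units ab by blast
    then show ?thesis using * ab(3) by auto
  qed
  ultimately show ?thesis unfolding P_def by blast
qed

text \<open>All sums above are finite, and \<^const>\<open>ideal_norm\<close> is the cardinality of a finite set.\<close>

lemma gauss_ring_box:
  assumes "z \<in> carrier gauss_ring" "n > 0"
  shows "\<exists>a b. a < n \<and> b < n \<and>
    (\<exists>q\<in>carrier gauss_ring. z = q * of_nat n + Complex (of_nat a) (of_nat b))"
proof -
  obtain u v :: int where uv: "Re z = of_int u" "Im z = of_int v"
    using assms(1) by (auto simp: gauss_ring_def elim!: Ints_cases)
  have mod: "real_of_int k = of_int (k div int n) * of_nat n + of_nat (nat (k mod int n))" for k
  proof -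
    have "k = (k div int n) * int n + int (nat (k mod int n))" using assms(2) by simp
    then show ?thesis by (metis of_int_add of_int_mult of_int_of_nat_eq)
  qed
  have "z = Complex (of_int (u div int n)) (of_int (v div int n)) * of_nat n
    + Complex (of_nat (nat (u mod int n))) (of_nat (nat (v mod int n)))"
    using mod[of u] mod[of v] uv by (simp add: complex_eq_iff)
  moreover have "nat (u mod int n) < n" "nat (v mod int n) < n"
    using assms(2) by (simp_all add: nat_less_iff)
  moreover have "Complex (of_int (u div int n)) (of_int (v div int n)) \<in> carrier gauss_ring"
    by (simp add: gauss_ring_def)
  ultimately show ?thesis by blast
qed

lemma finite_gauss_ring_Quot:
  assumes "I \<in> nonzero_ideals"
  shows "finite (carrier (gauss_ring Quot I))"
proof -
  note I = nonzero_idealsD[OF assms]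
  interpret ideal I gauss_ring by (rule I)
  obtain w where w: "w \<in> I" "w \<noteq> 0" using I(7) by blast
  obtain u v :: int where uv: "Re w = of_int u" "Im w = of_int v"
    using w(1) I(2) by (auto simp: gauss_ring_def elim!: Ints_cases)
  define n where "n = nat (u\<^sup>2 + v\<^sup>2)"
  have "u \<noteq> 0 \<or> v \<noteq> 0" using w(2) uv by (auto simp: complex_eq_iff)
  then have pos: "u\<^sup>2 + v\<^sup>2 > 0" by (simp add: sum_power2_gt_zero_iff)
  then have "n > 0" by (simp add: n_def)
  have "real n = (Re w)\<^sup>2 + (Im w)\<^sup>2" using pos uv by (simp add: n_def)
  then have "of_nat n = cnj w * w"
    by (auto simp: complex_eq_iff power2_eq_square)
  moreover have "cnj w \<in> carrier gauss_ring" using w(1) I(2) by (auto simp: gauss_ring_def)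
  ultimately have nI: "of_nat n \<in> I" using I(5) w(1) by metis
  have "carrier (gauss_ring Quot I) \<subseteq>
    (\<lambda>(a, b). I +>\<^bsub>gauss_ring\<^esub> Complex (of_nat a) (of_nat b)) ` ({..<n} \<times> {..<n})"
  proof
    fix X assume "X \<in> carrier (gauss_ring Quot I)"
    then obtain z where z: "z \<in> carrier gauss_ring" "X = I +>\<^bsub>gauss_ring\<^esub> z"
      by (auto simp: FactRing_def A_RCOSETS_def')
    obtain a b q where ab: "a < n" "b < n" "q \<in> carrier gauss_ring"
      "z = q * of_nat n + Complex (of_nat a) (of_nat b)"
      using gauss_ring_box[OF z(1) \<open>n > 0\<close>] by blast
    have "Complex (of_nat a) (of_nat b) \<in> carrier gauss_ring" by (simp add: gauss_ring_def)
    moreover have "z \<in> I +>\<^bsub>gauss_ring\<^esub> Complex (of_nat a) (of_nat b)"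
      using ab(4) I(5)[OF nI ab(3)] by (auto simp: a_r_coset_def' gauss_ring_def)
    ultimately have "X = I +>\<^bsub>gauss_ring\<^esub> Complex (of_nat a) (of_nat b)"
      using z(2) a_repr_independence' by metis
    then show "X \<in> (\<lambda>(a, b). I +>\<^bsub>gauss_ring\<^esub> Complex (of_nat a) (of_nat b)) ` ({..<n} \<times> {..<n})"
      using ab by auto
  qed
  then show ?thesis by (rule finite_subset) auto
qed

lemma finite_ideals_le: "finite {I \<in> nonzero_ideals. real (ideal_norm I) \<le> x}"
proof -
  define B where "B n = (\<lambda>(a, b). Complex (of_nat a) (of_nat b)) ` ({..<n} \<times> {..<n})" for n :: nat
  define S where "S n = {I \<in> nonzero_ideals. of_nat n \<in> I}" for n :: nat
  have fin: "finite (S n)" if "n > 0" for n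
  proof (rule finite_imageD)
    show "finite ((\<lambda>I. I \<inter> B n) ` S n)"
      by (rule finite_subset[of _ "Pow (B n)"]) (auto simp: B_def)
    show "inj_on (\<lambda>I. I \<inter> B n) (S n)"
    proof (rule inj_onI)
      have sub: "I \<subseteq> J" if "I \<in> S n" "J \<in> S n" "I \<inter> B n \<subseteq> J" for I J
      proof
        fix z assume "z \<in> I"
        have nz: "I \<in> nonzero_ideals" "J \<in> nonzero_ideals" and n: "of_nat n \<in> I" "of_nat n \<in> J"
          using that by (auto simp: S_def)
        note I = nonzero_idealsD[OF nz(1)] and J = nonzero_idealsD[OF nz(2)]
        have "z \<in> carrier gauss_ring" using I(2) \<open>z \<in> I\<close> by blast
        then obtain a b q where ab: "a < n" "b < n" "q \<in> carrier gauss_ring"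
          "z = q * of_nat n + Complex (of_nat a) (of_nat b)"
          using gauss_ring_box \<open>n > 0\<close> by blast
        have "Complex (of_nat a) (of_nat b) = z + - (q * of_nat n)" using ab by simp
        then have "Complex (of_nat a) (of_nat b) \<in> I"
          using I(4)[OF \<open>z \<in> I\<close> I(6)[OF I(5)[OF n(1) ab(3)]]] by metis
        moreover have "Complex (of_nat a) (of_nat b) \<in> B n" using ab by (auto simp: B_def)
        ultimately have "Complex (of_nat a) (of_nat b) \<in> J" using that(3) by blast
        then show "z \<in> J" using J(4)[OF J(5)[OF n(2) ab(3)]] ab(4) by metis
      qed
      fix I J assume "I \<in> S n" "J \<in> S n" "I \<inter> B n = J \<inter> B n"
      then show "I = J" using sub[of I J] sub[of J I] by blast
    qed
  qed
  have "{I \<in> nonzero_ideals. real (ideal_norm I) \<le> x} \<subseteq> (\<Union>n\<in>{1..nat \<lfloor>x\<rfloor>}. S n)"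
  proof
    fix I assume "I \<in> {I \<in> nonzero_ideals. real (ideal_norm I) \<le> x}"
    then have nz: "I \<in> nonzero_ideals" and le: "real (ideal_norm I) \<le> x" by auto
    note I = nonzero_idealsD[OF nz]
    interpret ideal I gauss_ring by (rule I)
    define k where "k = ideal_norm I"
    define g where "g j = I +>\<^bsub>gauss_ring\<^esub> (of_nat j :: complex)" for j
    have c: "of_nat j \<in> carrier gauss_ring" for j by (simp add: gauss_ring_def)
    have "g ` {..k} \<subseteq> carrier (gauss_ring Quot I)"
      using c by (auto simp: g_def FactRing_def A_RCOSETS_def')
    then have "card (g ` {..k}) \<le> k"
      using finite_gauss_ring_Quot[OF nz] by (simp add: k_def ideal_norm_def card_mono)
    then have "\<not> inj_on g {..k}" using card_image[of g "{..k}"] by auto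
    then obtain i j where ij: "i < j" "j \<le> k" "g i = g j"
      unfolding inj_on_def by (metis atMost_iff linorder_neqE_nat)
    have "of_nat j \<in> I +>\<^bsub>gauss_ring\<^esub> of_nat i"
      using ij(3) c a_repr_independenceD unfolding g_def by metis
    then obtain h where "h \<in> I" "of_nat j = h + (of_nat i :: complex)"
      by (auto simp: a_r_coset_def' gauss_ring_def)
    then have "of_nat (j - i) \<in> I" using ij(1) by (simp add: of_nat_diff)
    then have "I \<in> S (j - i)" using nz by (simp add: S_def)
    moreover have "j - i \<in> {1..nat \<lfloor>x\<rfloor>}"
      using ij le by (auto simp: k_def le_nat_floor)
    ultimately show "I \<in> (\<Union>n\<in>{1..nat \<lfloor>x\<rfloor>}. S n)" by blast
  qed
  then show ?thesis by (rule finite_subset) (auto intro: fin)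
qed

end

theory Submission
  imports Defs "HOL-Complex_Analysis.Complex_Analysis" "HOL-Library.Multiset"
begin

text \<open>By Weyl's criterion (Urysohn and Stone--Weierstrass on the circle, with a lattice point count in
  thin sectors) it suffices that \<open>f \<lambda>\<^sub>m\<close> has mean value zero for every \<open>m \<noteq> 0\<close>.  This is a theorem of
  Halasz, for which only the count \<open>A n + O(\<surd>n)\<close> of ideals and unique factorisation into primes are
  needed: ideals become multisets of primes, and grouping them by norm leads to Dirichlet convolution on
  the natural numbers.

  For a completely multiplicative \<open>f\<close> with partial sums \<open>S\<close>, Selberg's formula gives
  \<open>|S(X)| log\<^sup>2 X \<le> 2 X log X \<Sum>\<^bsub>j \<le> X\<^esub> |S(j)| / j\<^sup>2 + O(X log X)\<close>.
  By Cauchy--Schwarz the logarithmic mean on the right is controlled by the mean square of the partial sums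
  of \<open>f log\<close>, hence through the Fourier transform of \<open>1 / (h\<^sup>2 + t\<^sup>2)\<close> by the mean square of
  \<open>F' = F (F' / F)\<close> on the line \<open>Re s = 1 + \<epsilon>\<close>, where \<open>F\<close> is the Dirichlet series of \<open>f\<close>.
  Divergence of the distance makes \<open>\<epsilon> F(1 + \<epsilon> + i t)\<close> uniformly small for bounded \<open>t\<close>, and the
  mean square of \<open>F' / F\<close> is majorised by that of the untwisted series.  A general multiplicative function is the
  convolution of a completely multiplicative one with a function of absolutely convergent
  Dirichlet series at \<open>s = 1\<close>.\<close>

section \<open>Dirichlet convolution\<close>

text \<open>Neither \<open>f\<close> nor the angular character is a function of the norm, so
  grouping by norm destroys multiplicativity. Convolution identities survive, and the analytic part
  uses only these, together with domination by the untwisted coefficients. The first-order identity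
  bounds |S(X)| log X by a sum of \<Lambda>(k) |S(X / k)|. Chebyshev's bound leaves an error as
  large as the main term when \<Lambda> is replaced by its average there. For the second-order
  weights the average 2 log is known up to O(n) by elementary means, and this error is one logarithm
  below the main term. The hypothesis controls F only for bounded t: every fixed T is eventually
  below log x. Beyond T the trivial bound O(1 / \<epsilon>) for F is used, and the decay of the
  kernel pays a factor 1 / T. As only o(x) is claimed, finitely many primes, fixed before
  \<epsilon>, suffice to make \<epsilon> F small. Complete multiplicativity comes first because for
  a general multiplicative function the coefficients of F' / F at prime powers are not dominated by
  those of the untwisted series.\<close>

definition conv :: "(nat \<Rightarrow> 'a::comm_semiring_1) \<Rightarrow> (nat \<Rightarrow> 'a) \<Rightarrow> nat \<Rightarrow> 'a" where
  "conv f g n = (\<Sum>d | d dvd n. f d * g (n div d))"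

lemma finite_factor_pairs: "n > 0 \<Longrightarrow> finite {p. fst p * snd p = (n::nat)}"
  by (rule finite_subset[of _ "{..n} \<times> {..n}"]) auto

lemma conv_pairs:
  assumes "n > 0"
  shows "conv f g n = (\<Sum>p | fst p * snd p = n. f (fst p) * g (snd p))"
  unfolding conv_def
  by (rule sum.reindex_bij_witness[where i = fst and j = "\<lambda>d. (d, n div d)"])
     (use assms in auto)

lemma dvd_div_pos_nat:
  assumes "d dvd n" "n > (0::nat)"
  shows "d > 0" "n div d > 0"
proof -
  obtain k where "n = d * k" using assms(1) by (rule dvdE)
  then show "d > 0" "n div d > 0" using assms(2) by simp_all
qed

lemma conv_commute: "conv f g n = conv g f n"
\<comment> \<open>Every number divides 0, so the sum defining \<open>conv\<close> runs over an
  infinite set there and has the default value 0. The case n = 0 of the identities below is settled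
  in this way.\<close>
proof (cases "n = 0")
  case False
  show ?thesis unfolding conv_pairs[OF False[THEN neq0_conv[THEN iffD1]]]
    by (rule sum.reindex_bij_witness[where i = prod.swap and j = prod.swap])
       (auto simp: mult.commute)
qed (simp add: conv_def)

text \<open>Both sides are the same sum over ordered factorisations into three factors. Only the
  left bracketing is regrouped by hand; the right one is reduced to it by commutativity and a cyclic
  shift of the triple.\<close>

lemma conv_assoc: "conv (conv f g) h n = conv f (conv g h) n"
proof (cases "n = 0")
  case False
  then have n: "n > 0" by simp
  have *: "conv (conv f g) h n = (\<Sum>(a, b, c) | a * b * c = n. f a * g b * h c)" for f g h :: "nat \<Rightarrow> 'a"
  proof -
    have "conv (conv f g) h n
        = (\<Sum>p | fst p * snd p = n. \<Sum>q | fst q * snd q = fst p. f (fst q) * g (snd q) * h (snd p))"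
      unfolding conv_pairs[OF n]
    proof (intro sum.cong refl)
      fix p assume "p \<in> {x. fst x * snd x = n}"
      then have "fst p > 0" using n by auto
      then show "conv f g (fst p) * h (snd p) = (\<Sum>q | fst q * snd q = fst p. f (fst q) * g (snd q) * h (snd p))"
        by (simp add: conv_pairs sum_distrib_right)
    qed
    also have "\<dots> = (\<Sum>(p, q)\<in>(SIGMA p:{p. fst p * snd p = n}. {q. fst q * snd q = fst p}).
        f (fst q) * g (snd q) * h (snd p))"
    proof (rule sum.Sigma)
      show "finite {p. fst p * snd p = n}" by (rule finite_factor_pairs[OF n])
      show "\<forall>p\<in>{p. fst p * snd p = n}. finite {q. fst q * snd q = fst p}"
      proof
        fix p assume "p \<in> {p. fst p * snd p = n}"
        then have "fst p > 0" using n by auto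
        then show "finite {q. fst q * snd q = fst p}"
          by (rule finite_factor_pairs)
      qed
    qed
    also have "\<dots> = (\<Sum>(a, b, c) | a * b * c = n. f a * g b * h c)"
      by (rule sum.reindex_bij_witness[where i = "\<lambda>(a, b, c). ((a * b, c), (a, b))"
            and j = "\<lambda>(p, q). (fst q, snd q, snd p)"]) auto
    finally show ?thesis .
  qed
  have "conv f (conv g h) n = conv (conv g h) f n" by (rule conv_commute)
  also have "\<dots> = (\<Sum>(a, b, c) | a * b * c = n. g a * h b * f c)" by (rule *)
  also have "\<dots> = (\<Sum>(a, b, c) | a * b * c = n. f a * g b * h c)"
    by (rule sum.reindex_bij_witness[where i = "\<lambda>(a, b, c). (b, c, a)" and j = "\<lambda>(a, b, c). (c, a, b)"])
       (auto simp: mult_ac)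
  finally show ?thesis using * by simp
qed (simp add: conv_def)

text \<open>Divisors of a positive number and their cofactors are positive. This permits rewriting
  under \<open>conv\<close> with identities that are known for positive arguments only.\<close>

lemma conv_cong:
  assumes "\<And>k. k > 0 \<Longrightarrow> f k = f' k" "\<And>k. k > 0 \<Longrightarrow> g k = g' k"
  shows "conv f g n = conv f' g' n"
proof (cases "n = 0")
  case False
  have "f d * g (n div d) = f' d * g' (n div d)" if "d dvd n" for d
  proof -
    have "d > 0" "n div d > 0" using dvd_div_pos_nat[OF that] False by simp_all
    then show ?thesis using assms by simp
  qed
  then show ?thesis unfolding conv_def by (intro sum.cong) auto
qed (simp add: conv_def)

lemma conv_add_right: "conv f (\<lambda>k. g k + h k) n = conv f g n + conv f h n"
  by (simp add: conv_def distrib_left sum.distrib)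

text \<open>The bijection (n, d) to (d, n / d) turns a summatory function of a convolution into a
  sum over the region a b \<le> x. The weight is later a power n to the -s, which splits as a
  product, or a function of x / n, as in Moebius inversion.\<close>

lemma sum_conv_weighted:
  "(\<Sum>n=1..x. conv f g n * w n) = (\<Sum>a=1..x. \<Sum>b=1..x div a. f a * g b * w (a * b))"
proof -
  have "(\<Sum>n=1..x. conv f g n * w n)
      = (\<Sum>n=1..x. \<Sum>d | d dvd n. f d * g (n div d) * w n)"
    by (simp add: conv_def sum_distrib_right)
  also have "\<dots> = (\<Sum>(n, d)\<in>(SIGMA n:{1..x}. {d. d dvd n}). f d * g (n div d) * w n)"
    by (rule sum.Sigma) auto
  also have "\<dots> = (\<Sum>(a, b)\<in>(SIGMA a:{1..x}. {1..x div a}). f a * g b * w (a * b))"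
  proof (rule sum.reindex_bij_witness[where i = "\<lambda>(a, b). (a * b, a)" and j = "\<lambda>(n, d). (d, n div d)"])
    fix p assume "p \<in> (SIGMA n:{1..x}. {d. d dvd n})"
    then obtain n d where p: "p = (n, d)" "1 \<le> n" "n \<le> x" "d dvd n" by auto
    from p have "d > 0" "d \<le> n" by (auto intro: dvd_imp_le Nat.gr0I)
    then have "n div d \<ge> 1" "n div d \<le> x div d" using p by (auto simp: div_le_mono Suc_leI div_greater_zero_iff)
    then show "(case p of (n, d) \<Rightarrow> (d, n div d)) \<in> (SIGMA a:{1..x}. {1..x div a})"
      using p \<open>d > 0\<close> \<open>d \<le> n\<close> by auto
  next
    fix p assume "p \<in> (SIGMA a:{1..x}. {1..x div a})"
    then obtain a b where p: "p = (a, b)" "1 \<le> a" "a \<le> x" "1 \<le> b" "b \<le> x div a" by auto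
    then have "a * b \<le> x" by (metis mult.commute less_eq_div_iff_mult_less_eq less_le_trans zero_less_one)
    then show "(case p of (a, b) \<Rightarrow> (a * b, a)) \<in> (SIGMA n:{1..x}. {d. d dvd n})"
      using p by auto
  qed auto
  also have "\<dots> = (\<Sum>a=1..x. \<Sum>b=1..x div a. f a * g b * w (a * b))"
    by (rule sum.Sigma[symmetric]) auto
  finally show ?thesis .
qed

lemma sum_conv: "(\<Sum>n=1..x. conv f g n) = (\<Sum>a=1..x. f a * (\<Sum>b=1..x div a. g b))"
  using sum_conv_weighted[of f g "\<lambda>_. 1" x] by (simp add: sum_distrib_left)

text \<open>The logarithm is additive on factorisations, hence multiplication by it is a derivation
  for convolution. For Dirichlet series this is the product rule.\<close>

lemma conv_ln:
  fixes f g :: "nat \<Rightarrow> 'a::real_normed_field"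
  shows "conv f g n * of_real (ln n)
       = conv (\<lambda>k. f k * of_real (ln k)) g n + conv f (\<lambda>k. g k * of_real (ln k)) n"
proof (cases "n = 0")
  case False
  have "f d * g (n div d) * of_real (ln n) =
      f d * of_real (ln d) * g (n div d) + f d * (g (n div d) * of_real (ln (real (n div d))))"
    if "d dvd n" for d
  proof -
    have "d > 0" "n div d > 0" using dvd_div_pos_nat[OF that] False by simp_all
    have "real n = real d * real (n div d)"
      using that by (simp only: of_nat_mult[symmetric] dvd_mult_div_cancel)
    then have "ln (real n) = ln (real d) + ln (real (n div d))"
      using \<open>d > 0\<close> \<open>n div d > 0\<close> by (simp only: ln_mult_pos of_nat_0_less_iff)
    then show ?thesis by (simp only: of_real_add) (simp add: algebra_simps)
  qed
  then show ?thesis unfolding conv_def sum_distrib_right sum.distrib[symmetric]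
    by (intro sum.cong) auto
qed (simp add: conv_def)

text \<open>The twisted Selberg identity: with \<open>c\<close> in place of the constant function one this is
  \<open>\<Lambda>\<^sub>2 = \<Lambda> log + \<Lambda> * \<Lambda>\<close>.\<close>

lemma conv_selberg:
  fixes c l :: "nat \<Rightarrow> 'a::real_normed_field"
  assumes "\<And>n. n > 0 \<Longrightarrow> conv c l n = c n * of_real (ln n)" and n: "n > 0"
  shows "conv c (\<lambda>k. l k * of_real (ln k) + conv l l k) n = c n * of_real (ln n) ^ 2"
proof -
  have "conv (\<lambda>k. c k * of_real (ln k)) l n = conv (conv c l) l n"
    by (rule conv_cong) (simp_all add: assms)
  also have "\<dots> = conv c (conv l l) n" by (rule conv_assoc)
  finally have "conv c l n * of_real (ln n)
      = conv c (conv l l) n + conv c (\<lambda>k. l k * of_real (ln k)) n"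
    using conv_ln[of c l n] by simp
  then show ?thesis using assms(1)[OF n]
    by (simp add: conv_add_right power2_eq_square add.commute mult.assoc)
qed

lemma norm_conv_le:
  fixes f g :: "nat \<Rightarrow> complex"
  assumes "\<And>k. norm (f k) \<le> f' k" "\<And>k. norm (g k) \<le> g' k"
  shows "norm (conv f g n) \<le> conv f' g' n"
  unfolding conv_def
  by (intro sum_norm_le) (simp add: norm_mult mult_mono assms order_trans[OF norm_ge_zero assms(1)])

lemma conv_nonneg:
  fixes f g :: "nat \<Rightarrow> real"
  assumes "\<And>k. f k \<ge> 0" "\<And>k. g k \<ge> 0"
  shows "conv f g n \<ge> 0"
  unfolding conv_def using assms by (intro sum_nonneg) auto

section \<open>Partial summation and elementary inequalities\<close>

lemma sum_mult_antimono_le: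
  fixes w \<phi> :: "nat \<Rightarrow> real"
  assumes "\<And>k. (\<Sum>j=1..k. w j) \<le> C * k"
    and "\<And>j. 1 \<le> j \<Longrightarrow> j \<le> n \<Longrightarrow> \<phi> j \<ge> 0"
    and "\<And>j. 1 \<le> j \<Longrightarrow> j < n \<Longrightarrow> \<phi> (Suc j) \<le> \<phi> j"
  shows "(\<Sum>j=1..n. w j * \<phi> j) \<le> C * (\<Sum>j=1..n. \<phi> j)"
proof (cases "n = 0")
  case False
  \<comment> \<open>The boundary term is carried along: the excess of the partial sum over C m is
    nonpositive, so replacing \<phi> m by the smaller next value only increases the right side, and
    the induction closes.\<close>
  have "(\<Sum>j=1..m. w j * \<phi> j) - C * (\<Sum>j=1..m. \<phi> j) \<le> ((\<Sum>j=1..m. w j) - C * m) * \<phi> m"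
    if "1 \<le> m" "m \<le> n" for m
    using that
  proof (induction m rule: nat_induct_at_least)
    case (Suc m)
    have "((\<Sum>j=1..m. w j) - C * m) * \<phi> m \<le> ((\<Sum>j=1..m. w j) - C * m) * \<phi> (Suc m)"
      using assms(1)[of m] assms(3)[of m] Suc by (intro mult_left_mono_neg) auto
    then show ?case using Suc by (simp add: algebra_simps)
  qed (simp add: algebra_simps)
  from this[of n] have "(\<Sum>j=1..n. w j * \<phi> j) - C * (\<Sum>j=1..n. \<phi> j)
      \<le> ((\<Sum>j=1..n. w j) - C * n) * \<phi> n" using False by simp
  also have "\<dots> \<le> 0" using assms(1)[of n] assms(2)[of n] False by (intro mult_nonpos_nonneg) auto
  finally show ?thesis by simp
qed simp

text \<open>Summation by parts moves the differences onto \<open>D\<close>, where the increments of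
  \<open>R\<close> dominate them; a second summation by parts, now for \<open>R\<close>, undoes the
  first. A weight that is bounded only on average therefore costs no more than a bounded one,
  provided \<open>D\<close> varies no faster than \<open>R\<close>.\<close>

lemma abel_div_bound:
  fixes e D R :: "nat \<Rightarrow> real"
  assumes E: "\<And>k. \<bar>\<Sum>j=1..k. e j\<bar> \<le> C * k"
    and D: "\<And>m m'. m' \<le> m \<Longrightarrow> \<bar>D m - D m'\<bar> \<le> R m - R m'" and "D 0 = 0" "R 0 = 0"
  shows "\<bar>\<Sum>k=1..X. e k * D (X div k)\<bar> \<le> C * (\<Sum>k=1..X. R (X div k))"
proof -
  define d \<rho> where "d k = D (X div k)" and "\<rho> k = R (X div k)" for k
  have "(\<Sum>k=1..n. e k * d k) = (\<Sum>k=1..n. (\<Sum>j=1..k. e j) * (d k - d (Suc k))) + (\<Sum>j=1..n. e j) * d (Suc n)" for n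
    by (induction n) (simp_all add: algebra_simps)
  \<comment> \<open>The boundary term vanishes because \<open>X div Suc X = 0\<close> and
    \<open>D 0 = 0\<close>.\<close>
  from this[of X] have "\<bar>\<Sum>k=1..X. e k * d k\<bar> = \<bar>\<Sum>k=1..X. (\<Sum>j=1..k. e j) * (d k - d (Suc k))\<bar>"
    by (simp add: d_def assms)
  also have "\<dots> \<le> (\<Sum>k=1..X. \<bar>(\<Sum>j=1..k. e j) * (d k - d (Suc k))\<bar>)" by (rule sum_abs)
  also have "\<dots> \<le> (\<Sum>k=1..X. C * k * (\<rho> k - \<rho> (Suc k)))"
    unfolding abs_mult
  proof (intro sum_mono mult_mono E)
    fix k assume "k \<in> {1..X}"
    then have "X div Suc k \<le> X div k" by (intro div_le_mono2) auto
    then show "\<bar>d k - d (Suc k)\<bar> \<le> \<rho> k - \<rho> (Suc k)" unfolding d_def \<rho>_def by (rule D)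
  next
    fix k show "0 \<le> C * real k" using E[of k] by linarith
  qed auto
  also have "\<dots> = C * (\<Sum>k=1..X. k * (\<rho> k - \<rho> (Suc k)))" by (simp add: sum_distrib_left mult.assoc)
  also have "(\<Sum>k=1..n. k * (\<rho> k - \<rho> (Suc k))) = (\<Sum>k=1..n. \<rho> k) - n * \<rho> (Suc n)" for n
    by (induction n) (simp_all add: algebra_simps)
  finally show ?thesis by (simp add: d_def \<rho>_def assms)
qed

text \<open>The constant is 2 powr 2: halving the argument changes a power with exponent in [-2, 2]
  by at most this factor. It allows bounds at an intermediate point or at a floor to be stated at
  the endpoint.\<close>

lemma powr_half_le:
  fixes b t y :: real
  assumes "y / 2 \<le> t" "t \<le> y" "0 < y" "-2 \<le> b" "b \<le> 2"
  shows "t powr b \<le> 4 * y powr b"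
proof (cases "b \<ge> 0")
  case True
  then have "t powr b \<le> y powr b" using assms by (intro powr_mono2) auto
  then show ?thesis using powr_ge_zero[of y b] by linarith
next
  case False
  have "t powr b \<le> (y / 2) powr b" using assms False by (intro powr_mono2') auto
  also have "\<dots> = 2 powr (- b) * y powr b" using assms by (simp add: powr_divide powr_minus divide_simps)
  also have "\<dots> \<le> 2 powr 2 * y powr b" using assms by (intro mult_right_mono powr_mono) auto
  finally show ?thesis by simp
qed

lemma ln_le_powr:
  assumes "y \<ge> 1" "a > (0::real)"
  shows "ln y \<le> (1 / a) * y powr a"
proof -
  have "a * ln y = ln (y powr a)" using assms by (simp add: ln_powr)
  also have "\<dots> \<le> y powr a" using assms by (intro order_trans[OF ln_le_minus_one]) auto
  finally show ?thesis using assms by (simp add: field_simps)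
qed

lemma sum_powr_le:
  fixes b :: real
  assumes "0 < b" "b \<le> 1"
  shows "(\<Sum>k=1..n. real k powr (b - 1)) \<le> (1 / b) * real n powr b"
proof (induction n)
  case (Suc n)
  have "real (Suc n) powr (b - 1) \<le> (1 / b) * (real (Suc n) powr b - real n powr b)"
  proof (cases "n = 0")
    case False
    have "\<exists>z. real n < z \<and> z < real (Suc n) \<and>
        real (Suc n) powr b - real n powr b = (real (Suc n) - real n) * (b * z powr (b - 1))"
      by (rule MVT2) (use False in \<open>auto intro!: derivative_eq_intros\<close>)
    then obtain z where z: "real n < z" "z < real (Suc n)"
      "real (Suc n) powr b - real n powr b = b * z powr (b - 1)" by auto
    have "real (Suc n) powr (b - 1) \<le> z powr (b - 1)" using z assms False by (intro powr_mono2') auto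
    then show ?thesis using z assms by simp
  qed (use assms in auto)
  then show ?case using Suc by (simp add: algebra_simps)
qed simp

section \<open>Weights with a square-root error term\<close>

text \<open>The counting condition is Knopfmacher's Axiom A for arithmetical semigroups, with error
  exponent 1/2. Here \<open>r\<close> counts elements of given norm, while \<open>mu\<close> and
  \<open>lam\<close> are the Moebius and von Mangoldt functions summed over the elements of that
  norm. If Z is the Dirichlet series of \<open>r\<close>, then \<open>conv_lam\<close> is the
  coefficient form of -Z' = Z (-Z' / Z), and \<open>conv_mu\<close> that of (1 / Z) Z = 1.\<close>

locale axiom_A =
  fixes r mu lam :: "nat \<Rightarrow> real" and A B :: real
  assumes A_pos: "A > 0" and B_nonneg: "B \<ge> 0"
    and r_nonneg: "r n \<ge> 0" and r_1: "r 1 = 1"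
    and count: "\<bar>(\<Sum>k=1..n. r k) - A * n\<bar> \<le> B * sqrt n"
    and lam_nonneg: "lam n \<ge> 0"
    and conv_lam: "n > 0 \<Longrightarrow> conv r lam n = r n * ln n"
    and conv_mu: "n > 0 \<Longrightarrow> conv mu r n = (if n = 1 then 1 else 0)"
    and mu_le: "\<bar>mu n\<bar> \<le> r n"
begin

definition C0 :: real where "C0 = A + B"

lemma C0_pos: "C0 > 0"
  using A_pos B_nonneg by (simp add: C0_def)

lemma sqrt_le_nat: "sqrt (real n) \<le> real n"
  by (cases "n = 0") (auto intro!: real_le_lsqrt simp: power2_eq_square)

lemma count_le: "(\<Sum>k=1..n. r k) \<le> C0 * n"
proof -
  have "(\<Sum>k=1..n. r k) \<le> A * n + B * sqrt n" using count[of n] by linarith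
  also have "\<dots> \<le> A * n + B * n" using sqrt_le_nat[of n] B_nonneg by (intro add_left_mono mult_left_mono) auto
  finally show ?thesis by (simp add: C0_def algebra_simps)
qed

text \<open>Euler summation against the weights \<open>r\<close>, with remainder \<open>W\<close>.\<close>

lemma summation_error:
  fixes \<phi> \<phi>' P :: "real \<Rightarrow> real"
  assumes P: "\<And>t. t \<ge> 1 \<Longrightarrow> (P has_real_derivative \<phi> t) (at t)"
    and \<phi>: "\<And>t. t \<ge> 1 \<Longrightarrow> (\<phi> has_real_derivative \<phi>' t) (at t)"
    and \<phi>_le: "\<And>t. t \<ge> 1 \<Longrightarrow> \<bar>\<phi> t\<bar> \<le> M * t powr (a - 1 / 2)"
    and \<phi>'_le: "\<And>t. t \<ge> 1 \<Longrightarrow> \<bar>\<phi>' t\<bar> \<le> M * t powr (a - 3 / 2)"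
    and a: "-1/2 \<le> a" "a \<le> 1"
  shows "\<exists>W C. (\<forall>K\<ge>1. \<bar>W (Suc K) - W K\<bar> \<le> C * real (Suc K) powr (a - 1)) \<and>
    (\<forall>y\<ge>1. \<bar>(\<Sum>k=1..nat \<lfloor>y\<rfloor>. r k * \<phi> k) - A * P y - W (nat \<lfloor>y\<rfloor>)\<bar> \<le> C * y powr a)"
proof -
  have M: "M \<ge> 0" using \<phi>_le[of 1] by auto
  \<comment> \<open>\<open>e\<close> is the counting error, and \<open>W\<close> is what is left of
    the sum after the main term and the boundary term \<open>e K * \<phi> K\<close> are removed.
    Only the increments of \<open>W\<close> are controlled: they are summable for negative
    \<open>a\<close> and add up to a power for positive \<open>a\<close>, which gives the two lemmas
    that follow.\<close>
  define e where "e K = (\<Sum>k=1..K. r k) - A * K" for K :: nat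
  define W where "W K = (\<Sum>k=1..K. r k * \<phi> k) - A * P K - e K * \<phi> K" for K :: nat
  define C where "C = 4 * M * C0 + 4 * M * B + 4 * M * A"
  have C: "4 * M * C0 \<le> C" "4 * M * B + 4 * M * A \<le> C"
    using M A_pos B_nonneg C0_pos by (auto simp: C_def)
  have 1: "\<bar>W (Suc K) - W K\<bar> \<le> C * real (Suc K) powr (a - 1)" if K: "K \<ge> 1" for K
  proof -
    define m where "m = 4 * (M * real (Suc K) powr (a - 3 / 2))"
    have m: "\<bar>\<phi>' t\<bar> \<le> m" if "real K \<le> t" "t \<le> real (Suc K)" for t
    proof -
      have "t powr (a - 3 / 2) \<le> 4 * real (Suc K) powr (a - 3 / 2)"
        using that K a by (intro powr_half_le) auto
      then have "M * t powr (a - 3 / 2) \<le> M * (4 * real (Suc K) powr (a - 3 / 2))"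
        using M by (rule mult_left_mono)
      moreover have "\<bar>\<phi>' t\<bar> \<le> M * t powr (a - 3 / 2)" using that K by (intro \<phi>'_le) auto
      ultimately show ?thesis unfolding m_def by linarith
    qed
    have \<phi>_diff: "\<bar>\<phi> (Suc K) - \<phi> t\<bar> \<le> m" if t: "real K \<le> t" "t < real (Suc K)" for t
    proof -
      have "\<exists>z. t < z \<and> z < real (Suc K) \<and> \<phi> (Suc K) - \<phi> t = (real (Suc K) - t) * \<phi>' z"
        by (rule MVT2) (use t K in \<open>auto intro!: \<phi>\<close>)
      then obtain z where z: "t < z" "z < real (Suc K)" "\<phi> (Suc K) - \<phi> t = (real (Suc K) - t) * \<phi>' z" by blast
      have "\<bar>\<phi> (Suc K) - \<phi> t\<bar> = (real (Suc K) - t) * \<bar>\<phi>' z\<bar>" using z by (simp add: abs_mult)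
      also have "\<dots> \<le> 1 * m" using z t m[of z] by (intro mult_mono) auto
      finally show ?thesis by simp
    qed
    have "\<exists>z. real K < z \<and> z < real (Suc K) \<and> P (Suc K) - P K = (real (Suc K) - real K) * \<phi> z"
      by (rule MVT2) (use K in \<open>auto intro!: P\<close>)
    then obtain z where z: "real K < z" "z < real (Suc K)" "P (Suc K) - P K = \<phi> z" by auto
    \<comment> \<open>With the integral over one step replaced by a value \<phi> z, only differences
      of \<phi> remain. The factor \<open>e K\<close> of size sqrt K against a derivative of order a
      - 3/2 yields the exponent a - 1.\<close>
    have W: "W (Suc K) - W K = A * (\<phi> (Suc K) - \<phi> z) - e K * (\<phi> (Suc K) - \<phi> K)"
      using z(3) by (simp add: W_def e_def algebra_simps)
    have "B * sqrt K \<le> B * sqrt (Suc K)" using B_nonneg by (intro mult_left_mono) auto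
    then have e: "\<bar>e K\<bar> \<le> B * sqrt (Suc K)" using count[of K] unfolding e_def by linarith
    have "\<bar>W (Suc K) - W K\<bar> \<le> A * \<bar>\<phi> (Suc K) - \<phi> z\<bar> + \<bar>e K\<bar> * \<bar>\<phi> (Suc K) - \<phi> K\<bar>"
      unfolding W using A_pos by (intro order_trans[OF abs_triangle_ineq4]) (simp add: abs_mult)
    also have "\<dots> \<le> A * m + B * sqrt (Suc K) * m"
      using \<phi>_diff[of z] \<phi>_diff[of K] z e A_pos by (intro add_mono mult_mono) auto
    also have "\<dots> \<le> (A * sqrt (Suc K)) * m + B * sqrt (Suc K) * m"
      using A_pos m[of K] by (intro add_right_mono mult_right_mono) auto
    also have "\<dots> = 4 * M * C0 * (real (Suc K) powr (1 / 2) * real (Suc K) powr (a - 3 / 2))"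
      by (simp add: m_def C0_def powr_half_sqrt algebra_simps)
    also have "\<dots> = 4 * M * C0 * real (Suc K) powr (a - 1)"
      by (simp add: powr_add[symmetric])
    also have "\<dots> \<le> C * real (Suc K) powr (a - 1)" using C by (intro mult_right_mono) auto
    finally show ?thesis .
  qed
  have 2: "\<bar>(\<Sum>k=1..nat \<lfloor>y\<rfloor>. r k * \<phi> k) - A * P y - W (nat \<lfloor>y\<rfloor>)\<bar> \<le> C * y powr a" if y: "y \<ge> 1" for y
  proof -
    define K where "K = nat \<lfloor>y\<rfloor>"
    have K: "K \<ge> 1" "real K \<le> y" "y < real K + 1" using y by (auto simp: K_def le_nat_iff)
    then have half: "y / 2 \<le> real K" by linarith
    have \<phi>K: "\<bar>\<phi> t\<bar> \<le> 4 * (M * y powr (a - 1 / 2))" if t: "real K \<le> t" "t \<le> y" for t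
    proof -
      have "t powr (a - 1 / 2) \<le> 4 * y powr (a - 1 / 2)"
        using half t K a by (intro powr_half_le) auto
      then have "M * t powr (a - 1 / 2) \<le> M * (4 * y powr (a - 1 / 2))" using M by (intro mult_left_mono)
      then show ?thesis using \<phi>_le[of t] t K by auto
    qed
    have "\<bar>P y - P K\<bar> \<le> 4 * (M * y powr (a - 1 / 2))"
    proof (cases "real K = y")
      case False
      have "\<exists>z. real K < z \<and> z < y \<and> P y - P K = (y - real K) * \<phi> z"
        by (rule MVT2) (use K False in \<open>auto intro!: P\<close>)
      then obtain z where z: "real K < z" "z < y" "P y - P K = (y - real K) * \<phi> z" by blast
      have "\<bar>P y - P K\<bar> = (y - real K) * \<bar>\<phi> z\<bar>" using z by (simp add: abs_mult)
      also have "\<dots> \<le> 1 * (4 * (M * y powr (a - 1 / 2)))" using z K \<phi>K[of z] by (intro mult_mono) auto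
      finally show ?thesis by simp
    qed (use M in auto)
    moreover have "y powr (a - 1 / 2) \<le> y powr a" using y by (intro powr_mono) auto
    ultimately have PK: "\<bar>P y - P K\<bar> \<le> 4 * M * y powr a"
      using M mult_left_mono[of "y powr (a - 1 / 2)" "y powr a" "4 * M"] by simp
    have "B * sqrt K \<le> B * sqrt y" using B_nonneg K by (intro mult_left_mono) auto
    then have "\<bar>e K\<bar> \<le> B * sqrt y" using count[of K] unfolding e_def by linarith
    then have "\<bar>e K\<bar> * \<bar>\<phi> K\<bar> \<le> B * sqrt y * (4 * (M * y powr (a - 1 / 2)))"
      using \<phi>K[of K] K by (intro mult_mono) auto
    also have "\<dots> = 4 * M * B * (y powr (1 / 2) * y powr (a - 1 / 2))"
      using y by (simp add: powr_half_sqrt)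
    also have "\<dots> = 4 * M * B * y powr a" using y by (simp add: powr_add[symmetric])
    finally have eK: "\<bar>e K * \<phi> K\<bar> \<le> 4 * M * B * y powr a" by (simp add: abs_mult)
    have "(\<Sum>k=1..K. r k * \<phi> k) - A * P y - W K = e K * \<phi> K - A * (P y - P K)"
      by (simp add: W_def algebra_simps)
    then have "\<bar>(\<Sum>k=1..K. r k * \<phi> k) - A * P y - W K\<bar> \<le> \<bar>e K * \<phi> K\<bar> + A * \<bar>P y - P K\<bar>"
      using A_pos by (simp add: abs_mult order_trans[OF abs_triangle_ineq4])
    also have "\<dots> \<le> 4 * M * B * y powr a + A * (4 * M * y powr a)"
      using PK eK A_pos by (intro add_mono mult_left_mono) auto
    also have "\<dots> = (4 * M * B + 4 * M * A) * y powr a" by (simp add: algebra_simps)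
    also have "\<dots> \<le> C * y powr a" using C by (intro mult_right_mono) auto
    finally show ?thesis by (simp add: K_def)
  qed
  show ?thesis using 1 2 by blast
qed

text \<open>For a = -1/4 the increments of \<open>W\<close> are dominated by a telescoping series,
  so \<open>W\<close> converges. Its limit \<gamma> is the analogue of Euler's constant, and the
  tail is of the same order as the error term.\<close>

lemma summation_conv:
  fixes \<phi> \<phi>' P :: "real \<Rightarrow> real"
  assumes "\<And>t. t \<ge> 1 \<Longrightarrow> (P has_real_derivative \<phi> t) (at t)"
    and "\<And>t. t \<ge> 1 \<Longrightarrow> (\<phi> has_real_derivative \<phi>' t) (at t)"
    and "\<And>t. t \<ge> 1 \<Longrightarrow> \<bar>\<phi> t\<bar> \<le> M * t powr (- 3 / 4)"
    and "\<And>t. t \<ge> 1 \<Longrightarrow> \<bar>\<phi>' t\<bar> \<le> M * t powr (- 7 / 4)"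
  shows "\<exists>\<gamma> C. \<forall>y\<ge>1. \<bar>(\<Sum>k=1..nat \<lfloor>y\<rfloor>. r k * \<phi> k) - A * P y - \<gamma>\<bar> \<le> C * y powr (- 1 / 4)"
proof -
  obtain W C where W: "\<And>K. K \<ge> 1 \<Longrightarrow> \<bar>W (Suc K) - W K\<bar> \<le> C * real (Suc K) powr (- 1 / 4 - 1)"
    and S: "\<And>y. y \<ge> 1 \<Longrightarrow> \<bar>(\<Sum>k=1..nat \<lfloor>y\<rfloor>. r k * \<phi> k) - A * P y - W (nat \<lfloor>y\<rfloor>)\<bar> \<le> C * y powr (- 1 / 4)"
    using summation_error[OF assms(1,2), where M = M and a = "- 1 / 4"] assms(3,4) by auto
  have C: "C \<ge> 0" using S[of 1] by auto
  have step: "real (Suc K) powr (- 1 / 4 - 1) \<le> 4 * (real K powr (- 1 / 4) - real (Suc K) powr (- 1 / 4))"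
    if "K \<ge> 1" for K
  proof -
    have "\<exists>z. real K < z \<and> z < real (Suc K) \<and> real (Suc K) powr (- 1 / 4) - real K powr (- 1 / 4)
        = (real (Suc K) - real K) * ((- 1 / 4) * z powr (- 1 / 4 - 1))"
      by (rule MVT2) (use that in \<open>auto intro!: derivative_eq_intros\<close>)
    then obtain z where z: "real K < z" "z < real (Suc K)"
      "real (Suc K) powr (- 1 / 4) - real K powr (- 1 / 4) = (- 1 / 4) * z powr (- 1 / 4 - 1)" by auto
    have "real (Suc K) powr (- 1 / 4 - 1) \<le> z powr (- 1 / 4 - 1)" using z that by (intro powr_mono2') auto
    then show ?thesis using z(3) by simp
  qed
  have diff: "\<bar>W (K + n) - W K\<bar> \<le> 4 * C * (real K powr (- 1 / 4) - real (K + n) powr (- 1 / 4))" if "K \<ge> 1" for K n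
  proof (induction n)
    case (Suc n)
    have "\<bar>W (Suc (K + n)) - W (K + n)\<bar> \<le> C * (4 * (real (K + n) powr (- 1 / 4) - real (Suc (K + n)) powr (- 1 / 4)))"
      using W[of "K + n"] step[of "K + n"] that C by (intro order_trans[OF W] mult_left_mono) auto
    then show ?case using Suc by (simp add: algebra_simps)
  qed simp
  have diff': "\<bar>W (K + n) - W K\<bar> \<le> 4 * C * real K powr (- 1 / 4)" if "K \<ge> 1" for K n
  proof -
    have "4 * C * (real K powr (- 1 / 4) - real (K + n) powr (- 1 / 4)) \<le> 4 * C * real K powr (- 1 / 4)"
      using C by (intro mult_left_mono) auto
    then show ?thesis using diff[OF that, of n] by linarith
  qed
  have "Cauchy W"
  proof (rule metric_CauchyI)
    fix \<epsilon> :: real assume "\<epsilon> > 0"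
    have "(\<lambda>K. 4 * C * real K powr (- 1 / 4)) \<longlonglongrightarrow> 4 * C * 0"
      by (intro tendsto_mult tendsto_const tendsto_neg_powr filterlim_real_sequentially) auto
    then have "\<forall>\<^sub>F K in sequentially. 4 * C * real K powr (- 1 / 4) < \<epsilon> / 2"
      using \<open>\<epsilon> > 0\<close> by (intro order_tendstoD) auto
    then obtain K where K: "\<And>k. k \<ge> K \<Longrightarrow> 4 * C * real k powr (- 1 / 4) < \<epsilon> / 2"
      by (auto simp: eventually_sequentially)
    define L where "L = max K 1"
    have L: "\<bar>W m - W L\<bar> < \<epsilon> / 2" if "m \<ge> L" for m
      using diff'[of L "m - L"] K[of L] that by (simp add: L_def)
    show "\<exists>M. \<forall>m\<ge>M. \<forall>n\<ge>M. dist (W m) (W n) < \<epsilon>"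
    proof (intro exI[of _ L] allI impI)
      fix m n assume "m \<ge> L" "n \<ge> L"
      then show "dist (W m) (W n) < \<epsilon>" using L[of m] L[of n] unfolding dist_real_def by linarith
    qed
  qed
  then obtain \<gamma> where \<gamma>: "W \<longlonglongrightarrow> \<gamma>" using Cauchy_convergent_iff convergent_def by blast
  have lim: "\<bar>\<gamma> - W K\<bar> \<le> 4 * C * real K powr (- 1 / 4)" if "K \<ge> 1" for K
  proof (rule LIMSEQ_le_const2)
    show "(\<lambda>n. \<bar>W (n + K) - W K\<bar>) \<longlonglongrightarrow> \<bar>\<gamma> - W K\<bar>"
      by (intro tendsto_intros LIMSEQ_ignore_initial_segment \<gamma>)
    show "\<exists>N. \<forall>n\<ge>N. \<bar>W (n + K) - W K\<bar> \<le> 4 * C * real K powr (- 1 / 4)"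
      using diff'[OF that] by (auto simp: add.commute)
  qed
  \<comment> \<open>17 = 1 + 4 * 4: one C from the summation error, and 4 C for the distance of
    \<open>W\<close> from its limit, multiplied by 4 for passing from the floor of y to y.\<close>
  have "\<bar>(\<Sum>k=1..nat \<lfloor>y\<rfloor>. r k * \<phi> k) - A * P y - \<gamma>\<bar> \<le> (17 * C) * y powr (- 1 / 4)" if y: "y \<ge> 1" for y
  proof -
    define K where "K = nat \<lfloor>y\<rfloor>"
    have K: "K \<ge> 1" "real K \<le> y" "y < real K + 1" using y by (auto simp: K_def le_nat_iff)
    have "real K powr (- 1 / 4) \<le> 4 * y powr (- 1 / 4)" using K by (intro powr_half_le) auto
    then have "4 * C * real K powr (- 1 / 4) \<le> 4 * C * (4 * y powr (- 1 / 4))" using C by (intro mult_left_mono) auto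
    then show ?thesis using S[OF y] lim[OF K(1)] unfolding K_def[symmetric] by simp
  qed
  then show ?thesis by blast
qed

text \<open>For a = 3/4 the increments of \<open>W\<close> are no longer summable, but their sum is
  itself O(K powr (3 / 4)), so \<open>W\<close> is absorbed in the error and no constant
  appears.\<close>

lemma summation_bound:
  fixes \<phi> \<phi>' P :: "real \<Rightarrow> real"
  assumes "\<And>t. t \<ge> 1 \<Longrightarrow> (P has_real_derivative \<phi> t) (at t)"
    and "\<And>t. t \<ge> 1 \<Longrightarrow> (\<phi> has_real_derivative \<phi>' t) (at t)"
    and "\<And>t. t \<ge> 1 \<Longrightarrow> \<bar>\<phi> t\<bar> \<le> M * t powr (1 / 4)"
    and "\<And>t. t \<ge> 1 \<Longrightarrow> \<bar>\<phi>' t\<bar> \<le> M * t powr (- 3 / 4)"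
  shows "\<exists>C. \<forall>y\<ge>1. \<bar>(\<Sum>k=1..nat \<lfloor>y\<rfloor>. r k * \<phi> k) - A * P y\<bar> \<le> C * y powr (3 / 4)"
proof -
  obtain W C where W: "\<And>K. K \<ge> 1 \<Longrightarrow> \<bar>W (Suc K) - W K\<bar> \<le> C * real (Suc K) powr (3 / 4 - 1)"
    and S: "\<And>y. y \<ge> 1 \<Longrightarrow> \<bar>(\<Sum>k=1..nat \<lfloor>y\<rfloor>. r k * \<phi> k) - A * P y - W (nat \<lfloor>y\<rfloor>)\<bar> \<le> C * y powr (3 / 4)"
    using summation_error[OF assms(1,2), where M = M and a = "3 / 4"] assms(3,4) by auto
  have C: "C \<ge> 0" using S[of 1] by auto
  have WK: "\<bar>W K\<bar> \<le> \<bar>W 1\<bar> + C * (\<Sum>k=1..K. real k powr (3 / 4 - 1))" if "K \<ge> 1" for K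
    using that
  proof (induction K rule: nat_induct_at_least)
    case (Suc K)
    then show ?case using W[of K] by (simp add: algebra_simps)
  qed (use C in simp)
  have "\<bar>(\<Sum>k=1..nat \<lfloor>y\<rfloor>. r k * \<phi> k) - A * P y\<bar> \<le> (3 * C + \<bar>W 1\<bar>) * y powr (3 / 4)" if y: "y \<ge> 1" for y
  proof -
    define K where "K = nat \<lfloor>y\<rfloor>"
    have K: "K \<ge> 1" "real K \<le> y" using y by (auto simp: K_def le_nat_iff)
    have "(\<Sum>k=1..K. real k powr (3 / 4 - 1)) \<le> (1 / (3 / 4)) * real K powr (3 / 4)" by (rule sum_powr_le) auto
    also have "\<dots> \<le> 2 * y powr (3 / 4)" using K by (intro mult_mono powr_mono2) auto
    finally have "C * (\<Sum>k=1..K. real k powr (3 / 4 - 1)) \<le> C * (2 * y powr (3 / 4))" using C by (rule mult_left_mono)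
    moreover have "\<bar>W 1\<bar> \<le> \<bar>W 1\<bar> * y powr (3 / 4)"
      using y ge_one_powr_ge_zero[of y "3 / 4"] by (simp add: mult_le_cancel_left1)
    ultimately show ?thesis using S[OF y] WK[OF K(1)] unfolding K_def[symmetric] by (simp add: algebra_simps)
  qed
  then show ?thesis by blast
qed

text \<open>The exponents demanded by the summation lemmas leave a small power of room. It is spare
  here and absorbs the logarithms in the next two lemmas, through \<open>ln_le_powr\<close>.\<close>

lemma sum_inverse:
  "\<exists>\<gamma> C. \<forall>y\<ge>1. \<bar>(\<Sum>k=1..nat \<lfloor>y\<rfloor>. r k * (1 / k)) - A * ln y - \<gamma>\<bar> \<le> C * y powr (- 1 / 4)"
proof (rule summation_conv[where M = 1 and \<phi>' = "\<lambda>t. - 1 / t ^ 2"])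
  fix t :: real assume t: "t \<ge> 1"
  show "(ln has_real_derivative 1 / t) (at t)" using t by (auto intro!: derivative_eq_intros)
  show "((\<lambda>t. 1 / t) has_real_derivative - 1 / t ^ 2) (at t)"
    using t by (auto intro!: derivative_eq_intros simp: power2_eq_square)
  have "t powr (- 1) \<le> t powr (- 3 / 4)" "t powr (- 2) \<le> t powr (- 7 / 4)"
    by (rule powr_mono; use t in simp)+
  moreover have "t powr (- 1) = \<bar>1 / t\<bar>" "t powr (- 2) = \<bar>- 1 / t ^ 2\<bar>"
    using t by (simp_all add: powr_minus divide_inverse)
  ultimately show "\<bar>1 / t\<bar> \<le> 1 * t powr (- 3 / 4)" "\<bar>- 1 / t ^ 2\<bar> \<le> 1 * t powr (- 7 / 4)"
    by simp_all
qed

lemma sum_ln_inverse: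
  "\<exists>\<gamma> C. \<forall>y\<ge>1. \<bar>(\<Sum>k=1..nat \<lfloor>y\<rfloor>. r k * (ln k / k)) - A * ((ln y)\<^sup>2 / 2) - \<gamma>\<bar> \<le> C * y powr (- 1 / 4)"
proof (rule summation_conv[where M = 5 and \<phi>' = "\<lambda>t. (1 - ln t) / t ^ 2"])
  fix t :: real assume t: "t \<ge> 1"
  show "((\<lambda>y. (ln y)\<^sup>2 / 2) has_real_derivative ln t / t) (at t)" using t by (auto intro!: derivative_eq_intros)
  show "((\<lambda>t. ln t / t) has_real_derivative (1 - ln t) / t ^ 2) (at t)"
    using t by (auto intro!: derivative_eq_intros simp: power2_eq_square field_simps)
  have l: "ln t \<le> 4 * t powr (1 / 4)" using ln_le_powr[of t "1 / 4"] t by simp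
  have l0: "ln t \<ge> 0" using t by simp
  have t1: "1 \<le> t powr (1 / 4)" using t by (simp add: ge_one_powr_ge_zero)
  have "\<bar>ln t / t\<bar> = ln t * t powr (- 1)" using t l0 by (simp add: powr_minus divide_inverse)
  also have "\<dots> \<le> 5 * t powr (1 / 4) * t powr (- 1)" using l t1 by (intro mult_right_mono) auto
  also have "\<dots> = 5 * t powr (- 3 / 4)" by (simp only: mult.assoc powr_add[symmetric]) simp
  finally show "\<bar>ln t / t\<bar> \<le> 5 * t powr (- 3 / 4)" .
  have "\<bar>(1 - ln t) / t ^ 2\<bar> = \<bar>1 - ln t\<bar> * t powr (- 2)" using t by (simp add: powr_minus divide_inverse abs_mult)
  also have "\<dots> \<le> 5 * t powr (1 / 4) * t powr (- 2)" using l l0 t1 by (intro mult_right_mono) auto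
  also have "\<dots> = 5 * t powr (- 7 / 4)" by (simp only: mult.assoc powr_add[symmetric]) simp
  finally show "\<bar>(1 - ln t) / t ^ 2\<bar> \<le> 5 * t powr (- 7 / 4)" .
qed

lemma sum_ln_sq:
  "\<exists>C. \<forall>y\<ge>1. \<bar>(\<Sum>k=1..nat \<lfloor>y\<rfloor>. r k * (ln k)\<^sup>2) - A * (y * (ln y)\<^sup>2 - 2 * y * ln y + 2 * y)\<bar> \<le> C * y powr (3 / 4)"
proof (rule summation_bound[where M = 64 and \<phi>' = "\<lambda>t. 2 * ln t / t"])
  fix t :: real assume t: "t \<ge> 1"
  show "((\<lambda>y. y * (ln y)\<^sup>2 - 2 * y * ln y + 2 * y) has_real_derivative (ln t)\<^sup>2) (at t)"
    using t by (auto intro!: derivative_eq_intros simp: field_simps power2_eq_square)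
  show "((\<lambda>t. (ln t)\<^sup>2) has_real_derivative 2 * ln t / t) (at t)"
    using t by (auto intro!: derivative_eq_intros)
  have l: "ln t \<le> 8 * t powr (1 / 8)" "ln t \<le> 4 * t powr (1 / 4)"
    using ln_le_powr[of t "1 / 8"] ln_le_powr[of t "1 / 4"] t by simp_all
  have l0: "ln t \<ge> 0" using t by simp
  have "\<bar>(ln t)\<^sup>2\<bar> \<le> (8 * t powr (1 / 8))\<^sup>2" using power_mono[OF l(1) l0, of 2] by simp
  also have "\<dots> = 64 * t powr (1 / 4)" using t by (simp add: power_mult_distrib power2_eq_square powr_add[symmetric])
  finally show "\<bar>(ln t)\<^sup>2\<bar> \<le> 64 * t powr (1 / 4)" .
  have t0: "0 \<le> t powr (1 / 4)" by simp
  have "\<bar>2 * ln t / t\<bar> = 2 * ln t * t powr (- 1)" using t l0 by (simp add: powr_minus divide_inverse)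
  also have "\<dots> \<le> 64 * t powr (1 / 4) * t powr (- 1)"
    by (rule mult_right_mono) (use l t0 in linarith, simp)
  also have "\<dots> = 64 * t powr (- 3 / 4)" by (simp only: mult.assoc powr_add[symmetric]) simp
  finally show "\<bar>2 * ln t / t\<bar> \<le> 64 * t powr (- 3 / 4)" .
qed

end

section \<open>The Selberg formula\<close>

lemma nat_floor_divide: "nat \<lfloor>y / real k\<rfloor> = nat \<lfloor>y\<rfloor> div k" if "y \<ge> 0"
proof -
  have "\<lfloor>y / real_of_int (int k)\<rfloor> = \<lfloor>y\<rfloor> div int k" by (rule floor_divide_real_eq_div) simp
  then show ?thesis using that by (simp add: nat_div_distrib)
qed

text \<open>This is the lower bound n log n - 4 n for log n!. Comparing the logarithm with twice the
  square root makes the sum a power sum.\<close>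

lemma sum_ln_div_le: "(\<Sum>k=1..n. ln (real n / real k)) \<le> 4 * real n"
proof -
  have "(\<Sum>k=1..n. ln (real n / real k)) \<le> (\<Sum>k=1..n. 2 * (real n powr (1 / 2) * real k powr (1 / 2 - 1)))"
  proof (rule sum_mono)
    fix k assume "k \<in> {1..n}"
    then have k: "1 \<le> real k" "real k \<le> real n" by auto
    have "1 \<le> real n / real k" using k by (subst le_divide_eq_1_pos) auto
    then have "ln (real n / real k) \<le> (1 / (1 / 2)) * (real n / real k) powr (1 / 2)"
      by (rule ln_le_powr) simp
    also have "(real n / real k) powr (1 / 2) = real n powr (1 / 2) * real k powr (- (1 / 2))"
      by (simp only: powr_divide powr_minus_divide) simp
    finally have "ln (real n / real k) \<le> (1 / (1 / 2)) * (real n powr (1 / 2) * real k powr (- (1 / 2)))" .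
    moreover have "- (1 / 2) = 1 / 2 - (1::real)" by simp
    ultimately have "ln (real n / real k) \<le> (1 / (1 / 2)) * (real n powr (1 / 2) * real k powr (1 / 2 - 1))" by metis
    also have "1 / (1 / 2) = (2::real)" by simp
    finally show "ln (real n / real k) \<le> 2 * (real n powr (1 / 2) * real k powr (1 / 2 - 1))" .
  qed
  also have "\<dots> = 2 * real n powr (1 / 2) * (\<Sum>k=1..n. real k powr (1 / 2 - 1))"
    by (simp add: sum_distrib_left mult.assoc)
  also have "\<dots> \<le> 2 * real n powr (1 / 2) * ((1 / (1 / 2)) * real n powr (1 / 2))"
    by (intro mult_left_mono sum_powr_le) auto
  also have "\<dots> = 4 * (real n powr (1 / 2) * real n powr (1 / 2))" by simp
  also have "\<dots> = 4 * real n" by (cases "n = 0") (simp_all add: powr_add[symmetric])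
  finally show ?thesis .
qed

context axiom_A
begin

text \<open>Selberg's \<Lambda>_2. With Z the Dirichlet series of \<open>r\<close>, these are the
  coefficients of Z'' / Z, as \<open>conv_lam2\<close> expresses.\<close>

definition lam2 :: "nat \<Rightarrow> real" where
  "lam2 k = lam k * ln k + conv lam lam k"

lemma conv_lam2: "n > 0 \<Longrightarrow> conv r lam2 n = r n * (ln n)\<^sup>2"
  using conv_selberg[of r lam n] conv_lam by (simp add: lam2_def[abs_def])

lemma lam2_nonneg: "lam2 k \<ge> 0"
  using lam_nonneg by (cases "k = 0") (auto simp: lam2_def conv_nonneg)

text \<open>Moebius inversion for functions of a real variable: inserting the definition of
  \<open>H\<close> collects the values G (n / m) with coefficients \<open>conv mu r m\<close>, and
  only m = 1 survives.\<close>

lemma sum_r_inversion: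
  fixes G H :: "real \<Rightarrow> real"
  assumes H: "\<And>y. y \<ge> 1 \<Longrightarrow> H y = (\<Sum>k=1..nat \<lfloor>y\<rfloor>. r k * G (y / k))" and n: "n \<ge> 1"
  shows "G (real n) = (\<Sum>a=1..n. mu a * H (real n / a))"
proof -
  have "(\<Sum>m=1..n. conv mu r m * G (real n / m)) = (\<Sum>m=1..n. if m = 1 then G (real n) else 0)"
    by (intro sum.cong) (auto simp: conv_mu)
  also have "\<dots> = G (real n)" using n by (subst sum.delta) auto
  finally have "G (real n) = (\<Sum>m=1..n. conv mu r m * G (real n / m))" ..
  also have "\<dots> = (\<Sum>a=1..n. \<Sum>b=1..n div a. mu a * r b * G (real n / real (a * b)))"
    by (rule sum_conv_weighted)
  also have "\<dots> = (\<Sum>a=1..n. mu a * H (real n / a))"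
  proof (rule sum.cong[OF refl])
    fix a assume a: "a \<in> {1..n}"
    have "H (real n / a) = (\<Sum>k=1..nat \<lfloor>real n / a\<rfloor>. r k * G (real n / a / k))"
      using a by (intro H) auto
    also have "nat \<lfloor>real n / a\<rfloor> = n div a" using nat_floor_divide[of "real n" a] by simp
    finally show "(\<Sum>b=1..n div a. mu a * r b * G (real n / real (a * b))) = mu a * H (real n / a)"
      by (simp add: sum_distrib_left mult.assoc)
  qed
  finally show ?thesis .
qed

lemma sum_r_powr_le: "(\<Sum>k=1..n. r k * real k powr (- 7 / 8)) \<le> 8 * C0 * real n powr (1 / 8)"
proof -
  have "(\<Sum>k=1..n. r k * real k powr (- 7 / 8)) \<le> C0 * (\<Sum>k=1..n. real k powr (- 7 / 8))"
    by (rule sum_mult_antimono_le[OF count_le]) (auto intro!: powr_mono2')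
  also have "\<dots> = C0 * (\<Sum>k=1..n. real k powr (1 / 8 - 1))" by simp
  also have "\<dots> \<le> C0 * ((1 / (1 / 8)) * real n powr (1 / 8))"
    using C0_pos by (intro mult_left_mono sum_powr_le) auto
  finally show ?thesis by simp
qed

text \<open>A model 2 y ln y + b y + c for the summatory function of \<open>lam2\<close> is chosen
  so that its \<open>r\<close>-weighted sum reproduces that of \<open>r k * (ln k)\<^sup>2\<close>
  up to a power below y. Moebius inversion then transfers the small error back, with no information
  on \<open>mu\<close> beyond its domination by \<open>r\<close>.\<close>

lemma selberg_symmetry:
  "\<exists>C. \<forall>n. \<bar>(\<Sum>k=1..n. lam2 k) - 2 * (\<Sum>k=1..n. ln (real k))\<bar> \<le> C * real n"
proof -
  obtain g1 C1 where 1: "\<And>y. y \<ge> 1 \<Longrightarrow> \<bar>(\<Sum>k=1..nat \<lfloor>y\<rfloor>. r k * (1 / k)) - A * ln y - g1\<bar> \<le> C1 * y powr (- 1 / 4)"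
    using sum_inverse by blast
  obtain g2 C2 where 2: "\<And>y. y \<ge> 1 \<Longrightarrow> \<bar>(\<Sum>k=1..nat \<lfloor>y\<rfloor>. r k * (ln k / k)) - A * ((ln y)\<^sup>2 / 2) - g2\<bar> \<le> C2 * y powr (- 1 / 4)"
    using sum_ln_inverse by blast
  obtain C3 where 3: "\<And>y. y \<ge> 1 \<Longrightarrow> \<bar>(\<Sum>k=1..nat \<lfloor>y\<rfloor>. r k * (ln k)\<^sup>2) - A * (y * (ln y)\<^sup>2 - 2 * y * ln y + 2 * y)\<bar> \<le> C3 * y powr (3 / 4)"
    using sum_ln_sq by blast
  have nn: "C1 \<ge> 0" "C2 \<ge> 0" "C3 \<ge> 0" using 1[of 1] 2[of 1] 3[of 1] by auto
  \<comment> \<open>Summing the model against \<open>r\<close> gives the terms A y ln^2 y, (2 g1 + A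
    b) y ln y and (A c + b g1 - 2 g2) y. The constants are determined by matching the last two with
    -2 A y ln y and 2 A y from \<open>sum_ln_sq\<close>.\<close>
  define b where "b = - (2 * A + 2 * g1) / A"
  define c where "c = (2 * A + 2 * g2 - b * g1) / A"
  have bc: "A * b = - (2 * A + 2 * g1)" "A * c = 2 * A + 2 * g2 - b * g1"
    using A_pos by (simp_all add: b_def c_def)
  define \<Phi> where "\<Phi> y = 2 * y * ln y + b * y + c" for y :: real
  define G where "G y = (\<Sum>k=1..nat \<lfloor>y\<rfloor>. lam2 k) - \<Phi> y" for y
  define H where "H y = (\<Sum>k=1..nat \<lfloor>y\<rfloor>. r k * G (y / k))" for y
  define C4 where "C4 = C3 + 16 * C1 + 2 * C2 + \<bar>b\<bar> * C1 + \<bar>c\<bar> * (B + A)"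
  have C4: "C4 \<ge> 0" using nn A_pos B_nonneg by (simp add: C4_def)
  have H: "\<bar>H y\<bar> \<le> C4 * y powr (7 / 8)" if y: "y \<ge> 1" for y
  proof -
    define K where "K = nat \<lfloor>y\<rfloor>"
    have K: "K \<ge> 1" "real K \<le> y" "y < real K + 1" using y by (auto simp: K_def le_nat_iff)
    define U1 U2 U0 L where "U1 = (\<Sum>k=1..K. r k * (1 / k))" and "U2 = (\<Sum>k=1..K. r k * (ln k / k))"
      and "U0 = (\<Sum>k=1..K. r k)" and "L = (\<Sum>k=1..K. r k * (ln k)\<^sup>2)"
    define e1 e2 e0 e3 where "e1 = U1 - A * ln y - g1" and "e2 = U2 - A * ((ln y)\<^sup>2 / 2) - g2"
      and "e0 = U0 - A * y" and "e3 = L - A * (y * (ln y)\<^sup>2 - 2 * y * ln y + 2 * y)"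
    have "(\<Sum>k=1..K. r k * (\<Sum>j=1..nat \<lfloor>y / k\<rfloor>. lam2 j)) = (\<Sum>k=1..K. r k * (\<Sum>j=1..K div k. lam2 j))"
      using y by (simp add: nat_floor_divide K_def)
    also have "\<dots> = (\<Sum>k=1..K. conv r lam2 k)" by (rule sum_conv[symmetric])
    also have "\<dots> = L" unfolding L_def by (intro sum.cong) (auto simp: conv_lam2)
    finally have "H y = L - (\<Sum>k=1..K. r k * \<Phi> (y / k))"
      unfolding H_def G_def K_def[symmetric] by (simp add: right_diff_distrib sum_subtractf)
    also have "(\<Sum>k=1..K. r k * \<Phi> (y / k)) = (\<Sum>k=1..K. 2 * y * ln y * (r k * (1 / k)) - 2 * y * (r k * (ln k / k))
        + b * y * (r k * (1 / k)) + c * r k)"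
    proof (rule sum.cong[OF refl])
      fix k assume "k \<in> {1..K}"
      then have l: "ln (y / k) = ln y - ln k" using y by (simp add: ln_div)
      show "r k * \<Phi> (y / k) = 2 * y * ln y * (r k * (1 / k)) - 2 * y * (r k * (ln k / k))
        + b * y * (r k * (1 / k)) + c * r k" unfolding \<Phi>_def l by (simp add: algebra_simps diff_divide_distrib)
    qed
    also have "\<dots> = 2 * y * ln y * U1 - 2 * y * U2 + b * y * U1 + c * U0"
      by (simp only: sum.distrib sum_subtractf sum_distrib_left U1_def U2_def U0_def)
    finally have Hy: "H y = L - (2 * y * ln y * U1 - 2 * y * U2 + b * y * U1 + c * U0)" .
    have E: "L = e3 + A * (y * (ln y)\<^sup>2 - 2 * y * ln y + 2 * y)" "U1 = e1 + A * ln y + g1"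
      "U2 = e2 + A * ((ln y)\<^sup>2 / 2) + g2" "U0 = e0 + A * y"
      by (simp_all add: e1_def e2_def e0_def e3_def)
    have "H y = (e3 - 2 * y * ln y * e1 + 2 * y * e2 - b * y * e1 - c * e0)
        - (A * b + 2 * A + 2 * g1) * (y * ln y) - (A * c - 2 * A - 2 * g2 + b * g1) * y"
      unfolding Hy E by (simp add: algebra_simps power2_eq_square)
    then have He: "H y = e3 - 2 * y * ln y * e1 + 2 * y * e2 - b * y * e1 - c * e0"
      using bc by simp
    \<comment> \<open>The worst error is y ln y times y powr (-1/4). The exponent 7/8 leaves room
      for the logarithm.\<close>
    define Y where "Y = y powr (7 / 8)"
    have y34: "y powr (3 / 4) \<le> Y" unfolding Y_def using y by (intro powr_mono) auto
    have "y powr 1 * y powr (- 1 / 4) = y powr (3 / 4)" by (simp only: powr_add[symmetric]) simp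
    then have yy: "y * y powr (- 1 / 4) = y powr (3 / 4)" using y by simp
    have l: "ln y \<le> 8 * y powr (1 / 8)" "ln y \<ge> 0" using ln_le_powr[of y "1 / 8"] y by simp_all
    have e1: "\<bar>e1\<bar> \<le> C1 * y powr (- 1 / 4)" and e2: "\<bar>e2\<bar> \<le> C2 * y powr (- 1 / 4)"
      and e3: "\<bar>e3\<bar> \<le> C3 * y powr (3 / 4)"
      using 1[OF y] 2[OF y] 3[OF y] by (simp_all add: e1_def e2_def e3_def U1_def U2_def L_def K_def)
    have "0 \<le> A * (y - K)" using K A_pos by simp
    moreover have "e0 = (U0 - A * K) - A * (y - K)" by (simp add: e0_def algebra_simps)
    ultimately have "\<bar>e0\<bar> \<le> \<bar>U0 - A * K\<bar> + A * (y - K)" by linarith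
    also have "\<dots> \<le> B * sqrt K + A * 1"
      unfolding U0_def using count[of K] K A_pos by (intro add_mono mult_left_mono) auto
    also have "\<dots> \<le> B * y powr (1 / 2) + A * y powr (1 / 2)"
    proof (intro add_mono mult_left_mono)
      show "sqrt (real K) \<le> y powr (1 / 2)" using K by (simp add: powr_half_sqrt)
      show "1 \<le> y powr (1 / 2)" using y by (intro ge_one_powr_ge_zero) auto
    qed (use A_pos B_nonneg in auto)
    also have "\<dots> = (B + A) * y powr (1 / 2)" by (simp add: algebra_simps)
    also have "\<dots> \<le> (B + A) * Y" unfolding Y_def using A_pos B_nonneg y
      by (intro mult_left_mono powr_mono) auto
    finally have e0: "\<bar>c * e0\<bar> \<le> \<bar>c\<bar> * (B + A) * Y"
      unfolding abs_mult mult.assoc by (intro mult_left_mono) auto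
    have ye1: "\<bar>y * e1\<bar> \<le> C1 * y powr (3 / 4)"
    proof -
      have "\<bar>y * e1\<bar> = y * \<bar>e1\<bar>" using y by (simp add: abs_mult)
      also have "\<dots> \<le> y * (C1 * y powr (- 1 / 4))" using y e1 by (intro mult_left_mono) auto
      finally show ?thesis using yy by (simp only: mult.left_commute)
    qed
    then have "\<bar>b * y * e1\<bar> \<le> \<bar>b\<bar> * (C1 * y powr (3 / 4))"
      unfolding mult.assoc abs_mult[of b] by (intro mult_left_mono) auto
    also have "\<dots> \<le> \<bar>b\<bar> * (C1 * Y)" using y34 nn by (intro mult_left_mono) auto
    finally have be1: "\<bar>b * y * e1\<bar> \<le> \<bar>b\<bar> * C1 * Y" by simp
    have "\<bar>2 * y * ln y * e1\<bar> = 2 * ln y * \<bar>y * e1\<bar>" using y l by (simp add: abs_mult)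
    also have "\<dots> \<le> 2 * (8 * y powr (1 / 8)) * (C1 * y powr (3 / 4))"
      using l ye1 by (intro mult_mono) auto
    also have "\<dots> = 16 * C1 * (y powr (1 / 8) * y powr (3 / 4))" by simp
    also have "\<dots> = 16 * C1 * Y" unfolding Y_def by (simp only: powr_add[symmetric]) simp
    finally have le1: "\<bar>2 * y * ln y * e1\<bar> \<le> 16 * C1 * Y" .
    have "\<bar>y * e2\<bar> \<le> C2 * y powr (3 / 4)"
    proof -
      have "\<bar>y * e2\<bar> = y * \<bar>e2\<bar>" using y by (simp add: abs_mult)
      also have "\<dots> \<le> y * (C2 * y powr (- 1 / 4))" using y e2 by (intro mult_left_mono) auto
      finally show ?thesis using yy by (simp only: mult.left_commute)
    qed
    then have ye2: "\<bar>2 * y * e2\<bar> \<le> 2 * C2 * Y"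
      using mult_left_mono[OF y34 nn(2)] by (simp add: abs_mult)
    have e3': "\<bar>e3\<bar> \<le> C3 * Y" using e3 mult_left_mono[OF y34 nn(3)] by simp
    have "\<bar>H y\<bar> \<le> C3 * Y + 16 * C1 * Y + 2 * C2 * Y + \<bar>b\<bar> * C1 * Y + \<bar>c\<bar> * (B + A) * Y"
      unfolding He using e3' le1 ye2 be1 e0 by linarith
    then show ?thesis by (simp add: C4_def Y_def algebra_simps)
  qed
  \<comment> \<open>An error exponent below 1 is essential: the sum of r a (n / a) powr (7/8) is
    O(n), whereas the exponent 1 would lose a logarithm.\<close>
  have G: "\<bar>G n\<bar> \<le> 8 * C0 * C4 * real n" if n: "n \<ge> 1" for n :: nat
  proof -
    have "\<bar>G n\<bar> = \<bar>\<Sum>a=1..n. mu a * H (real n / a)\<bar>"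
      using sum_r_inversion[of H G n] n by (simp add: H_def)
    also have "\<dots> \<le> (\<Sum>a=1..n. r a * (C4 * (real n / a) powr (7 / 8)))"
    proof (rule order_trans[OF sum_abs sum_mono])
      fix a assume a: "a \<in> {1..n}"
      show "\<bar>mu a * H (real n / a)\<bar> \<le> r a * (C4 * (real n / a) powr (7 / 8))"
        unfolding abs_mult using a H[of "real n / a"] mu_le[of a] r_nonneg[of a] by (intro mult_mono) auto
    qed
    also have "\<dots> = (\<Sum>a=1..n. C4 * real n powr (7 / 8) * (r a * real a powr (- 7 / 8)))"
    proof (rule sum.cong[OF refl])
      fix a assume a: "a \<in> {1..n}"
      have "(real n / real a) powr (7 / 8) = real n powr (7 / 8) * real a powr (- (7 / 8))"
        by (simp only: powr_divide powr_minus_divide) simp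
      then show "r a * (C4 * (real n / a) powr (7 / 8)) = C4 * real n powr (7 / 8) * (r a * real a powr (- 7 / 8))"
        by simp
    qed
    also have "\<dots> = C4 * real n powr (7 / 8) * (\<Sum>a=1..n. r a * real a powr (- 7 / 8))"
      by (simp only: sum_distrib_left)
    also have "\<dots> \<le> C4 * real n powr (7 / 8) * (8 * C0 * real n powr (1 / 8))"
      using C4 by (intro mult_left_mono sum_r_powr_le) auto
    also have "\<dots> = 8 * C0 * C4 * (real n powr (7 / 8) * real n powr (1 / 8))" by simp
    also have "\<dots> = 8 * C0 * C4 * real n" using n by (simp only: powr_add[symmetric]) simp
    finally show ?thesis .
  qed
  have "\<bar>(\<Sum>k=1..n. lam2 k) - 2 * (\<Sum>k=1..n. ln (real k))\<bar> \<le> (8 * C0 * C4 + \<bar>b\<bar> + \<bar>c\<bar> + 8) * n" for n :: nat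
  proof (cases "n = 0")
    case False
    then have n: "n \<ge> 1" by simp
    \<comment> \<open>The model contains 2 n ln n and the claim contains twice the sum of ln k.
      Their difference is twice this sum, hence O(n).\<close>
    have "(\<Sum>k=1..n. ln (real n / real k)) = (\<Sum>k=1..n. ln (real n) - ln (real k))"
      using n by (intro sum.cong) (auto simp: ln_div)
    then have s: "(\<Sum>k=1..n. ln (real n / real k)) = n * ln n - (\<Sum>k=1..n. ln (real k))"
      by (simp add: sum_subtractf)
    have s0: "0 \<le> (\<Sum>k=1..n. ln (real n / real k))" by (intro sum_nonneg) auto
    have "(\<Sum>k=1..n. lam2 k) - 2 * (\<Sum>k=1..n. ln (real k))
        = G n + b * n + c + 2 * (\<Sum>k=1..n. ln (real n / real k))"
      unfolding s G_def \<Phi>_def by (simp add: algebra_simps)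
    also have "\<bar>\<dots>\<bar> \<le> 8 * C0 * C4 * real n + \<bar>b\<bar> * n + \<bar>c\<bar> * n + 2 * (4 * real n)"
    proof -
      have "\<bar>b * n\<bar> = \<bar>b\<bar> * n" by (simp add: abs_mult)
      moreover have "\<bar>c\<bar> \<le> \<bar>c\<bar> * n" using n by (simp add: mult_le_cancel_left1)
      ultimately show ?thesis using G[OF n] s0 sum_ln_div_le[of n] by linarith
    qed
    finally show ?thesis by (simp add: algebra_simps)
  qed simp
  then show ?thesis by blast
qed

text \<open>For k beyond sqrt n one has lam k ln n / 2 \<le> lam k ln k \<le> lam2 k, and the
  Selberg formula bounds the sum of the latter by O(n ln n). The remaining k are so few that lam k
  \<le> r k ln k, the d = 1 term of the convolution identity, is enough.\<close>

lemma chebyshev: "\<exists>C. \<forall>n. (\<Sum>k=1..n. lam k) \<le> C * real n"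
proof -
  obtain C where C: "\<And>n. \<bar>(\<Sum>k=1..n. lam2 k) - 2 * (\<Sum>k=1..n. ln (real k))\<bar> \<le> C * real n"
    using selberg_symmetry by blast
  have C_nonneg: "C \<ge> 0" using C[of 1] by auto
  have lam_le: "lam k \<le> r k * ln k" if "k > 0" for k
  proof -
    have "lam k = r 1 * lam (k div 1)" by (simp only: r_1) simp
    also have "\<dots> \<le> conv r lam k"
      unfolding conv_def using that r_nonneg lam_nonneg
      by (intro member_le_sum[of "1::nat" "{d. d dvd k}" "\<lambda>d. r d * lam (k div d)"]) auto
    finally show ?thesis using conv_lam[OF that] by simp
  qed
  have "(\<Sum>k=1..n. lam k) \<le> (4 * C0 + 4 + 4 * C) * n" if n: "n \<ge> 3" for n :: nat
  proof -
    have ln1: "ln (real n) \<ge> 1"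
      using n exp_le by (subst ln_ge_iff) auto
    have "(\<Sum>k=1..n. lam k) \<le> (\<Sum>k=1..n. if real k \<le> sqrt n then r k * ln n else 0)
        + (\<Sum>k=1..n. lam2 k * (2 / ln n))"
      unfolding sum.distrib[symmetric]
    proof (rule sum_mono)
      fix k assume k: "k \<in> {1..n}"
      then have kk: "k > 0" "real k \<le> real n" by auto
      have l2: "lam2 k \<ge> 0" by (rule lam2_nonneg)
      show "lam k \<le> (if real k \<le> sqrt n then r k * ln n else 0) + lam2 k * (2 / ln n)"
      proof (cases "real k \<le> sqrt n")
        case True
        have "lam k \<le> r k * ln k" using lam_le kk by simp
        also have "\<dots> \<le> r k * ln n" using kk r_nonneg by (intro mult_left_mono) auto
        finally show ?thesis using True l2 ln1 by (simp add: add_increasing2)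
      next
        case False
        have "ln (sqrt n) \<le> ln (real k)" using False n kk by (subst ln_le_cancel_iff) auto
        then have "ln n / 2 \<le> ln (real k)" using n by (simp add: ln_sqrt)
        then have "lam k * (ln n / 2) \<le> lam k * ln (real k)" using lam_nonneg by (intro mult_left_mono) auto
        also have "\<dots> \<le> lam2 k" using conv_nonneg[of lam lam k] lam_nonneg by (simp add: lam2_def)
        finally have "lam k \<le> lam2 k * (2 / ln n)" using ln1 by (simp add: field_simps)
        then show ?thesis using False by simp
      qed
    qed
    also have "(\<Sum>k=1..n. if real k \<le> sqrt n then r k * ln n else 0) \<le> 4 * C0 * n"
    proof -
      define s where "s = nat \<lfloor>sqrt n\<rfloor>"
      have s: "real s \<le> sqrt n" by (simp add: s_def)
      have "(\<Sum>k=1..n. if real k \<le> sqrt n then r k * ln n else 0) = (\<Sum>k\<in>{1..n} \<inter> {k. real k \<le> sqrt n}. r k * ln n)"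
        by (simp add: sum.inter_restrict)
      also have "\<dots> \<le> (\<Sum>k=1..s. r k * ln n)"
        using r_nonneg ln1 by (intro sum_mono2) (auto simp: s_def le_nat_floor)
      also have "\<dots> = ln n * (\<Sum>k=1..s. r k)" by (simp add: sum_distrib_left mult.commute)
      also have "\<dots> \<le> ln n * (C0 * sqrt n)"
      proof (rule mult_left_mono)
        show "(\<Sum>k=1..s. r k) \<le> C0 * sqrt n"
          using count_le[of s] mult_left_mono[OF s, of C0] C0_pos by linarith
      qed (use ln1 in simp)
      also have "\<dots> \<le> (2 * sqrt n) * (C0 * sqrt n)"
        using ln_le_powr[of "real n" "1 / 2"] n C0_pos by (intro mult_right_mono) (auto simp: powr_half_sqrt)
      also have "\<dots> = 2 * C0 * n" by simp
      also have "\<dots> \<le> 4 * C0 * n" using C0_pos by (simp add: mult_right_mono)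
      finally show ?thesis .
    qed
    also have "(\<Sum>k=1..n. lam2 k * (2 / ln n)) \<le> (4 + 4 * C) * n"
    proof -
      have "(\<Sum>k=1..n. ln (real k)) \<le> (\<Sum>k=1..n. ln (real n))" by (intro sum_mono) auto
      then have "(\<Sum>k=1..n. lam2 k) \<le> 2 * (n * ln n) + C * n" using C[of n] by simp
      also have "\<dots> \<le> 2 * (n * ln n) + C * (n * ln n)"
        using C_nonneg ln1 by (intro add_left_mono mult_left_mono) (auto simp: mult_le_cancel_left1)
      also have "\<dots> = (2 + C) * n * ln n" by (simp add: algebra_simps)
      finally have "(\<Sum>k=1..n. lam2 k) * (2 / ln n) \<le> ((2 + C) * n * ln n) * (2 / ln n)"
        using ln1 by (intro mult_right_mono) auto
      also have "\<dots> = (4 + 2 * C) * n" using ln1 by (simp add: field_simps)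
      also have "\<dots> \<le> (4 + 4 * C) * n" using C_nonneg by (intro mult_right_mono) auto
      finally show ?thesis by (simp only: sum_distrib_right)
    qed
    finally show ?thesis by (simp add: algebra_simps)
  qed
  note large = this
  define C' where "C' = 4 * C0 + 4 + 4 * C + (\<Sum>k=1..3. lam k)"
  have "(\<Sum>k=1..n. lam k) \<le> C' * n" for n :: nat
  proof (cases "n \<ge> 3")
    case True
    have "(4 * C0 + 4 + 4 * C) * real n \<le> C' * n"
      unfolding C'_def using lam_nonneg by (intro mult_right_mono) (auto intro!: sum_nonneg add_increasing2)
    then show ?thesis using large[OF True] by linarith
  next
    case False
    show ?thesis
    proof (cases "n = 0")
      case n: False
      have "(\<Sum>k=1..n. lam k) \<le> (\<Sum>k=1..3. lam k)" using False lam_nonneg by (intro sum_mono2) auto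
      also have "\<dots> \<le> C'" using C0_pos C_nonneg by (simp add: C'_def)
      also have "\<dots> \<le> C' * n"
      proof -
        have "C' \<ge> 0" unfolding C'_def using C0_pos C_nonneg lam_nonneg by (intro add_nonneg_nonneg sum_nonneg) auto
        then show ?thesis using n by (simp add: mult_le_cancel_left1)
      qed
      finally show ?thesis .
    qed simp
  qed
  then show ?thesis by blast
qed

end

section \<open>A mean square formula\<close>

text \<open>The contour is the rectangle on [-R, R] of height R, which encloses the single pole i h.
  For l \<ge> 0 the exponential is bounded by 1 in the upper half plane, so the other three sides,
  of total length 4 R, contribute at most 4 R / (R^2 - h^2).\<close>

lemma fourier_rectangle:
  fixes h l R :: real
  assumes "h > 0" "l \<ge> 0" "R > h"
  shows "\<bar>integral {-R..R} (\<lambda>t. cos (l * t) / (h\<^sup>2 + t\<^sup>2)) - pi / h * exp (- h * l)\<bar> \<le> 4 * R / (R\<^sup>2 - h\<^sup>2)"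
proof -
  \<comment> \<open>Dividing out one pole only keeps \<open>f\<close> holomorphic on the half plane
    Im z > -h, so Cauchy's integral formula on this convex set evaluates the integral of
    \<open>g\<close> without residues.\<close>
  define f where "f z = exp (\<i> * of_real l * z) / (z + \<i> * of_real h)" for z
  define g where "g w = f w / (w - \<i> * of_real h)" for w
  define S where "S = {z. Im z > - h}"
  define a1 a2 a3 a4 where "a1 = Complex (-R) 0" and "a2 = Complex R 0" and "a3 = Complex R R" and "a4 = Complex (-R) R"
  have R: "R > 0" using assms by simp
  have g_eq: "g w = exp (\<i> * of_real l * w) / (w\<^sup>2 + (of_real h)\<^sup>2)" for w
    by (simp add: g_def f_def algebra_simps power2_eq_square)
  have sub: "path_image (rectpath a1 a3) \<subseteq> S - {\<i> * of_real h}"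
  proof
    fix z assume z: "z \<in> path_image (rectpath a1 a3)"
    then have "z \<in> cbox a1 a3 - box a1 a3"
      using R path_image_rectpath_cbox_minus_box[of a1 a3] by (simp add: a1_def a3_def)
    then show "z \<in> S - {\<i> * of_real h}"
      using R assms by (auto simp: in_cbox_complex_iff in_box_complex_iff a1_def a3_def S_def)
  qed
  have "((\<lambda>w. f w / (w - \<i> * of_real h)) has_contour_integral
      (2*pi * \<i> * winding_number (rectpath a1 a3) (\<i> * of_real h) * f (\<i> * of_real h))) (rectpath a1 a3)"
  proof (rule Cauchy_integral_formula_convex_simple)
    show "convex S" unfolding S_def by (rule convex_halfspace_Im_gt)
    have "z + \<i> * of_real h \<noteq> 0" if "z \<in> S" for z
    proof
      assume "z + \<i> * of_real h = 0"
      then have "Im (z + \<i> * of_real h) = 0" by simp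
      then show False using that by (simp add: S_def)
    qed
    then show "f holomorphic_on S" unfolding f_def by (intro holomorphic_intros) auto
    have "open S" unfolding S_def by (rule open_halfspace_Im_gt)
    then show "\<i> * of_real h \<in> interior S" using assms by (simp add: interior_open S_def)
  qed (use sub in auto)
  moreover have "winding_number (rectpath a1 a3) (\<i> * of_real h) = 1"
    by (rule winding_number_rectpath) (use assms in \<open>auto simp: in_box_complex_iff a1_def a3_def\<close>)
  moreover have "f (\<i> * of_real h) = exp (- of_real (h * l)) / (2 * \<i> * of_real h)"
    by (simp add: f_def algebra_simps)
  ultimately have main: "(g has_contour_integral (of_real (pi / h * exp (- h * l)))) (rectpath a1 a3)"
    using assms by (simp add: g_def[abs_def] exp_of_real[symmetric] del: exp_of_real)
  have nz: "w\<^sup>2 + (of_real h)\<^sup>2 \<noteq> 0" if "w \<in> S - {\<i> * of_real h}" for w :: complex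
  proof
    assume "w\<^sup>2 + (of_real h)\<^sup>2 = 0"
    then have "(w - \<i> * of_real h) * (w + \<i> * of_real h) = 0" by (simp add: algebra_simps power2_eq_square)
    then have "w + \<i> * of_real h = 0" using that by auto
    then have "Im (w + \<i> * of_real h) = 0" by simp
    then show False using that by (simp add: S_def)
  qed
  have segs: "path_image (rectpath a1 a3) = closed_segment a1 a2 \<union> closed_segment a2 a3 \<union> closed_segment a3 a4 \<union> closed_segment a4 a1"
    unfolding rectpath_def a1_def a2_def a3_def a4_def by (auto simp: Let_def path_image_join)
  have cont: "continuous_on (path_image (rectpath a1 a3)) g"
    unfolding g_eq using sub nz by (intro continuous_intros) auto
  have int: "g contour_integrable_on (linepath a b)" if "closed_segment a b \<subseteq> path_image (rectpath a1 a3)" for a b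
    by (rule contour_integrable_continuous_linepath) (rule continuous_on_subset[OF cont that])
  define I where "I a b = contour_integral (linepath a b) g" for a b
  have i: "(g has_contour_integral I a b) (linepath a b)" if "closed_segment a b \<subseteq> path_image (rectpath a1 a3)" for a b
    unfolding I_def by (rule has_contour_integral_integral[OF int[OF that]])
  have "(g has_contour_integral (I a1 a2 + (I a2 a3 + (I a3 a4 + I a4 a1)))) (linepath a1 a2 +++ linepath a2 a3 +++ linepath a3 a4 +++ linepath a4 a1)"
    by (intro has_contour_integral_join i valid_path_join valid_path_linepath) (use segs in auto)
  then have "(g has_contour_integral (I a1 a2 + (I a2 a3 + (I a3 a4 + I a4 a1)))) (rectpath a1 a3)"
    by (simp add: rectpath_def Let_def a1_def a2_def a3_def a4_def)
  with main have sum: "of_real (pi / h * exp (- h * l)) = I a1 a2 + (I a2 a3 + (I a3 a4 + I a4 a1))"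
    by (rule has_contour_integral_unique)
  have Rh: "R\<^sup>2 - h\<^sup>2 > 0" using assms by (simp add: power2_eq_square mult_strict_mono)
  have bound: "norm (I a b) \<le> 1 / (R\<^sup>2 - h\<^sup>2) * norm (b - a)"
    if ab: "closed_segment a b \<subseteq> path_image (rectpath a1 a3)"
      and far: "\<And>w. w \<in> closed_segment a b \<Longrightarrow> R \<le> norm w \<and> Im w \<ge> 0" for a b
    unfolding I_def
  proof (rule contour_integral_bound_linepath[OF int[OF ab]])
    show "0 \<le> 1 / (R\<^sup>2 - h\<^sup>2)" using Rh by simp
    fix w assume w: "w \<in> closed_segment a b"
    have "R\<^sup>2 - h\<^sup>2 \<le> (norm w)\<^sup>2 - h\<^sup>2" using far[OF w] R by (simp add: power_mono)
    also have "\<dots> = norm (w\<^sup>2) - norm (- (of_real h)\<^sup>2 :: complex)" using assms by (simp add: norm_power)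
    also have "\<dots> \<le> norm (w\<^sup>2 - (- (of_real h)\<^sup>2))" by (rule norm_triangle_ineq2)
    finally have "R\<^sup>2 - h\<^sup>2 \<le> norm (w\<^sup>2 + (of_real h)\<^sup>2)" by simp
    moreover have "norm (exp (\<i> * of_real l * w)) \<le> 1" using far[OF w] assms by simp
    ultimately show "norm (g w) \<le> 1 / (R\<^sup>2 - h\<^sup>2)"
      unfolding g_eq norm_divide using Rh by (intro frac_le) auto
  qed
  have far: "R \<le> norm w \<and> Im w \<ge> 0"
    if "w \<in> closed_segment a2 a3 \<union> closed_segment a3 a4 \<union> closed_segment a4 a1" for w
  proof -
    have "Im w \<ge> 0 \<and> (Re w = R \<or> Im w = R \<or> Re w = - R)"
      using that R unfolding a1_def a2_def a3_def a4_def
      by (auto simp: closed_segment_same_Re closed_segment_same_Im closed_segment_eq_real_ivl split: if_splits)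
    then show ?thesis using abs_Re_le_cmod[of w] abs_Im_le_cmod[of w] R by auto
  qed
  have "a3 - a2 = \<i> * of_real R" "a4 - a3 = of_real (- 2 * R)" "a1 - a4 = - (\<i> * of_real R)"
    by (simp_all add: complex_eq_iff a1_def a2_def a3_def a4_def)
  then have len: "norm (a3 - a2) = R" "norm (a4 - a3) = 2 * R" "norm (a1 - a4) = R"
    using R by (simp_all add: norm_mult)
  have "norm (I a2 a3) \<le> 1 / (R\<^sup>2 - h\<^sup>2) * norm (a3 - a2)"
    by (rule bound) (use segs far in auto)
  then have b23: "norm (I a2 a3) \<le> 1 / (R\<^sup>2 - h\<^sup>2) * R" by (simp only: len)
  have "norm (I a3 a4) \<le> 1 / (R\<^sup>2 - h\<^sup>2) * norm (a4 - a3)"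
    by (rule bound) (use segs far in auto)
  then have b34: "norm (I a3 a4) \<le> 1 / (R\<^sup>2 - h\<^sup>2) * (2 * R)" by (simp only: len)
  have "norm (I a4 a1) \<le> 1 / (R\<^sup>2 - h\<^sup>2) * norm (a1 - a4)"
    by (rule bound) (use segs far in auto)
  then have b41: "norm (I a4 a1) \<le> 1 / (R\<^sup>2 - h\<^sup>2) * R" by (simp only: len)
  have "norm (I a1 a2 - of_real (pi / h * exp (- h * l))) = norm (I a2 a3 + (I a3 a4 + I a4 a1))"
  proof -
    have "I a1 a2 - of_real (pi / h * exp (- h * l)) = - (I a2 a3 + (I a3 a4 + I a4 a1))" unfolding sum by simp
    then show ?thesis by (simp only: norm_minus_cancel)
  qed
  also have "\<dots> \<le> norm (I a2 a3) + (norm (I a3 a4) + norm (I a4 a1))"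
    by (intro order_trans[OF norm_triangle_ineq] add_left_mono norm_triangle_ineq)
  also have "\<dots> \<le> 1 / (R\<^sup>2 - h\<^sup>2) * R + (1 / (R\<^sup>2 - h\<^sup>2) * (2 * R) + 1 / (R\<^sup>2 - h\<^sup>2) * R)"
    by (intro add_mono b23 b34 b41)
  also have "\<dots> = 4 * R / (R\<^sup>2 - h\<^sup>2)" by (simp add: field_simps)
  finally have *: "norm (I a1 a2 - of_real (pi / h * exp (- h * l))) \<le> 4 * R / (R\<^sup>2 - h\<^sup>2)" .
  have "(g has_contour_integral I a1 a2) (linepath a1 a2)" by (rule i) (use segs in auto)
  then have "((\<lambda>x. g (of_real x)) has_integral I a1 a2) {Re a1..Re a2}"
    by (subst (asm) has_contour_integral_linepath_Reals_iff)
       (use R in \<open>auto simp: a1_def a2_def complex_is_Real_iff\<close>)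
  then have "((\<lambda>x. Re (g (of_real x))) has_integral Re (I a1 a2)) {-R..R}"
    using has_integral_linear[OF _ bounded_linear_Re] by (auto simp: a1_def a2_def o_def)
  moreover have "Re (g (of_real t)) = cos (l * t) / (h\<^sup>2 + t\<^sup>2)" for t
  proof -
    have "(of_real t)\<^sup>2 + (of_real h)\<^sup>2 = (of_real (h\<^sup>2 + t\<^sup>2) :: complex)" by simp
    then have "g (of_real t) = exp (\<i> * of_real (l * t)) / of_real (h\<^sup>2 + t\<^sup>2)"
      unfolding g_eq by (simp add: mult.assoc)
    then show ?thesis by (simp only: Re_divide_of_real) (simp add: Re_exp)
  qed
  ultimately have "integral {-R..R} (\<lambda>t. cos (l * t) / (h\<^sup>2 + t\<^sup>2)) = Re (I a1 a2)"
    by (simp add: integral_unique)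
  moreover have "\<bar>Re (I a1 a2) - pi / h * exp (- h * l)\<bar> \<le> norm (I a1 a2 - of_real (pi / h * exp (- h * l)))"
    by (rule order_trans[OF _ abs_Re_le_cmod]) simp
  ultimately show ?thesis using * by linarith
qed

text \<open>The contour closes in the upper half plane for nonnegative frequencies only; evenness of
  the cosine supplies the others.\<close>

lemma fourier_cauchy_kernel:
  fixes h l :: real
  assumes "h > 0"
  shows "((\<lambda>R. integral {-R..R} (\<lambda>t. cos (l * t) / (h\<^sup>2 + t\<^sup>2))) \<longlongrightarrow> pi / h * exp (- h * \<bar>l\<bar>)) at_top"
proof -
  have "((\<lambda>R. integral {-R..R} (\<lambda>t. cos (\<bar>l\<bar> * t) / (h\<^sup>2 + t\<^sup>2)) - pi / h * exp (- h * \<bar>l\<bar>)) \<longlongrightarrow> 0) at_top"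
  proof (rule Lim_null_comparison)
    show "\<forall>\<^sub>F R in at_top. norm (integral {-R..R} (\<lambda>t. cos (\<bar>l\<bar> * t) / (h\<^sup>2 + t\<^sup>2)) - pi / h * exp (- h * \<bar>l\<bar>))
        \<le> 4 * R / (R\<^sup>2 - h\<^sup>2)"
      using eventually_gt_at_top[of h] by eventually_elim (use fourier_rectangle[OF assms] in auto)
    show "((\<lambda>R. 4 * R / (R\<^sup>2 - h\<^sup>2)) \<longlongrightarrow> 0) at_top" by real_asymp
  qed
  moreover have "cos (\<bar>l\<bar> * t) = cos (l * t)" for t by (cases "l \<ge> 0") auto
  ultimately show ?thesis by (simp add: LIM_zero_iff)
qed

text \<open>Expanding the square, the kernel turns the mean square of a Dirichlet polynomial into a
  quadratic form with weights \<open>exp (- h * |u k - u l|)\<close>.\<close>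

lemma mean_square_kernel:
  fixes a :: "'i \<Rightarrow> complex" and u :: "'i \<Rightarrow> real" and h :: real
  assumes "finite X" "h > 0"
  shows "((\<lambda>R. integral {-R..R} (\<lambda>t. (norm (\<Sum>k\<in>X. a k * exp (- \<i> * of_real (u k * t))))\<^sup>2 / (h\<^sup>2 + t\<^sup>2)))
    \<longlongrightarrow> pi / h * (\<Sum>k\<in>X. \<Sum>l\<in>X. Re (a k * cnj (a l)) * exp (- h * \<bar>u k - u l\<bar>))) at_top"
proof -
  have den: "h\<^sup>2 + t\<^sup>2 \<noteq> 0" for t using assms(2) by (simp add: sum_power2_eq_zero_iff)
  have expand: "(norm (\<Sum>k\<in>X. a k * exp (- \<i> * of_real (u k * t))))\<^sup>2
      = (\<Sum>k\<in>X. \<Sum>l\<in>X. Re (a k * cnj (a l)) * cos ((u k - u l) * t) + Im (a k * cnj (a l)) * sin ((u k - u l) * t))" for t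
  proof -
    let ?z = "\<Sum>k\<in>X. a k * exp (- \<i> * of_real (u k * t))"
    have "(norm z)\<^sup>2 = Re (z * cnj z)" for z unfolding cmod_power2 by (simp add: power2_eq_square)
    then have "(norm ?z)\<^sup>2 = Re (?z * cnj ?z)" .
    also have "?z * cnj ?z = (\<Sum>k\<in>X. \<Sum>l\<in>X. (a k * exp (- \<i> * of_real (u k * t))) * cnj (a l * exp (- \<i> * of_real (u l * t))))"
      by (simp add: sum_product)
    also have "Re \<dots> = (\<Sum>k\<in>X. \<Sum>l\<in>X. Re ((a k * exp (- \<i> * of_real (u k * t))) * cnj (a l * exp (- \<i> * of_real (u l * t)))))"
      by simp
    also have "\<dots> = (\<Sum>k\<in>X. \<Sum>l\<in>X. Re (a k * cnj (a l)) * cos ((u k - u l) * t) + Im (a k * cnj (a l)) * sin ((u k - u l) * t))"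
    proof (intro sum.cong refl)
      fix k l
      have "(a k * exp (- \<i> * of_real (u k * t))) * cnj (a l * exp (- \<i> * of_real (u l * t)))
          = (a k * cnj (a l)) * (exp (- \<i> * of_real (u k * t)) * exp (\<i> * of_real (u l * t)))"
        by (simp add: exp_cnj)
      also have "exp (- \<i> * of_real (u k * t)) * exp (\<i> * of_real (u l * t)) = cis (- ((u k - u l) * t))"
        unfolding cis_conv_exp exp_add[symmetric] by (rule arg_cong[where f = exp]) (simp add: algebra_simps)
      finally show "Re ((a k * exp (- \<i> * of_real (u k * t))) * cnj (a l * exp (- \<i> * of_real (u l * t))))
          = Re (a k * cnj (a l)) * cos ((u k - u l) * t) + Im (a k * cnj (a l)) * sin ((u k - u l) * t)"
        by (simp only: times_complex.sel cis.sel cos_minus sin_minus)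
    qed
    finally show ?thesis .
  qed
  have cosI: "(\<lambda>t. cos (c * t) / (h\<^sup>2 + t\<^sup>2)) integrable_on {-R..R}" for c R
    by (intro integrable_continuous_real continuous_intros) (use den in auto)
  have sinI: "((\<lambda>t. sin (c * t) / (h\<^sup>2 + t\<^sup>2)) has_integral 0) {-R..R}" for c R
  proof -
    have i: "(\<lambda>t. sin (c * t) / (h\<^sup>2 + t\<^sup>2)) integrable_on {-R..R}"
      by (intro integrable_continuous_real continuous_intros) (use den in auto)
    have "integral {-R..R} (\<lambda>t. sin (c * (-t)) / (h\<^sup>2 + (-t)\<^sup>2)) = integral {-R..R} (\<lambda>t. sin (c * t) / (h\<^sup>2 + t\<^sup>2))"
      using Henstock_Kurzweil_Integration.integral_reflect_real[of R "-R" "\<lambda>t. sin (c * t) / (h\<^sup>2 + t\<^sup>2)"] by simp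
    then have "integral {-R..R} (\<lambda>t. sin (c * t) / (h\<^sup>2 + t\<^sup>2)) = 0" by simp
    then show ?thesis using i by (simp add: has_integral_integral)
  qed
  have "((\<lambda>t. (norm (\<Sum>k\<in>X. a k * exp (- \<i> * of_real (u k * t))))\<^sup>2 / (h\<^sup>2 + t\<^sup>2)) has_integral
      (\<Sum>k\<in>X. \<Sum>l\<in>X. Re (a k * cnj (a l)) * integral {-R..R} (\<lambda>t. cos ((u k - u l) * t) / (h\<^sup>2 + t\<^sup>2))
        + Im (a k * cnj (a l)) * 0)) {-R..R}" for R
  proof -
    have "((\<lambda>t. (\<Sum>k\<in>X. \<Sum>l\<in>X. Re (a k * cnj (a l)) * (cos ((u k - u l) * t) / (h\<^sup>2 + t\<^sup>2))
        + Im (a k * cnj (a l)) * (sin ((u k - u l) * t) / (h\<^sup>2 + t\<^sup>2)))) has_integral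
      (\<Sum>k\<in>X. \<Sum>l\<in>X. Re (a k * cnj (a l)) * integral {-R..R} (\<lambda>t. cos ((u k - u l) * t) / (h\<^sup>2 + t\<^sup>2))
        + Im (a k * cnj (a l)) * 0)) {-R..R}"
      by (intro has_integral_sum assms has_integral_add has_integral_mult_right sinI integrable_integral cosI)
    then show ?thesis
      unfolding expand sum_divide_distrib add_divide_distrib times_divide_eq_right .
  qed
  then have eq: "integral {-R..R} (\<lambda>t. (norm (\<Sum>k\<in>X. a k * exp (- \<i> * of_real (u k * t))))\<^sup>2 / (h\<^sup>2 + t\<^sup>2))
      = (\<Sum>k\<in>X. \<Sum>l\<in>X. Re (a k * cnj (a l)) * integral {-R..R} (\<lambda>t. cos ((u k - u l) * t) / (h\<^sup>2 + t\<^sup>2)))" for R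
    by (simp add: integral_unique)
  have "pi / h * (\<Sum>k\<in>X. \<Sum>l\<in>X. Re (a k * cnj (a l)) * exp (- h * \<bar>u k - u l\<bar>))
      = (\<Sum>k\<in>X. \<Sum>l\<in>X. Re (a k * cnj (a l)) * (pi / h * exp (- h * \<bar>u k - u l\<bar>)))"
    by (simp only: sum_distrib_left mult.left_commute)
  then show ?thesis unfolding eq
    by (simp only:) (intro tendsto_sum tendsto_mult tendsto_const fourier_cauchy_kernel assms)
qed

section \<open>Dirichlet polynomials and their quadratic forms\<close>

lemma sum_inverse_le: "n \<ge> 1 \<Longrightarrow> (\<Sum>k=1..n. 1 / real k) \<le> 1 + ln (real n)"
proof (induction n rule: nat_induct_at_least)
  case (Suc n)
  have "ln (real n / real (Suc n)) \<le> real n / real (Suc n) - 1" using Suc by (intro ln_le_minus_one) auto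
  also have "\<dots> = - (1 / real (Suc n))" by (simp add: field_simps)
  finally have "1 / real (Suc n) \<le> ln (real (Suc n)) - ln (real n)" using Suc by (simp add: ln_div)
  then show ?case using Suc by simp
qed simp

lemma sum_powr_eps_le:
  fixes \<epsilon> :: real
  assumes "0 < \<epsilon>" "\<epsilon> \<le> 1"
  shows "(\<Sum>k=1..n. real k powr (- (1 + \<epsilon>))) \<le> 2 / \<epsilon>"
proof -
  have "(\<Sum>k=1..n. real k powr (- (1 + \<epsilon>))) \<le> 1 + (1 / \<epsilon>) * (1 - real n powr (- \<epsilon>))" if "n \<ge> 1"
    using that
  proof (induction n rule: nat_induct_at_least)
    case (Suc n)
    have "\<exists>z. real n < z \<and> z < real (Suc n) \<and>
        real (Suc n) powr (- \<epsilon>) - real n powr (- \<epsilon>) = (real (Suc n) - real n) * (- \<epsilon> * z powr (- \<epsilon> - 1))"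
      by (rule MVT2) (use Suc in \<open>auto intro!: derivative_eq_intros\<close>)
    then obtain z where z: "real n < z" "z < real (Suc n)"
      "real (Suc n) powr (- \<epsilon>) - real n powr (- \<epsilon>) = - \<epsilon> * z powr (- \<epsilon> - 1)" by auto
    have "real (Suc n) powr (- (1 + \<epsilon>)) \<le> z powr (- (1 + \<epsilon>))" using z assms Suc by (intro powr_mono2') auto
    also have "\<dots> = (1 / \<epsilon>) * (real n powr (- \<epsilon>) - real (Suc n) powr (- \<epsilon>))"
    proof -
      have "- \<epsilon> - 1 = - (1 + \<epsilon>)" by simp
      then have "real n powr (- \<epsilon>) - real (Suc n) powr (- \<epsilon>) = \<epsilon> * z powr (- (1 + \<epsilon>))" using z(3) by (metis minus_diff_eq minus_mult_left minus_minus)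
      then show ?thesis using assms by simp
    qed
    finally show ?case using Suc by (simp add: algebra_simps)
  qed simp
  moreover have "1 + (1 / \<epsilon>) * (1 - real n powr (- \<epsilon>)) \<le> 2 / \<epsilon>"
  proof -
    have "(1 / \<epsilon>) * (1 - real n powr (- \<epsilon>)) \<le> (1 / \<epsilon>) * 1" using assms by (intro mult_left_mono) auto
    moreover have "1 \<le> 1 / \<epsilon>" using assms by simp
    moreover have "2 / \<epsilon> = 1 / \<epsilon> + 1 / \<epsilon>" by simp
    ultimately show ?thesis by linarith
  qed
  ultimately show ?thesis using assms by (cases "n = 0") auto
qed

lemma sum_weights_eps_le:
  fixes w :: "nat \<Rightarrow> real"
  assumes "\<And>n. (\<Sum>k=1..n. w k) \<le> C * real n" "0 < \<epsilon>" "\<epsilon> \<le> 1" "C \<ge> 0"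
  shows "(\<Sum>k=1..n. w k * real k powr (- (1 + \<epsilon>))) \<le> 2 * C / \<epsilon>"
proof -
  have "(\<Sum>k=1..n. w k * real k powr (- (1 + \<epsilon>))) \<le> C * (\<Sum>k=1..n. real k powr (- (1 + \<epsilon>)))"
    using assms(2) by (intro sum_mult_antimono_le[OF assms(1)]) (auto intro!: powr_mono2')
  also have "\<dots> \<le> C * (2 / \<epsilon>)" using assms by (intro mult_left_mono sum_powr_eps_le) auto
  finally show ?thesis by (simp only: times_divide_eq_right mult.commute[of C 2])
qed

text \<open>The Dirichlet series at \<sigma> + i t, truncated at \<open>Y\<close>. The analytic
  estimates are made for truncations, uniformly in all large \<open>Y\<close>, so that integrals of
  finite sums suffice.\<close>

definition dpoly :: "(nat \<Rightarrow> complex) \<Rightarrow> real \<Rightarrow> nat \<Rightarrow> real \<Rightarrow> complex" where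
  "dpoly a \<sigma> Y t = (\<Sum>k=1..Y. a k * of_real (real k powr (- \<sigma>)) * exp (- \<i> * of_real (ln (real k) * t)))"

lemma norm_dpoly_le:
  assumes "\<And>k. norm (a k) \<le> w k"
  shows "norm (dpoly a \<sigma> Y t) \<le> (\<Sum>k=1..Y. w k * real k powr (- \<sigma>))"
  unfolding dpoly_def
proof (rule sum_norm_le)
  fix k
  have "norm (a k * of_real (real k powr (- \<sigma>)) * exp (- \<i> * of_real (ln (real k) * t))) = norm (a k) * real k powr (- \<sigma>)"
    by (simp add: norm_mult)
  also have "\<dots> \<le> w k * real k powr (- \<sigma>)" by (intro mult_right_mono assms) auto
  finally show "norm (a k * of_real (real k powr (- \<sigma>)) * exp (- \<i> * of_real (ln (real k) * t))) \<le> w k * real k powr (- \<sigma>)" .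
qed

lemma continuous_on_dpoly [continuous_intros]: "continuous_on A (dpoly a \<sigma> Y)"
  unfolding dpoly_def[abs_def] by (intro continuous_intros)

text \<open>This is h / pi times the integral of |A|^2 / (h^2 + t^2), where A is the truncated
  series. It is read in two ways: for nonnegative majorants it is estimated termwise, and for h =
  \<sigma> it is a weighted sum of squares of partial sums.\<close>

definition qform :: "real \<Rightarrow> (nat \<Rightarrow> complex) \<Rightarrow> real \<Rightarrow> nat \<Rightarrow> real" where
  "qform h a \<sigma> Y = (\<Sum>k=1..Y. \<Sum>l=1..Y. Re (a k * cnj (a l)) * (real k powr (- \<sigma>) * real l powr (- \<sigma>) * exp (- h * \<bar>ln (real k) - ln (real l)\<bar>)))"

lemma mean_square_dpoly:
  assumes "h > 0"
  shows "((\<lambda>R. integral {-R..R} (\<lambda>t. (norm (dpoly a \<sigma> Y t))\<^sup>2 / (h\<^sup>2 + t\<^sup>2))) \<longlongrightarrow> pi / h * qform h a \<sigma> Y) at_top"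
proof -
  have "qform h a \<sigma> Y = (\<Sum>k=1..Y. \<Sum>l=1..Y. Re (a k * of_real (real k powr (- \<sigma>)) * cnj (a l * of_real (real l powr (- \<sigma>))))
      * exp (- h * \<bar>ln (real k) - ln (real l)\<bar>))"
    unfolding qform_def
  proof (intro sum.cong refl)
    fix k l
    have "a k * of_real (real k powr (- \<sigma>)) * cnj (a l * of_real (real l powr (- \<sigma>)))
        = of_real (real k powr (- \<sigma>) * real l powr (- \<sigma>)) * (a k * cnj (a l))" by simp
    then have "Re (a k * of_real (real k powr (- \<sigma>)) * cnj (a l * of_real (real l powr (- \<sigma>))))
        = (real k powr (- \<sigma>) * real l powr (- \<sigma>)) * Re (a k * cnj (a l))"
      by (simp only: Re_complex_of_real times_complex.sel Im_complex_of_real; simp)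
    then show "Re (a k * cnj (a l)) * (real k powr (- \<sigma>) * real l powr (- \<sigma>) * exp (- h * \<bar>ln (real k) - ln (real l)\<bar>))
        = Re (a k * of_real (real k powr (- \<sigma>)) * cnj (a l * of_real (real l powr (- \<sigma>)))) * exp (- h * \<bar>ln (real k) - ln (real l)\<bar>)"
      by simp
  qed
  then show ?thesis
    using mean_square_kernel[OF finite_atLeastAtMost assms, of "\<lambda>k. a k * of_real (real k powr (- \<sigma>))" "\<lambda>k. ln (real k)" 1 Y]
    by (simp add: dpoly_def)
qed

text \<open>All kernel weights are positive, so the coefficients may be replaced by their majorants.
  For h \<ge> 1 the kernel is at most min(k, l) / max(k, l). The sum over the smaller index is then
  C max(k, l) by the average bound on \<open>w\<close>, and a sum of w k / k^(1 + \<epsilon>)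
  remains. For the logarithmic derivative this requires Chebyshev's bound only.\<close>

lemma qform_nonneg_weights_le:
  fixes w :: "nat \<Rightarrow> real"
  assumes w: "\<And>k. norm (a k) \<le> w k" and C: "\<And>n. (\<Sum>k=1..n. w k) \<le> C * real n" "C \<ge> 0"
    and \<epsilon>: "0 < \<epsilon>" "\<epsilon> \<le> 1" and h: "h \<ge> 1"
  shows "qform h a (1 + \<epsilon>) Y \<le> 4 * C\<^sup>2 / \<epsilon>"
proof -
  have w0: "w k \<ge> 0" for k using order_trans[OF norm_ge_zero w] .
  \<comment> \<open>One half of the double sum, with the larger index first. The diagonal is counted
    in both halves, which an upper bound tolerates.\<close>
  define S where "S k l = (if l \<le> k then w k * real k powr (- (2 + \<epsilon>)) * w l else 0)" for k l
  have S0: "S k l \<ge> 0" for k l using w0 by (simp add: S_def)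
  have half: "w k * w l * (real k powr (- (1 + \<epsilon>)) * real l powr (- (1 + \<epsilon>)) * exp (- \<bar>ln (real k) - ln (real l)\<bar>)) \<le> S k l"
    if kl: "1 \<le> l" "l \<le> k" for k l
  proof -
    have "exp (- \<bar>ln (real k) - ln (real l)\<bar>) = exp (ln (real l) - ln (real k))" using kl by simp
    also have "\<dots> = real l / real k" using kl unfolding exp_diff by simp
    also have "\<dots> = real l powr 1 * real k powr (- 1)" using kl by (simp add: powr_minus_divide)
    finally have "real k powr (- (1 + \<epsilon>)) * real l powr (- (1 + \<epsilon>)) * exp (- \<bar>ln (real k) - ln (real l)\<bar>)
        = (real k powr (- (1 + \<epsilon>)) * real k powr (- 1)) * (real l powr (- (1 + \<epsilon>)) * real l powr 1)" by simp
    also have "\<dots> = real k powr (- (2 + \<epsilon>)) * real l powr (- \<epsilon>)"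
    proof -
      have "- (1 + \<epsilon>) + - 1 = - (2 + \<epsilon>)" "- (1 + \<epsilon>) + 1 = - \<epsilon>" by simp_all
      then show ?thesis by (simp only: powr_add[symmetric])
    qed
    also have "\<dots> \<le> real k powr (- (2 + \<epsilon>)) * real l powr 0"
      using kl \<epsilon> by (intro mult_left_mono powr_mono) auto
    finally have "real k powr (- (1 + \<epsilon>)) * real l powr (- (1 + \<epsilon>)) * exp (- \<bar>ln (real k) - ln (real l)\<bar>)
        \<le> real k powr (- (2 + \<epsilon>))" using kl by simp
    then have "w k * w l * (real k powr (- (1 + \<epsilon>)) * real l powr (- (1 + \<epsilon>)) * exp (- \<bar>ln (real k) - ln (real l)\<bar>))
        \<le> w k * w l * real k powr (- (2 + \<epsilon>))" using w0 by (intro mult_left_mono) auto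
    then show ?thesis using kl by (simp add: S_def mult_ac)
  qed
  have pair_le: "Re (a k * cnj (a l)) * (real k powr (- (1 + \<epsilon>)) * real l powr (- (1 + \<epsilon>)) * exp (- h * \<bar>ln (real k) - ln (real l)\<bar>))
      \<le> S k l + S l k" if kl: "1 \<le> k" "1 \<le> l" for k l
  proof -
    have "Re (a k * cnj (a l)) \<le> norm (a k * cnj (a l))" by (rule complex_Re_le_cmod)
    also have "\<dots> \<le> w k * w l" unfolding norm_mult using w w0 by (intro mult_mono) auto
    finally have 1: "Re (a k * cnj (a l)) \<le> w k * w l" .
    have "1 * \<bar>ln (real k) - ln (real l)\<bar> \<le> h * \<bar>ln (real k) - ln (real l)\<bar>" using h by (intro mult_right_mono) auto
    then have 2: "exp (- h * \<bar>ln (real k) - ln (real l)\<bar>) \<le> exp (- \<bar>ln (real k) - ln (real l)\<bar>)" by simp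
    have "Re (a k * cnj (a l)) * (real k powr (- (1 + \<epsilon>)) * real l powr (- (1 + \<epsilon>)) * exp (- h * \<bar>ln (real k) - ln (real l)\<bar>))
      \<le> w k * w l * (real k powr (- (1 + \<epsilon>)) * real l powr (- (1 + \<epsilon>)) * exp (- \<bar>ln (real k) - ln (real l)\<bar>))"
      using 1 2 w0 by (intro mult_mono mult_left_mono) auto
    also have "\<dots> \<le> S k l + S l k"
    proof (cases "l \<le> k")
      case True
      then show ?thesis using half[of l k] kl S0[of l k] by linarith
    next
      case False
      then have "w l * w k * (real l powr (- (1 + \<epsilon>)) * real k powr (- (1 + \<epsilon>)) * exp (- \<bar>ln (real l) - ln (real k)\<bar>)) \<le> S l k"
        using half[of k l] kl by simp
      moreover have "\<bar>ln (real l) - ln (real k)\<bar> = \<bar>ln (real k) - ln (real l)\<bar>" by (rule abs_minus_commute)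
      ultimately have "w k * w l * (real k powr (- (1 + \<epsilon>)) * real l powr (- (1 + \<epsilon>)) * exp (- \<bar>ln (real k) - ln (real l)\<bar>)) \<le> S l k"
        by (simp only: mult_ac)
      then show ?thesis using S0[of k l] by linarith
    qed
    finally show ?thesis .
  qed
  have "qform h a (1 + \<epsilon>) Y \<le> (\<Sum>k=1..Y. \<Sum>l=1..Y. S k l + S l k)"
    unfolding qform_def by (intro sum_mono pair_le) auto
  also have "\<dots> = (\<Sum>k=1..Y. \<Sum>l=1..Y. S k l) + (\<Sum>k=1..Y. \<Sum>l=1..Y. S l k)" by (simp add: sum.distrib)
  also have "(\<Sum>k=1..Y. \<Sum>l=1..Y. S l k) = (\<Sum>k=1..Y. \<Sum>l=1..Y. S k l)" by (rule sum.swap)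
  also have "(\<Sum>k=1..Y. \<Sum>l=1..Y. S k l) \<le> (\<Sum>k=1..Y. C * (w k * real k powr (- (1 + \<epsilon>))))"
  proof (rule sum_mono)
    fix k assume k: "k \<in> {1..Y}"
    have "(\<Sum>l=1..Y. S k l) = (\<Sum>l\<in>{1..Y} \<inter> {l. l \<le> k}. w k * real k powr (- (2 + \<epsilon>)) * w l)"
      unfolding S_def by (subst sum.inter_restrict, simp, rule sum.cong, auto)
    also have "{1..Y} \<inter> {l. l \<le> k} = {1..k}" using k by auto
    also have "(\<Sum>l=1..k. w k * real k powr (- (2 + \<epsilon>)) * w l) = w k * real k powr (- (2 + \<epsilon>)) * (\<Sum>l=1..k. w l)"
      by (simp add: sum_distrib_left)
    also have "\<dots> \<le> w k * real k powr (- (2 + \<epsilon>)) * (C * real k)" using w0 by (intro mult_left_mono C) auto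
    also have "\<dots> = C * (w k * (real k powr (- (2 + \<epsilon>)) * real k powr 1))" using k by simp
    also have "real k powr (- (2 + \<epsilon>)) * real k powr 1 = real k powr (- (1 + \<epsilon>))"
    proof -
      have "- (2 + \<epsilon>) + 1 = - (1 + \<epsilon>)" by simp
      then show ?thesis by (simp only: powr_add[symmetric])
    qed
    finally show "(\<Sum>l=1..Y. S k l) \<le> C * (w k * real k powr (- (1 + \<epsilon>)))" .
  qed
  also have "\<dots> = C * (\<Sum>k=1..Y. w k * real k powr (- (1 + \<epsilon>)))" by (simp add: sum_distrib_left)
  also have "\<dots> \<le> C * (2 * C / \<epsilon>)" using C \<epsilon> by (intro mult_left_mono sum_weights_eps_le) auto
  finally show ?thesis by (simp add: power2_eq_square)
qed

text \<open>The discrete counterpart of Plancherel.\<close>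

lemma qform_partial_sums:
  fixes b :: "nat \<Rightarrow> complex" and \<sigma> :: real
  defines "S \<equiv> \<lambda>k. \<Sum>j=1..k. b j" and "m \<equiv> \<lambda>k. real k powr (- 2 * \<sigma>)"
  assumes "\<sigma> > 0"
  shows "qform \<sigma> b \<sigma> Y = (\<Sum>k=1..Y. (norm (S k))\<^sup>2 * (m k - m (Suc k))) + (norm (S Y))\<^sup>2 * m (Suc Y)"
proof -
  \<comment> \<open>Taking h equal to \<sigma> makes the weight collapse to max(k, l) to the power
    -2 \<sigma>. A weight depending on the maximum alone is diagonalised by partial sums.\<close>
  have w: "real k powr (- \<sigma>) * real l powr (- \<sigma>) * exp (- \<sigma> * \<bar>ln (real k) - ln (real l)\<bar>) = m (max k l)"
    if "1 \<le> k" "1 \<le> l" for k l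
  proof -
    have *: "real k powr (- \<sigma>) * real l powr (- \<sigma>) * exp (- \<sigma> * \<bar>ln (real k) - ln (real l)\<bar>) = m k"
      if "1 \<le> l" "l \<le> k" for k l
      using that unfolding m_def powr_def by (simp add: exp_add[symmetric] algebra_simps)
    show ?thesis
    proof (cases "l \<le> k")
      case True
      then show ?thesis using *[of l k] that by (simp add: max_def)
    next
      case False
      then show ?thesis using *[of k l] that by (simp add: max_def abs_minus_commute mult_ac)
    qed
  qed
  have "qform \<sigma> b \<sigma> Y = (\<Sum>k=1..Y. \<Sum>l=1..Y. Re (b k * cnj (b l)) * m (max k l))"
    unfolding qform_def
  proof (intro sum.cong refl)
    fix k l assume "k \<in> {1..Y}" "l \<in> {1..Y}"
    then show "Re (b k * cnj (b l)) * (real k powr (- \<sigma>) * real l powr (- \<sigma>) * exp (- \<sigma> * \<bar>ln (real k) - ln (real l)\<bar>))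
        = Re (b k * cnj (b l)) * m (max k l)" by (subst w) auto
  qed
  also have "\<dots> = (\<Sum>k=1..Y. (norm (S k))\<^sup>2 * (m k - m (Suc k))) + (norm (S Y))\<^sup>2 * m (Suc Y)"
  proof (induction Y)
    case (Suc Y)
    let ?b = "b (Suc Y)"
    have r: "(\<Sum>l=1..Y. Re (b k * cnj (b l)) * m (max k l)) + Re (b k * cnj ?b) * m (max k (Suc Y))
        = (\<Sum>l=1..Y. Re (b k * cnj (b l)) * m (max k l)) + Re (b k * cnj ?b) * m (Suc Y)" if "k \<in> {1..Y}" for k
      using that by (simp add: max_def)
    have "(\<Sum>k=1..Suc Y. \<Sum>l=1..Suc Y. Re (b k * cnj (b l)) * m (max k l))
      = (\<Sum>k=1..Y. (\<Sum>l=1..Y. Re (b k * cnj (b l)) * m (max k l)) + Re (b k * cnj ?b) * m (max k (Suc Y)))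
        + ((\<Sum>l=1..Y. Re (?b * cnj (b l)) * m (max (Suc Y) l)) + Re (?b * cnj ?b) * m (max (Suc Y) (Suc Y)))"
      by simp
    also have "(\<Sum>k=1..Y. (\<Sum>l=1..Y. Re (b k * cnj (b l)) * m (max k l)) + Re (b k * cnj ?b) * m (max k (Suc Y)))
      = (\<Sum>k=1..Y. \<Sum>l=1..Y. Re (b k * cnj (b l)) * m (max k l)) + (\<Sum>k=1..Y. Re (b k * cnj ?b) * m (Suc Y))"
      by (simp only: r sum.distrib cong: sum.cong)
    also have "(\<Sum>k=1..Y. Re (b k * cnj ?b) * m (Suc Y)) = Re (S Y * cnj ?b) * m (Suc Y)"
      by (simp only: S_def sum_distrib_right Re_sum)
    also have "(\<Sum>l=1..Y. Re (?b * cnj (b l)) * m (max (Suc Y) l)) = (\<Sum>l=1..Y. Re (?b * cnj (b l)) * m (Suc Y))"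
      by (intro sum.cong) (auto simp: max_def)
    also have "\<dots> = Re (?b * cnj (S Y)) * m (Suc Y)"
      by (simp only: S_def sum_distrib_right sum_distrib_left Re_sum cnj_sum)
    also have "m (max (Suc Y) (Suc Y)) = m (Suc Y)" by simp
    finally have *: "(\<Sum>k=1..Suc Y. \<Sum>l=1..Suc Y. Re (b k * cnj (b l)) * m (max k l))
      = (\<Sum>k=1..Y. \<Sum>l=1..Y. Re (b k * cnj (b l)) * m (max k l))
        + (Re (S Y * cnj ?b) + Re (?b * cnj (S Y)) + Re (?b * cnj ?b)) * m (Suc Y)"
      by (simp add: algebra_simps)
    have "(norm (S (Suc Y)))\<^sup>2 = (norm (S Y))\<^sup>2 + (Re (S Y * cnj ?b) + Re (?b * cnj (S Y)) + Re (?b * cnj ?b))"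
    proof -
      have "S (Suc Y) = S Y + ?b" by (simp add: S_def)
      then show ?thesis unfolding cmod_power2 by (simp add: power2_eq_square algebra_simps)
    qed
    then show ?case unfolding * Suc by (simp add: algebra_simps)
  qed (simp add: S_def)
  finally show ?thesis .
qed

text \<open>All terms of the discrete Plancherel identity are nonnegative, so an initial section is
  bounded by the form for every larger \<open>Y\<close>. This frees \<open>Y\<close> to be chosen
  after \<epsilon>.\<close>

lemma qform_ge:
  fixes b :: "nat \<Rightarrow> complex"
  assumes "0 < \<epsilon>" "\<epsilon> \<le> 1" "U \<le> Y"
  shows "(\<Sum>k=1..U. (norm (\<Sum>j=1..k. b j))\<^sup>2 * real k powr (- (3 + 2 * \<epsilon>))) \<le> 16 * qform (1 + \<epsilon>) b (1 + \<epsilon>) Y"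
proof -
  define m where "m k = real k powr (- 2 * (1 + \<epsilon>))" for k :: nat
  \<comment> \<open>By the mean value theorem the difference is 2 (1 + \<epsilon>) z to the power
    -(3 + 2 \<epsilon>) with z \<le> 2 k. Since the exponent is at most 5 in size, the loss is at
    most 2 / 32.\<close>
  have m: "real k powr (- (3 + 2 * \<epsilon>)) / 16 \<le> m k - m (Suc k)" if k: "k \<ge> 1" for k
  proof -
    have "\<exists>z. real k < z \<and> z < real (Suc k) \<and>
        real (Suc k) powr (- 2 * (1 + \<epsilon>)) - real k powr (- 2 * (1 + \<epsilon>)) = (real (Suc k) - real k) * (- 2 * (1 + \<epsilon>) * z powr (- 2 * (1 + \<epsilon>) - 1))"
      by (rule MVT2) (use k in \<open>auto intro!: derivative_eq_intros\<close>)
    then obtain z where z: "real k < z" "z < real (Suc k)"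
      "m (Suc k) - m k = - 2 * (1 + \<epsilon>) * z powr (- 2 * (1 + \<epsilon>) - 1)" by (auto simp: m_def)
    have "2 powr (- 5) * real k powr (- (3 + 2 * \<epsilon>)) \<le> 2 powr (- (3 + 2 * \<epsilon>)) * real k powr (- (3 + 2 * \<epsilon>))"
      using assms by (intro mult_right_mono powr_mono) auto
    also have "\<dots> = (2 * real k) powr (- (3 + 2 * \<epsilon>))" by (simp add: powr_mult)
    also have "\<dots> \<le> z powr (- (3 + 2 * \<epsilon>))" using z k assms by (intro powr_mono2') auto
    finally have "2 * (2 powr (- 5) * real k powr (- (3 + 2 * \<epsilon>))) \<le> 2 * (1 + \<epsilon>) * z powr (- (3 + 2 * \<epsilon>))"
      using assms by (intro mult_mono) auto
    moreover have "m k - m (Suc k) = 2 * (1 + \<epsilon>) * z powr (- (3 + 2 * \<epsilon>))"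
    proof -
      have "- 2 * (1 + \<epsilon>) - 1 = - (3 + 2 * \<epsilon>)" by simp
      with z(3) have *: "m (Suc k) - m k = - 2 * (1 + \<epsilon>) * z powr (- (3 + 2 * \<epsilon>))" by metis
      have neg: "- (- 2 * u * v) = 2 * u * v" for u v :: real by simp
      have "m k - m (Suc k) = - (m (Suc k) - m k)" by simp
      then show ?thesis unfolding * neg .
    qed
    moreover have "2 powr (- 5) = (1 / 32 :: real)" by (simp add: powr_minus)
    ultimately show ?thesis by simp
  qed
  have "(\<Sum>k=1..U. (norm (\<Sum>j=1..k. b j))\<^sup>2 * real k powr (- (3 + 2 * \<epsilon>)))
      \<le> (\<Sum>k=1..Y. (norm (\<Sum>j=1..k. b j))\<^sup>2 * real k powr (- (3 + 2 * \<epsilon>)))"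
    using assms by (intro sum_mono2) auto
  also have "\<dots> \<le> (\<Sum>k=1..Y. 16 * ((norm (\<Sum>j=1..k. b j))\<^sup>2 * (m k - m (Suc k))))"
  proof (rule sum_mono)
    fix k assume "k \<in> {1..Y}"
    then have "real k powr (- (3 + 2 * \<epsilon>)) \<le> 16 * (m k - m (Suc k))" using m[of k] by simp
    then have "(norm (\<Sum>j=1..k. b j))\<^sup>2 * real k powr (- (3 + 2 * \<epsilon>)) \<le> (norm (\<Sum>j=1..k. b j))\<^sup>2 * (16 * (m k - m (Suc k)))"
      by (intro mult_left_mono) auto
    then show "(norm (\<Sum>j=1..k. b j))\<^sup>2 * real k powr (- (3 + 2 * \<epsilon>)) \<le> 16 * ((norm (\<Sum>j=1..k. b j))\<^sup>2 * (m k - m (Suc k)))"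
      by (simp only: mult.left_commute)
  qed
  also have "\<dots> = 16 * (\<Sum>k=1..Y. (norm (\<Sum>j=1..k. b j))\<^sup>2 * (m k - m (Suc k)))" by (simp add: sum_distrib_left)
  also have "\<dots> \<le> 16 * qform (1 + \<epsilon>) b (1 + \<epsilon>) Y"
    using qform_partial_sums[of "1 + \<epsilon>" b Y] assms unfolding m_def by simp
  finally show ?thesis .
qed

section \<open>Mean values of twisted weights\<close>

text \<open>\<open>c\<close> holds the coefficients of F and \<open>lf\<close> those of -F' / F,
  each dominated by its untwisted counterpart. The bound on \<open>lf\<close> is the place where
  complete multiplicativity enters. The condition \<open>small\<close> says that \<epsilon> F(1 +
  \<epsilon> + i t) tends to 0 uniformly for |t| \<le> T, stated for long truncations.\<close>

locale halasz = axiom_A +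
  fixes c lf :: "nat \<Rightarrow> complex"
  assumes c_le: "norm (c n) \<le> r n" and lf_le: "norm (lf n) \<le> lam n"
    and conv_lf: "n > 0 \<Longrightarrow> conv c lf n = c n * of_real (ln n)"
    and small: "\<lbrakk>\<eta> > 0; T > 0\<rbrakk> \<Longrightarrow> \<exists>\<epsilon>0>0. \<forall>\<epsilon>. 0 < \<epsilon> \<and> \<epsilon> < \<epsilon>0 \<longrightarrow>
      (\<exists>Y0. \<forall>Y\<ge>Y0. \<forall>t. \<bar>t\<bar> \<le> T \<longrightarrow> norm (dpoly c (1 + \<epsilon>) Y t) \<le> \<eta> / \<epsilon>)"
begin

definition cl :: "nat \<Rightarrow> complex" where
  "cl k = c k * of_real (ln (real k))"

definition S :: "nat \<Rightarrow> complex" where "S n = (\<Sum>k=1..n. c k)"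

definition Ch :: real where "Ch = (SOME C. \<forall>n. (\<Sum>k=1..n. lam k) \<le> C * real n)"

lemma Ch: "(\<Sum>k=1..n. lam k) \<le> Ch * real n"
  using someI_ex[OF chebyshev] unfolding Ch_def by blast

lemma Ch_nonneg: "Ch \<ge> 0"
  using Ch[of 1] lam_nonneg[of 1] by simp

lemma norm_dpoly_c_le:
  assumes "0 < \<epsilon>" "\<epsilon> \<le> 1"
  shows "norm (dpoly c (1 + \<epsilon>) Y t) \<le> 2 * C0 / \<epsilon>"
  by (rule order_trans[OF norm_dpoly_le[OF c_le] sum_weights_eps_le[OF count_le assms less_imp_le[OF C0_pos]]])

text \<open>The product of the truncations exceeds the truncation of the product by the pairs a, b
  \<le> Y with a b > Y. Each of these gains (a b) to the power -\<epsilon>/2, hence Y to this power,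
  and the series that remain are bounded at 1 + \<epsilon>/2; this halving of \<epsilon> turns each
  2 into a 4.\<close>

lemma dpoly_product_approx:
  assumes \<epsilon>: "0 < \<epsilon>" "\<epsilon> \<le> 1" and Y: "Y \<ge> 1"
  shows "norm (dpoly cl (1 + \<epsilon>) Y t - dpoly c (1 + \<epsilon>) Y t * dpoly lf (1 + \<epsilon>) Y t)
    \<le> real Y powr (- (\<epsilon> / 2)) * ((4 * C0 / \<epsilon>) * (4 * Ch / \<epsilon>))"
proof -
  define w where "w k = of_real (real k powr (- (1 + \<epsilon>))) * exp (- \<i> * of_real (ln (real k) * t))" for k :: nat
  have w_mult: "w (a * b) = w a * w b" if "a \<ge> 1" "b \<ge> 1" for a b
  proof -
    have "ln (real (a * b)) = ln (real a) + ln (real b)" using that by (simp add: ln_mult)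
    then have "exp (- \<i> * of_real (ln (real (a * b)) * t)) = exp (- \<i> * of_real (ln (real a) * t)) * exp (- \<i> * of_real (ln (real b) * t))"
      by (simp only: exp_add[symmetric]; simp add: algebra_simps)
    moreover have "real (a * b) powr (- (1 + \<epsilon>)) = real a powr (- (1 + \<epsilon>)) * real b powr (- (1 + \<epsilon>))"
      by (simp add: powr_mult)
    ultimately show ?thesis unfolding w_def by (simp only: of_real_mult mult_ac)
  qed
  have norm_w: "norm (w k) = real k powr (- (1 + \<epsilon>))" for k by (simp add: w_def norm_mult)
  have "dpoly cl (1 + \<epsilon>) Y t = (\<Sum>n=1..Y. conv c lf n * w n)"
    unfolding dpoly_def by (intro sum.cong refl) (simp add: cl_def conv_lf w_def mult.assoc)
  also have "\<dots> = (\<Sum>a=1..Y. \<Sum>b=1..Y div a. c a * lf b * w (a * b))" by (rule sum_conv_weighted)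
  also have "\<dots> = (\<Sum>a=1..Y. \<Sum>b=1..Y div a. (c a * w a) * (lf b * w b))"
    by (intro sum.cong refl) (simp add: w_mult)
  finally have A: "dpoly cl (1 + \<epsilon>) Y t = (\<Sum>a=1..Y. \<Sum>b=1..Y div a. (c a * w a) * (lf b * w b))" .
  have P: "dpoly c (1 + \<epsilon>) Y t * dpoly lf (1 + \<epsilon>) Y t = (\<Sum>a=1..Y. \<Sum>b=1..Y. (c a * w a) * (lf b * w b))"
    unfolding dpoly_def by (simp add: sum_product w_def mult.assoc)
  have split: "(\<Sum>b=1..Y. (c a * w a) * (lf b * w b))
      = (\<Sum>b=1..Y div a. (c a * w a) * (lf b * w b)) + (\<Sum>b\<in>{1..Y} - {1..Y div a}. (c a * w a) * (lf b * w b))" for a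
    by (subst add.commute, rule sum.subset_diff) (auto intro: order_trans[OF _ div_le_dividend])
  have "dpoly cl (1 + \<epsilon>) Y t - dpoly c (1 + \<epsilon>) Y t * dpoly lf (1 + \<epsilon>) Y t
      = - (\<Sum>a=1..Y. \<Sum>b\<in>{1..Y} - {1..Y div a}. (c a * w a) * (lf b * w b))"
    unfolding A P split sum.distrib by simp
  then have "norm (dpoly cl (1 + \<epsilon>) Y t - dpoly c (1 + \<epsilon>) Y t * dpoly lf (1 + \<epsilon>) Y t)
      = norm (\<Sum>a=1..Y. \<Sum>b\<in>{1..Y} - {1..Y div a}. (c a * w a) * (lf b * w b))" by simp
  also have "\<dots> \<le> (\<Sum>a=1..Y. \<Sum>b\<in>{1..Y} - {1..Y div a}. real Y powr (- (\<epsilon> / 2)) *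
      ((r a * real a powr (- (1 + \<epsilon> / 2))) * (lam b * real b powr (- (1 + \<epsilon> / 2)))))"
  proof (intro sum_norm_le)
    fix a b assume ab: "a \<in> {1..Y}" "b \<in> {1..Y} - {1..Y div a}"
    then have "Y div a < b" "a \<ge> 1" "b \<ge> 1" by auto
    then have "Y < b * a" by (subst (asm) div_less_iff_less_mult) auto
    then have Yab: "real Y \<le> real (a * b)" by (simp only: of_nat_le_iff mult.commute[of b])
    have split_exp: "real k powr (- (1 + \<epsilon>)) = real k powr (- (\<epsilon> / 2)) * real k powr (- (1 + \<epsilon> / 2))" for k
    proof -
      have "- (\<epsilon> / 2) + - (1 + \<epsilon> / 2) = - (1 + \<epsilon>)" by simp
      then show ?thesis by (simp only: powr_add[symmetric])
    qed
    have "norm ((c a * w a) * (lf b * w b)) = norm (c a) * norm (lf b) * (real a powr (- (1 + \<epsilon>)) * real b powr (- (1 + \<epsilon>)))"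
      by (simp add: norm_mult norm_w)
    also have "real a powr (- (1 + \<epsilon>)) * real b powr (- (1 + \<epsilon>))
        = (real a powr (- (\<epsilon> / 2)) * real b powr (- (\<epsilon> / 2))) * (real a powr (- (1 + \<epsilon> / 2)) * real b powr (- (1 + \<epsilon> / 2)))"
      unfolding split_exp by (simp only: mult_ac)
    also have "real a powr (- (\<epsilon> / 2)) * real b powr (- (\<epsilon> / 2)) = real (a * b) powr (- (\<epsilon> / 2))"
      by (simp add: powr_mult)
    also have "norm (c a) * norm (lf b) * (real (a * b) powr (- (\<epsilon> / 2)) * (real a powr (- (1 + \<epsilon> / 2)) * real b powr (- (1 + \<epsilon> / 2))))
      \<le> r a * lam b * (real Y powr (- (\<epsilon> / 2)) * (real a powr (- (1 + \<epsilon> / 2)) * real b powr (- (1 + \<epsilon> / 2))))"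
      using Y Yab \<epsilon> r_nonneg lam_nonneg by (intro mult_mono mult_right_mono powr_mono2' c_le lf_le mult_nonneg_nonneg) auto
    finally show "norm ((c a * w a) * (lf b * w b)) \<le> real Y powr (- (\<epsilon> / 2)) *
      ((r a * real a powr (- (1 + \<epsilon> / 2))) * (lam b * real b powr (- (1 + \<epsilon> / 2))))" by (simp only: mult_ac)
  qed
  also have "\<dots> \<le> (\<Sum>a=1..Y. \<Sum>b=1..Y. real Y powr (- (\<epsilon> / 2)) *
      ((r a * real a powr (- (1 + \<epsilon> / 2))) * (lam b * real b powr (- (1 + \<epsilon> / 2)))))"
    using r_nonneg lam_nonneg by (intro sum_mono sum_mono2) auto
  also have "\<dots> = real Y powr (- (\<epsilon> / 2)) * ((\<Sum>a=1..Y. r a * real a powr (- (1 + \<epsilon> / 2))) * (\<Sum>b=1..Y. lam b * real b powr (- (1 + \<epsilon> / 2))))"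
    unfolding sum_product by (simp only: sum_distrib_left)
  also have "\<dots> \<le> real Y powr (- (\<epsilon> / 2)) * ((2 * C0 / (\<epsilon> / 2)) * (2 * Ch / (\<epsilon> / 2)))"
  proof (intro mult_left_mono mult_mono)
    show "(\<Sum>a=1..Y. r a * real a powr (- (1 + \<epsilon> / 2))) \<le> 2 * C0 / (\<epsilon> / 2)"
      using \<epsilon> C0_pos by (intro sum_weights_eps_le count_le) auto
    show "(\<Sum>a=1..Y. lam a * real a powr (- (1 + \<epsilon> / 2))) \<le> 2 * Ch / (\<epsilon> / 2)"
      using \<epsilon> Ch_nonneg by (intro sum_weights_eps_le Ch) auto
    show "0 \<le> (\<Sum>a=1..Y. lam a * real a powr (- (1 + \<epsilon> / 2)))" using lam_nonneg by (intro sum_nonneg) auto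
  qed (use \<epsilon> C0_pos in auto)
  finally show ?thesis by simp
qed

text \<open>The three summands belong to the truncation error, to the range |t| \<le> T and to the
  range |t| > T in the next lemma.\<close>

definition K0 :: real where "K0 = 2 * pi + 8 * pi * Ch\<^sup>2 + 64 * pi * C0\<^sup>2 * Ch\<^sup>2"

lemma K0_pos: "K0 > 0"
  unfolding K0_def using pi_gt_zero by (intro add_pos_nonneg) auto

text \<open>In F' = F (F' / F) the first factor is estimated pointwise and the second in mean
  square. For |t| \<le> T the first is at most \<eta> / \<epsilon>. For larger t it is O(1 /
  \<epsilon>), but there 1 / (1 + t^2) \<le> 2 / (T^2 + t^2), and the mean square against this wider
  kernel carries the factor pi / T.\<close>

lemma qform_cl_small:
  assumes \<epsilon>: "0 < \<epsilon>" "\<epsilon> \<le> 1" and \<eta>: "\<eta> > 0" and T: "T \<ge> 1"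
    and F: "\<And>Y t. Y \<ge> Y0 \<Longrightarrow> \<bar>t\<bar> \<le> T \<Longrightarrow> norm (dpoly c (1 + \<epsilon>) Y t) \<le> \<eta> / \<epsilon>"
  shows "\<exists>Y1. \<forall>Y\<ge>Y1. qform (1 + \<epsilon>) cl (1 + \<epsilon>) Y \<le> K0 * (\<eta>\<^sup>2 + 1 / T) / \<epsilon> ^ 3"
proof -
  have "(\<lambda>Y. real Y powr (- (\<epsilon> / 2)) * ((4 * C0 / \<epsilon>) * (4 * Ch / \<epsilon>))) \<longlonglongrightarrow> 0 * ((4 * C0 / \<epsilon>) * (4 * Ch / \<epsilon>))"
    by (intro tendsto_mult tendsto_const tendsto_neg_powr filterlim_real_sequentially) (use \<epsilon> in auto)
  then have "\<forall>\<^sub>F Y in sequentially. real Y powr (- (\<epsilon> / 2)) * ((4 * C0 / \<epsilon>) * (4 * Ch / \<epsilon>)) < \<eta>"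
    using \<eta> by (intro order_tendstoD) auto
  then obtain Y2 where Y2: "\<And>Y. Y \<ge> Y2 \<Longrightarrow> real Y powr (- (\<epsilon> / 2)) * ((4 * C0 / \<epsilon>) * (4 * Ch / \<epsilon>)) < \<eta>"
    by (auto simp: eventually_sequentially)
  have "qform (1 + \<epsilon>) cl (1 + \<epsilon>) Y \<le> K0 * (\<eta>\<^sup>2 + 1 / T) / \<epsilon> ^ 3" if Y: "Y \<ge> max (max Y0 Y2) 1" for Y
  proof -
    define AA FF GG where "AA t = dpoly cl (1 + \<epsilon>) Y t" and "FF t = dpoly c (1 + \<epsilon>) Y t" and "GG t = dpoly lf (1 + \<epsilon>) Y t" for t
    have cont: "continuous_on X AA" "continuous_on X GG" for X
      unfolding AA_def[abs_def] GG_def[abs_def] by (intro continuous_intros)+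
    have approx: "norm (AA t - FF t * GG t) \<le> \<eta>" for t
      using dpoly_product_approx[OF \<epsilon>, of Y t] Y2[of Y] Y unfolding AA_def FF_def GG_def by simp
    have den: "(1 + \<epsilon>)\<^sup>2 + t\<^sup>2 > 0" "1\<^sup>2 + t\<^sup>2 > 0" "T\<^sup>2 + t\<^sup>2 > 0" for t :: real
      using \<epsilon> T by (auto intro!: add_pos_nonneg)
    have sq: "(norm (AA t))\<^sup>2 \<le> 2 * \<eta>\<^sup>2 + 2 * (norm (FF t) * norm (GG t))\<^sup>2" for t
    proof -
      have "norm (AA t) \<le> norm (AA t - FF t * GG t) + norm (FF t * GG t)"
        using norm_triangle_ineq[of "AA t - FF t * GG t" "FF t * GG t"] by simp
      also have "\<dots> \<le> \<eta> + norm (FF t) * norm (GG t)" using approx[of t] by (simp add: norm_mult)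
      finally have "(norm (AA t))\<^sup>2 \<le> (\<eta> + norm (FF t) * norm (GG t))\<^sup>2" by (intro power_mono) auto
      also have "\<dots> \<le> 2 * \<eta>\<^sup>2 + 2 * (norm (FF t) * norm (GG t))\<^sup>2"
        using zero_le_power2[of "\<eta> - norm (FF t) * norm (GG t)"] by (simp add: power2_eq_square algebra_simps)
      finally show ?thesis .
    qed
    \<comment> \<open>The three terms are the truncation error, the bounded range and the far range.
      The first is written with cos (0 * t) so that \<open>fourier_cauchy_kernel\<close> evaluates
      its integral as well.\<close>
    have ptw: "(norm (AA t))\<^sup>2 / ((1 + \<epsilon>)\<^sup>2 + t\<^sup>2) \<le> 2 * \<eta>\<^sup>2 * (cos (0 * t) / (1\<^sup>2 + t\<^sup>2))
        + 2 * (\<eta> / \<epsilon>)\<^sup>2 * ((norm (GG t))\<^sup>2 / (1\<^sup>2 + t\<^sup>2)) + 16 * (C0 / \<epsilon>)\<^sup>2 * ((norm (GG t))\<^sup>2 / (T\<^sup>2 + t\<^sup>2))" for t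
    proof -
      have "(norm (AA t))\<^sup>2 / ((1 + \<epsilon>)\<^sup>2 + t\<^sup>2) \<le> (2 * \<eta>\<^sup>2 + 2 * (norm (FF t) * norm (GG t))\<^sup>2) / (1\<^sup>2 + t\<^sup>2)"
        using sq \<epsilon> den[of t] by (intro frac_le) (auto intro!: power_mono add_right_mono)
      also have "\<dots> = 2 * \<eta>\<^sup>2 * (cos (0 * t) / (1\<^sup>2 + t\<^sup>2)) + 2 * (norm (FF t))\<^sup>2 * ((norm (GG t))\<^sup>2 / (1\<^sup>2 + t\<^sup>2))"
        by (simp add: add_divide_distrib power_mult_distrib)
      also have "2 * (norm (FF t))\<^sup>2 * ((norm (GG t))\<^sup>2 / (1\<^sup>2 + t\<^sup>2)) \<le>
          2 * (\<eta> / \<epsilon>)\<^sup>2 * ((norm (GG t))\<^sup>2 / (1\<^sup>2 + t\<^sup>2)) + 16 * (C0 / \<epsilon>)\<^sup>2 * ((norm (GG t))\<^sup>2 / (T\<^sup>2 + t\<^sup>2))"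
      proof (cases "\<bar>t\<bar> \<le> T")
        case True
        then have "(norm (FF t))\<^sup>2 \<le> (\<eta> / \<epsilon>)\<^sup>2" unfolding FF_def using F[of Y t] Y by (intro power_mono) auto
        then have "2 * (norm (FF t))\<^sup>2 * ((norm (GG t))\<^sup>2 / (1\<^sup>2 + t\<^sup>2)) \<le> 2 * (\<eta> / \<epsilon>)\<^sup>2 * ((norm (GG t))\<^sup>2 / (1\<^sup>2 + t\<^sup>2))"
          using den[of t] by (intro mult_right_mono) auto
        moreover have "0 \<le> 16 * (C0 / \<epsilon>)\<^sup>2 * ((norm (GG t))\<^sup>2 / (T\<^sup>2 + t\<^sup>2))" using den[of t] by simp
        ultimately show ?thesis by linarith
      next
        case False
        then have "T\<^sup>2 \<le> t\<^sup>2" using T by (simp add: abs_le_square_iff[symmetric])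
        then have "1 / (1\<^sup>2 + t\<^sup>2) \<le> 2 / (T\<^sup>2 + t\<^sup>2)" using den[of t] by (simp add: field_simps)
        then have "(norm (GG t))\<^sup>2 * (1 / (1\<^sup>2 + t\<^sup>2)) \<le> (norm (GG t))\<^sup>2 * (2 / (T\<^sup>2 + t\<^sup>2))" by (intro mult_left_mono) auto
        then have g: "(norm (GG t))\<^sup>2 / (1\<^sup>2 + t\<^sup>2) \<le> 2 * ((norm (GG t))\<^sup>2 / (T\<^sup>2 + t\<^sup>2))" by (simp add: mult.commute)
        have "(norm (FF t))\<^sup>2 \<le> (2 * C0 / \<epsilon>)\<^sup>2" unfolding FF_def using norm_dpoly_c_le[OF \<epsilon>] by (intro power_mono) auto
        then have "2 * (norm (FF t))\<^sup>2 * ((norm (GG t))\<^sup>2 / (1\<^sup>2 + t\<^sup>2)) \<le> 2 * (2 * C0 / \<epsilon>)\<^sup>2 * (2 * ((norm (GG t))\<^sup>2 / (T\<^sup>2 + t\<^sup>2)))"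
          using g den[of t] by (intro mult_mono) auto
        also have "\<dots> = 16 * (C0 / \<epsilon>)\<^sup>2 * ((norm (GG t))\<^sup>2 / (T\<^sup>2 + t\<^sup>2))" by (simp add: power_divide power_mult_distrib)
        finally show ?thesis using den[of t] by (simp add: add_increasing)
      qed
      finally show ?thesis by simp
    qed
    have i1: "(\<lambda>t. (norm (AA t))\<^sup>2 / ((1 + \<epsilon>)\<^sup>2 + t\<^sup>2)) integrable_on {-R..R}" for R
      using den(1) by (intro integrable_continuous_real continuous_intros cont) (auto simp: less_imp_neq[symmetric])
    have i2: "(\<lambda>t. (norm (GG t))\<^sup>2 / (1\<^sup>2 + t\<^sup>2)) integrable_on {-R..R}" for R
      using den(2) by (intro integrable_continuous_real continuous_intros cont) (auto simp: less_imp_neq[symmetric])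
    have i3: "(\<lambda>t. (norm (GG t))\<^sup>2 / (T\<^sup>2 + t\<^sup>2)) integrable_on {-R..R}" for R
      using den(3) by (intro integrable_continuous_real continuous_intros cont) (auto simp: less_imp_neq[symmetric])
    have i4: "(\<lambda>t. cos (0 * t) / (1\<^sup>2 + t\<^sup>2)) integrable_on {-R..R}" for R :: real
      using den(2) by (intro integrable_continuous_real continuous_intros) (auto simp: less_imp_neq[symmetric])
    have int_le: "integral {-R..R} (\<lambda>t. (norm (AA t))\<^sup>2 / ((1 + \<epsilon>)\<^sup>2 + t\<^sup>2))
      \<le> 2 * \<eta>\<^sup>2 * integral {-R..R} (\<lambda>t. cos (0 * t) / (1\<^sup>2 + t\<^sup>2))
        + 2 * (\<eta> / \<epsilon>)\<^sup>2 * integral {-R..R} (\<lambda>t. (norm (GG t))\<^sup>2 / (1\<^sup>2 + t\<^sup>2))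
        + 16 * (C0 / \<epsilon>)\<^sup>2 * integral {-R..R} (\<lambda>t. (norm (GG t))\<^sup>2 / (T\<^sup>2 + t\<^sup>2))" for R
    proof (rule has_integral_le[OF integrable_integral[OF i1]])
      show "((\<lambda>t. 2 * \<eta>\<^sup>2 * (cos (0 * t) / (1\<^sup>2 + t\<^sup>2)) + 2 * (\<eta> / \<epsilon>)\<^sup>2 * ((norm (GG t))\<^sup>2 / (1\<^sup>2 + t\<^sup>2))
          + 16 * (C0 / \<epsilon>)\<^sup>2 * ((norm (GG t))\<^sup>2 / (T\<^sup>2 + t\<^sup>2))) has_integral
        2 * \<eta>\<^sup>2 * integral {-R..R} (\<lambda>t. cos (0 * t) / (1\<^sup>2 + t\<^sup>2))
        + 2 * (\<eta> / \<epsilon>)\<^sup>2 * integral {-R..R} (\<lambda>t. (norm (GG t))\<^sup>2 / (1\<^sup>2 + t\<^sup>2))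
        + 16 * (C0 / \<epsilon>)\<^sup>2 * integral {-R..R} (\<lambda>t. (norm (GG t))\<^sup>2 / (T\<^sup>2 + t\<^sup>2))) {-R..R}"
        by (intro has_integral_add has_integral_mult_right integrable_integral i2 i3 i4)
    qed (rule ptw)
    have lim1: "((\<lambda>R. integral {-R..R} (\<lambda>t. (norm (AA t))\<^sup>2 / ((1 + \<epsilon>)\<^sup>2 + t\<^sup>2))) \<longlongrightarrow> pi / (1 + \<epsilon>) * qform (1 + \<epsilon>) cl (1 + \<epsilon>) Y) at_top"
      unfolding AA_def using \<epsilon> by (intro mean_square_dpoly) auto
    have lim2: "((\<lambda>R. 2 * \<eta>\<^sup>2 * integral {-R..R} (\<lambda>t. cos (0 * t) / (1\<^sup>2 + t\<^sup>2))
        + 2 * (\<eta> / \<epsilon>)\<^sup>2 * integral {-R..R} (\<lambda>t. (norm (GG t))\<^sup>2 / (1\<^sup>2 + t\<^sup>2))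
        + 16 * (C0 / \<epsilon>)\<^sup>2 * integral {-R..R} (\<lambda>t. (norm (GG t))\<^sup>2 / (T\<^sup>2 + t\<^sup>2)))
      \<longlongrightarrow> 2 * \<eta>\<^sup>2 * (pi / 1 * exp (- 1 * \<bar>0\<bar>)) + 2 * (\<eta> / \<epsilon>)\<^sup>2 * (pi / 1 * qform 1 lf (1 + \<epsilon>) Y)
        + 16 * (C0 / \<epsilon>)\<^sup>2 * (pi / T * qform T lf (1 + \<epsilon>) Y)) at_top"
      unfolding GG_def using T by (intro tendsto_intros mean_square_dpoly fourier_cauchy_kernel) auto
    have "pi / (1 + \<epsilon>) * qform (1 + \<epsilon>) cl (1 + \<epsilon>) Y \<le> 2 * \<eta>\<^sup>2 * (pi / 1 * exp (- 1 * \<bar>0\<bar>)) + 2 * (\<eta> / \<epsilon>)\<^sup>2 * (pi / 1 * qform 1 lf (1 + \<epsilon>) Y)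
        + 16 * (C0 / \<epsilon>)\<^sup>2 * (pi / T * qform T lf (1 + \<epsilon>) Y)"
      by (rule tendsto_le[OF _ lim2 lim1]) (use int_le in auto)
    also have "\<dots> \<le> 2 * \<eta>\<^sup>2 * pi + 2 * (\<eta> / \<epsilon>)\<^sup>2 * (pi * (4 * Ch\<^sup>2 / \<epsilon>)) + 16 * (C0 / \<epsilon>)\<^sup>2 * (pi / T * (4 * Ch\<^sup>2 / \<epsilon>))"
    proof -
      have q: "qform h lf (1 + \<epsilon>) Y \<le> 4 * Ch\<^sup>2 / \<epsilon>" if "h \<ge> 1" for h
        by (rule qform_nonneg_weights_le[OF lf_le Ch Ch_nonneg \<epsilon> that])
      have "2 * (\<eta> / \<epsilon>)\<^sup>2 * (pi * qform 1 lf (1 + \<epsilon>) Y) \<le> 2 * (\<eta> / \<epsilon>)\<^sup>2 * (pi * (4 * Ch\<^sup>2 / \<epsilon>))"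
        using q[of 1] by (intro mult_left_mono) auto
      moreover have "16 * (C0 / \<epsilon>)\<^sup>2 * (pi / T * qform T lf (1 + \<epsilon>) Y) \<le> 16 * (C0 / \<epsilon>)\<^sup>2 * (pi / T * (4 * Ch\<^sup>2 / \<epsilon>))"
        using q[of T] T by (intro mult_left_mono) auto
      ultimately show ?thesis by simp
    qed
    also have "\<dots> \<le> (2 * pi * \<eta>\<^sup>2) / \<epsilon> ^ 3 + (8 * pi * Ch\<^sup>2 * \<eta>\<^sup>2) / \<epsilon> ^ 3 + (64 * pi * C0\<^sup>2 * Ch\<^sup>2 / T) / \<epsilon> ^ 3"
    proof (intro add_mono)
      have "\<epsilon> ^ 3 \<le> 1" using \<epsilon> by (simp add: power_le_one)
      then have "2 * pi * \<eta>\<^sup>2 * \<epsilon> ^ 3 \<le> 2 * pi * \<eta>\<^sup>2 * 1" by (intro mult_left_mono) auto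
      then show "2 * \<eta>\<^sup>2 * pi \<le> (2 * pi * \<eta>\<^sup>2) / \<epsilon> ^ 3" using \<epsilon> by (simp add: field_simps)
    qed (use \<epsilon> in \<open>simp_all add: power_divide power2_eq_square power3_eq_cube field_simps\<close>)
    also have "\<dots> \<le> K0 * (\<eta>\<^sup>2 + 1 / T) / \<epsilon> ^ 3"
    proof -
      have "2 * pi * \<eta>\<^sup>2 + 8 * pi * Ch\<^sup>2 * \<eta>\<^sup>2 + 64 * pi * C0\<^sup>2 * Ch\<^sup>2 / T
          = (2 * pi + 8 * pi * Ch\<^sup>2) * \<eta>\<^sup>2 + 64 * pi * C0\<^sup>2 * Ch\<^sup>2 * (1 / T)" by (simp add: algebra_simps)
      also have "\<dots> \<le> K0 * \<eta>\<^sup>2 + K0 * (1 / T)"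
      proof -
        have "0 \<le> 64 * pi * C0\<^sup>2 * Ch\<^sup>2" "0 \<le> 2 * pi + 8 * pi * Ch\<^sup>2" by simp_all
        then have "2 * pi + 8 * pi * Ch\<^sup>2 \<le> K0" "64 * pi * C0\<^sup>2 * Ch\<^sup>2 \<le> K0"
          unfolding K0_def by linarith+
        then show ?thesis using T by (intro add_mono mult_right_mono) auto
      qed
      finally have "2 * pi * \<eta>\<^sup>2 + 8 * pi * Ch\<^sup>2 * \<eta>\<^sup>2 + 64 * pi * C0\<^sup>2 * Ch\<^sup>2 / T \<le> K0 * (\<eta>\<^sup>2 + 1 / T)"
        by (simp add: algebra_simps)
      then show ?thesis unfolding add_divide_distrib[symmetric] using \<epsilon> by (intro divide_right_mono) auto
    qed
    finally have main: "pi / (1 + \<epsilon>) * qform (1 + \<epsilon>) cl (1 + \<epsilon>) Y \<le> K0 * (\<eta>\<^sup>2 + 1 / T) / \<epsilon> ^ 3" .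
    \<comment> \<open>Nonnegativity is the empty section of \<open>qform_ge\<close>. It is required
      to drop the factor pi / (1 + \<epsilon>), which is at least 1.\<close>
    have q0: "qform (1 + \<epsilon>) cl (1 + \<epsilon>) Y \<ge> 0"
    proof -
      have "0 \<le> (\<Sum>k=1..0. (norm (\<Sum>j=1..k. cl j))\<^sup>2 * real k powr (- (3 + 2 * \<epsilon>)))" by simp
      also have "\<dots> \<le> 16 * qform (1 + \<epsilon>) cl (1 + \<epsilon>) Y" by (rule qform_ge[OF \<epsilon>]) simp
      finally show ?thesis by simp
    qed
    have "1 \<le> pi / (1 + \<epsilon>)" using \<epsilon> pi_gt3 by simp
    then have "1 * qform (1 + \<epsilon>) cl (1 + \<epsilon>) Y \<le> pi / (1 + \<epsilon>) * qform (1 + \<epsilon>) cl (1 + \<epsilon>) Y"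
      using q0 by (intro mult_right_mono)
    then show ?thesis using main by linarith
  qed
  then show ?thesis by blast
qed

text \<open>The choice \<epsilon> = 1 / ln X makes k^(2 \<epsilon>) at most e^2 for k \<le> X, so
  the weight k^-3 is interchangeable with k^-(3 + 2 \<epsilon>), and \<epsilon>^-3 becomes the cube
  of ln X.\<close>

lemma partial_sums_mean_square:
  assumes \<kappa>: "\<kappa> > 0"
  shows "\<exists>X0. \<forall>X\<ge>X0. (\<Sum>k=1..X. (norm (\<Sum>j=1..k. cl j))\<^sup>2 / real k ^ 3) \<le> \<kappa> * ln (real X) ^ 3"
proof -
  \<comment> \<open>16 comes from \<open>qform_ge\<close> and exp 2 from the change of weight. Then
    \<eta> and T are chosen so that \<eta>^2 and 1 / T each contribute at most \<kappa> / 2.\<close>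
  define M where "M = 16 * exp 2 * K0"
  have M: "M > 0" using K0_pos by (simp add: M_def)
  define \<eta> where "\<eta> = sqrt (\<kappa> / (2 * M))"
  define T where "T = max 1 (2 * M / \<kappa>)"
  have \<eta>: "\<eta> > 0" "\<eta>\<^sup>2 = \<kappa> / (2 * M)" using \<kappa> M by (simp_all add: \<eta>_def)
  have T: "T \<ge> 1" "1 / T \<le> \<kappa> / (2 * M)"
  proof -
    have "2 * M / \<kappa> \<le> T" by (simp add: T_def)
    then have "1 / T \<le> 1 / (2 * M / \<kappa>)" using \<kappa> M by (intro divide_left_mono) (auto simp: T_def)
    then show "1 / T \<le> \<kappa> / (2 * M)" by simp
  qed (simp add: T_def)
  have MK: "M * (\<eta>\<^sup>2 + 1 / T) \<le> \<kappa>"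
  proof -
    have "M * (\<eta>\<^sup>2 + 1 / T) \<le> M * (\<kappa> / (2 * M) + \<kappa> / (2 * M))" using T \<eta> M by (intro mult_left_mono add_mono) auto
    also have "\<dots> = \<kappa>" using M by (simp add: field_simps)
    finally show ?thesis .
  qed
  obtain \<epsilon>0 where \<epsilon>0: "\<epsilon>0 > 0" and F: "\<And>\<epsilon>. 0 < \<epsilon> \<Longrightarrow> \<epsilon> < \<epsilon>0 \<Longrightarrow>
      \<exists>Y0. \<forall>Y\<ge>Y0. \<forall>t. \<bar>t\<bar> \<le> T \<longrightarrow> norm (dpoly c (1 + \<epsilon>) Y t) \<le> \<eta> / \<epsilon>"
    using small[OF \<eta>(1), of T] T by auto
  have "filterlim (\<lambda>X. ln (real X)) at_top sequentially"
    by (rule filterlim_compose[OF ln_at_top filterlim_real_sequentially])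
  then have "\<forall>\<^sub>F X in sequentially. ln (real X) > max 1 (1 / \<epsilon>0)" unfolding filterlim_at_top_dense by (rule spec)
  then obtain X0 where X0: "\<And>X. X \<ge> X0 \<Longrightarrow> ln (real X) > max 1 (1 / \<epsilon>0)" by (auto simp: eventually_sequentially)
  have "(\<Sum>k=1..X. (norm (\<Sum>j=1..k. cl j))\<^sup>2 / real k ^ 3) \<le> \<kappa> * ln (real X) ^ 3" if X: "X \<ge> X0" for X
  proof -
    define L where "L = ln (real X)"
    have L: "L > 1" "L > 1 / \<epsilon>0" using X0[OF X] by (auto simp: L_def)
    define \<epsilon> where "\<epsilon> = 1 / L"
    have \<epsilon>: "0 < \<epsilon>" "\<epsilon> \<le> 1" "\<epsilon> < \<epsilon>0" using L \<epsilon>0 by (auto simp: \<epsilon>_def field_simps)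
    obtain Y0 where Y0: "\<And>Y t. Y \<ge> Y0 \<Longrightarrow> \<bar>t\<bar> \<le> T \<Longrightarrow> norm (dpoly c (1 + \<epsilon>) Y t) \<le> \<eta> / \<epsilon>"
      using F[of \<epsilon>] \<epsilon> by blast
    obtain Y1 where Y1: "\<And>Y. Y \<ge> Y1 \<Longrightarrow> qform (1 + \<epsilon>) cl (1 + \<epsilon>) Y \<le> K0 * (\<eta>\<^sup>2 + 1 / T) / \<epsilon> ^ 3"
      using qform_cl_small[OF \<epsilon>(1,2) \<eta>(1) T(1) Y0] by blast
    have "(\<Sum>k=1..X. (norm (\<Sum>j=1..k. cl j))\<^sup>2 / real k ^ 3)
        \<le> (\<Sum>k=1..X. exp 2 * ((norm (\<Sum>j=1..k. cl j))\<^sup>2 * real k powr (- (3 + 2 * \<epsilon>))))"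
    proof (rule sum_mono)
      fix k assume k: "k \<in> {1..X}"
      have "real k powr (2 * \<epsilon>) = exp (2 * \<epsilon> * ln (real k))" using k by (simp add: powr_def)
      also have "\<dots> \<le> exp (2 * \<epsilon> * L)" using k \<epsilon> by (auto simp: L_def)
      also have "2 * \<epsilon> * L = 2" using L by (simp add: \<epsilon>_def)
      finally have "real k powr (2 * \<epsilon>) * real k powr (- (3 + 2 * \<epsilon>)) \<le> exp 2 * real k powr (- (3 + 2 * \<epsilon>))"
        by (intro mult_right_mono) auto
      moreover have "real k powr (2 * \<epsilon>) * real k powr (- (3 + 2 * \<epsilon>)) = 1 / real k ^ 3"
      proof -
        have "real k powr (2 * \<epsilon>) * real k powr (- (3 + 2 * \<epsilon>)) = real k powr (- 3)"
          by (simp only: powr_add[symmetric]; simp)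
        then show ?thesis using k by (simp add: powr_minus powr_numeral divide_inverse)
      qed
      ultimately have "(norm (\<Sum>j=1..k. cl j))\<^sup>2 * (1 / real k ^ 3) \<le> (norm (\<Sum>j=1..k. cl j))\<^sup>2 * (exp 2 * real k powr (- (3 + 2 * \<epsilon>)))"
        by (intro mult_left_mono) auto
      then show "(norm (\<Sum>j=1..k. cl j))\<^sup>2 / real k ^ 3 \<le> exp 2 * ((norm (\<Sum>j=1..k. cl j))\<^sup>2 * real k powr (- (3 + 2 * \<epsilon>)))"
        by (simp add: mult_ac)
    qed
    also have "\<dots> = exp 2 * (\<Sum>k=1..X. (norm (\<Sum>j=1..k. cl j))\<^sup>2 * real k powr (- (3 + 2 * \<epsilon>)))"
      by (simp only: sum_distrib_left)
    \<comment> \<open>\<open>Y1\<close> depends on \<epsilon>, hence on X, and may exceed X. The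
      form is taken at the larger of the two.\<close>
    also have "\<dots> \<le> exp 2 * (16 * qform (1 + \<epsilon>) cl (1 + \<epsilon>) (max X Y1))"
      by (intro mult_left_mono qform_ge \<epsilon>) auto
    also have "\<dots> \<le> exp 2 * (16 * (K0 * (\<eta>\<^sup>2 + 1 / T) / \<epsilon> ^ 3))"
      by (intro mult_left_mono Y1) auto
    also have "\<dots> = M * (\<eta>\<^sup>2 + 1 / T) * L ^ 3" using L by (simp add: M_def \<epsilon>_def power_divide)
    also have "\<dots> \<le> \<kappa> * L ^ 3" using MK L by (intro mult_right_mono) auto
    finally show ?thesis by (simp add: L_def)
  qed
  then show ?thesis by blast
qed

text \<open>The partial sums of c log equal S(k) ln k up to O(k), so their mean square controls
  |S(k)| ln k / k^2 on average. To remove the factor ln k, the range below a small power of X is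
  estimated trivially; above it ln k is comparable with ln X.\<close>

lemma log_average_small:
  assumes \<kappa>: "\<kappa> > 0"
  shows "\<exists>X0. \<forall>X\<ge>X0. (\<Sum>k=1..X. norm (S k) / (real k)\<^sup>2) \<le> \<kappa> * ln (real X)"
proof -
  \<comment> \<open>The range k \<le> X^\<delta> contributes C0 (1 + \<delta> ln X). The remaining
    one contributes 3 s (ln X)^2 / (\<delta> ln X), which is 3 \<delta> ln X for s =
    \<delta>^2.\<close>
  define \<delta> where "\<delta> = \<kappa> / (2 * (C0 + 3))"
  have \<delta>: "\<delta> > 0" "(C0 + 3) * \<delta> = \<kappa> / 2" using \<kappa> C0_pos by (simp_all add: \<delta>_def field_simps)
  define s where "s = \<delta>\<^sup>2"
  have s: "s > 0" using \<delta> by (simp add: s_def)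
  obtain X1 where X1: "\<And>X. X \<ge> X1 \<Longrightarrow> (\<Sum>k=1..X. (norm (\<Sum>j=1..k. cl j))\<^sup>2 / real k ^ 3) \<le> s\<^sup>2 * ln (real X) ^ 3"
    using partial_sums_mean_square[of "s\<^sup>2"] s by auto
  have "filterlim (\<lambda>X. ln (real X)) at_top sequentially"
    by (rule filterlim_compose[OF ln_at_top filterlim_real_sequentially])
  then have "\<forall>\<^sub>F X in sequentially. ln (real X) > max 1 (max (8 * C0 / s) (2 * C0 / \<kappa>))" unfolding filterlim_at_top_dense by (rule spec)
  then obtain X2 where X2: "\<And>X. X \<ge> X2 \<Longrightarrow> ln (real X) > max 1 (max (8 * C0 / s) (2 * C0 / \<kappa>))" by (auto simp: eventually_sequentially)
  have S_le: "norm (S k) \<le> C0 * real k" for k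
  proof -
    have "norm (S k) \<le> (\<Sum>j=1..k. r j)" unfolding S_def by (intro sum_norm_le c_le)
    then show ?thesis using count_le[of k] by linarith
  qed
  \<comment> \<open>The discrepancy is the sum of c j ln(k / j), whose weights are large only for
    small j; \<open>sum_ln_div_le\<close> makes it O(k).\<close>
  have S_ln: "norm (S k) * ln (real k) \<le> norm (\<Sum>j=1..k. cl j) + 4 * C0 * real k" if k: "k \<ge> 1" for k
  proof -
    have "S k * of_real (ln (real k)) - (\<Sum>j=1..k. cl j) = (\<Sum>j=1..k. c j * of_real (ln (real k / real j)))"
      unfolding S_def cl_def sum_distrib_right sum_subtractf[symmetric]
      using k by (intro sum.cong refl) (simp add: ln_div algebra_simps)
    also have "norm \<dots> \<le> (\<Sum>j=1..k. r j * ln (real k / real j))"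
    proof (rule sum_norm_le)
      fix j assume j: "j \<in> {1..k}"
      then have "ln (real k / real j) \<ge> 0" by simp
      then show "norm (c j * of_real (ln (real k / real j))) \<le> r j * ln (real k / real j)"
        unfolding norm_mult norm_of_real using c_le[of j] r_nonneg[of j] by (intro mult_mono) auto
    qed
    also have "\<dots> \<le> C0 * (\<Sum>j=1..k. ln (real k / real j))"
    proof (rule sum_mult_antimono_le[OF count_le])
      fix j assume "1 \<le> j" "j < k"
      then show "ln (real k / real (Suc j)) \<le> ln (real k / real j)"
        by (subst ln_le_cancel_iff) (auto intro!: divide_left_mono)
    qed auto
    also have "\<dots> \<le> C0 * (4 * real k)" using C0_pos by (intro mult_left_mono sum_ln_div_le) auto
    finally have 1: "norm (S k * of_real (ln (real k)) - (\<Sum>j=1..k. cl j)) \<le> 4 * C0 * real k" by simp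
    have "norm (S k) * ln (real k) = norm (S k * of_real (ln (real k)))" using k by (simp add: norm_mult)
    also have "\<dots> \<le> norm (S k * of_real (ln (real k)) - (\<Sum>j=1..k. cl j)) + norm (\<Sum>j=1..k. cl j)"
      using norm_triangle_ineq[of "S k * of_real (ln (real k)) - (\<Sum>j=1..k. cl j)" "\<Sum>j=1..k. cl j"] by simp
    finally show ?thesis using 1 by linarith
  qed
  have "(\<Sum>k=1..X. norm (S k) / (real k)\<^sup>2) \<le> \<kappa> * ln (real X)" if X: "X \<ge> max (max X1 X2) 1" for X
  proof -
    define L where "L = ln (real X)"
    have "L > max 1 (max (8 * C0 / s) (2 * C0 / \<kappa>))" using X2[of X] X by (simp add: L_def)
    then have L: "L > 1" "L > 8 * C0 / s" "L > 2 * C0 / \<kappa>" by auto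
    then have L': "8 * C0 \<le> s * L" "C0 \<le> \<kappa> / 2 * L" using s \<kappa> by (simp_all add: field_simps)
    have harm: "(\<Sum>k=1..X. 1 / real k) \<le> 1 + L" using sum_inverse_le[of X] X by (simp add: L_def)
    have "(\<Sum>k=1..X. norm (S k) * ln (real k) / (real k)\<^sup>2)
        \<le> (\<Sum>k=1..X. ((norm (\<Sum>j=1..k. cl j))\<^sup>2 / real k ^ 3) * (1 / (2 * s * L)) + (s * L / 2 + 4 * C0) * (1 / real k))"
    proof (rule sum_mono)
      fix k assume k: "k \<in> {1..X}"
      define b where "b = norm (\<Sum>j=1..k. cl j)"
      have sL: "s * L > 0" using s L by simp
      \<comment> \<open>Cauchy--Schwarz in the form of the arithmetic-geometric inequality. The
        parameter s L balances the mean square, at most s^2 L^3, against the harmonic sum, about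
        L.\<close>
      have "0 \<le> (b - s * L * real k)\<^sup>2" by simp
      then have "2 * (s * L) * real k * b \<le> b\<^sup>2 + (s * L)\<^sup>2 * (real k)\<^sup>2" by (simp add: power2_eq_square algebra_simps)
      moreover have "0 < 2 * (s * L) * real k" using s L k by (intro mult_pos_pos) auto
      ultimately have "b \<le> (b\<^sup>2 + (s * L)\<^sup>2 * (real k)\<^sup>2) / (2 * (s * L) * real k)"
        by (subst pos_le_divide_eq) (simp_all add: mult_ac)
      then have "b / (real k)\<^sup>2 \<le> ((b\<^sup>2 + (s * L)\<^sup>2 * (real k)\<^sup>2) / (2 * (s * L) * real k)) / (real k)\<^sup>2"
        by (intro divide_right_mono) auto
      also have "\<dots> = b\<^sup>2 / real k ^ 3 * (1 / (2 * s * L)) + s * L / 2 * (1 / real k)"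
        using sL k by (simp add: add_divide_distrib power2_eq_square power3_eq_cube)
      finally have 1: "b / (real k)\<^sup>2 \<le> b\<^sup>2 / real k ^ 3 * (1 / (2 * s * L)) + s * L / 2 * (1 / real k)" .
      have "norm (S k) * ln (real k) / (real k)\<^sup>2 \<le> (b + 4 * C0 * real k) / (real k)\<^sup>2"
        unfolding b_def using S_ln[of k] k by (intro divide_right_mono) auto
      also have "\<dots> = b / (real k)\<^sup>2 + 4 * C0 * (1 / real k)" using k by (simp add: add_divide_distrib power2_eq_square)
      finally show "norm (S k) * ln (real k) / (real k)\<^sup>2
          \<le> ((norm (\<Sum>j=1..k. cl j))\<^sup>2 / real k ^ 3) * (1 / (2 * s * L)) + (s * L / 2 + 4 * C0) * (1 / real k)"
        using 1 unfolding b_def distrib_right by linarith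
    qed
    also have "\<dots> = (\<Sum>k=1..X. (norm (\<Sum>j=1..k. cl j))\<^sup>2 / real k ^ 3) * (1 / (2 * s * L)) + (s * L / 2 + 4 * C0) * (\<Sum>k=1..X. 1 / real k)"
      by (simp only: sum.distrib sum_distrib_left sum_distrib_right)
    also have "\<dots> \<le> (s\<^sup>2 * L ^ 3) * (1 / (2 * s * L)) + (s * L / 2 + 4 * C0) * (1 + L)"
      using X1[of X] X s L C0_pos harm by (intro add_mono mult_right_mono mult_left_mono) (auto simp: L_def)
    also have "(s\<^sup>2 * L ^ 3) * (1 / (2 * s * L)) = s * L\<^sup>2 / 2"
      using s L by (simp add: power2_eq_square power3_eq_cube)
    also have "(s * L / 2 + 4 * C0) * (1 + L) \<le> (s * L / 2 + s * L / 2) * (L + L)"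
      using L' L s by (intro mult_mono add_mono) auto
    finally have "(\<Sum>k=1..X. norm (S k) * ln (real k) / (real k)\<^sup>2) \<le> s * L\<^sup>2 / 2 + (s * L / 2 + s * L / 2) * (L + L)" by simp
    also have "\<dots> \<le> 3 * s * L\<^sup>2" using s L by (simp add: power2_eq_square algebra_simps)
    finally have main: "(\<Sum>k=1..X. norm (S k) * ln (real k) / (real k)\<^sup>2) \<le> 3 * s * L\<^sup>2" .
    \<comment> \<open>The cut at X^\<delta>.\<close>
    define q where "q = nat \<lfloor>exp (\<delta> * L)\<rfloor>"
    have q: "q \<ge> 1" "real q \<le> exp (\<delta> * L)"
      using \<delta> L by (auto simp: q_def le_nat_iff)
    have "ln (real q) \<le> ln (exp (\<delta> * L))" using q by (subst ln_le_cancel_iff) auto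
    then have lnq: "ln (real q) \<le> \<delta> * L" by simp
    have "(\<Sum>k=1..X. norm (S k) / (real k)\<^sup>2)
        \<le> (\<Sum>k=1..X. (if k \<le> q then C0 * (1 / real k) else 0) + (1 / (\<delta> * L)) * (norm (S k) * ln (real k) / (real k)\<^sup>2))"
    proof (rule sum_mono)
      fix k assume k: "k \<in> {1..X}"
      show "norm (S k) / (real k)\<^sup>2 \<le> (if k \<le> q then C0 * (1 / real k) else 0) + (1 / (\<delta> * L)) * (norm (S k) * ln (real k) / (real k)\<^sup>2)"
      proof (cases "k \<le> q")
        case True
        have "norm (S k) / (real k)\<^sup>2 \<le> (C0 * real k) / (real k)\<^sup>2" by (intro divide_right_mono S_le) auto
        also have "\<dots> = C0 * (1 / real k)" by (simp add: power2_eq_square)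
        finally have "norm (S k) / (real k)\<^sup>2 \<le> C0 * (1 / real k)" .
        moreover have "0 \<le> (1 / (\<delta> * L)) * (norm (S k) * ln (real k) / (real k)\<^sup>2)" using \<delta> L k by simp
        ultimately show ?thesis using True by simp
      next
        case False
        then have "exp (\<delta> * L) < real k" unfolding q_def by (simp add: nat_le_iff floor_less_iff not_le) (simp add: nat_less_iff floor_less_iff)
        then have "\<delta> * L \<le> ln (real k)" using k by (subst ln_ge_iff) auto
        then have "(\<delta> * L) * (norm (S k) / (real k)\<^sup>2) \<le> ln (real k) * (norm (S k) / (real k)\<^sup>2)" by (intro mult_right_mono) auto
        then show ?thesis using False \<delta> L by (simp add: field_simps)
      qed
    qed
    also have "\<dots> = (\<Sum>k=1..X. if k \<le> q then C0 * (1 / real k) else 0) + (1 / (\<delta> * L)) * (\<Sum>k=1..X. norm (S k) * ln (real k) / (real k)\<^sup>2)"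
      by (simp only: sum.distrib sum_distrib_left)
    also have "(\<Sum>k=1..X. if k \<le> q then C0 * (1 / real k) else 0) \<le> C0 * (1 + \<delta> * L)"
    proof -
      have "(\<Sum>k=1..X. if k \<le> q then C0 * (1 / real k) else 0) = (\<Sum>k\<in>{1..X} \<inter> {k. k \<le> q}. C0 * (1 / real k))"
        by (subst sum.inter_restrict, simp, rule sum.cong, auto)
      also have "\<dots> \<le> (\<Sum>k=1..q. C0 * (1 / real k))" using C0_pos by (intro sum_mono2) auto
      also have "\<dots> = C0 * (\<Sum>k=1..q. 1 / real k)" by (simp only: sum_distrib_left)
      also have "\<dots> \<le> C0 * (1 + \<delta> * L)" using sum_inverse_le[OF q(1)] lnq C0_pos by (intro mult_left_mono) auto
      finally show ?thesis .
    qed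
    also have "(1 / (\<delta> * L)) * (\<Sum>k=1..X. norm (S k) * ln (real k) / (real k)\<^sup>2) \<le> (1 / (\<delta> * L)) * (3 * s * L\<^sup>2)"
      using main \<delta> L by (intro mult_left_mono) auto
    also have "(1 / (\<delta> * L)) * (3 * s * L\<^sup>2) = 3 * \<delta> * L" using \<delta> L by (simp add: s_def power2_eq_square)
    also have "C0 * (1 + \<delta> * L) + 3 * \<delta> * L = C0 + ((C0 + 3) * \<delta>) * L" by (simp add: algebra_simps)
    also have "\<dots> \<le> \<kappa> / 2 * L + \<kappa> / 2 * L" unfolding \<delta>(2) using L' by linarith
    finally show ?thesis by (simp add: L_def)
  qed
  then show ?thesis by blast
qed

end

section \<open>From logarithmic means to mean values\<close>

lemma (in axiom_A) sum_count_div_le: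
  assumes "X \<ge> 1"
  shows "(\<Sum>k=1..X. \<Sum>j=1..X div k. r j) \<le> C0 * real X * (1 + ln (real X))"
proof -
  have "(\<Sum>k=1..X. \<Sum>j=1..X div k. r j) \<le> (\<Sum>k=1..X. C0 * real X * (1 / real k))"
  proof (rule sum_mono)
    fix k
    have "(\<Sum>j=1..X div k. r j) \<le> C0 * real (X div k)" by (rule count_le)
    also have "\<dots> \<le> C0 * (real X / real k)" using C0_pos by (intro mult_left_mono of_nat_div_le_of_nat) auto
    finally show "(\<Sum>j=1..X div k. r j) \<le> C0 * real X * (1 / real k)" by simp
  qed
  also have "\<dots> = C0 * real X * (\<Sum>k=1..X. 1 / real k)" by (simp only: sum_distrib_left)
  also have "\<dots> \<le> C0 * real X * (1 + ln (real X))"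
    using C0_pos assms by (intro mult_left_mono sum_inverse_le) auto
  finally show ?thesis .
qed

context halasz
begin

lemma S_0: "S 0 = 0" by (simp add: S_def)

text \<open>Since the coefficients are dominated by \<open>r\<close>, |S| moves no faster than the
  counting function, which serves as the comparison function \<open>R\<close> in
  \<open>abel_div_bound\<close>.\<close>

lemma norm_S_diff:
  assumes "m' \<le> m"
  shows "\<bar>norm (S m) - norm (S m')\<bar> \<le> (\<Sum>j=1..m. r j) - (\<Sum>j=1..m'. r j)"
proof -
  have "\<bar>norm (S m) - norm (S m')\<bar> \<le> norm (S m - S m')" by (rule norm_triangle_ineq3)
  also have "S m - S m' = (\<Sum>j\<in>{1..m} - {1..m'}. c j)"
    unfolding S_def using assms by (subst sum_diff) auto
  also have "norm \<dots> \<le> (\<Sum>j\<in>{1..m} - {1..m'}. r j)" by (intro sum_norm_le c_le)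
  also have "\<dots> = (\<Sum>j=1..m. r j) - (\<Sum>j=1..m'. r j)" using assms by (subst sum_diff) auto
  finally show ?thesis .
qed

lemma norm_S_le: "norm (S k) \<le> C0 * real k"
  using norm_S_diff[of 0 k] count_le[of k] by (simp add: S_0)

text \<open>Writing |S| as the sum of its increments and exchanging the order of summation gives
  increments weighted by floor(X / j). Dropping the floors costs at most r j per term, and summation
  by parts turns the weights 1 / j into 1 / (j (j + 1)).\<close>

lemma sum_norm_S_div_le:
  assumes X: "X \<ge> 1"
  shows "(\<Sum>k=1..X. norm (S (X div k))) \<le> real X * (\<Sum>j=1..X. norm (S j) / (real j)\<^sup>2) + 2 * C0 * real X"
proof -
  define \<Delta> where "\<Delta> j = norm (S j) - norm (S (j - 1))" for j
  have tel: "(\<Sum>j=1..m. \<Delta> j) = norm (S m)" for m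
    by (induction m) (simp_all add: \<Delta>_def S_0)
  have \<Delta>_le: "\<bar>\<Delta> j\<bar> \<le> r j" if "j \<ge> 1" for j
  proof -
    define i where "i = j - 1"
    have i: "j = Suc i" using that by (simp add: i_def)
    show ?thesis using norm_S_diff[of i j] by (simp add: \<Delta>_def i)
  qed
  have "(\<Sum>k=1..X. norm (S (X div k))) = (\<Sum>k=1..X. 1 * (\<Sum>j=1..X div k. \<Delta> j))" by (simp only: tel mult_1)
  also have "\<dots> = (\<Sum>n=1..X. conv (\<lambda>_. 1) \<Delta> n)" by (rule sum_conv[symmetric])
  also have "\<dots> = (\<Sum>n=1..X. conv \<Delta> (\<lambda>_. 1) n)" by (simp only: conv_commute[of \<Delta>])
  also have "\<dots> = (\<Sum>j=1..X. \<Delta> j * (\<Sum>b=1..X div j. 1))" by (rule sum_conv)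
  also have "\<dots> = (\<Sum>j=1..X. \<Delta> j * real (X div j))" by simp
  also have "\<dots> \<le> (\<Sum>j=1..X. real X * (\<Delta> j / real j) + r j)"
  proof (rule sum_mono)
    fix j assume j: "j \<in> {1..X}"
    have "real X / real j - real (X div j) \<le> 1"
      using real_of_int_div3[of "int X" "int j"] by (simp add: zdiv_int[symmetric])
    moreover have "real (X div j) \<le> real X / real j" by (rule of_nat_div_le_of_nat)
    ultimately have "\<bar>real (X div j) - real X / real j\<bar> \<le> 1" by linarith
    then have "\<bar>\<Delta> j * (real (X div j) - real X / real j)\<bar> \<le> r j * 1"
      unfolding abs_mult using \<Delta>_le[of j] j r_nonneg[of j] by (intro mult_mono) auto
    then show "\<Delta> j * real (X div j) \<le> real X * (\<Delta> j / real j) + r j"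
      by (simp add: algebra_simps)
  qed
  also have "\<dots> = real X * (\<Sum>j=1..X. \<Delta> j / real j) + (\<Sum>j=1..X. r j)"
    by (simp only: sum.distrib sum_distrib_left)
  also have "(\<Sum>j=1..X. \<Delta> j / real j) \<le> (\<Sum>j=1..X. norm (S j) / (real j)\<^sup>2) + norm (S X) / real X"
  proof -
    have "(\<Sum>j=1..m. \<Delta> j / real j) = (\<Sum>j=1..m. norm (S j) * (1 / real j - 1 / real (Suc j))) + norm (S m) / real (Suc m)" for m
      by (induction m) (simp_all add: \<Delta>_def S_0 algebra_simps diff_divide_distrib)
    from this[of X] have "(\<Sum>j=1..X. \<Delta> j / real j) = (\<Sum>j=1..X. norm (S j) * (1 / real j - 1 / real (Suc j))) + norm (S X) / real (Suc X)" .
    also have "\<dots> \<le> (\<Sum>j=1..X. norm (S j) / (real j)\<^sup>2) + norm (S X) / real X"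
    proof (intro add_mono sum_mono)
      fix j assume j: "j \<in> {1..X}"
      have "1 / real j - 1 / real (Suc j) = 1 / (real j * real (Suc j))" using j by (simp add: field_simps)
      also have "\<dots> \<le> 1 / (real j * real j)" using j by (intro divide_left_mono mult_left_mono) auto
      finally have "norm (S j) * (1 / real j - 1 / real (Suc j)) \<le> norm (S j) * (1 / (real j * real j))"
        by (intro mult_left_mono) auto
      then show "norm (S j) * (1 / real j - 1 / real (Suc j)) \<le> norm (S j) / (real j)\<^sup>2" by (simp add: power2_eq_square)
    next
      show "norm (S X) / real (Suc X) \<le> norm (S X) / real X" using X by (intro divide_left_mono) auto
    qed
    finally show ?thesis .
  qed
  finally have "(\<Sum>k=1..X. norm (S (X div k))) \<le> real X * ((\<Sum>j=1..X. norm (S j) / (real j)\<^sup>2) + norm (S X) / real X) + (\<Sum>j=1..X. r j)"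
    by (simp add: mult_left_mono)
  then show ?thesis using count_le[of X] norm_S_le[of X] X by (simp add: algebra_simps)
qed

text \<open>The weights \<open>\<Lambda>\<^sub>2\<close> can be replaced by \<open>2 log\<close>, since by Selberg's formula their partial
  sums agree up to \<open>O(n)\<close> and \<open>S\<close> varies slowly.\<close>

lemma norm_S_selberg:
  "\<exists>C\<ge>0. \<forall>X\<ge>1. norm (S X) * (ln (real X))\<^sup>2
     \<le> 2 * ln (real X) * (\<Sum>k=1..X. norm (S (X div k))) + C * real X * (1 + ln (real X))"
proof -
  obtain C where C: "\<And>n. \<bar>(\<Sum>k=1..n. lam2 k) - 2 * (\<Sum>k=1..n. ln (real k))\<bar> \<le> C * real n"
    using selberg_symmetry by blast
  have C_nonneg: "C \<ge> 0" using C[of 1] by auto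
  \<comment> \<open>The twisted \<Lambda>_2, dominated by \<open>lam2\<close>. Its convolution with
    \<open>c\<close> multiplies \<open>c\<close> by the square of the logarithm.\<close>
  define lf2 where "lf2 k = lf k * of_real (ln (real k)) + conv lf lf k" for k
  have lf2: "conv c lf2 n = c n * of_real (ln (real n)) ^ 2" if "n > 0" for n
    unfolding lf2_def[abs_def] by (rule conv_selberg[OF conv_lf that])
  have lf2_le: "norm (lf2 k) \<le> lam2 k" if "k \<ge> 1" for k
  proof -
    have "norm (lf2 k) \<le> norm (lf k) * ln (real k) + norm (conv lf lf k)"
      unfolding lf2_def using that by (intro order_trans[OF norm_triangle_ineq]) (simp add: norm_mult)
    also have "\<dots> \<le> lam k * ln (real k) + conv lam lam k"
      using that by (intro add_mono mult_right_mono norm_conv_le lf_le) auto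
    finally show ?thesis by (simp add: lam2_def)
  qed
  have "norm (S X) * (ln (real X))\<^sup>2
     \<le> 2 * ln (real X) * (\<Sum>k=1..X. norm (S (X div k))) + (8 * C0 + C * C0) * real X * (1 + ln (real X))"
    if X: "X \<ge> 1" for X
  proof -
    define L where "L = ln (real X)"
    have L: "L \<ge> 0" using X by (simp add: L_def)
    have "(\<Sum>k=1..X. c k * of_real ((ln (real k))\<^sup>2)) = (\<Sum>k=1..X. conv lf2 c k)"
      by (intro sum.cong refl) (simp add: conv_commute[of lf2] lf2)
    also have "\<dots> = (\<Sum>k=1..X. lf2 k * S (X div k))" unfolding S_def by (rule sum_conv)
    finally have 1: "(\<Sum>k=1..X. c k * of_real ((ln (real k))\<^sup>2)) = (\<Sum>k=1..X. lf2 k * S (X div k))" .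
    \<comment> \<open>Replacing ln^2 k by ln^2 X costs at most 2 L times the sum of r k ln(X / k).
      That sum is O(X), so one logarithm is gained on the trivial bound.\<close>
    have "norm (S X * of_real (L\<^sup>2) - (\<Sum>k=1..X. c k * of_real ((ln (real k))\<^sup>2)))
        = norm (\<Sum>k=1..X. c k * of_real (L\<^sup>2 - (ln (real k))\<^sup>2))"
      unfolding S_def sum_distrib_right sum_subtractf[symmetric] of_real_diff right_diff_distrib ..
    also have "\<dots> \<le> (\<Sum>k=1..X. 2 * L * (r k * ln (real X / real k)))"
    proof (rule sum_norm_le)
      fix k assume k: "k \<in> {1..X}"
      define l where "l = ln (real k)"
      have l: "0 \<le> l" "l \<le> L" using k by (auto simp: l_def L_def)
      have "L\<^sup>2 - l\<^sup>2 = (L + l) * (L - l)" by (simp add: power2_eq_square algebra_simps)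
      also have "\<dots> \<le> 2 * L * (L - l)" using l by (intro mult_right_mono) auto
      finally have 2: "L\<^sup>2 - l\<^sup>2 \<le> 2 * L * (L - l)" .
      have 3: "0 \<le> L\<^sup>2 - l\<^sup>2" using l by (simp add: power_mono)
      have "norm (c k * of_real (L\<^sup>2 - l\<^sup>2)) = norm (c k) * (L\<^sup>2 - l\<^sup>2)"
        using 3 by (simp only: norm_mult norm_of_real abs_of_nonneg)
      also have "\<dots> \<le> r k * (2 * L * (L - l))"
        using 2 3 c_le[of k] r_nonneg[of k] by (intro mult_mono) auto
      also have "L - l = ln (real X / real k)" using k by (simp add: L_def l_def ln_div)
      finally show "norm (c k * of_real (L\<^sup>2 - (ln (real k))\<^sup>2)) \<le> 2 * L * (r k * ln (real X / real k))"
        by (simp add: l_def mult_ac)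
    qed
    also have "\<dots> = 2 * L * (\<Sum>k=1..X. r k * ln (real X / real k))" by (simp only: sum_distrib_left)
    also have "\<dots> \<le> 2 * L * (C0 * (\<Sum>k=1..X. ln (real X / real k)))"
    proof (intro mult_left_mono sum_mult_antimono_le[OF count_le])
      fix j assume "1 \<le> j" "j < X"
      then show "ln (real X / real (Suc j)) \<le> ln (real X / real j)"
        by (subst ln_le_cancel_iff) (auto intro!: divide_left_mono)
    qed (use L in auto)
    also have "\<dots> \<le> 2 * L * (C0 * (4 * real X))" using L C0_pos by (intro mult_left_mono sum_ln_div_le) auto
    finally have 2: "norm (S X * of_real (L\<^sup>2) - (\<Sum>k=1..X. c k * of_real ((ln (real k))\<^sup>2))) \<le> 8 * C0 * real X * L"
      by (simp add: mult_ac)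
    have "norm (\<Sum>k=1..X. lf2 k * S (X div k)) \<le> (\<Sum>k=1..X. lam2 k * norm (S (X div k)))"
      by (intro sum_norm_le) (auto simp: norm_mult intro!: mult_right_mono lf2_le)
    also have "\<dots> = (\<Sum>k=1..X. (lam2 k - 2 * ln (real k)) * norm (S (X div k))) + (\<Sum>k=1..X. 2 * ln (real k) * norm (S (X div k)))"
      unfolding sum.distrib[symmetric] by (intro sum.cong refl) (simp add: algebra_simps)
    also have "(\<Sum>k=1..X. (lam2 k - 2 * ln (real k)) * norm (S (X div k))) \<le> C * (\<Sum>k=1..X. \<Sum>j=1..X div k. r j)"
    proof -
      have "\<bar>\<Sum>k=1..X. (lam2 k - 2 * ln (real k)) * norm (S (X div k))\<bar> \<le> C * (\<Sum>k=1..X. \<Sum>j=1..X div k. r j)"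
      proof (rule abel_div_bound)
        show "\<bar>\<Sum>j=1..k. lam2 j - 2 * ln (real j)\<bar> \<le> C * real k" for k
          using C[of k] by (simp add: sum_subtractf sum_distrib_left)
      qed (use norm_S_diff in \<open>auto simp: S_0\<close>)
      then show ?thesis by linarith
    qed
    also have "C * (\<Sum>k=1..X. \<Sum>j=1..X div k. r j) \<le> C * (C0 * real X * (1 + L))"
      unfolding L_def using C_nonneg X by (intro mult_left_mono sum_count_div_le) auto
    also have "(\<Sum>k=1..X. 2 * ln (real k) * norm (S (X div k))) \<le> (\<Sum>k=1..X. 2 * L * norm (S (X div k)))"
      by (intro sum_mono mult_right_mono) (auto simp: L_def)
    also have "\<dots> = 2 * L * (\<Sum>k=1..X. norm (S (X div k)))" by (simp only: sum_distrib_left)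
    finally have 3: "norm (\<Sum>k=1..X. lf2 k * S (X div k)) \<le> C * (C0 * real X * (1 + L)) + 2 * L * (\<Sum>k=1..X. norm (S (X div k)))"
      by simp
    have "norm (S X) * L\<^sup>2 = norm (S X * of_real (L\<^sup>2))" by (simp only: norm_mult norm_of_real abs_of_nonneg zero_le_power2)
    also have "\<dots> \<le> norm (S X * of_real (L\<^sup>2) - (\<Sum>k=1..X. c k * of_real ((ln (real k))\<^sup>2)))
        + norm (\<Sum>k=1..X. c k * of_real ((ln (real k))\<^sup>2))"
      using norm_triangle_ineq[of "S X * of_real (L\<^sup>2) - (\<Sum>k=1..X. c k * of_real ((ln (real k))\<^sup>2))"
          "\<Sum>k=1..X. c k * of_real ((ln (real k))\<^sup>2)"] by simp
    also have "\<dots> \<le> 8 * C0 * real X * L + (C * (C0 * real X * (1 + L)) + 2 * L * (\<Sum>k=1..X. norm (S (X div k))))"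
      using 2 3 1 by simp
    also have "8 * C0 * real X * L \<le> 8 * C0 * real X * (1 + L)" using C0_pos by (intro mult_left_mono) auto
    finally show ?thesis unfolding L_def by (simp add: algebra_simps)
  qed
  then show ?thesis using C_nonneg C0_pos by (intro exI[of _ "8 * C0 + C * C0"]) auto
qed

text \<open>In the inequality of \<open>norm_S_selberg\<close> the sum of |S(X / k)| is X times the
  logarithmic mean, which is o(X ln X), up to O(X). After division by X (ln X)^2 every term on the
  right tends to 0.\<close>

theorem mean_value_zero: "(\<lambda>n. S n / of_nat n) \<longlonglongrightarrow> 0"
proof -
  obtain C where C: "C \<ge> 0" and bound: "\<And>X. X \<ge> 1 \<Longrightarrow> norm (S X) * (ln (real X))\<^sup>2
     \<le> 2 * ln (real X) * (\<Sum>k=1..X. norm (S (X div k))) + C * real X * (1 + ln (real X))"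
    using norm_S_selberg by blast
  show ?thesis
  proof (rule LIMSEQ_I)
    fix e :: real assume e: "e > 0"
    \<comment> \<open>The inequality doubles e / 8 to e / 4. The choice of \<open>X2\<close> keeps
      the lower order terms below another e / 4.\<close>
    obtain X1 where X1: "\<And>X. X \<ge> X1 \<Longrightarrow> (\<Sum>k=1..X. norm (S k) / (real k)\<^sup>2) \<le> e / 8 * ln (real X)"
      using log_average_small[of "e / 8"] e by auto
    have "filterlim (\<lambda>X. ln (real X)) at_top sequentially"
      by (rule filterlim_compose[OF ln_at_top filterlim_real_sequentially])
    then have "\<forall>\<^sub>F X in sequentially. ln (real X) > max 1 (4 * (2 * C + 4 * C0) / e)" unfolding filterlim_at_top_dense by (rule spec)
    then obtain X2 where X2: "\<And>X. X \<ge> X2 \<Longrightarrow> ln (real X) > max 1 (4 * (2 * C + 4 * C0) / e)" by (auto simp: eventually_sequentially)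
    have "norm (S X / of_nat X - 0) < e" if X: "X \<ge> max 1 (max X1 X2)" for X
    proof -
      define L where "L = ln (real X)"
      have "L > max 1 (4 * (2 * C + 4 * C0) / e)" using X2[of X] X by (simp add: L_def)
      then have L: "L > 1" "4 * (2 * C + 4 * C0) < e * L" using e by (auto simp: field_simps)
      have X0: "real X > 0" using X by simp
      have "norm (S X) * L\<^sup>2 \<le> 2 * L * (\<Sum>k=1..X. norm (S (X div k))) + C * real X * (1 + L)"
        unfolding L_def using X by (intro bound) auto
      also have "\<dots> \<le> 2 * L * (real X * (e / 8 * L) + 2 * C0 * real X) + C * real X * (L + L)"
      proof (intro add_mono mult_left_mono)
        have "(\<Sum>k=1..X. norm (S (X div k))) \<le> real X * (\<Sum>j=1..X. norm (S j) / (real j)\<^sup>2) + 2 * C0 * real X"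
          using X by (intro sum_norm_S_div_le) auto
        also have "\<dots> \<le> real X * (e / 8 * L) + 2 * C0 * real X"
          unfolding L_def using X by (intro add_right_mono mult_left_mono X1) auto
        finally show "(\<Sum>k=1..X. norm (S (X div k))) \<le> real X * (e / 8 * L) + 2 * C0 * real X" .
      qed (use L C in auto)
      also have "\<dots> = real X * L * (e / 4 * L + (2 * C + 4 * C0))" by (simp add: algebra_simps)
      also have "\<dots> < real X * L * (e / 4 * L + e * L / 4)"
      proof (rule mult_strict_left_mono)
        show "e / 4 * L + (2 * C + 4 * C0) < e / 4 * L + e * L / 4"
          unfolding add_less_cancel_left using L(2) by simp
      qed (use L X0 in simp)
      also have "\<dots> = (e / 2 * real X) * L\<^sup>2" by (simp add: power2_eq_square algebra_simps)
      finally have "norm (S X) < e / 2 * real X" using L by (simp add: mult_less_cancel_right)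
      then have "norm (S X) / real X < e / 2" using X0 by (simp add: field_simps)
      then have "norm (S X) / real X < e" using e by linarith
      then show ?thesis by (simp add: norm_divide)
    qed
    then show "\<exists>no. \<forall>n\<ge>no. norm (S n / of_nat n - 0) < e" by blast
  qed
qed

end

section \<open>Multisets of normed primes\<close>

text \<open>The divisors of m p^k with p not dividing m are the d p^j with d dividing m and j \<le>
  k, each obtained once. Divisor sums over multisets are evaluated by splitting off one prime power
  in this way.\<close>

lemma sub_extend_image:
  assumes "p \<notin># m"
  shows "{d. d \<subseteq># m + replicate_mset k p} = (\<lambda>(d, j). d + replicate_mset j p) ` ({d. d \<subseteq># m} \<times> {..k})"
    and "inj_on (\<lambda>(d, j). d + replicate_mset j p) ({d. d \<subseteq># m} \<times> {..k})"
proof -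
  have m0: "count m p = 0" using assms by (simp add: count_eq_zero_iff)
  show "{d. d \<subseteq># m + replicate_mset k p} = (\<lambda>(d, j). d + replicate_mset j p) ` ({d. d \<subseteq># m} \<times> {..k})"
  proof (intro equalityI subsetI)
    fix e assume "e \<in> {d. d \<subseteq># m + replicate_mset k p}"
    then have le: "count e x \<le> count m x + count (replicate_mset k p) x" for x
      by (simp add: subseteq_mset_def)
    have "filter_mset (\<lambda>x. x \<noteq> p) e \<subseteq># m"
      unfolding subseteq_mset_def
    proof
      fix x show "count (filter_mset (\<lambda>x. x \<noteq> p) e) x \<le> count m x" using le[of x] by auto
    qed
    moreover have "count e p \<le> k" using le[of p] m0 by simp
    moreover have "e = filter_mset (\<lambda>x. x \<noteq> p) e + replicate_mset (count e p) p"
      by (rule multiset_eqI) auto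
    ultimately show "e \<in> (\<lambda>(d, j). d + replicate_mset j p) ` ({d. d \<subseteq># m} \<times> {..k})"
      by (intro image_eqI[of _ _ "(filter_mset (\<lambda>x. x \<noteq> p) e, count e p)"]) auto
  next
    fix e assume "e \<in> (\<lambda>(d, j). d + replicate_mset j p) ` ({d. d \<subseteq># m} \<times> {..k})"
    then obtain d j where "e = d + replicate_mset j p" "d \<subseteq># m" "j \<le> k" by auto
    then show "e \<in> {d. d \<subseteq># m + replicate_mset k p}"
      by (simp add: subseteq_mset_def add_mono)
  qed
  show "inj_on (\<lambda>(d, j). d + replicate_mset j p) ({d. d \<subseteq># m} \<times> {..k})"
  proof (rule inj_onI)
    fix x y assume "x \<in> {d. d \<subseteq># m} \<times> {..k}" "y \<in> {d. d \<subseteq># m} \<times> {..k}"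
      "(case x of (d, j) \<Rightarrow> d + replicate_mset j p) = (case y of (d, j) \<Rightarrow> d + replicate_mset j p)"
    then obtain d j d' j' where xy: "x = (d, j)" "y = (d', j')" "d \<subseteq># m" "d' \<subseteq># m"
      and eq: "d + replicate_mset j p = d' + replicate_mset j' p" by auto
    have "count d p = 0" "count d' p = 0" using xy m0 by (metis le_zero_eq mset_subset_eq_count)+
    then have "j = j'" using arg_cong[OF eq, of "\<lambda>z. count z p"] by simp
    then show "x = y" using eq xy by simp
  qed
qed

lemma sum_sub_extend:
  assumes "p \<notin># m"
  shows "(\<Sum>d | d \<subseteq># m + replicate_mset k p. F d) = (\<Sum>d | d \<subseteq># m. \<Sum>j\<le>k. F (d + replicate_mset j p))"
  unfolding sub_extend_image(1)[OF assms] sum.cartesian_product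
  by (subst sum.reindex[OF sub_extend_image(2)[OF assms]]) (simp add: case_prod_beta)

text \<open>Each step adds a full prime power coprime to the rest, since a multiplicative function
  splits only along coprime factors.\<close>

lemma multiset_prime_power_induct [case_names empty step]:
  assumes "Q {#}" and step: "\<And>m p k. Q m \<Longrightarrow> p \<notin># m \<Longrightarrow> k \<ge> 1 \<Longrightarrow> Q (m + replicate_mset k p)"
  shows "Q m"
proof (induction m rule: measure_induct_rule[of size])
  case (less m)
  show ?case
  proof (cases "m = {#}")
    case False
    then obtain p where p: "p \<in># m" by auto
    have m: "m = filter_mset (\<lambda>x. x \<noteq> p) m + replicate_mset (count m p) p" by (rule multiset_eqI) auto
    have k: "count m p \<ge> 1" using p by (simp add: Suc_le_eq)
    have "size m = size (filter_mset (\<lambda>x. x \<noteq> p) m) + count m p"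
      by (subst m) (simp only: size_union size_replicate_mset)
    then have "Q (filter_mset (\<lambda>x. x \<noteq> p) m)" using less k by simp
    then have "Q (filter_mset (\<lambda>x. x \<noteq> p) m + replicate_mset (count m p) p)" using k by (intro step) auto
    then show ?thesis using m by simp
  qed (use assms in simp)
qed

lemma finite_sub: "finite {d. d \<subseteq># m}"
proof (induction m rule: multiset_prime_power_induct)
  case (step m p k)
  then show ?case unfolding sub_extend_image(1)[OF step(2)] by simp
qed simp

text \<open>Dirichlet convolution on the free commutative monoid: sub-multisets are divisors and
  multiset difference is the quotient.\<close>

definition mconv :: "('p multiset \<Rightarrow> 'a::comm_semiring_1) \<Rightarrow> ('p multiset \<Rightarrow> 'a) \<Rightarrow> 'p multiset \<Rightarrow> 'a" where
  "mconv f g m = (\<Sum>d | d \<subseteq># m. f d * g (m - d))"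

definition mmoebius :: "'p multiset \<Rightarrow> real" where
  "mmoebius d = (if \<forall>p. count d p \<le> 1 then (- 1) ^ size d else 0)"

text \<open>When a new prime power is added, the divisors with j = 0 and j = 1 copies of the prime
  cancel and those with more contribute 0.\<close>

lemma sum_mmoebius: "(\<Sum>d | d \<subseteq># m. mmoebius d) = (if m = {#} then 1 else 0)"
proof (induction m rule: multiset_prime_power_induct)
  case empty
  then show ?case by (simp add: mmoebius_def)
next
  case (step m p k)
  have "(\<Sum>d | d \<subseteq># m + replicate_mset k p. mmoebius d) = (\<Sum>d | d \<subseteq># m. \<Sum>j\<le>k. mmoebius (d + replicate_mset j p))"
    by (rule sum_sub_extend[OF step(2)])
  also have "\<dots> = (\<Sum>d | d \<subseteq># m. 0)"
  proof (rule sum.cong[OF refl])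
    fix d assume "d \<in> {d. d \<subseteq># m}"
    then have d: "count d p = 0" using step(2) by (metis count_eq_zero_iff mem_Collect_eq mset_subset_eqD)
    have "mmoebius (d + replicate_mset j p) = (if j = 0 then mmoebius d else if j = 1 then - mmoebius d else 0)" for j
    proof -
      have "(\<forall>q. count (d + replicate_mset j p) q \<le> 1) \<longleftrightarrow> (\<forall>q. count d q \<le> 1) \<and> j \<le> 1"
      proof (intro iffI conjI allI)
        assume a: "\<forall>q. count (d + replicate_mset j p) q \<le> 1"
        show "count d q \<le> 1" for q using a[rule_format, of q] by simp
        show "j \<le> 1" using a[rule_format, of p] by simp
      next
        fix q assume "(\<forall>q. count d q \<le> 1) \<and> j \<le> 1"
        then show "count (d + replicate_mset j p) q \<le> 1" using d by (cases "q = p") auto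
      qed
      then show ?thesis by (auto simp: mmoebius_def)
    qed
    then have "(\<Sum>j\<le>k. mmoebius (d + replicate_mset j p)) = (\<Sum>j\<le>k. if j = 0 then mmoebius d else if j = 1 then - mmoebius d else 0)" by simp
    also have "\<dots> = (\<Sum>j\<in>{0, 1::nat}. if j = 0 then mmoebius d else if j = 1 then - mmoebius d else 0)"
      by (rule sum.mono_neutral_right) (use step(3) in auto)
    finally show "(\<Sum>j\<le>k. mmoebius (d + replicate_mset j p)) = 0" by simp
  qed
  finally show ?case using step(3) by (auto simp: replicate_mset_eq_empty_iff)
qed

text \<open>A free commutative monoid on \<open>P\<close> with a multiplicative norm and a
  square-root counting law; this is all that the theorem of Halasz uses about the ideals.\<close>

locale normed_primes =
  fixes P :: "'p set" and N :: "'p \<Rightarrow> nat" and A B :: real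
  assumes N_ge_2: "p \<in> P \<Longrightarrow> N p \<ge> 2"
    and A_gt_0: "A > 0" and B_ge_0: "B \<ge> 0"
    and finite_le: "finite {m. set_mset m \<subseteq> P \<and> prod_mset (image_mset N m) \<le> n}"
    and count_bound: "\<bar>real (card {m. set_mset m \<subseteq> P \<and> prod_mset (image_mset N m) \<le> n}) - A * n\<bar> \<le> B * sqrt n"
begin

definition nm :: "'p multiset \<Rightarrow> nat" where "nm m = prod_mset (image_mset N m)"
definition MS :: "'p multiset set" where "MS = {m. set_mset m \<subseteq> P}"
definition MSle :: "nat \<Rightarrow> 'p multiset set" where "MSle n = {m \<in> MS. nm m \<le> n}"
definition level :: "nat \<Rightarrow> 'p multiset set" where "level n = {m \<in> MS. nm m = n}"
text \<open>Summation over the fibres of the norm. A multiplicative function on the monoid does not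
  become multiplicative on the natural numbers, but convolution is respected, as
  \<open>push_mconv\<close> shows.\<close>

definition push :: "('p multiset \<Rightarrow> 'a::comm_monoid_add) \<Rightarrow> nat \<Rightarrow> 'a" where
  "push f n = (\<Sum>m\<in>level n. f m)"

lemma nm_add [simp]: "nm (a + b) = nm a * nm b" by (simp add: nm_def)
lemma nm_empty [simp]: "nm {#} = 1" by (simp add: nm_def)
lemma nm_single [simp]: "nm {#p#} = N p" by (simp add: nm_def)
lemma nm_replicate [simp]: "nm (replicate_mset k p) = N p ^ k" by (simp add: nm_def)

lemma nm_pos: "m \<in> MS \<Longrightarrow> nm m > 0"
proof (induction m)
  case (add p m)
  then show ?case using N_ge_2[of p] by (auto simp: nm_def MS_def)
qed simp

lemma nm_gt_1: "m \<in> MS \<Longrightarrow> m \<noteq> {#} \<Longrightarrow> nm m > 1"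
proof (induction m)
  case (add p m)
  have "nm m > 0" using add by (intro nm_pos) (auto simp: MS_def)
  moreover have "N p \<ge> 2" using add N_ge_2 by (auto simp: MS_def)
  ultimately have "2 * 1 \<le> N p * nm m" by (intro mult_le_mono) auto
  then show ?case by (simp add: nm_def)
qed simp

lemma MS_add: "a + b \<in> MS \<longleftrightarrow> a \<in> MS \<and> b \<in> MS" by (auto simp: MS_def)
lemma MS_empty: "{#} \<in> MS" by (simp add: MS_def)
lemma finite_MSle: "finite (MSle n)"
  using finite_le[of n] by (simp add: MSle_def MS_def nm_def)

lemma finite_level: "finite (level n)"
  by (rule finite_subset[OF _ finite_MSle[of n]]) (auto simp: level_def MSle_def)

lemma push_mult: "push (\<lambda>m. f m * w (nm m)) n = push f n * w n" for f :: "'p multiset \<Rightarrow> 'a::comm_semiring_1"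
  unfolding push_def sum_distrib_right by (intro sum.cong) (auto simp: level_def)

lemma sum_push: "(\<Sum>k=1..n. push f k) = (\<Sum>m\<in>MSle n. f m)"
proof -
  have "(\<Sum>k=1..n. push f k) = (\<Sum>k=1..n. sum f {m \<in> MSle n. nm m = k})"
    unfolding push_def by (intro sum.cong arg_cong2[where f = sum]) (auto simp: level_def MSle_def)
  also have "\<dots> = sum f (MSle n)"
    by (rule sum.group[OF finite_MSle]) (use nm_pos in \<open>auto simp: MSle_def Suc_le_eq\<close>)
  finally show ?thesis .
qed

lemma sum_push_mult: "(\<Sum>k=1..n. push f k * w k) = (\<Sum>m\<in>MSle n. f m * w (nm m))"
  for f :: "'p multiset \<Rightarrow> 'a::comm_semiring_1"
  using sum_push[of "\<lambda>m. f m * w (nm m)" n] by (simp add: push_mult)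

lemma push_cong: "(\<And>m. m \<in> MS \<Longrightarrow> f m = g m) \<Longrightarrow> push f n = push g n"
  unfolding push_def by (intro sum.cong) (auto simp: level_def)

text \<open>The norm is multiplicative, so the pairs (d, e) with product of norm n are sorted by the
  norm k of d, which divides n and leaves norm n / k for e.\<close>

lemma push_mconv:
  assumes "n > 0"
  shows "push (mconv f g) n = conv (push f) (push g) n"
proof -
  have "push (mconv f g) n = (\<Sum>m\<in>level n. \<Sum>d | d \<subseteq># m. f d * g (m - d))"
    by (simp add: push_def mconv_def)
  also have "\<dots> = (\<Sum>(m, d)\<in>(SIGMA m:level n. {d. d \<subseteq># m}). f d * g (m - d))"
    by (rule sum.Sigma) (auto simp: finite_level finite_sub)
  also have "\<dots> = (\<Sum>(k, d, e)\<in>(SIGMA k:{k. k dvd n}. level k \<times> level (n div k)). f d * g e)"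
  proof (rule sum.reindex_bij_witness[where i = "\<lambda>(k, d, e). (d + e, d)" and j = "\<lambda>(m, d). (nm d, d, m - d)"])
    fix a assume "a \<in> (SIGMA m:level n. {d. d \<subseteq># m})"
    then obtain m d where a: "a = (m, d)" "m \<in> MS" "nm m = n" "d \<subseteq># m" by (auto simp: level_def)
    then have m: "m = d + (m - d)" by simp
    then have "nm m = nm d * nm (m - d)" by (metis nm_add)
    moreover have "d \<in> MS" "m - d \<in> MS" using a m by (metis MS_add)+
    moreover from this have "nm d > 0" by (intro nm_pos)
    ultimately show "(case a of (m, d) \<Rightarrow> (nm d, d, m - d)) \<in> (SIGMA k:{k. k dvd n}. level k \<times> level (n div k))"
      using a by (auto simp: level_def)
    show "(case case a of (m, d) \<Rightarrow> (nm d, d, m - d) of (k, d, e) \<Rightarrow> (d + e, d)) = a" using a by simp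
    show "(case case a of (m, d) \<Rightarrow> (nm d, d, m - d) of (k, d, e) \<Rightarrow> f d * g e) = (case a of (m, d) \<Rightarrow> f d * g (m - d))"
      using a by simp
  next
    fix b assume "b \<in> (SIGMA k:{k. k dvd n}. level k \<times> level (n div k))"
    then obtain k d e where b: "b = (k, d, e)" "k dvd n" "d \<in> MS" "nm d = k" "e \<in> MS" "nm e = n div k"
      by (auto simp: level_def)
    then show "(case b of (k, d, e) \<Rightarrow> (d + e, d)) \<in> (SIGMA m:level n. {d. d \<subseteq># m})"
      by (auto simp: level_def MS_add)
    show "(case case b of (k, d, e) \<Rightarrow> (d + e, d) of (m, d) \<Rightarrow> (nm d, d, m - d)) = b" using b by simp
  qed
  also have "\<dots> = (\<Sum>k | k dvd n. \<Sum>(d, e)\<in>level k \<times> level (n div k). f d * g e)"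
    using assms by (subst sum.Sigma) (auto simp: finite_level case_prod_beta)
  also have "\<dots> = conv (push f) (push g) n"
    unfolding conv_def push_def sum_product by (simp add: sum.cartesian_product)
  finally show ?thesis .
qed

text \<open>The von Mangoldt function: a multiset with exactly one distinct element is a proper
  prime power.\<close>

definition mlam :: "'p multiset \<Rightarrow> real" where
  "mlam d = (if card (set_mset d) = 1 then ln (N (the_elem (set_mset d))) else 0)"

lemma mlam_nonneg: "m \<in> MS \<Longrightarrow> mlam m \<ge> 0"
proof -
  assume m: "m \<in> MS"
  show "mlam m \<ge> 0"
  proof (cases "card (set_mset m) = 1")
    case True
    then obtain p where p: "set_mset m = {p}" by (auto simp: card_1_singleton_iff)
    then have "N p \<ge> 2" using m N_ge_2 by (auto simp: MS_def)
    then show ?thesis using p by (simp add: mlam_def)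
  qed (simp add: mlam_def)
qed

text \<open>Adding p^k creates new prime-power divisors only on top of the empty multiset, namely p,
  ..., p^k. They contribute k ln N p, the increase of the logarithm of the norm.\<close>

lemma sum_mlam: "m \<in> MS \<Longrightarrow> (\<Sum>d | d \<subseteq># m. mlam d) = ln (nm m)"
proof (induction m rule: multiset_prime_power_induct)
  case empty
  then show ?case by (simp add: mlam_def)
next
  case (step m p k)
  have mp: "m \<in> MS" "p \<in> P" using step by (auto simp: MS_def)
  have "(\<Sum>d | d \<subseteq># m + replicate_mset k p. mlam d) = (\<Sum>d | d \<subseteq># m. \<Sum>j\<le>k. mlam (d + replicate_mset j p))"
    by (rule sum_sub_extend[OF step(2)])
  also have "\<dots> = (\<Sum>d | d \<subseteq># m. mlam d + (if d = {#} then k * ln (N p) else 0))"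
  proof (rule sum.cong[OF refl])
    fix d assume "d \<in> {d. d \<subseteq># m}"
    then have d: "p \<notin># d" using step(2) by (auto dest: mset_subset_eqD)
    have "(\<Sum>j\<le>k. mlam (d + replicate_mset j p)) = mlam d + (\<Sum>j=1..k. mlam (d + replicate_mset j p))"
    proof -
      have "{..k} = insert 0 {1..k}" by auto
      then show ?thesis by simp
    qed
    also have "(\<Sum>j=1..k. mlam (d + replicate_mset j p)) = (\<Sum>j=1..k. if d = {#} then ln (N p) else 0)"
    proof (rule sum.cong[OF refl])
      fix j assume "j \<in> {1..k}"
      then have "set_mset (d + replicate_mset j p) = insert p (set_mset d)" by auto
      then show "mlam (d + replicate_mset j p) = (if d = {#} then ln (N p) else 0)"
        using d by (auto simp: mlam_def card_insert_if)
    qed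
    finally show "(\<Sum>j\<le>k. mlam (d + replicate_mset j p)) = mlam d + (if d = {#} then k * ln (N p) else 0)"
      by auto
  qed
  also have "\<dots> = (\<Sum>d | d \<subseteq># m. mlam d) + k * ln (N p)"
    using finite_sub[of m] by (simp add: sum.distrib sum.delta)
  also have "\<dots> = ln (nm m) + ln (N p ^ k)" using step mp N_ge_2[of p] by (simp add: ln_realpow)
  also have "\<dots> = ln (nm (m + replicate_mset k p))"
    using nm_pos[OF mp(1)] N_ge_2[OF mp(2)] by (simp add: ln_mult)
  finally show ?case .
qed

definition rr :: "nat \<Rightarrow> real" where "rr = push (\<lambda>_. 1)"

lemma sum_rr: "(\<Sum>k=1..n. rr k) = card (MSle n)"
  unfolding rr_def sum_push by simp

lemma norm_push_le:
  fixes f :: "'p multiset \<Rightarrow> 'a::real_normed_vector"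
  assumes "\<And>m. m \<in> MS \<Longrightarrow> norm (f m) \<le> g m"
  shows "norm (push f n) \<le> push g n"
  unfolding push_def by (intro sum_norm_le assms) (auto simp: level_def)

text \<open>The two convolution conditions are the divisor sums of \<open>mlam\<close> and
  \<open>mmoebius\<close>, transported by \<open>push_mconv\<close>. The empty multiset is the only
  element of norm 1.\<close>

sublocale axiom_A rr "push mmoebius" "push mlam" A B
proof
  show "A > 0" "B \<ge> 0" by (rule A_gt_0 B_ge_0)+
  show "rr n \<ge> 0" for n by (simp add: rr_def push_def)
  have "level 1 = {{#}}" using nm_gt_1 by (fastforce simp: level_def MS_empty)
  then show "rr 1 = 1" by (simp add: rr_def push_def)
  show "\<bar>(\<Sum>k=1..n. rr k) - A * n\<bar> \<le> B * sqrt n" for n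
    using count_bound[of n] unfolding sum_rr by (simp add: MSle_def MS_def nm_def)
  show "push mlam n \<ge> 0" for n unfolding push_def by (intro sum_nonneg mlam_nonneg) (auto simp: level_def)
  show "\<bar>push mmoebius n\<bar> \<le> rr n" for n
    using norm_push_le[of mmoebius "\<lambda>_. 1" n] by (simp add: rr_def mmoebius_def)
  fix n :: nat assume n: "n > 0"
  have "conv rr (push mlam) n = conv (push mlam) (push (\<lambda>_. 1)) n" unfolding rr_def by (rule conv_commute)
  also have "\<dots> = push (mconv mlam (\<lambda>_. 1)) n" by (rule push_mconv[OF n, symmetric])
  also have "\<dots> = push (\<lambda>m. 1 * ln (nm m)) n"
    by (rule push_cong) (simp add: mconv_def sum_mlam)
  also have "\<dots> = rr n * ln n" unfolding rr_def by (rule push_mult)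
  finally show "conv rr (push mlam) n = rr n * ln n" .
  have "conv (push mmoebius) rr n = push (mconv mmoebius (\<lambda>_. 1)) n" unfolding rr_def by (rule push_mconv[OF n, symmetric])
  also have "\<dots> = push (\<lambda>m. if m = {#} then 1 else 0) n" by (rule push_cong) (simp add: mconv_def sum_mmoebius)
  also have "\<dots> = (if {#} \<in> level n then 1 else 0)"
    unfolding push_def using finite_level by (simp add: sum.delta)
  also have "\<dots> = (if n = 1 then 1 else 0)" by (auto simp: level_def MS_empty)
  finally show "conv (push mmoebius) rr n = (if n = 1 then 1 else 0)" .
qed

end

text \<open>Since log(1 - z) differs from -z by at most |z|^2 / (1 - |z|) \<le> 2 \<rho>^2, an Euler
  factor compares with the majorant's through the real parts alone, up to a summable square.\<close>

lemma euler_factor_le: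
  fixes z :: complex
  assumes "norm z \<le> \<rho>" "\<rho> \<le> 1 / 2"
  shows "(1 - \<rho>) \<le> norm (1 - z) * exp (- (\<rho> - Re z) + 2 * \<rho>\<^sup>2)"
proof -
  have \<rho>: "0 \<le> \<rho>" using assms(1) order_trans[OF norm_ge_zero] by blast
  have z: "norm (- z) < 1" using assms by simp
  have nz: "1 + (- z) \<noteq> 0"
  proof
    assume "1 + (- z) = 0"
    then have "z = 1" by simp
    then show False using assms by simp
  qed
  have "- Re (ln (1 + (- z)) - (- z)) \<le> norm (ln (1 + (- z)) - (- z))"
    using abs_Re_le_cmod[of "ln (1 + (- z)) - (- z)"] by linarith
  also have "\<dots> \<le> (norm (- z))\<^sup>2 / (1 - norm (- z))" by (rule Ln_approx_linear[OF z])
  also have "\<dots> \<le> \<rho>\<^sup>2 / (1 / 2)"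
    using assms by (intro frac_le power_mono) auto
  finally have "- ln (norm (1 + (- z))) \<le> Re z + 2 * \<rho>\<^sup>2" using nz by (simp add: Re_Ln)
  moreover have "1 + (- z) = 1 - z" by simp
  ultimately have 1: "- ln (norm (1 - z)) \<le> Re z + 2 * \<rho>\<^sup>2" by simp
  have pos: "norm (1 - z) > 0" using nz by simp
  have "1 - \<rho> \<le> exp (- \<rho>)" using exp_ge_add_one_self[of "- \<rho>"] by simp
  also have "\<dots> \<le> exp (ln (norm (1 - z)) + (- (\<rho> - Re z) + 2 * \<rho>\<^sup>2))" using 1 by simp
  also have "\<dots> = norm (1 - z) * exp (- (\<rho> - Re z) + 2 * \<rho>\<^sup>2)" using pos by (simp only: exp_add exp_ln)
  finally show ?thesis .
qed

section \<open>Euler products to the right of the line Re s = 1\<close>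

context normed_primes
begin

definition cmul :: "('p \<Rightarrow> complex) \<Rightarrow> 'p multiset \<Rightarrow> complex" where
  "cmul g m = prod_mset (image_mset g m)"

lemma cmul_simps [simp]: "cmul g {#} = 1" "cmul g (a + b) = cmul g a * cmul g b"
    "cmul g (add_mset p m) = g p * cmul g m" "cmul g (replicate_mset k p) = g p ^ k"
  by (simp_all add: cmul_def)

lemma norm_cmul_le:
  assumes "m \<in> MS" "\<And>p. p \<in> P \<Longrightarrow> norm (g p) \<le> real (N p) powr (- \<sigma>)"
  shows "norm (cmul g m) \<le> real (nm m) powr (- \<sigma>)"
  using assms(1)
proof (induction m)
  case (add p m)
  then have "p \<in> P" "m \<in> MS" by (auto simp: MS_def)
  then have "norm (g p) * norm (cmul g m) \<le> real (N p) powr (- \<sigma>) * real (nm m) powr (- \<sigma>)"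
    using add assms(2) by (intro mult_mono) auto
  also have "\<dots> = real (nm (add_mset p m)) powr (- \<sigma>)" by (simp add: nm_def powr_mult)
  finally show ?case by (simp add: norm_mult)
qed simp

lemma norm_cmul_le_1:
  assumes "m \<in> MS" "\<And>p. p \<in> P \<Longrightarrow> norm (g p) \<le> 1"
  shows "norm (cmul g m) \<le> 1"
  using assms(1)
proof (induction m)
  case (add p m)
  then have "p \<in> P" "m \<in> MS" by (auto simp: MS_def)
  then have "norm (g p) * norm (cmul g m) \<le> 1 * 1"
    using add assms(2) by (intro mult_mono) auto
  then show ?case by (simp add: norm_mult)
qed simp

lemma finite_subset_MSle: "finite X \<Longrightarrow> X \<subseteq> MS \<Longrightarrow> \<exists>n. X \<subseteq> MSle n"
  by (rule exI[of _ "Max (nm ` X)"]) (auto simp: MSle_def)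

lemma sum_nm_powr_le:
  assumes "0 < \<epsilon>" "\<epsilon> \<le> 1" "finite X" "X \<subseteq> MS"
  shows "(\<Sum>m\<in>X. real (nm m) powr (- (1 + \<epsilon>))) \<le> 2 * C0 / \<epsilon>"
proof -
  obtain n where "X \<subseteq> MSle n" using finite_subset_MSle assms by blast
  then have "(\<Sum>m\<in>X. real (nm m) powr (- (1 + \<epsilon>))) \<le> (\<Sum>m\<in>MSle n. 1 * real (nm m) powr (- (1 + \<epsilon>)))"
    by (simp add: sum_mono2 finite_MSle)
  also have "\<dots> = (\<Sum>k=1..n. rr k * real k powr (- (1 + \<epsilon>)))"
    unfolding rr_def by (rule sum_push_mult[symmetric])
  also have "\<dots> \<le> 2 * C0 / \<epsilon>" using assms C0_pos by (intro sum_weights_eps_le count_le) auto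
  finally show ?thesis .
qed

lemma nm_powr_summable:
  assumes "0 < \<epsilon>" "\<epsilon> \<le> 1" "X \<subseteq> MS"
  shows "(\<lambda>m. real (nm m) powr (- (1 + \<epsilon>))) summable_on X"
proof (rule nonneg_bounded_partial_sums_imp_summable_on[where C = "2 * C0 / \<epsilon>"])
  show "\<forall>\<^sub>F Y in finite_subsets_at_top X. (\<Sum>m\<in>Y. real (nm m) powr (- (1 + \<epsilon>))) \<le> 2 * C0 / \<epsilon>"
    unfolding eventually_finite_subsets_at_top
    by (intro exI[of _ "{}"] conjI allI impI sum_nm_powr_le assms(1,2)) (use assms(3) in auto)
qed auto

definition zeta :: "real \<Rightarrow> real" where
  "zeta \<sigma> = infsum (\<lambda>m. real (nm m) powr (- \<sigma>)) MS"

lemma zeta_le: "0 < \<epsilon> \<Longrightarrow> \<epsilon> \<le> 1 \<Longrightarrow> zeta (1 + \<epsilon>) \<le> 2 * C0 / \<epsilon>"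
  unfolding zeta_def by (intro infsum_le_finite_sums nm_powr_summable sum_nm_powr_le) auto

lemma cmul_abs_summable:
  assumes "0 < \<epsilon>" "\<epsilon> \<le> 1" "X \<subseteq> MS" "\<And>p. p \<in> P \<Longrightarrow> norm (g p) \<le> real (N p) powr (- (1 + \<epsilon>))"
  shows "(\<lambda>m. norm (cmul g m)) summable_on X"
  by (rule Infinite_Sum.abs_summable_on_comparison_test'[OF nm_powr_summable[OF assms(1,2,3)]])
     (use assms norm_cmul_le in blast)

definition sieved :: "'p set \<Rightarrow> 'p multiset set" where
  "sieved Q = {m \<in> MS. set_mset m \<inter> Q = {}}"

text \<open>Elements free of Q are either free of q too, or q times an element free of Q. Each prime
  thus removes one factor 1 - g q, and only finite products occur.\<close>

lemma infsum_sieved: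
  assumes \<epsilon>: "0 < \<epsilon>" "\<epsilon> \<le> 1" and g: "\<And>p. p \<in> P \<Longrightarrow> norm (g p) \<le> real (N p) powr (- (1 + \<epsilon>))"
    and Q: "finite Q" "Q \<subseteq> P"
  shows "infsum (cmul g) (sieved Q) = (\<Prod>p\<in>Q. 1 - g p) * infsum (cmul g) MS"
  using Q
proof (induction Q)
  case empty
  then show ?case by (simp add: sieved_def)
next
  case (insert q Q)
  have sum: "cmul g summable_on X" if "X \<subseteq> MS" for X
    by (rule abs_summable_summable[OF cmul_abs_summable[OF \<epsilon> that g]])
  have eq: "sieved Q = sieved (insert q Q) \<union> add_mset q ` sieved Q"
  proof (intro equalityI subsetI)
    fix m assume m: "m \<in> sieved Q"
    show "m \<in> sieved (insert q Q) \<union> add_mset q ` sieved Q"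
    proof (cases "q \<in># m")
      case True
      then have "m = add_mset q (m - {#q#})" by simp
      moreover have "m - {#q#} \<in> sieved Q" using m by (auto simp: sieved_def MS_def dest: in_diffD)
      ultimately show ?thesis by blast
    qed (use m in \<open>auto simp: sieved_def\<close>)
  qed (use insert in \<open>auto simp: sieved_def MS_def\<close>)
  have "infsum (cmul g) (sieved (insert q Q) \<union> add_mset q ` sieved Q)
      = infsum (cmul g) (sieved (insert q Q)) + infsum (cmul g) (add_mset q ` sieved Q)"
    by (rule infsum_Un_disjoint)
      (use insert in \<open>auto simp: sieved_def MS_def intro!: sum\<close>)
  then have "infsum (cmul g) (sieved Q) = infsum (cmul g) (sieved (insert q Q)) + infsum (cmul g) (add_mset q ` sieved Q)"
    by (simp only: eq[symmetric])
  also have "infsum (cmul g) (add_mset q ` sieved Q) = infsum (cmul g \<circ> add_mset q) (sieved Q)"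
    by (rule infsum_reindex) (auto simp: inj_on_def)
  also have "\<dots> = g q * infsum (cmul g) (sieved Q)" by (simp add: o_def infsum_cmult_right')
  finally have "infsum (cmul g) (sieved (insert q Q)) = infsum (cmul g) (sieved Q) - g q * infsum (cmul g) (sieved Q)"
    by (metis add_diff_cancel_right')
  then have "infsum (cmul g) (sieved (insert q Q)) = (1 - g q) * infsum (cmul g) (sieved Q)"
    by (simp only: left_diff_distrib mult_1)
  then show ?case using insert by simp
qed

text \<open>On elements coprime to Q the twisted sum is trivially at most the untwisted one.
  Restoring the Euler factors at the finite set Q on both sides and comparing them by
  \<open>euler_factor_le\<close> yields the saving, so neither an infinite product nor a logarithm
  of F is formed.\<close>

lemma norm_euler_le:
  assumes \<epsilon>: "0 < \<epsilon>" "\<epsilon> \<le> 1" and g: "\<And>p. p \<in> P \<Longrightarrow> norm (g p) \<le> real (N p) powr (- (1 + \<epsilon>))"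
    and Q: "finite Q" "Q \<subseteq> P"
  shows "norm (infsum (cmul g) MS) \<le> zeta (1 + \<epsilon>) * exp (- (\<Sum>p\<in>Q. real (N p) powr (- (1 + \<epsilon>)) - Re (g p)) + 4 * C0)"
proof -
  define \<rho> where "\<rho> p = real (N p) powr (- (1 + \<epsilon>))" for p
  define g0 where "g0 p = complex_of_real (\<rho> p)" for p
  have g0: "\<And>p. p \<in> P \<Longrightarrow> norm (g0 p) \<le> real (N p) powr (- (1 + \<epsilon>))" by (simp add: g0_def \<rho>_def)
  have cmul_g0: "cmul g0 m = of_real (real (nm m) powr (- (1 + \<epsilon>)))" for m
    by (induction m) (simp_all add: nm_def g0_def \<rho>_def powr_mult)
  have half: "\<rho> p \<le> 1 / 2" "\<rho> p \<le> real (N p) powr (- 1)" if "p \<in> P" for p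
  proof -
    have N: "real (N p) \<ge> 2" using N_ge_2[OF that] by simp
    show "\<rho> p \<le> real (N p) powr (- 1)" unfolding \<rho>_def using N \<epsilon> by (intro powr_mono) auto
    also have "\<dots> \<le> 1 / 2" using N by (simp add: powr_minus field_simps)
    finally show "\<rho> p \<le> 1 / 2" .
  qed
  have sub: "sieved Q \<subseteq> MS" by (auto simp: sieved_def)
  have s: "(\<lambda>m. real (nm m) powr (- (1 + \<epsilon>))) summable_on X" if "X \<subseteq> MS" for X
    by (rule nm_powr_summable[OF \<epsilon> that])
  have re: "infsum (cmul g0) X = of_real (infsum (\<lambda>m. real (nm m) powr (- (1 + \<epsilon>))) X)" if "X \<subseteq> MS" for X
    unfolding cmul_g0[abs_def] by (intro infsumI has_sum_of_real has_sum_infsum s that)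
  have "complex_of_real (infsum (\<lambda>m. real (nm m) powr (- (1 + \<epsilon>))) (sieved Q))
      = of_real ((\<Prod>p\<in>Q. 1 - \<rho> p) * zeta (1 + \<epsilon>))"
    using infsum_sieved[OF \<epsilon> g0 Q] unfolding re[OF sub] re[OF subset_refl] by (simp add: zeta_def g0_def)
  then have sieve0: "infsum (\<lambda>m. real (nm m) powr (- (1 + \<epsilon>))) (sieved Q) = (\<Prod>p\<in>Q. 1 - \<rho> p) * zeta (1 + \<epsilon>)"
    by (simp only: of_real_eq_iff)
  have "norm (infsum (cmul g) (sieved Q)) \<le> infsum (\<lambda>m. norm (cmul g m)) (sieved Q)"
    by (rule norm_infsum_bound[OF cmul_abs_summable[OF \<epsilon> sub g]])
  also have "\<dots> \<le> infsum (\<lambda>m. real (nm m) powr (- (1 + \<epsilon>))) (sieved Q)"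
    by (rule infsum_mono[OF cmul_abs_summable[OF \<epsilon> sub g] s[OF sub]], assumption)
      (rule norm_cmul_le[OF _ g]; use sub in blast)
  also have "\<dots> = (\<Prod>p\<in>Q. 1 - \<rho> p) * zeta (1 + \<epsilon>)" by (rule sieve0)
  also have "infsum (cmul g) (sieved Q) = (\<Prod>p\<in>Q. 1 - g p) * infsum (cmul g) MS"
    by (rule infsum_sieved[OF \<epsilon> _ Q]) (rule g)
  finally have 1: "(\<Prod>p\<in>Q. norm (1 - g p)) * norm (infsum (cmul g) MS) \<le> (\<Prod>p\<in>Q. 1 - \<rho> p) * zeta (1 + \<epsilon>)"
    by (simp add: norm_mult prod_norm)
  have pos: "(\<Prod>p\<in>Q. norm (1 - g p)) > 0"
  proof (rule prod_pos)
    fix p assume p: "p \<in> Q"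
    then have "norm (g p) \<le> 1 / 2" using g[of p] half[of p] Q by (auto simp: \<rho>_def)
    moreover have "1 - norm (g p) \<le> norm (1 - g p)" using norm_triangle_ineq2[of 1 "g p"] by simp
    ultimately show "norm (1 - g p) > 0" by linarith
  qed
  have "(\<Prod>p\<in>Q. 1 - \<rho> p) \<le> (\<Prod>p\<in>Q. norm (1 - g p) * exp (- (\<rho> p - Re (g p)) + 2 * (\<rho> p)\<^sup>2))"
  proof (rule prod_mono)
    fix p assume "p \<in> Q"
    then have p: "p \<in> P" using Q by auto
    show "0 \<le> 1 - \<rho> p \<and> 1 - \<rho> p \<le> norm (1 - g p) * exp (- (\<rho> p - Re (g p)) + 2 * (\<rho> p)\<^sup>2)"
      using half(1)[OF p] euler_factor_le[OF g[OF p, folded \<rho>_def] half(1)[OF p]] by linarith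
  qed
  also have "\<dots> = (\<Prod>p\<in>Q. norm (1 - g p)) * exp (\<Sum>p\<in>Q. - (\<rho> p - Re (g p)) + 2 * (\<rho> p)\<^sup>2)"
    using Q by (simp add: prod.distrib exp_sum)
  also have "(\<Sum>p\<in>Q. - (\<rho> p - Re (g p)) + 2 * (\<rho> p)\<^sup>2) = - (\<Sum>p\<in>Q. \<rho> p - Re (g p)) + 2 * (\<Sum>p\<in>Q. (\<rho> p)\<^sup>2)"
    by (simp only: sum.distrib sum_negf sum_distrib_left)
  also have "(\<Prod>p\<in>Q. norm (1 - g p)) * exp (- (\<Sum>p\<in>Q. \<rho> p - Re (g p)) + 2 * (\<Sum>p\<in>Q. (\<rho> p)\<^sup>2))
      \<le> (\<Prod>p\<in>Q. norm (1 - g p)) * exp (- (\<Sum>p\<in>Q. \<rho> p - Re (g p)) + 4 * C0)"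
  proof -
    \<comment> \<open>The squares are bounded by the values at s = 2, summed over the single primes
      in Q, so by 2 C0. The factor 2 from \<open>euler_factor_le\<close> makes this 4 C0.\<close>
    have "(\<Sum>p\<in>Q. (\<rho> p)\<^sup>2) \<le> (\<Sum>p\<in>Q. real (nm {#p#}) powr (- (1 + 1)))"
    proof (rule sum_mono)
      fix p assume "p \<in> Q"
      then have p: "p \<in> P" using Q by auto
      have "(\<rho> p)\<^sup>2 \<le> (real (N p) powr (- 1))\<^sup>2" using half[OF p] by (intro power_mono) (auto simp: \<rho>_def)
      also have "\<dots> = real (N p) powr (- 1 + - 1)" by (simp only: power2_eq_square powr_add)
      finally show "(\<rho> p)\<^sup>2 \<le> real (nm {#p#}) powr (- (1 + 1))" by simp
    qed
    also have "\<dots> = (\<Sum>m\<in>(\<lambda>p. {#p#}) ` Q. real (nm m) powr (- (1 + 1)))"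
      by (subst sum.reindex) (auto simp: inj_on_def)
    also have "\<dots> \<le> 2 * C0 / 1" using Q by (intro sum_nm_powr_le) (auto simp: MS_def)
    finally show ?thesis using pos by simp
  qed
  finally have "(\<Prod>p\<in>Q. 1 - \<rho> p) * zeta (1 + \<epsilon>)
      \<le> ((\<Prod>p\<in>Q. norm (1 - g p)) * exp (- (\<Sum>p\<in>Q. \<rho> p - Re (g p)) + 4 * C0)) * zeta (1 + \<epsilon>)"
    by (rule mult_right_mono) (auto simp: zeta_def intro!: infsum_nonneg)
  with 1 have "(\<Prod>p\<in>Q. norm (1 - g p)) * norm (infsum (cmul g) MS)
      \<le> (\<Prod>p\<in>Q. norm (1 - g p)) * (zeta (1 + \<epsilon>) * exp (- (\<Sum>p\<in>Q. \<rho> p - Re (g p)) + 4 * C0))"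
    by (simp add: mult_ac)
  then show ?thesis using pos by (simp add: \<rho>_def)
qed

text \<open>What has to be verified is the condition \<open>small\<close>. A cutoff y with distance
  at least K for all |t| \<le> T is fixed first. For \<epsilon> small in terms of y, the weights N
  p^-(1 + \<epsilon>) on these primes are at least half of 1 / N p, so the saving in the Euler
  product is at least exp(K / 2), uniformly in t.\<close>

lemma halasz_completely_multiplicative:
  assumes g: "\<And>p. p \<in> P \<Longrightarrow> norm (g p) \<le> 1"
    and dist: "\<And>K T. \<exists>y. \<forall>t. \<bar>t\<bar> \<le> T \<longrightarrow>
      (\<Sum>p | p \<in> P \<and> N p \<le> y. (1 - Re (g p * exp (- \<i> * of_real (ln (N p) * t)))) / N p) \<ge> K"
  shows "(\<lambda>n. (\<Sum>m\<in>MSle n. cmul g m) / of_nat n) \<longlonglongrightarrow> 0"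
proof -
  interpret halasz rr "push mmoebius" "push mlam" A B "push (cmul g)" "push (\<lambda>m. cmul g m * of_real (mlam m))"
  proof
    show "norm (push (cmul g) n) \<le> rr n" for n
      unfolding rr_def by (rule norm_push_le) (rule norm_cmul_le_1[OF _ g])
    show "norm (push (\<lambda>m. cmul g m * of_real (mlam m)) n) \<le> push mlam n" for n
    proof (rule norm_push_le)
      fix m assume m: "m \<in> MS"
      have "norm (cmul g m) * mlam m \<le> 1 * mlam m"
        using norm_cmul_le_1[OF m g] mlam_nonneg[OF m] by (intro mult_right_mono) auto
      then show "norm (cmul g m * of_real (mlam m)) \<le> mlam m" using mlam_nonneg[OF m] by (simp add: norm_mult)
    qed
    fix n :: nat assume n: "n > 0"
    have "conv (push (cmul g)) (push (\<lambda>m. cmul g m * of_real (mlam m))) n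
        = conv (push (\<lambda>m. cmul g m * of_real (mlam m))) (push (cmul g)) n" by (rule conv_commute)
    also have "\<dots> = push (mconv (\<lambda>m. cmul g m * of_real (mlam m)) (cmul g)) n" by (rule push_mconv[OF n, symmetric])
    also have "\<dots> = push (\<lambda>m. cmul g m * of_real (ln (nm m))) n"
    proof (rule push_cong)
      fix m assume m: "m \<in> MS"
      have "mconv (\<lambda>m. cmul g m * of_real (mlam m)) (cmul g) m = (\<Sum>d | d \<subseteq># m. cmul g m * of_real (mlam d))"
        unfolding mconv_def
      proof (rule sum.cong[OF refl])
        fix d assume "d \<in> {d. d \<subseteq># m}"
        then have "cmul g m = cmul g d * cmul g (m - d)" by (metis cmul_simps(2) mem_Collect_eq subset_mset.add_diff_inverse)
        then show "cmul g d * of_real (mlam d) * cmul g (m - d) = cmul g m * of_real (mlam d)" by (simp add: mult_ac)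
      qed
      also have "\<dots> = cmul g m * of_real (\<Sum>d | d \<subseteq># m. mlam d)" by (simp add: sum_distrib_left)
      also have "\<dots> = cmul g m * of_real (ln (nm m))" using sum_mlam[OF m] by simp
      finally show "mconv (\<lambda>m. cmul g m * of_real (mlam m)) (cmul g) m = cmul g m * of_real (ln (nm m))" .
    qed
    also have "\<dots> = push (cmul g) n * of_real (ln n)" by (rule push_mult)
    finally show "conv (push (cmul g)) (push (\<lambda>m. cmul g m * of_real (mlam m))) n = push (cmul g) n * of_real (ln n)" .
  next
    fix \<eta> T :: real assume \<eta>: "\<eta> > 0" and T: "T > 0"
    \<comment> \<open>M collects 2 C0 from \<open>zeta_le\<close> and exp (4 C0) from
      \<open>norm_euler_le\<close>. K is then chosen with M exp(-K / 2) = \<eta> / 2; the other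
      \<eta> / 2 is reserved for the truncation.\<close>
    define M where "M = 2 * C0 * exp (4 * C0)"
    have M: "M > 0" using C0_pos by (simp add: M_def)
    define K where "K = 2 * ln (2 * M / \<eta>)"
    have expK: "M * exp (- (K / 2)) = \<eta> / 2" using M \<eta> by (simp add: K_def exp_minus field_simps)
    obtain y where y: "\<And>t. \<bar>t\<bar> \<le> T \<Longrightarrow> (\<Sum>p | p \<in> P \<and> N p \<le> y. (1 - Re (g p * exp (- \<i> * of_real (ln (N p) * t)))) / N p) \<ge> K"
      using dist[of T K] by blast
    define Q where "Q = {p \<in> P. N p \<le> y}"
    have Q: "Q \<subseteq> P" "finite Q"
    proof -
      have "(\<lambda>p. {#p#}) ` Q \<subseteq> MSle y" by (auto simp: Q_def MSle_def MS_def)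
      then have "finite ((\<lambda>p. {#p#}) ` Q)" using finite_MSle finite_subset by blast
      then show "finite Q" by (rule finite_imageD) (auto simp: inj_on_def)
    qed (auto simp: Q_def)
    \<comment> \<open>Adding 2 keeps ln y' positive. For \<epsilon> below ln 2 / ln y' every prime
      of Q satisfies N p powr (-\<epsilon>) \<ge> 1/2.\<close>
    define y' where "y' = real y + 2"
    define e0 where "e0 = min 1 (ln 2 / ln y')"
    have lny: "ln y' > 0" by (simp add: y'_def)
    have e0: "e0 > 0" using lny by (simp add: e0_def)
    show "\<exists>\<epsilon>0>0. \<forall>\<epsilon>. 0 < \<epsilon> \<and> \<epsilon> < \<epsilon>0 \<longrightarrow> (\<exists>Y0. \<forall>Y\<ge>Y0. \<forall>t. \<bar>t\<bar> \<le> T \<longrightarrow> norm (dpoly (push (cmul g)) (1 + \<epsilon>) Y t) \<le> \<eta> / \<epsilon>)"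
    proof (intro exI[of _ e0] conjI e0 allI impI)
      fix \<epsilon> :: real assume "0 < \<epsilon> \<and> \<epsilon> < e0"
      then have \<epsilon>: "0 < \<epsilon>" "\<epsilon> \<le> 1" "\<epsilon> * ln y' \<le> ln 2" using lny by (auto simp: e0_def field_simps)
      \<comment> \<open>A finite set exhausting the majorant up to \<eta> / (2 \<epsilon>) bounds
        the tail of every twisted series beyond \<open>Y0\<close>, whatever t is.\<close>
      have "((\<lambda>m. real (nm m) powr (- (1 + \<epsilon>))) has_sum zeta (1 + \<epsilon>)) MS"
        unfolding zeta_def by (rule has_sum_infsum[OF nm_powr_summable[OF \<epsilon>(1,2) subset_refl]])
      then have "\<forall>\<^sub>F X in finite_subsets_at_top MS. (\<Sum>m\<in>X. real (nm m) powr (- (1 + \<epsilon>))) > zeta (1 + \<epsilon>) - \<eta> / 2 / \<epsilon>"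
        unfolding has_sum_def using \<eta> \<epsilon> by (intro order_tendstoD) auto
      then obtain X where X: "finite X" "X \<subseteq> MS" "(\<Sum>m\<in>X. real (nm m) powr (- (1 + \<epsilon>))) > zeta (1 + \<epsilon>) - \<eta> / 2 / \<epsilon>"
        unfolding eventually_finite_subsets_at_top by blast
      obtain Y0 where Y0: "X \<subseteq> MSle Y0" using finite_subset_MSle X by blast
      show "\<exists>Y0. \<forall>Y\<ge>Y0. \<forall>t. \<bar>t\<bar> \<le> T \<longrightarrow> norm (dpoly (push (cmul g)) (1 + \<epsilon>) Y t) \<le> \<eta> / \<epsilon>"
      proof (intro exI[of _ Y0] allI impI)
        fix Y t assume Y: "Y0 \<le> Y" and t: "\<bar>t\<bar> \<le> T"
        define w where "w k = of_real (real k powr (- (1 + \<epsilon>))) * exp (- \<i> * of_real (ln (real k) * t))" for k :: nat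
        define z where "z p = g p * w (N p)" for p
        have w_mult: "w (a * b) = w a * w b" if "a > 0" "b > 0" for a b
        proof -
          have l: "ln (real (a * b)) = ln (real a) + ln (real b)" using that by (simp add: ln_mult)
          have "exp (- \<i> * of_real (ln (real (a * b)) * t)) = exp (- \<i> * of_real (ln (real a) * t)) * exp (- \<i> * of_real (ln (real b) * t))"
            unfolding l by (simp only: exp_add[symmetric]; simp add: algebra_simps)
          moreover have "real (a * b) powr (- (1 + \<epsilon>)) = real a powr (- (1 + \<epsilon>)) * real b powr (- (1 + \<epsilon>))"
            by (simp add: powr_mult)
          ultimately show ?thesis unfolding w_def by (simp only: of_real_mult mult_ac)
        qed
        have cmul_z: "cmul z m = cmul g m * w (nm m)" if "m \<in> MS" for m
          using that
        proof (induction m)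
          case empty
          then show ?case by (simp add: w_def)
        next
          case (add p m)
          then have "p \<in> P" "m \<in> MS" by (auto simp: MS_def)
          then have "w (N p * nm m) = w (N p) * w (nm m)" using N_ge_2[of p] nm_pos[of m] by (intro w_mult) auto
          then show ?case using add \<open>m \<in> MS\<close> by (simp add: z_def nm_def)
        qed
        have z_le: "norm (z p) \<le> real (N p) powr (- (1 + \<epsilon>))" if "p \<in> P" for p
          using g[OF that] mult_right_mono[OF g[OF that], of "real (N p) powr (- (1 + \<epsilon>))"]
          by (simp add: z_def w_def norm_mult)
        have "dpoly (push (cmul g)) (1 + \<epsilon>) Y t = (\<Sum>k=1..Y. push (cmul g) k * w k)"
          by (simp add: dpoly_def w_def mult.assoc)
        also have "\<dots> = (\<Sum>m\<in>MSle Y. cmul g m * w (nm m))" by (rule sum_push_mult)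
        also have "\<dots> = (\<Sum>m\<in>MSle Y. cmul z m)" by (intro sum.cong) (auto simp: cmul_z MSle_def)
        also have "\<dots> = infsum (cmul z) (MSle Y)" by (simp add: finite_MSle)
        finally have d: "dpoly (push (cmul g)) (1 + \<epsilon>) Y t = infsum (cmul z) (MSle Y)" .
        have sub: "MSle Y \<subseteq> MS" "MS - MSle Y \<subseteq> MS" by (auto simp: MSle_def)
        have un: "MSle Y \<union> (MS - MSle Y) = MS" using sub by auto
        have "infsum (cmul z) (MSle Y \<union> (MS - MSle Y)) = infsum (cmul z) (MSle Y) + infsum (cmul z) (MS - MSle Y)"
          by (rule infsum_Un_disjoint) (auto intro!: abs_summable_summable[OF cmul_abs_summable[OF \<epsilon>(1,2)]] z_le simp: MSle_def)
        then have "dpoly (push (cmul g)) (1 + \<epsilon>) Y t = infsum (cmul z) MS - infsum (cmul z) (MS - MSle Y)" using d un by simp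
        then have 1: "norm (dpoly (push (cmul g)) (1 + \<epsilon>) Y t) \<le> norm (infsum (cmul z) MS) + norm (infsum (cmul z) (MS - MSle Y))"
          using norm_triangle_ineq4 by metis
        have "norm (infsum (cmul z) (MS - MSle Y)) \<le> infsum (\<lambda>m. norm (cmul z m)) (MS - MSle Y)"
          by (rule norm_infsum_bound[OF cmul_abs_summable[OF \<epsilon>(1,2) sub(2) z_le]])
        also have "\<dots> \<le> infsum (\<lambda>m. real (nm m) powr (- (1 + \<epsilon>))) (MS - MSle Y)"
          by (rule infsum_mono[OF cmul_abs_summable[OF \<epsilon>(1,2) sub(2) z_le] nm_powr_summable[OF \<epsilon>(1,2) sub(2)]], assumption)
             (rule norm_cmul_le[OF _ z_le]; use sub in blast)
        also have "infsum (\<lambda>m. real (nm m) powr (- (1 + \<epsilon>))) (MSle Y \<union> (MS - MSle Y))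
            = infsum (\<lambda>m. real (nm m) powr (- (1 + \<epsilon>))) (MSle Y) + infsum (\<lambda>m. real (nm m) powr (- (1 + \<epsilon>))) (MS - MSle Y)"
          by (rule infsum_Un_disjoint[OF nm_powr_summable[OF \<epsilon>(1,2) sub(1)] nm_powr_summable[OF \<epsilon>(1,2) sub(2)]]) auto
        then have "infsum (\<lambda>m. real (nm m) powr (- (1 + \<epsilon>))) (MS - MSle Y) = zeta (1 + \<epsilon>) - (\<Sum>m\<in>MSle Y. real (nm m) powr (- (1 + \<epsilon>)))"
          using un finite_MSle[of Y] by (simp add: zeta_def)
        also have "\<dots> \<le> \<eta> / 2 / \<epsilon>"
        proof -
          have "X \<subseteq> MSle Y" using Y0 Y by (auto simp: MSle_def)
          then have "(\<Sum>m\<in>X. real (nm m) powr (- (1 + \<epsilon>))) \<le> (\<Sum>m\<in>MSle Y. real (nm m) powr (- (1 + \<epsilon>)))"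
            by (intro sum_mono2 finite_MSle) auto
          then show ?thesis using X(3) by linarith
        qed
        finally have 2: "norm (infsum (cmul z) (MS - MSle Y)) \<le> \<eta> / 2 / \<epsilon>" .
        have "K / 2 \<le> (\<Sum>p\<in>Q. real (N p) powr (- (1 + \<epsilon>)) - Re (z p))"
        proof -
          have "K \<le> (\<Sum>p\<in>Q. (1 - Re (g p * exp (- \<i> * of_real (ln (N p) * t)))) / N p)" using y[OF t] by (simp add: Q_def)
          also have "\<dots> \<le> (\<Sum>p\<in>Q. 2 * (real (N p) powr (- (1 + \<epsilon>)) - Re (z p)))"
          proof (rule sum_mono)
            fix p assume "p \<in> Q"
            then have p: "p \<in> P" "real (N p) \<le> y'" "real (N p) \<ge> 2" using N_ge_2[of p] by (auto simp: Q_def y'_def)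
            define u where "u = g p * exp (- \<i> * of_real (ln (N p) * t))"
            have "norm u \<le> 1" using g[OF p(1)] by (simp add: u_def norm_mult)
            then have u: "Re u \<le> 1" using complex_Re_le_cmod[of u] by linarith
            have "\<epsilon> * ln (real (N p)) \<le> \<epsilon> * ln y'" using p \<epsilon> by (intro mult_left_mono) auto
            then have "\<epsilon> * ln (real (N p)) \<le> ln 2" using \<epsilon>(3) by linarith
            then have "exp (- ln 2) \<le> exp (- \<epsilon> * ln (real (N p)))" by simp
            then have h: "1 / 2 \<le> real (N p) powr (- \<epsilon>)" using p by (simp add: powr_def exp_minus)
            have "real (N p) powr (- (1 + \<epsilon>)) = real (N p) powr (- 1 + - \<epsilon>)" by simp
            also have "\<dots> = real (N p) powr (- 1) * real (N p) powr (- \<epsilon>)" by (rule powr_add)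
            finally have np: "real (N p) powr (- (1 + \<epsilon>)) = real (N p) powr (- \<epsilon>) / N p" using p by (simp add: powr_minus field_simps)
            have "z p = of_real (real (N p) powr (- (1 + \<epsilon>))) * u" by (simp add: z_def w_def u_def mult_ac)
            then have "Re (z p) = real (N p) powr (- (1 + \<epsilon>)) * Re u" by simp
            then have "real (N p) powr (- (1 + \<epsilon>)) - Re (z p) = real (N p) powr (- (1 + \<epsilon>)) * (1 - Re u)" by (simp add: algebra_simps)
            also have "\<dots> = real (N p) powr (- \<epsilon>) * ((1 - Re u) / N p)" unfolding np by simp
            also have "\<dots> \<ge> 1 / 2 * ((1 - Re u) / N p)" using h u p by (intro mult_right_mono) auto
            finally show "(1 - Re (g p * exp (- \<i> * of_real (ln (N p) * t)))) / N p \<le> 2 * (real (N p) powr (- (1 + \<epsilon>)) - Re (z p))"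
              by (simp add: u_def)
          qed
          also have "\<dots> = 2 * (\<Sum>p\<in>Q. real (N p) powr (- (1 + \<epsilon>)) - Re (z p))" by (simp only: sum_distrib_left)
          finally show ?thesis by simp
        qed
        then have "exp (- (\<Sum>p\<in>Q. real (N p) powr (- (1 + \<epsilon>)) - Re (z p)) + 4 * C0) \<le> exp (- (K / 2) + 4 * C0)" by simp
        then have "zeta (1 + \<epsilon>) * exp (- (\<Sum>p\<in>Q. real (N p) powr (- (1 + \<epsilon>)) - Re (z p)) + 4 * C0) \<le> (2 * C0 / \<epsilon>) * exp (- (K / 2) + 4 * C0)"
          using zeta_le[OF \<epsilon>(1,2)] C0_pos \<epsilon> by (intro mult_mono) auto
        also have "\<dots> = (M * exp (- (K / 2))) / \<epsilon>" unfolding M_def exp_add by simp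
        also have "\<dots> = \<eta> / 2 / \<epsilon>" by (simp add: expK)
        finally have e: "zeta (1 + \<epsilon>) * exp (- (\<Sum>p\<in>Q. real (N p) powr (- (1 + \<epsilon>)) - Re (z p)) + 4 * C0) \<le> \<eta> / 2 / \<epsilon>" .
        have "norm (infsum (cmul z) MS) \<le> zeta (1 + \<epsilon>) * exp (- (\<Sum>p\<in>Q. real (N p) powr (- (1 + \<epsilon>)) - Re (z p)) + 4 * C0)"
          by (rule norm_euler_le[OF \<epsilon>(1,2) _ Q(2,1)]) (rule z_le)
        from this e have "norm (infsum (cmul z) MS) \<le> \<eta> / 2 / \<epsilon>" by (rule order_trans)
        then have "norm (dpoly (push (cmul g)) (1 + \<epsilon>) Y t) \<le> \<eta> / 2 / \<epsilon> + \<eta> / 2 / \<epsilon>" using 1 2 by linarith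
        then show "norm (dpoly (push (cmul g)) (1 + \<epsilon>) Y t) \<le> \<eta> / \<epsilon>" by (simp add: field_simps)
      qed
    qed
  qed
  show ?thesis using mean_value_zero unfolding S_def sum_push .
qed

end

section \<open>From completely multiplicative to multiplicative functions\<close>

lemma dominated_convolution_small:
  fixes h c :: "nat \<Rightarrow> complex" and C D :: real
  defines "S \<equiv> \<lambda>n. \<Sum>k=1..n. c k"
  assumes h: "\<And>n. (\<Sum>k=1..n. norm (h k) / k) \<le> D"
    and S: "\<And>n. norm (S n) \<le> C * n" and C: "C > 0" and lim: "(\<lambda>n. S n / of_nat n) \<longlonglongrightarrow> 0"
  shows "(\<lambda>n. (\<Sum>k=1..n. conv h c k) / of_nat n) \<longlonglongrightarrow> 0"
proof (rule LIMSEQ_I)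
  fix e :: real assume e: "e > 0"
  define a where "a k = norm (h (Suc k)) / Suc k" for k
  have a_nonneg: "a k \<ge> 0" for k by (simp add: a_def)
  have a_sum: "(\<Sum>k<n. a k) = (\<Sum>k=1..n. norm (h k) / k)" for n
    unfolding a_def by (rule sum.reindex_bij_witness[where i = "\<lambda>k. k - 1" and j = Suc]) auto
  have "summable a"
    by (rule summableI_nonneg_bounded[OF a_nonneg]) (use h a_sum in simp)
  then have "\<exists>K. \<forall>m\<ge>K. \<forall>n. norm (sum a {m..<n}) < e / (2 * C)"
    using e C by (subst (asm) summable_Cauchy) simp
  then obtain K where K: "\<And>n. norm (sum a {K..<n}) < e / (2 * C)" by blast
  define D' where "D' = \<bar>D\<bar> + 1"
  have D': "D' > 0" "D \<le> D'" by (auto simp: D'_def)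
  define \<kappa> where "\<kappa> = e / (2 * D')"
  have \<kappa>: "\<kappa> > 0" using e D' by (simp add: \<kappa>_def)
  obtain J where J: "\<And>n. n \<ge> J \<Longrightarrow> norm (S n / of_nat n - 0) < \<kappa>"
    using LIMSEQ_D[OF lim \<kappa>] by blast
  have SJ: "norm (S n) \<le> \<kappa> * n" if "n \<ge> J" for n
  proof (cases "n = 0")
    case False
    have "norm (S n) / n < \<kappa>" using J[OF that] by (simp add: norm_divide)
    then show ?thesis using False by (simp add: field_simps)
  qed (simp add: S_def)
  \<comment> \<open>The sum equals the sum of h k S(n div k). For k \<le> K the size of n forces n
    div k \<ge> J, where S is small relative to its argument; for k > K the trivial bound on S meets
    the small tail of the series of |h k| / k.\<close>
  have "norm ((\<Sum>k=1..n. conv h c k) / of_nat n - 0) < e" if n: "n \<ge> max 1 (Suc J * Suc K)" for n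
  proof -
    have n1: "n \<ge> 1" "Suc J * Suc K \<le> n" using n by auto
    have Kn: "K \<le> n"
    proof -
      have "1 * K \<le> Suc J * Suc K" by (intro mult_le_mono) auto
      then show ?thesis using n1 by simp
    qed
    have "norm (\<Sum>k=1..n. conv h c k) = norm (\<Sum>k=1..n. h k * S (n div k))" unfolding S_def by (subst sum_conv) simp
    also have "\<dots> \<le> (\<Sum>k=1..n. (if k \<le> K then \<kappa> else C) * n * (norm (h k) / k))"
    proof (rule sum_norm_le)
      fix k assume k: "k \<in> {1..n}"
      have dk: "real (n div k) \<le> n / k" by (rule of_nat_div_le_of_nat)
      have "norm (S (n div k)) \<le> (if k \<le> K then \<kappa> else C) * (n / k)"
      proof (cases "k \<le> K")
        case True
        have "J * k \<le> Suc J * Suc K" using True by (intro mult_le_mono) auto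
        then have "J * k \<le> n" using n1 by simp
        then have "J \<le> n div k" using k by (simp add: less_eq_div_iff_mult_less_eq)
        then have "norm (S (n div k)) \<le> \<kappa> * real (n div k)" by (rule SJ)
        also have "\<dots> \<le> \<kappa> * (n / k)" using dk \<kappa> by (intro mult_left_mono) auto
        finally show ?thesis using True by simp
      next
        case False
        have "norm (S (n div k)) \<le> C * real (n div k)" by (rule S)
        also have "\<dots> \<le> C * (n / k)" using dk C by (intro mult_left_mono) auto
        finally show ?thesis using False by simp
      qed
      then have "norm (h k) * norm (S (n div k)) \<le> norm (h k) * ((if k \<le> K then \<kappa> else C) * (n / k))"
        by (intro mult_left_mono) auto
      then show "norm (h k * S (n div k)) \<le> (if k \<le> K then \<kappa> else C) * n * (norm (h k) / k)"
        by (simp add: norm_mult mult_ac)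
    qed
    also have "\<dots> = real n * (\<Sum>k=1..n. (if k \<le> K then \<kappa> else C) * (norm (h k) / k))"
      by (simp add: sum_distrib_left mult_ac)
    also have "(\<Sum>k=1..n. (if k \<le> K then \<kappa> else C) * (norm (h k) / k)) = (\<Sum>k<n. (if k < K then \<kappa> else C) * a k)"
      unfolding a_def by (rule sum.reindex_bij_witness[where j = "\<lambda>k. k - 1" and i = Suc]) auto
    also have "\<dots> = (\<Sum>k<K. (if k < K then \<kappa> else C) * a k) + (\<Sum>k=K..<n. (if k < K then \<kappa> else C) * a k)"
      using Kn by (simp only: lessThan_atLeast0 sum.atLeastLessThan_concat)
    also have "\<dots> = \<kappa> * (\<Sum>k<K. a k) + C * (\<Sum>k=K..<n. a k)" by (simp add: sum_distrib_left)
    also have "\<dots> < \<kappa> * D' + C * (e / (2 * C))"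
    proof (rule add_le_less_mono)
      show "\<kappa> * (\<Sum>k<K. a k) \<le> \<kappa> * D'"
        unfolding a_sum using h[of K] D' \<kappa> by (intro mult_left_mono) auto
      show "C * (\<Sum>k=K..<n. a k) < C * (e / (2 * C))" using K[of n] C by (intro mult_strict_left_mono) auto
    qed
    also have "\<dots> = e" using C D' by (simp add: \<kappa>_def field_simps)
    finally have "norm (\<Sum>k=1..n. conv h c k) < real n * e" using n1 by simp
    then show ?thesis using n1 by (simp add: norm_divide field_simps)
  qed
  then show "\<exists>no. \<forall>n\<ge>no. norm ((\<Sum>k=1..n. conv h c k) / of_nat n - 0) < e" by blast
qed

text \<open>A geometric series of ratio at most 1/2 without its linear term. The induction keeps the
  remainder 4 / n^(K + 2), which decreases by at least 2 / n^(K + 2) in each step because n \<ge>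
  2.\<close>

lemma powerful_sum_le:
  assumes "n \<ge> (2::nat)"
  shows "(\<Sum>j\<le>K. if j = 0 then 1 else if j \<ge> 2 then 2 / real n ^ j else 0) \<le> 1 + 4 / (real n)\<^sup>2"
proof -
  have "(\<Sum>j\<le>Suc K. if j = 0 then 1 else if j \<ge> 2 then 2 / real n ^ j else 0) \<le> 1 + 4 / (real n)\<^sup>2 - 4 / real n ^ (Suc (Suc K))" for K
  proof (induction K)
    case (Suc K)
    have "4 / real n ^ (Suc (Suc (Suc K))) = (4 / real n) / real n ^ (Suc (Suc K))" by simp
    also have "\<dots> \<le> 2 / real n ^ (Suc (Suc K))" using assms by (intro divide_right_mono) (auto simp: field_simps)
    finally have 1: "4 / real n ^ (Suc (Suc (Suc K))) \<le> 2 / real n ^ (Suc (Suc K))" .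
    have "4 / real n ^ (Suc (Suc K)) = 2 / real n ^ (Suc (Suc K)) + 2 / real n ^ (Suc (Suc K))" by simp
    moreover have "(\<Sum>j\<le>Suc (Suc K). if j = 0 then 1 else if j \<ge> 2 then 2 / real n ^ j else 0)
        = (\<Sum>j\<le>Suc K. if j = 0 then 1 else if j \<ge> 2 then 2 / real n ^ j else 0) + 2 / real n ^ (Suc (Suc K))"
      by (subst sum.atMost_Suc) simp
    ultimately show ?case using Suc 1 by linarith
  qed (simp add: power2_eq_square)
  from this[of K] have "(\<Sum>j\<le>Suc K. if j = 0 then 1 else if j \<ge> 2 then 2 / real n ^ j else 0) \<le> 1 + 4 / (real n)\<^sup>2"
  proof -
    have "0 \<le> 4 / real n ^ Suc (Suc K)" by simp
    then show ?thesis using \<open>_ \<le> 1 + 4 / (real n)\<^sup>2 - 4 / real n ^ (Suc (Suc K))\<close> by linarith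
  qed
  moreover have "(\<Sum>j\<le>K. if j = 0 then 1 else if j \<ge> 2 then 2 / real n ^ j else 0)
      \<le> (\<Sum>j\<le>Suc K. if j = 0 then 1 else if j \<ge> 2 then 2 / real n ^ j else (0::real))"
    by (rule sum_mono2) auto
  ultimately show ?thesis by linarith
qed

context normed_primes
begin

lemma prod_extend:
  assumes "p \<notin># d"
  shows "(\<Prod>q\<in>set_mset (d + replicate_mset j p). u q (count (d + replicate_mset j p) q))
    = (\<Prod>q\<in>set_mset d. u q (count d q)) * (if j = 0 then 1 else u p j :: 'a::comm_monoid_mult)"
proof (cases "j = 0")
  case False
  then have s: "set_mset (d + replicate_mset j p) = insert p (set_mset d)" by auto
  have "count d p = 0" using assms by (simp add: count_eq_zero_iff)
  then have "(\<Prod>q\<in>insert p (set_mset d). u q (count (d + replicate_mset j p) q))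
      = u p j * (\<Prod>q\<in>set_mset d. u q (count (d + replicate_mset j p) q))"
    using assms by simp
  also have "(\<Prod>q\<in>set_mset d. u q (count (d + replicate_mset j p) q)) = (\<Prod>q\<in>set_mset d. u q (count d q))"
    using assms by (intro prod.cong) auto
  finally show ?thesis using False unfolding s by (simp add: mult.commute)
qed simp

text \<open>The coefficient of x^j, for j \<ge> 1, in the local series of f multiplied by 1 - f(p)
  x. It vanishes at j = 1 when f is 1 at the empty multiset. The value at j = 0 is an artefact of
  natural subtraction; \<open>hfun\<close> evaluates only positive multiplicities.\<close>

definition hfac :: "('p multiset \<Rightarrow> complex) \<Rightarrow> 'p \<Rightarrow> nat \<Rightarrow> complex" where
  "hfac f p j = f (replicate_mset j p) - f {#p#} * f (replicate_mset (j - 1) p)"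

definition hfun :: "('p multiset \<Rightarrow> complex) \<Rightarrow> 'p multiset \<Rightarrow> complex" where
  "hfun f m = (\<Prod>p\<in>set_mset m. hfac f p (count m p))"

text \<open>At one prime the sum of hfac j f(p)^(k - j), with 1 at j = 0, telescopes to f(p^k). Both
  sides then split along coprime prime powers.\<close>

lemma multiplicative_eq_mconv:
  assumes f1: "f {#} = 1"
    and f: "\<And>a b. a \<in> MS \<Longrightarrow> b \<in> MS \<Longrightarrow> set_mset a \<inter> set_mset b = {} \<Longrightarrow> f (a + b) = f a * f b"
    and "m \<in> MS"
  shows "mconv (hfun f) (cmul (\<lambda>p. f {#p#})) m = f m"
  using assms(3)
proof (induction m rule: multiset_prime_power_induct)
  case empty
  then show ?case by (simp add: mconv_def hfun_def f1)
next
  case (step m p k)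
  let ?g = "\<lambda>p. f {#p#}"
  have tel: "(\<Sum>j\<le>k. (if j = 0 then 1 else hfac f p j) * ?g p ^ (k - j)) = f (replicate_mset k p)" for k
  proof (induction k)
    case (Suc k)
    have "(\<Sum>j\<le>Suc k. (if j = 0 then 1 else hfac f p j) * ?g p ^ (Suc k - j))
        = (\<Sum>j\<le>k. (if j = 0 then 1 else hfac f p j) * ?g p ^ (Suc k - j)) + hfac f p (Suc k)" by simp
    also have "(\<Sum>j\<le>k. (if j = 0 then 1 else hfac f p j) * ?g p ^ (Suc k - j))
        = (\<Sum>j\<le>k. ?g p * ((if j = 0 then 1 else hfac f p j) * ?g p ^ (k - j)))"
      by (intro sum.cong refl) (simp add: Suc_diff_le)
    also have "\<dots> = ?g p * f (replicate_mset k p)" by (simp only: sum_distrib_left[symmetric] Suc)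
    finally show ?case by (simp add: hfac_def)
  qed (simp add: f1)
  have "mconv (hfun f) (cmul ?g) (m + replicate_mset k p)
      = (\<Sum>d | d \<subseteq># m. \<Sum>j\<le>k. hfun f (d + replicate_mset j p) * cmul ?g (m + replicate_mset k p - (d + replicate_mset j p)))"
    unfolding mconv_def by (rule sum_sub_extend[OF step(2)])
  also have "\<dots> = (\<Sum>d | d \<subseteq># m. \<Sum>j\<le>k. (hfun f d * cmul ?g (m - d)) * ((if j = 0 then 1 else hfac f p j) * ?g p ^ (k - j)))"
  proof (intro sum.cong refl)
    fix d j assume d: "d \<in> {d. d \<subseteq># m}" and j: "j \<in> {..k}"
    have pd: "p \<notin># d" using d step(2) by (auto dest: mset_subset_eqD)
    have "m + replicate_mset k p - (d + replicate_mset j p) = (m - d) + replicate_mset (k - j) p"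
      using d j by (intro multiset_eqI) (auto simp: subseteq_mset_def)
    moreover have "hfun f (d + replicate_mset j p) = hfun f d * (if j = 0 then 1 else hfac f p j)"
      unfolding hfun_def by (rule prod_extend[OF pd])
    ultimately show "hfun f (d + replicate_mset j p) * cmul ?g (m + replicate_mset k p - (d + replicate_mset j p))
        = (hfun f d * cmul ?g (m - d)) * ((if j = 0 then 1 else hfac f p j) * ?g p ^ (k - j))"
      by (simp add: mult_ac)
  qed
  also have "\<dots> = mconv (hfun f) (cmul ?g) m * f (replicate_mset k p)"
    by (simp only: sum_product[symmetric] tel mconv_def)
  also have "\<dots> = f m * f (replicate_mset k p)" using step by (simp add: MS_add)
  also have "\<dots> = f (m + replicate_mset k p)" using step by (intro f[symmetric]) (auto simp: MS_add)
  finally show ?case .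
qed

text \<open>A majorant of |hfac| / N p^j: a difference of two terms of modulus at most 1 is at most
  2, and the entry at j = 1 is zero.\<close>

definition upow :: "'p \<Rightarrow> nat \<Rightarrow> real" where
  "upow p j = (if j \<ge> 2 then 2 / real (N p) ^ j else 0)"

text \<open>A box in which the exponents at different primes vary independently, so that the sum
  over it factors as a finite Euler product. The multisets of bounded norm are enclosed in such a
  box.\<close>

definition bounded_ms :: "'p set \<Rightarrow> nat \<Rightarrow> 'p multiset set" where
  "bounded_ms X K = {m. set_mset m \<subseteq> X \<and> (\<forall>p. count m p \<le> K)}"

lemma sum_bounded_ms:
  assumes "finite X" "X \<subseteq> P"
  shows "finite (bounded_ms X K) \<and> (\<Sum>m\<in>bounded_ms X K. \<Prod>p\<in>set_mset m. upow p (count m p)) \<le> (\<Prod>p\<in>X. 1 + 4 / (real (N p))\<^sup>2)"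
  using assms
proof (induction X)
  case empty
  have "bounded_ms {} K = {{#}}" by (auto simp: bounded_ms_def)
  then show ?case by simp
next
  case (insert x X)
  have IH: "finite (bounded_ms X K)" "(\<Sum>m\<in>bounded_ms X K. \<Prod>p\<in>set_mset m. upow p (count m p)) \<le> (\<Prod>p\<in>X. 1 + 4 / (real (N p))\<^sup>2)"
    using insert by auto
  have x0: "count m x = 0" "x \<notin># m" if "m \<in> bounded_ms X K" for m
    using that insert by (auto simp: bounded_ms_def count_eq_zero_iff)
  have img: "bounded_ms (insert x X) K = (\<lambda>(d, j). d + replicate_mset j x) ` (bounded_ms X K \<times> {..K})"
  proof (intro equalityI subsetI)
    fix m assume m: "m \<in> bounded_ms (insert x X) K"
    have "m = filter_mset (\<lambda>y. y \<noteq> x) m + replicate_mset (count m x) x" by (rule multiset_eqI) auto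
    moreover have "filter_mset (\<lambda>y. y \<noteq> x) m \<in> bounded_ms X K" "count m x \<le> K"
      using m by (auto simp: bounded_ms_def)
    ultimately show "m \<in> (\<lambda>(d, j). d + replicate_mset j x) ` (bounded_ms X K \<times> {..K})"
      by (intro image_eqI[of _ _ "(filter_mset (\<lambda>y. y \<noteq> x) m, count m x)"]) auto
  next
    fix m assume "m \<in> (\<lambda>(d, j). d + replicate_mset j x) ` (bounded_ms X K \<times> {..K})"
    then obtain d j where d: "m = d + replicate_mset j x" "d \<in> bounded_ms X K" "j \<le> K" by auto
    have "count m p \<le> K" for p using d x0(1)[OF d(2)] by (cases "p = x") (auto simp: bounded_ms_def)
    then show "m \<in> bounded_ms (insert x X) K" using d by (auto simp: bounded_ms_def split: if_splits)
  qed
  have inj: "inj_on (\<lambda>(d, j). d + replicate_mset j x) (bounded_ms X K \<times> {..K})"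
  proof (rule inj_onI)
    fix a b assume "a \<in> bounded_ms X K \<times> {..K}" "b \<in> bounded_ms X K \<times> {..K}"
      "(case a of (d, j) \<Rightarrow> d + replicate_mset j x) = (case b of (d, j) \<Rightarrow> d + replicate_mset j x)"
    then obtain d j d' j' where ab: "a = (d, j)" "b = (d', j')" "d \<in> bounded_ms X K" "d' \<in> bounded_ms X K"
      and eq: "d + replicate_mset j x = d' + replicate_mset j' x" by auto
    have "j = j'" using arg_cong[OF eq, of "\<lambda>z. count z x"] x0(1)[OF ab(3)] x0(1)[OF ab(4)] by simp
    then show "a = b" using eq ab by simp
  qed
  have "(\<Sum>m\<in>bounded_ms (insert x X) K. \<Prod>p\<in>set_mset m. upow p (count m p))
      = (\<Sum>(d, j)\<in>bounded_ms X K \<times> {..K}. \<Prod>p\<in>set_mset (d + replicate_mset j x). upow p (count (d + replicate_mset j x) p))"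
    unfolding img by (subst sum.reindex[OF inj]) (simp add: case_prod_beta)
  also have "\<dots> = (\<Sum>(d, j)\<in>bounded_ms X K \<times> {..K}. (\<Prod>p\<in>set_mset d. upow p (count d p)) * (if j = 0 then 1 else upow x j))"
  proof (rule sum.cong[OF refl])
    fix a assume "a \<in> bounded_ms X K \<times> {..K}"
    then obtain d j where a: "a = (d, j)" "d \<in> bounded_ms X K" by auto
    show "(case a of (d, j) \<Rightarrow> \<Prod>p\<in>set_mset (d + replicate_mset j x). upow p (count (d + replicate_mset j x) p))
        = (case a of (d, j) \<Rightarrow> (\<Prod>p\<in>set_mset d. upow p (count d p)) * (if j = 0 then 1 else upow x j))"
      unfolding a split_conv by (rule prod_extend[OF x0(2)[OF a(2)]])
  qed
  also have "\<dots> = (\<Sum>d\<in>bounded_ms X K. \<Prod>p\<in>set_mset d. upow p (count d p)) * (\<Sum>j\<le>K. if j = 0 then 1 else upow x j)"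
    by (simp only: sum.cartesian_product[symmetric] sum_product)
  also have "\<dots> \<le> (\<Prod>p\<in>X. 1 + 4 / (real (N p))\<^sup>2) * (1 + 4 / (real (N x))\<^sup>2)"
  proof (rule mult_mono)
    show "(\<Sum>j\<le>K. if j = 0 then 1 else upow x j) \<le> 1 + 4 / (real (N x))\<^sup>2"
      unfolding upow_def using insert N_ge_2 by (intro powerful_sum_le) auto
  qed (use IH in \<open>auto intro!: prod_nonneg sum_nonneg simp: upow_def\<close>)
  finally show ?case using insert IH img by (simp add: mult.commute)
qed

lemma hfun_le:
  assumes "m \<in> MS" and f1: "f {#} = 1" and f_le: "\<And>m. m \<in> MS \<Longrightarrow> norm (f m) \<le> 1"
  shows "norm (hfun f m) / nm m \<le> (\<Prod>p\<in>set_mset m. upow p (count m p))"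
proof -
  have "real (nm m) = (\<Prod>p\<in>set_mset m. real (N p) ^ count m p)"
  proof (induction m rule: multiset_prime_power_induct)
    case (step m p k)
    then show ?case
      unfolding prod_extend[OF step(2), where u = "\<lambda>q j. real (N q) ^ j"] by simp
  qed simp
  then have "norm (hfun f m) / nm m = (\<Prod>p\<in>set_mset m. norm (hfac f p (count m p)) / real (N p) ^ count m p)"
    by (simp add: hfun_def prod_norm[symmetric] prod_dividef)
  also have "\<dots> \<le> (\<Prod>p\<in>set_mset m. upow p (count m p))"
  proof (rule prod_mono)
    fix p assume p: "p \<in> set_mset m"
    then have pP: "p \<in> P" using assms by (auto simp: MS_def)
    have c: "count m p \<ge> 1" using p by (simp add: Suc_le_eq)
    have le: "norm (f (replicate_mset j p)) \<le> 1" "norm (f {#p#}) \<le> 1" for j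
      using pP by (auto intro!: f_le simp: MS_def)
    have "norm (hfac f p (count m p)) \<le> (if count m p \<ge> 2 then 2 else 0)"
    proof (cases "count m p = 1")
      case True
      then show ?thesis by (simp add: hfac_def f1)
    next
      case False
      have "norm (hfac f p (count m p)) \<le> norm (f (replicate_mset (count m p) p)) + norm (f {#p#}) * norm (f (replicate_mset (count m p - 1) p))"
        unfolding hfac_def by (rule order_trans[OF norm_triangle_ineq4]) (simp add: norm_mult)
      also have "\<dots> \<le> 1 + 1 * 1" using le by (intro add_mono mult_mono) auto
      moreover have "count m p \<ge> 2" using False c by linarith
      ultimately show ?thesis by simp
    qed
    then have "norm (hfac f p (count m p)) / real (N p) ^ count m p \<le> (if count m p \<ge> 2 then 2 else 0) / real (N p) ^ count m p"
      by (intro divide_right_mono) auto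
    then show "0 \<le> norm (hfac f p (count m p)) / real (N p) ^ count m p
        \<and> norm (hfac f p (count m p)) / real (N p) ^ count m p \<le> upow p (count m p)"
      by (auto simp: upow_def)
  qed
  finally show ?thesis .
qed

text \<open>\<open>hfun\<close> lives on elements in which every prime occurs at least twice, so its
  weighted sum is majorised by a product of 1 + 4 / N p^2. The exponent 8 C0 is 4 times the bound 2
  C0 for the sum of N p^-2.\<close>

lemma sum_hfun_le:
  assumes f1: "f {#} = 1" and f_le: "\<And>m. m \<in> MS \<Longrightarrow> norm (f m) \<le> 1"
  shows "(\<Sum>k=1..n. norm (push (hfun f) k) / k) \<le> exp (8 * C0)"
proof -
  have "(\<Sum>k=1..n. norm (push (hfun f) k) / k) \<le> (\<Sum>k=1..n. push (\<lambda>m. norm (hfun f m)) k * (1 / k))"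
    by (rule sum_mono) (auto intro!: divide_right_mono norm_push_le)
  also have "\<dots> = (\<Sum>m\<in>MSle n. norm (hfun f m) * (1 / nm m))" by (rule sum_push_mult)
  also have "\<dots> \<le> (\<Sum>m\<in>MSle n. \<Prod>p\<in>set_mset m. upow p (count m p))"
  proof (rule sum_mono)
    fix m assume "m \<in> MSle n"
    then have "m \<in> MS" by (simp add: MSle_def)
    then show "norm (hfun f m) * (1 / nm m) \<le> (\<Prod>p\<in>set_mset m. upow p (count m p))"
      using hfun_le[of m f] f1 f_le by simp
  qed
  also have "\<dots> \<le> exp (8 * C0)"
  proof -
    define X where "X = (\<Union>m\<in>MSle n. set_mset m)"
    define K where "K = (\<Sum>m\<in>MSle n. size m)"
    have X: "finite X" "X \<subseteq> P" using finite_MSle by (auto simp: X_def MSle_def MS_def)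
    have sub: "MSle n \<subseteq> bounded_ms X K"
    proof
      fix m assume m: "m \<in> MSle n"
      have "count m p \<le> K" for p
      proof -
        have "count m p \<le> size m" by (rule count_le_size)
        also have "\<dots> \<le> K" unfolding K_def by (rule member_le_sum[OF m _ finite_MSle]) simp
        finally show ?thesis .
      qed
      then show "m \<in> bounded_ms X K" using m by (auto simp: bounded_ms_def X_def)
    qed
    have "(\<Sum>m\<in>MSle n. \<Prod>p\<in>set_mset m. upow p (count m p)) \<le> (\<Sum>m\<in>bounded_ms X K. \<Prod>p\<in>set_mset m. upow p (count m p))"
      using sum_bounded_ms[OF X] sub by (intro sum_mono2) (auto intro!: prod_nonneg simp: upow_def)
    also have "\<dots> \<le> (\<Prod>p\<in>X. 1 + 4 / (real (N p))\<^sup>2)" using sum_bounded_ms[OF X] by blast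
    also have "\<dots> \<le> (\<Prod>p\<in>X. exp (4 / (real (N p))\<^sup>2))" by (rule prod_mono) (auto intro!: exp_ge_add_one_self add_nonneg_nonneg)
    also have "\<dots> = exp (4 * (\<Sum>p\<in>X. real (nm {#p#}) powr (- (1 + 1))))"
      unfolding exp_sum[OF X(1), symmetric] sum_distrib_left
      by (intro arg_cong[where f = exp] sum.cong refl) (simp add: powr_minus powr_numeral divide_inverse)
    also have "(\<Sum>p\<in>X. real (nm {#p#}) powr (- (1 + 1))) = (\<Sum>m\<in>(\<lambda>p. {#p#}) ` X. real (nm m) powr (- (1 + 1)))"
      by (subst sum.reindex) (auto simp: inj_on_def)
    also have "exp (4 * \<dots>) \<le> exp (4 * (2 * C0 / 1))"
    proof -
      have "(\<Sum>m\<in>(\<lambda>p. {#p#}) ` X. real (nm m) powr (- (1 + 1))) \<le> 2 * C0 / 1"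
        using X by (intro sum_nm_powr_le) (auto simp: MS_def)
      then show ?thesis by simp
    qed
    finally show ?thesis by simp
  qed
  finally show ?thesis .
qed

text \<open>The distance involves values at primes only, and there f agrees with its completely
  multiplicative companion. The companion therefore satisfies the same hypothesis, and the factor
  \<open>hfun f\<close> is harmless.\<close>

theorem halasz_multiplicative:
  assumes f1: "f {#} = 1"
    and f: "\<And>a b. a \<in> MS \<Longrightarrow> b \<in> MS \<Longrightarrow> set_mset a \<inter> set_mset b = {} \<Longrightarrow> f (a + b) = f a * f b"
    and f_le: "\<And>m. m \<in> MS \<Longrightarrow> norm (f m) \<le> 1"
    and dist: "\<And>K T. \<exists>y. \<forall>t. \<bar>t\<bar> \<le> T \<longrightarrow>
      (\<Sum>p | p \<in> P \<and> N p \<le> y. (1 - Re (f {#p#} * exp (- \<i> * of_real (ln (N p) * t)))) / N p) \<ge> K"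
  shows "(\<lambda>n. (\<Sum>m\<in>MSle n. f m) / of_nat n) \<longlonglongrightarrow> 0"
proof -
  define g where "g p = f {#p#}" for p
  have g: "norm (g p) \<le> 1" if "p \<in> P" for p using that by (auto simp: g_def MS_def intro!: f_le)
  have lim: "(\<lambda>n. (\<Sum>k=1..n. push (cmul g) k) / of_nat n) \<longlonglongrightarrow> 0"
    unfolding sum_push by (rule halasz_completely_multiplicative[OF g]) (use dist in \<open>simp_all add: g_def\<close>)
  have "norm (\<Sum>k=1..n. push (cmul g) k) \<le> C0 * n" for n
  proof -
    have "norm (\<Sum>k=1..n. push (cmul g) k) \<le> (\<Sum>k=1..n. rr k)"
      unfolding rr_def by (intro sum_norm_le norm_push_le norm_cmul_le_1 g)
    then show ?thesis using count_le[of n] by linarith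
  qed
  moreover have "(\<Sum>k=1..n. norm (push (hfun f) k) / k) \<le> exp (8 * C0)" for n
    using sum_hfun_le[of f n] f1 f_le by blast
  ultimately have "(\<lambda>n. (\<Sum>k=1..n. conv (push (hfun f)) (push (cmul g)) k) / of_nat n) \<longlonglongrightarrow> 0"
    by (rule dominated_convolution_small[OF _ _ C0_pos lim, rotated])
  moreover have "(\<Sum>k=1..n. conv (push (hfun f)) (push (cmul g)) k) = (\<Sum>m\<in>MSle n. f m)" for n
  proof -
    have "(\<Sum>k=1..n. conv (push (hfun f)) (push (cmul g)) k) = (\<Sum>k=1..n. push (mconv (hfun f) (cmul g)) k)"
      by (intro sum.cong refl) (simp add: push_mconv)
    also have "\<dots> = (\<Sum>k=1..n. push f k)"
      by (intro sum.cong refl push_cong) (simp add: g_def[abs_def] multiplicative_eq_mconv[OF f1 f])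
    finally show ?thesis unfolding sum_push .
  qed
  ultimately show ?thesis by simp
qed

end

section \<open>Ideals of the Gaussian integers\<close>

abbreviation ZI :: "complex set" where "ZI \<equiv> carrier gauss_ring"

abbreviation pid :: "complex \<Rightarrow> complex set" where "pid \<equiv> cgenideal gauss_ring"

lemma ZI_iff: "z \<in> ZI \<longleftrightarrow> Re z \<in> \<int> \<and> Im z \<in> \<int>"
  by (simp add: gauss_ring_def)

lemma ZI_simps [simp]: "0 \<in> ZI" "1 \<in> ZI" "\<i> \<in> ZI" "of_nat n \<in> ZI"
  by (simp_all add: ZI_iff)

lemma ZI_closed [intro]:
  "a \<in> ZI \<Longrightarrow> b \<in> ZI \<Longrightarrow> a * b \<in> ZI" "a \<in> ZI \<Longrightarrow> b \<in> ZI \<Longrightarrow> a + b \<in> ZI"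
  "a \<in> ZI \<Longrightarrow> b \<in> ZI \<Longrightarrow> a - b \<in> ZI" "a \<in> ZI \<Longrightarrow> - a \<in> ZI" "a \<in> ZI \<Longrightarrow> cnj a \<in> ZI"
  by (simp_all add: ZI_iff)

lemma gauss_ring_sel [simp]: "mult gauss_ring = (*)" "add gauss_ring = (+)" "zero gauss_ring = 0" "one gauss_ring = 1"
  by (simp_all add: gauss_ring_def)

interpretation gauss: domain gauss_ring by (rule domain_gauss_ring)

lemma pid_eq: "pid z = {x * z | x. x \<in> ZI}" by (rule cgenideal_gauss_ring)

lemma mem_pid_self: "z \<in> pid z"
proof -
  have "z = 1 * z" by simp
  then show ?thesis unfolding pid_eq using ZI_simps(2) by blast
qed

lemma pid_nonzero: "z \<in> ZI \<Longrightarrow> z \<noteq> 0 \<Longrightarrow> pid z \<in> nonzero_ideals"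
  using gauss.cgenideal_ideal[of z] mem_pid_self[of z] by (auto simp: nonzero_ideals_def)

lemma pid_subset: "z \<in> pid w \<Longrightarrow> pid z \<subseteq> pid w"
  unfolding pid_eq by (auto simp: mult.assoc[symmetric] intro: ZI_closed)

lemma pid_mult_image: "pid (a * b) = (\<lambda>x. a * x) ` pid b"
  unfolding pid_eq by (auto simp: mult_ac)

lemma pid_mult_cong: "pid b = pid c \<Longrightarrow> pid (a * b) = pid (a * c)"
  by (simp add: pid_mult_image)

lemma pid_mult_cancel: "pid (a * b) = pid (a * c) \<Longrightarrow> a \<noteq> 0 \<Longrightarrow> pid b = pid c"
  unfolding pid_mult_image by (simp add: inj_image_eq_iff inj_def)

lemma ideal_gen:
  assumes "I \<in> nonzero_ideals"
  shows "ideal_gen I \<in> ZI" "pid (ideal_gen I) = I" "0 \<le> Arg (ideal_gen I)" "Arg (ideal_gen I) < pi / 2" "ideal_gen I \<noteq> 0"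
proof -
  have *: "ideal_gen I \<in> ZI \<and> pid (ideal_gen I) = I \<and> 0 \<le> Arg (ideal_gen I) \<and> Arg (ideal_gen I) < pi / 2"
    unfolding ideal_gen_def by (rule theI'[OF ideal_gen_unique[OF assms]])
  then show "ideal_gen I \<in> ZI" "pid (ideal_gen I) = I" "0 \<le> Arg (ideal_gen I)" "Arg (ideal_gen I) < pi / 2" by auto
  show "ideal_gen I \<noteq> 0"
  proof
    assume "ideal_gen I = 0"
    then have "I = {0}" using * by (auto simp: pid_eq)
    then show False using assms by (simp add: nonzero_ideals_def)
  qed
qed

lemma ideal_gen_pid:
  assumes "z \<in> ZI" "z \<noteq> 0" "0 \<le> Arg z" "Arg z < pi / 2"
  shows "ideal_gen (pid z) = z"
  using ideal_gen_unique[OF pid_nonzero[OF assms(1,2)]] ideal_gen[OF pid_nonzero[OF assms(1,2)]] assms by blast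

section \<open>Residue systems and the norm of a principal ideal\<close>

lemma norm_ge_1: "z \<in> ZI \<Longrightarrow> z \<noteq> 0 \<Longrightarrow> 1 \<le> (cmod z)\<^sup>2"
proof -
  assume z: "z \<in> ZI" "z \<noteq> 0"
  obtain k :: int where k: "(cmod z)\<^sup>2 = k" using gauss_ring_norm_int[OF z(1)] by blast
  have "(cmod z)\<^sup>2 > 0" using z by simp
  then show ?thesis unfolding k by simp
qed

lemma norm_1_unit:
  assumes "z \<in> ZI" "(cmod z)\<^sup>2 \<le> 1" "z \<noteq> 0"
  shows "cnj z * z = 1"
proof -
  have "(cmod z)\<^sup>2 = 1" using assms norm_ge_1[of z] by simp
  then show ?thesis by (metis complex_norm_square mult.commute of_real_1)
qed

text \<open>A complete system of residues modulo \<open>a\<close>. Norms are computed by counting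
  such systems, which can be written down explicitly, in place of cosets.\<close>

definition transversal :: "complex set \<Rightarrow> complex \<Rightarrow> bool" where
  "transversal R a \<longleftrightarrow> R \<subseteq> ZI \<and> (\<forall>z\<in>ZI. \<exists>!r. r \<in> R \<and> z - r \<in> pid a)"

lemma pid_closed:
  assumes "a \<in> ZI"
  shows "x \<in> pid a \<Longrightarrow> y \<in> pid a \<Longrightarrow> x + y \<in> pid a" "x \<in> pid a \<Longrightarrow> y \<in> pid a \<Longrightarrow> x - y \<in> pid a"
    "x \<in> pid a \<Longrightarrow> - x \<in> pid a" "0 \<in> pid a" "x \<in> pid a \<Longrightarrow> x \<in> ZI"
proof -
  show "x + y \<in> pid a" if "x \<in> pid a" "y \<in> pid a"
  proof -
    obtain u v where "u \<in> ZI" "v \<in> ZI" "x = u * a" "y = v * a" using \<open>x \<in> pid a\<close> \<open>y \<in> pid a\<close> by (auto simp: pid_eq)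
    then have "x + y = (u + v) * a" "u + v \<in> ZI" by (auto simp: algebra_simps)
    then show ?thesis unfolding pid_eq by blast
  qed
  show "x - y \<in> pid a" if "x \<in> pid a" "y \<in> pid a"
  proof -
    obtain u v where "u \<in> ZI" "v \<in> ZI" "x = u * a" "y = v * a" using \<open>x \<in> pid a\<close> \<open>y \<in> pid a\<close> by (auto simp: pid_eq)
    then have "x - y = (u - v) * a" "u - v \<in> ZI" by (auto simp: algebra_simps)
    then show ?thesis unfolding pid_eq by blast
  qed
  show "- x \<in> pid a" if "x \<in> pid a"
  proof -
    obtain u where "u \<in> ZI" "x = u * a" using \<open>x \<in> pid a\<close> by (auto simp: pid_eq)
    then have "- x = (- u) * a" "- u \<in> ZI" by auto
    then show ?thesis unfolding pid_eq by blast
  qed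
  have "0 = 0 * a" by simp
  then show "0 \<in> pid a" unfolding pid_eq using ZI_simps(1) by blast
  show "x \<in> pid a \<Longrightarrow> x \<in> ZI" using assms by (auto simp: pid_eq)
qed

lemma transversal_exists:
  assumes "a \<in> ZI"
  shows "\<exists>R. transversal R a"
proof -
  define E where "E z = (SOME w. w \<in> ZI \<and> z - w \<in> pid a)" for z
  have E: "E z \<in> ZI \<and> z - E z \<in> pid a" if "z \<in> ZI" for z
    unfolding E_def by (rule someI[of _ z]) (use that pid_closed(4)[OF assms] in simp)
  \<comment> \<open>The predicate from which the representative is chosen depends only on the class
    of z, so congruent elements receive the same choice.\<close>
  have Eeq: "E z = E z'" if "z - z' \<in> pid a" for z z'
  proof -
    have "z - w \<in> pid a \<longleftrightarrow> z' - w \<in> pid a" for w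
      using pid_closed(1)[OF assms that, of "z' - w"] pid_closed(2)[OF assms _ that, of "z - w"] by auto
    then show ?thesis unfolding E_def by simp
  qed
  have "transversal (E ` ZI) a"
    unfolding transversal_def
  proof (intro conjI ballI)
    show "E ` ZI \<subseteq> ZI" using E by auto
    fix z assume z: "z \<in> ZI"
    show "\<exists>!r. r \<in> E ` ZI \<and> z - r \<in> pid a"
    proof (intro ex1I[of _ "E z"] conjI)
      show "E z \<in> E ` ZI" "z - E z \<in> pid a" using E z by auto
      fix r assume "r \<in> E ` ZI \<and> z - r \<in> pid a"
      then obtain z' where z': "z' \<in> ZI" "r = E z'" "z - E z' \<in> pid a" by auto
      then have "(z - E z') - (z' - E z') \<in> pid a" by (intro pid_closed(2)[OF assms, of "z - E z'" "z' - E z'"]) (use E z' in auto)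
      then show "r = E z" using Eeq[of z z'] z' by simp
    qed
  qed
  then show ?thesis by blast
qed

lemma transversal_card:
  assumes R: "transversal R a" and a: "a \<in> ZI"
  shows "card R = ideal_norm (pid a)"
proof -
  have RZ: "R \<subseteq> ZI" and ex1: "\<And>z. z \<in> ZI \<Longrightarrow> \<exists>!r. r \<in> R \<and> z - r \<in> pid a" using R by (auto simp: transversal_def)
  define coset where "coset z = {h + z | h. h \<in> pid a}" for z
  have mem: "w \<in> coset z \<longleftrightarrow> w - z \<in> pid a" for w z
  proof
    assume "w - z \<in> pid a"
    moreover have "w = (w - z) + z" by simp
    ultimately show "w \<in> coset z" unfolding coset_def by blast
  qed (auto simp: coset_def)
  have ceq: "coset z = coset w" if "z - w \<in> pid a" for z w
  proof -
    have "x - z \<in> pid a \<longleftrightarrow> x - w \<in> pid a" for x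
      using pid_closed(1)[OF a that, of "x - z"] pid_closed(2)[OF a _ that, of "x - w"] by (auto simp: algebra_simps)
    then show ?thesis using mem by blast
  qed
  have carr: "carrier (gauss_ring Quot pid a) = coset ` ZI"
    by (auto simp: FactRing_def A_RCOSETS_def' a_r_coset_def' coset_def)
  have "bij_betw coset R (coset ` ZI)"
  proof (rule bij_betwI')
    fix x y assume xy: "x \<in> R" "y \<in> R"
    show "coset x = coset y \<longleftrightarrow> x = y"
    proof
      assume "coset x = coset y"
      then have "x - y \<in> pid a" using mem[of x x] mem[of x y] pid_closed(4)[OF a] by simp
      then show "x = y" using ex1[of x] xy RZ pid_closed(4)[OF a] by (metis cancel_comm_monoid_add_class.diff_cancel subsetD)
    qed simp
  next
    fix x assume "x \<in> R" then show "coset x \<in> coset ` ZI" using RZ by auto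
  next
    fix y assume "y \<in> coset ` ZI"
    then obtain z where "z \<in> ZI" "y = coset z" by auto
    then show "\<exists>x\<in>R. y = coset x" using ex1[of z] ceq by metis
  qed
  then show ?thesis unfolding ideal_norm_def carr by (rule bij_betw_same_card)
qed

text \<open>Expansion to base a: the first digit is the residue modulo a, the second the residue
  modulo b of the quotient. This makes the norm multiplicative.\<close>

lemma transversal_mult:
  assumes R: "transversal R a" and R': "transversal R' b" and ab: "a \<in> ZI" "b \<in> ZI" "a \<noteq> 0"
  shows "transversal ((\<lambda>(r, r'). r + a * r') ` (R \<times> R')) (a * b)" "inj_on (\<lambda>(r, r'). r + a * r') (R \<times> R')"
proof -
  have RZ: "R \<subseteq> ZI" "R' \<subseteq> ZI" using R R' by (auto simp: transversal_def)
  have u1: "r = s" if "r \<in> R" "s \<in> R" "r - s \<in> pid a" for r s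
    using R that RZ pid_closed(4)[OF ab(1)] unfolding transversal_def by (metis cancel_comm_monoid_add_class.diff_cancel subsetD)
  have u2: "r = s" if "r \<in> R'" "s \<in> R'" "r - s \<in> pid b" for r s
    using R' that RZ pid_closed(4)[OF ab(2)] unfolding transversal_def by (metis cancel_comm_monoid_add_class.diff_cancel subsetD)
  have uniq: "r = s \<and> r' = s'"
    if "r \<in> R" "s \<in> R" "r' \<in> R'" "s' \<in> R'" and d: "(r + a * r') - (s + a * s') \<in> pid (a * b)" for r s r' s'
  proof -
    obtain q where q: "q \<in> ZI" "(r + a * r') - (s + a * s') = q * (a * b)" using d by (auto simp: pid_eq)
    then have "r - s = (q * b + s' - r') * a" by (simp add: algebra_simps)
    moreover have "q * b + s' - r' \<in> ZI" using q ab that RZ by auto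
    ultimately have "r - s \<in> pid a" unfolding pid_eq by blast
    then have rs: "r = s" using u1 that by blast
    then have "a * (r' - s') = a * (q * b)" using q by (simp add: algebra_simps)
    then have "r' - s' = q * b" using ab by simp
    then have "r' - s' \<in> pid b" using q unfolding pid_eq by blast
    then show ?thesis using rs u2 that by blast
  qed
  have ab0: "a * b \<in> ZI" using ab by auto
  show "inj_on (\<lambda>(r, r'). r + a * r') (R \<times> R')"
    using uniq pid_closed(4)[OF ab0] by (auto simp: inj_on_def)
  show "transversal ((\<lambda>(r, r'). r + a * r') ` (R \<times> R')) (a * b)"
    unfolding transversal_def
  proof (intro conjI ballI)
    show "(\<lambda>(r, r'). r + a * r') ` (R \<times> R') \<subseteq> ZI" using RZ ab by auto
    fix z assume z: "z \<in> ZI"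
    obtain r where r: "r \<in> R" "z - r \<in> pid a" using R z unfolding transversal_def by blast
    then obtain q where q: "q \<in> ZI" "z - r = q * a" by (auto simp: pid_eq)
    obtain r' where r': "r' \<in> R'" "q - r' \<in> pid b" using R' q unfolding transversal_def by blast
    then obtain q' where q': "q' \<in> ZI" "q - r' = q' * b" by (auto simp: pid_eq)
    have "z - (r + a * r') = (z - r) - a * r'" by simp
    also have "\<dots> = a * (q - r')" unfolding q by (simp add: algebra_simps)
    finally have "z - (r + a * r') = q' * (a * b)" unfolding q' by (simp add: mult_ac)
    then have m: "z - (r + a * r') \<in> pid (a * b)" using q' unfolding pid_eq by blast
    show "\<exists>!x. x \<in> (\<lambda>(r, r'). r + a * r') ` (R \<times> R') \<and> z - x \<in> pid (a * b)"
    proof (intro ex1I[of _ "r + a * r'"] conjI m)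
      show "r + a * r' \<in> (\<lambda>(r, r'). r + a * r') ` (R \<times> R')" using r r' by (intro image_eqI[of _ _ "(r, r')"]) auto
      fix x assume x: "x \<in> (\<lambda>(r, r'). r + a * r') ` (R \<times> R') \<and> z - x \<in> pid (a * b)"
      then obtain s s' where s: "s \<in> R" "s' \<in> R'" "x = s + a * s'" by auto
      have "(z - (s + a * s')) - (z - (r + a * r')) \<in> pid (a * b)" by (rule pid_closed(2)[OF ab0]) (use x s m in auto)
      moreover have "(z - (s + a * s')) - (z - (r + a * r')) = (r + a * r') - (s + a * s')" by simp
      ultimately show "x = r + a * r'" using uniq[of r s r' s'] r r' s by metis
    qed
  qed
qed

lemma ideal_norm_mult:
  assumes "a \<in> ZI" "b \<in> ZI" "a \<noteq> 0"
  shows "ideal_norm (pid (a * b)) = ideal_norm (pid a) * ideal_norm (pid b)"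
proof -
  obtain R R' where R: "transversal R a" "transversal R' b" using transversal_exists assms by blast
  note T = transversal_mult[OF R assms]
  have "ideal_norm (pid (a * b)) = card ((\<lambda>(r, r'). r + a * r') ` (R \<times> R'))"
    using transversal_card[OF T(1) ZI_closed(1)[OF assms(1,2)]] by simp
  also have "\<dots> = card R * card R'" by (simp add: card_image[OF T(2)] card_cartesian_product)
  finally show ?thesis using transversal_card[OF R(1)] transversal_card[OF R(2)] assms by simp
qed

text \<open>Conjugation is an automorphism carrying residue systems modulo a to residue systems
  modulo its conjugate.\<close>

lemma ideal_norm_cnj:
  assumes "a \<in> ZI"
  shows "ideal_norm (pid (cnj a)) = ideal_norm (pid a)"
proof -
  obtain R where R: "transversal R a" using transversal_exists assms by blast
  have mem: "x \<in> pid (cnj a) \<longleftrightarrow> cnj x \<in> pid a" for x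
  proof
    assume "x \<in> pid (cnj a)"
    then obtain q where "q \<in> ZI" "x = q * cnj a" by (auto simp: pid_eq)
    then have "cnj q \<in> ZI" "cnj x = cnj q * a" by auto
    then show "cnj x \<in> pid a" unfolding pid_eq by blast
  next
    assume "cnj x \<in> pid a"
    then obtain q where q: "q \<in> ZI" "cnj x = q * a" by (auto simp: pid_eq)
    then have "cnj q \<in> ZI" "x = cnj q * cnj a" by (auto, metis complex_cnj_cnj complex_cnj_mult)
    then show "x \<in> pid (cnj a)" unfolding pid_eq by blast
  qed
  have "transversal (cnj ` R) (cnj a)"
    unfolding transversal_def
  proof (intro conjI ballI)
    show "cnj ` R \<subseteq> ZI" using R by (auto simp: transversal_def)
    fix z assume "z \<in> ZI"
    then have "cnj z \<in> ZI" by auto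
    then obtain r where r: "r \<in> R" "cnj z - r \<in> pid a" and u: "\<And>s. s \<in> R \<Longrightarrow> cnj z - s \<in> pid a \<Longrightarrow> s = r"
      using R unfolding transversal_def by blast
    show "\<exists>!s. s \<in> cnj ` R \<and> z - s \<in> pid (cnj a)"
    proof (rule ex1I[of _ "cnj r"])
      show "cnj r \<in> cnj ` R \<and> z - cnj r \<in> pid (cnj a)" unfolding mem using r by simp
      fix s assume s: "s \<in> cnj ` R \<and> z - s \<in> pid (cnj a)"
      then obtain r' where r': "r' \<in> R" "s = cnj r'" by blast
      then have "cnj z - r' \<in> pid a" using s unfolding mem by simp
      then show "s = cnj r" using u r' by simp
    qed
  qed
  then have "card (cnj ` R) = ideal_norm (pid (cnj a))" using assms by (intro transversal_card) auto
  moreover have "card (cnj ` R) = card R" by (intro card_image) (auto simp: inj_on_def)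
  ultimately show ?thesis using transversal_card[OF R assms] by simp
qed

lemma ideal_norm_of_nat:
  assumes "n > 0"
  shows "ideal_norm (pid (of_nat n)) = n\<^sup>2"
proof -
  define R where "R = (\<lambda>(a, b). Complex (of_nat a) (of_nat b)) ` ({..<n} \<times> {..<n})"
  have "transversal R (of_nat n)"
    unfolding transversal_def
  proof (intro conjI ballI)
    show "R \<subseteq> ZI" by (auto simp: R_def ZI_iff)
    fix z assume "z \<in> ZI"
    then obtain a b q where ab: "a < n" "b < n" "q \<in> ZI" "z = q * of_nat n + Complex (of_nat a) (of_nat b)"
      using gauss_ring_box[OF _ assms] by blast
    show "\<exists>!r. r \<in> R \<and> z - r \<in> pid (of_nat n)"
    proof (intro ex1I[of _ "Complex (of_nat a) (of_nat b)"] conjI)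
      show "Complex (of_nat a) (of_nat b) \<in> R" using ab by (auto simp: R_def)
      show "z - Complex (of_nat a) (of_nat b) \<in> pid (of_nat n)" using ab by (auto simp: pid_eq)
      fix r assume r: "r \<in> R \<and> z - r \<in> pid (of_nat n)"
      then obtain a' b' where a': "a' < n" "b' < n" "r = Complex (of_nat a') (of_nat b')" by (auto simp: R_def)
      obtain q' where q': "q' \<in> ZI" "z - r = q' * of_nat n" using r by (auto simp: pid_eq)
      have "(q' - q) * of_nat n = Complex (of_nat a) (of_nat b) - r" using q' ab by (simp add: algebra_simps)
      moreover have "q' - q \<in> ZI" using q' ab by auto
      then obtain u v :: int where "Re (q' - q) = u" "Im (q' - q) = v" by (auto simp: ZI_iff elim!: Ints_cases)
      ultimately have "real_of_int u * n = real a - real a'" "real_of_int v * n = real b - real b'"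
        using a' by (auto simp: complex_eq_iff)
      then have "u * int n = int a - int a'" "v * int n = int b - int b'"
        by (metis of_int_diff of_int_eq_iff of_int_mult of_int_of_nat_eq)+
      then have "int n dvd int a - int a'" "int n dvd int b - int b'" by (metis dvd_triv_right)+
      then have "a mod n = a' mod n" "b mod n = b' mod n" by (simp_all add: mod_eq_dvd_iff[symmetric] zmod_int[symmetric] flip: of_nat_mod)
      then show "r = Complex (of_nat a) (of_nat b)" using ab a' by simp
    qed
  qed
  then have "ideal_norm (pid (of_nat n)) = card R" by (intro transversal_card[symmetric]) auto
  also have "\<dots> = n * n" unfolding R_def by (subst card_image) (auto simp: inj_on_def)
  finally show ?thesis by (simp add: power2_eq_square)
qed

text \<open>With n = |z|^2, multiplicativity applied to z times its conjugate gives N(z)^2 = N(n) =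
  n^2, where N(n) is counted on a square grid.\<close>

lemma ideal_norm_pid:
  assumes "z \<in> ZI" "z \<noteq> 0"
  shows "real (ideal_norm (pid z)) = (cmod z)\<^sup>2"
proof -
  obtain k :: int where k: "(cmod z)\<^sup>2 = k" using gauss_ring_norm_int[OF assms(1)] by blast
  then have "k > 0" using norm_ge_1[OF assms] by linarith
  define n where "n = nat k"
  have n: "n > 0" "(cmod z)\<^sup>2 = n" using \<open>k > 0\<close> k by (simp_all add: n_def)
  have "z * cnj z = of_nat n" using n(2) complex_norm_square[of z] by (metis of_real_of_nat_eq of_real_power)
  then have "ideal_norm (pid z) * ideal_norm (pid z) = n\<^sup>2"
    using ideal_norm_mult[of z "cnj z"] ideal_norm_cnj[of z] ideal_norm_of_nat[OF n(1)] assms ZI_closed(5)[OF assms(1)]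
    by simp
  then have "ideal_norm (pid z) = n" by (simp add: power2_eq_square[symmetric])
  then show ?thesis using n by simp
qed

text \<open>The greatest common divisor with its Bezout representation; it exists because the sum of
  the two ideals is principal.\<close>

lemma pid_add_generator:
  assumes "a \<in> ZI" "b \<in> ZI" "b \<noteq> 0"
  shows "\<exists>d\<in>ZI. d \<noteq> 0 \<and> pid a <+>\<^bsub>gauss_ring\<^esub> pid b = pid d \<and> a \<in> pid d \<and> b \<in> pid d
    \<and> (\<exists>x\<in>ZI. \<exists>y\<in>ZI. d = x * a + y * b)"
proof -
  define J where "J = pid a <+>\<^bsub>gauss_ring\<^esub> pid b"
  have mem: "x \<in> J \<longleftrightarrow> (\<exists>u\<in>pid a. \<exists>v\<in>pid b. x = u + v)" for x
    by (auto simp: J_def set_add_def' )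
  have "ideal J gauss_ring"
    unfolding J_def by (rule gauss.add_ideals) (use assms gauss.cgenideal_ideal in auto)
  moreover have "a = a + 0" "b = 0 + b" by simp_all
  then have "a \<in> J" "b \<in> J" unfolding mem using mem_pid_self pid_closed(4) assms by blast+
  ultimately have J: "J \<in> nonzero_ideals" using assms by (auto simp: nonzero_ideals_def)
  have "ideal_gen J \<in> J" using mem_pid_self[of "ideal_gen J"] ideal_gen(2)[OF J] by simp
  then have "\<exists>x\<in>ZI. \<exists>y\<in>ZI. ideal_gen J = x * a + y * b" unfolding mem by (auto simp: pid_eq)
  then show ?thesis using ideal_gen[OF J] \<open>a \<in> J\<close> \<open>b \<in> J\<close> unfolding J_def by metis
qed

section \<open>Prime ideals and unique factorisation\<close>

lemma prime_idealsD:
  assumes "Q \<in> prime_ideals"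
  shows "Q \<in> nonzero_ideals" "1 \<notin> Q" "\<And>a b. a \<in> ZI \<Longrightarrow> b \<in> ZI \<Longrightarrow> a * b \<in> Q \<Longrightarrow> a \<in> Q \<or> b \<in> Q"
proof -
  have Q: "Q \<in> nonzero_ideals" "primeideal Q gauss_ring" using assms by (auto simp: prime_ideals_def)
  show "Q \<in> nonzero_ideals" by (rule Q)
  interpret primeideal Q gauss_ring by (rule Q)
  show "1 \<notin> Q"
    using one_imp_carrier I_notcarr by auto
  show "a \<in> Q \<or> b \<in> Q" if "a \<in> ZI" "b \<in> ZI" "a * b \<in> Q" for a b using I_prime[of a b] that by simp
qed

text \<open>A divisor w of z that is minimal in norm among the nonunits generates a prime ideal. If
  w divides a b, the greatest common divisor d of b and w again divides z. If d is no unit,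
  minimality makes it an associate of w, so w divides b; if d is a unit, Bezout shows that w divides
  a.\<close>

lemma prime_ideal_above:
  assumes "z \<in> ZI" "z \<noteq> 0" "(cmod z)\<^sup>2 > 1"
  shows "\<exists>Q\<in>prime_ideals. z \<in> Q"
proof -
  define D where "D w \<longleftrightarrow> w \<in> ZI \<and> z \<in> pid w \<and> w \<noteq> 0 \<and> (cmod w)\<^sup>2 > 1" for w
  have "D z" using assms mem_pid_self by (simp add: D_def)
  then obtain w where w: "D w" and min: "\<And>v. D v \<Longrightarrow> ideal_norm (pid w) \<le> ideal_norm (pid v)"
    using ex_has_least_nat[of D z "\<lambda>w. ideal_norm (pid w)"] by blast
  have wZ: "w \<in> ZI" "w \<noteq> 0" "z \<in> pid w" "(cmod w)\<^sup>2 > 1" using w by (auto simp: D_def)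
  have "primeideal (pid w) gauss_ring"
  proof (rule primeidealI)
    show "ideal (pid w) gauss_ring" using gauss.cgenideal_ideal wZ by auto
    show "cring gauss_ring" by (rule gauss.is_cring)
    show "ZI \<noteq> pid w"
    proof
      assume "ZI = pid w"
      then have "1 \<in> pid w" using ZI_simps(2) by blast
      then obtain q where q: "q \<in> ZI" "1 = q * w" unfolding pid_eq by blast
      then have "q \<noteq> 0" by auto
      have "1 * 1 < (cmod q)\<^sup>2 * (cmod w)\<^sup>2" using norm_ge_1[OF q(1) \<open>q \<noteq> 0\<close>] wZ by (intro mult_le_less_imp_less) auto
      also have "\<dots> = (cmod (q * w))\<^sup>2" by (simp add: norm_mult power_mult_distrib)
      finally show False using q(2) by simp
    qed
    fix a b assume ab: "a \<in> ZI" "b \<in> ZI" "a \<otimes>\<^bsub>gauss_ring\<^esub> b \<in> pid w"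
    show "a \<in> pid w \<or> b \<in> pid w"
    proof (rule disjCI)
      assume "b \<notin> pid w"
      obtain d x y where d: "d \<in> ZI" "d \<noteq> 0" "b \<in> pid d" "w \<in> pid d" "x \<in> ZI" "y \<in> ZI" "d = x * b + y * w"
        using pid_add_generator[OF ab(2) wZ(1,2)] by blast
      show "a \<in> pid w"
      proof (cases "(cmod d)\<^sup>2 > 1")
        case True
        have "z \<in> pid d" using pid_subset[OF d(4)] wZ by auto
        then have "D d" using d True by (simp add: D_def)
        then have "real (ideal_norm (pid w)) \<le> real (ideal_norm (pid d))" using min by simp
        \<comment> \<open>Since d divides w, minimality forces the quotient to have norm at most 1,
          hence to be a unit.\<close>
        then have le: "(cmod w)\<^sup>2 \<le> (cmod d)\<^sup>2" using ideal_norm_pid wZ d by simp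
        obtain q where q: "q \<in> ZI" "w = q * d" using d by (auto simp: pid_eq)
        have "q \<noteq> 0" using q wZ by auto
        have "(cmod q)\<^sup>2 * (cmod d)\<^sup>2 \<le> 1 * (cmod d)\<^sup>2" using le q by (simp add: norm_mult power_mult_distrib)
        then have "(cmod q)\<^sup>2 \<le> 1" using d by simp
        then have "cnj q * q = 1" using norm_1_unit q \<open>q \<noteq> 0\<close> by blast
        then have "d = cnj q * w" unfolding q(2) by (simp add: mult.assoc[symmetric])
        then have "d \<in> pid w" unfolding pid_eq using q by blast
        then have "b \<in> pid w" using pid_subset d(3) by blast
        then show ?thesis using \<open>b \<notin> pid w\<close> by simp
      next
        case False
        then have "(cmod d)\<^sup>2 \<le> 1" by simp
        then have "cnj d * d = 1" by (rule norm_1_unit[OF d(1) _ d(2)])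
        then have "a = cnj d * (d * a)" by (simp add: mult.assoc[symmetric])
        also have "d * a = x * (a * b) + (y * a) * w" unfolding d(7) by (simp add: algebra_simps)
        finally have "a = cnj d * (x * (a * b)) + (cnj d * y * a) * w" by (simp only: distrib_left mult.assoc)
        moreover have "cnj d * (x * (a * b)) \<in> pid w"
        proof -
          obtain q where "q \<in> ZI" "a * b = q * w" using ab by (auto simp: pid_eq)
          then have "cnj d * (x * (a * b)) = (cnj d * x * q) * w" "cnj d * x * q \<in> ZI"
            using d(1,5) by (simp add: mult_ac, blast)
          then show ?thesis unfolding pid_eq by blast
        qed
        moreover have "(cnj d * y * a) * w \<in> pid w"
        proof -
          have "cnj d * y * a \<in> ZI" using d(1,6) ab(1) by blast
          then show ?thesis unfolding pid_eq by blast
        qed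
        ultimately show ?thesis using pid_closed(1)[OF wZ(1)] by metis
      qed
    qed
  qed
  then have "pid w \<in> prime_ideals" using pid_nonzero wZ by (simp add: prime_ideals_def)
  then show ?thesis using wZ by blast
qed

text \<open>If q = c q', then primality of Q puts c or q' into Q. In the first case cancelling q
  makes q' a unit, which is impossible; in the second Q' lies in Q.\<close>

lemma prime_ideals_eq:
  assumes "Q \<in> prime_ideals" "Q' \<in> prime_ideals" "Q \<subseteq> Q'"
  shows "Q = Q'"
proof -
  note Q = prime_idealsD[OF assms(1)] and Q' = prime_idealsD[OF assms(2)]
  define q q' where "q = ideal_gen Q" and "q' = ideal_gen Q'"
  have q: "q \<in> ZI" "pid q = Q" "q \<noteq> 0" using ideal_gen[OF Q(1)] by (auto simp: q_def)
  have q': "q' \<in> ZI" "pid q' = Q'" "q' \<noteq> 0" using ideal_gen[OF Q'(1)] by (auto simp: q'_def)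
  have "q \<in> pid q'" using mem_pid_self[of q] assms(3) q q' by auto
  then obtain c where c: "c \<in> ZI" "q = c * q'" by (auto simp: pid_eq)
  then have "c * q' \<in> Q" using mem_pid_self[of q] q by simp
  then have "c \<in> Q \<or> q' \<in> Q" using Q(3) c q' by blast
  then show ?thesis
  proof
    assume "q' \<in> Q"
    then have "Q' \<subseteq> Q" using pid_subset[of q' q] q q' by simp
    then show ?thesis using assms(3) by blast
  next
    assume "c \<in> Q"
    then obtain d where d: "d \<in> ZI" "c = d * q" using q by (auto simp: pid_eq)
    then have "(d * q') * q = q" using c(2) by (metis mult.commute mult.left_commute)
    then have "q = (d * q') * q" ..
    then have "d * q' = 1" using q(3) mult_cancel_right1[of q "d * q'"] by blast
    then have "1 \<in> pid q'" unfolding pid_eq using d by (metis (mono_tags, lifting) mem_Collect_eq)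
    then show ?thesis using Q'(2) q' by simp
  qed
qed

text \<open>A generator of the product ideal, in general not the one normalised by its argument. It
  is exactly multiplicative, which the normalised generators are not.\<close>

definition gprod :: "complex set multiset \<Rightarrow> complex" where
  "gprod m = prod_mset (image_mset ideal_gen m)"

definition ideal_of :: "complex set multiset \<Rightarrow> complex set" where
  "ideal_of m = pid (gprod m)"

lemma gprod_simps [simp]: "gprod {#} = 1" "gprod (a + b) = gprod a * gprod b"
  "gprod (add_mset p m) = ideal_gen p * gprod m"
  by (simp_all add: gprod_def)

lemma gprod_ZI: "set_mset m \<subseteq> prime_ideals \<Longrightarrow> gprod m \<in> ZI \<and> gprod m \<noteq> 0"
proof (induction m)
  case (add p m)
  then have "ideal_gen p \<in> ZI" "ideal_gen p \<noteq> 0" using ideal_gen[of p] prime_idealsD[of p] by auto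
  then show ?case using add by auto
qed simp

lemma ideal_of_nonzero: "set_mset m \<subseteq> prime_ideals \<Longrightarrow> ideal_of m \<in> nonzero_ideals"
  using gprod_ZI pid_nonzero by (auto simp: ideal_of_def)

lemma pid_1: "pid 1 = ZI" by (auto simp: pid_eq)

lemma ideal_of_single: "p \<in> prime_ideals \<Longrightarrow> ideal_of {#p#} = p"
  using ideal_gen(2)[of p] prime_idealsD[of p] by (simp add: ideal_of_def)

lemma ideal_norm_ideal_of:
  "set_mset m \<subseteq> prime_ideals \<Longrightarrow> ideal_norm (ideal_of m) = prod_mset (image_mset ideal_norm m)"
proof (induction m)
  case empty
  have "real (ideal_norm (pid 1)) = (cmod 1)\<^sup>2" by (rule ideal_norm_pid) auto
  then show ?case by (simp add: ideal_of_def)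
next
  case (add p m)
  have p: "ideal_gen p \<in> ZI" "ideal_gen p \<noteq> 0" "pid (ideal_gen p) = p" using add ideal_gen[of p] prime_idealsD[of p] by auto
  have m: "gprod m \<in> ZI" using add gprod_ZI by auto
  show ?case using ideal_norm_mult[OF p(1) m p(2)] add p by (simp add: ideal_of_def)
qed

lemma gprod_mem_prime:
  assumes "set_mset m \<subseteq> prime_ideals" "Q \<in> prime_ideals" "gprod m \<in> Q"
  shows "Q \<in># m"
  using assms(1,3)
proof (induction m)
  case empty
  then show ?case using prime_idealsD[OF assms(2)] by simp
next
  case (add p m)
  have p: "ideal_gen p \<in> ZI" "pid (ideal_gen p) = p" using add ideal_gen[of p] prime_idealsD[of p] by auto
  have m: "gprod m \<in> ZI" using add gprod_ZI by auto
  have "ideal_gen p \<in> Q \<or> gprod m \<in> Q" using prime_idealsD(3)[OF assms(2) p(1) m] add by simp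
  then show ?case
  proof
    assume "ideal_gen p \<in> Q"
    moreover have "pid (ideal_gen Q) = Q" using ideal_gen[of Q] prime_idealsD[OF assms(2)] by auto
    ultimately have "p \<subseteq> Q" using pid_subset[of "ideal_gen p" "ideal_gen Q"] p by simp
    then show ?case using prime_ideals_eq[of p Q] add assms(2) by auto
  qed (use add in auto)
qed

lemma prime_mem_gprod:
  assumes "set_mset m \<subseteq> prime_ideals" "Q \<in># m"
  shows "gprod m \<in> Q"
proof -
  obtain m' where m: "m = add_mset Q m'" using assms(2) by (meson mset_add)
  have "pid (ideal_gen Q) = Q" using ideal_gen[of Q] prime_idealsD[of Q] assms by auto
  moreover have "gprod m \<in> pid (ideal_gen Q)"
    unfolding pid_eq m using gprod_ZI[of m'] assms m by (auto simp: mult.commute)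
  ultimately show ?thesis by simp
qed

text \<open>A prime of the first multiset contains the common ideal, so it occurs in the second; its
  generator cancels from both products.\<close>

lemma ideal_of_inj:
  assumes "set_mset m \<subseteq> prime_ideals" "set_mset m' \<subseteq> prime_ideals" "ideal_of m = ideal_of m'"
  shows "m = m'"
  using assms
proof (induction m arbitrary: m')
  case empty
  show ?case
  proof (rule ccontr)
    assume "{#} \<noteq> m'"
    then obtain Q where Q: "Q \<in># m'" by auto
    then have Qp: "Q \<in> prime_ideals" using empty by auto
    have "1 \<in> pid (gprod m')" using empty mem_pid_self[of 1] by (simp add: ideal_of_def)
    moreover have "pid (gprod m') \<subseteq> pid (ideal_gen Q)"
      using prime_mem_gprod[OF empty(2) Q] ideal_gen[of Q] prime_idealsD[OF Qp] by (intro pid_subset) auto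
    ultimately show False using prime_idealsD[OF Qp] ideal_gen(2)[of Q] by auto
  qed
next
  case (add p m)
  have p: "p \<in> prime_ideals" using add by auto
  have gp: "ideal_gen p \<in> ZI" "ideal_gen p \<noteq> 0" "pid (ideal_gen p) = p" using ideal_gen[of p] prime_idealsD[OF p] by auto
  have "gprod m' \<in> pid (gprod (add_mset p m))" using add(4) mem_pid_self[of "gprod m'"] by (simp add: ideal_of_def)
  also have "\<dots> \<subseteq> pid (ideal_gen p)"
    using prime_mem_gprod[OF add(2), of p] gp by (intro pid_subset) simp
  finally have "p \<in># m'" using gprod_mem_prime[OF add(3) p] gp by simp
  then obtain m'' where m'': "m' = add_mset p m''" by (meson mset_add)
  have "pid (gprod m) = pid (gprod m'')"
    by (rule pid_mult_cancel[of "ideal_gen p"]) (use add(4) gp in \<open>simp_all add: ideal_of_def m''\<close>)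
  then show ?case using add m'' by (simp add: ideal_of_def)
qed

text \<open>Strong induction on the norm: a prime above the generator is divided out. Its generator
  has norm greater than 1, so the quotient generates an ideal of smaller norm.\<close>

lemma ideal_of_surj: "I \<in> nonzero_ideals \<Longrightarrow> \<exists>m. set_mset m \<subseteq> prime_ideals \<and> ideal_of m = I"
proof (induction I rule: measure_induct_rule[of ideal_norm])
  case (less I)
  define z where "z = ideal_gen I"
  have z: "z \<in> ZI" "z \<noteq> 0" "pid z = I" using ideal_gen[OF less(2)] by (auto simp: z_def)
  show ?case
  proof (cases "(cmod z)\<^sup>2 > 1")
    case True
    then obtain Q where Q: "Q \<in> prime_ideals" "z \<in> Q" using prime_ideal_above z by blast
    have gQ: "ideal_gen Q \<in> ZI" "ideal_gen Q \<noteq> 0" "pid (ideal_gen Q) = Q" using ideal_gen[of Q] prime_idealsD[OF Q(1)] by auto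
    then obtain q where q: "q \<in> ZI" "z = q * ideal_gen Q" using Q by (auto simp: pid_eq)
    have q0: "q \<noteq> 0" using q z by auto
    have "(cmod (ideal_gen Q))\<^sup>2 > 1"
    proof (rule ccontr)
      assume "\<not> (cmod (ideal_gen Q))\<^sup>2 > 1"
      then have "(cmod (ideal_gen Q))\<^sup>2 \<le> 1" by simp
      then have "cnj (ideal_gen Q) * ideal_gen Q = 1" by (rule norm_1_unit[OF gQ(1) _ gQ(2)])
      then have "1 \<in> pid (ideal_gen Q)" unfolding pid_eq using gQ by (metis (mono_tags, lifting) ZI_closed(5) mem_Collect_eq)
      then show False using prime_idealsD[OF Q(1)] gQ by simp
    qed
    then have "1 * (cmod q)\<^sup>2 < (cmod (ideal_gen Q))\<^sup>2 * (cmod q)\<^sup>2" using q0 by (intro mult_strict_right_mono) auto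
    also have "\<dots> = (cmod z)\<^sup>2" unfolding q(2) by (simp add: norm_mult power_mult_distrib)
    finally have "real (ideal_norm (pid q)) < real (ideal_norm I)" using ideal_norm_pid z q q0 by auto
    then obtain m where m: "set_mset m \<subseteq> prime_ideals" "ideal_of m = pid q" using less(1)[of "pid q"] pid_nonzero[OF q(1) q0] by auto
    have "ideal_of (add_mset Q m) = pid (ideal_gen Q * q)"
      using pid_mult_cong[of "gprod m" q "ideal_gen Q"] m by (simp add: ideal_of_def)
    then have "ideal_of (add_mset Q m) = I" using z q by (simp add: mult.commute)
    then show ?thesis using m Q by (intro exI[of _ "add_mset Q m"]) auto
  next
    case False
    then have "(cmod z)\<^sup>2 \<le> 1" by simp
    then have "cnj z * z = 1" by (rule norm_1_unit[OF z(1) _ z(2)])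
    then have "1 \<in> pid z" unfolding pid_eq using z by (metis (mono_tags, lifting) ZI_closed(5) mem_Collect_eq)
    then have "pid 1 \<subseteq> pid z" by (rule pid_subset)
    moreover have "pid z \<subseteq> pid 1" using z by (intro pid_subset) (simp add: pid_1)
    ultimately have "ideal_of {#} = I" using z by (simp add: ideal_of_def)
    then show ?thesis by (intro exI[of _ "{#}"]) auto
  qed
qed

section \<open>Products of ideals and the angular characters\<close>

lemma ideal_prod_pid:
  assumes "a \<in> ZI" "b \<in> ZI"
  shows "ideal_prod gauss_ring (pid a) (pid b) = pid (a * b)"
proof (intro equalityI subsetI)
  fix x assume "x \<in> ideal_prod gauss_ring (pid a) (pid b)"
  then show "x \<in> pid (a * b)"
  proof induction
    case (prod i j)
    then obtain u v where "u \<in> ZI" "v \<in> ZI" "i = u * a" "j = v * b" by (auto simp: pid_eq)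
    then have "i * j = (u * v) * (a * b)" "u * v \<in> ZI" by (auto simp: mult_ac)
    then show ?case unfolding pid_eq gauss_ring_sel by blast
  next
    case (sum s t)
    then show ?case using pid_closed(1)[of "a * b"] assms by auto
  qed
next
  fix x assume "x \<in> pid (a * b)"
  then obtain u where u: "u \<in> ZI" "x = u * (a * b)" by (auto simp: pid_eq)
  have "(u * a) \<otimes>\<^bsub>gauss_ring\<^esub> b \<in> ideal_prod gauss_ring (pid a) (pid b)"
    by (rule ideal_prod.prod) (use u mem_pid_self in \<open>auto simp: pid_eq\<close>)
  then show "x \<in> ideal_prod gauss_ring (pid a) (pid b)" using u by (simp add: mult.assoc)
qed

text \<open>The sum of the two ideals is generated by a common divisor. Were it no unit, a prime
  above it would occur in both multisets.\<close>

lemma coprime_ideal_of: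
  assumes "set_mset a \<subseteq> prime_ideals" "set_mset b \<subseteq> prime_ideals" "set_mset a \<inter> set_mset b = {}"
  shows "coprime_ideals (ideal_of a) (ideal_of b)"
proof -
  obtain d where d: "d \<in> ZI" "d \<noteq> 0" "ideal_of a <+>\<^bsub>gauss_ring\<^esub> ideal_of b = pid d" "gprod a \<in> pid d" "gprod b \<in> pid d"
    unfolding ideal_of_def using pid_add_generator[of "gprod a" "gprod b"] gprod_ZI assms by blast
  have "\<not> (cmod d)\<^sup>2 > 1"
  proof
    assume "(cmod d)\<^sup>2 > 1"
    then obtain Q where Q: "Q \<in> prime_ideals" "d \<in> Q" using prime_ideal_above d by blast
    have "pid (ideal_gen Q) = Q" using ideal_gen[of Q] prime_idealsD[OF Q(1)] by auto
    then have "pid d \<subseteq> Q" using pid_subset[of d "ideal_gen Q"] Q by simp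
    then have "Q \<in># a" "Q \<in># b" using gprod_mem_prime[OF assms(1) Q(1)] gprod_mem_prime[OF assms(2) Q(1)] d by auto
    then show False using assms(3) by auto
  qed
  then have "(cmod d)\<^sup>2 \<le> 1" by simp
  then have "cnj d * d = 1" by (rule norm_1_unit[OF d(1) _ d(2)])
  then have "1 \<in> pid d" unfolding pid_eq using d by (metis (mono_tags, lifting) ZI_closed(5) mem_Collect_eq)
  then have "ZI \<subseteq> pid d" using pid_subset[of 1 d] by (simp add: pid_1)
  then show ?thesis using d pid_closed(5)[OF d(1)] unfolding coprime_ideals_def by auto
qed

lemma ideal_of_add:
  assumes "set_mset a \<subseteq> prime_ideals" "set_mset b \<subseteq> prime_ideals"
  shows "ideal_of (a + b) = ideal_prod gauss_ring (ideal_of a) (ideal_of b)"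
  using ideal_prod_pid[of "gprod a" "gprod b"] gprod_ZI assms by (simp add: ideal_of_def)

lemma ideal_of_multiplicative:
  assumes "multiplicative_on_ideals f" "set_mset a \<subseteq> prime_ideals" "set_mset b \<subseteq> prime_ideals" "set_mset a \<inter> set_mset b = {}"
  shows "f (ideal_of (a + b)) = f (ideal_of a) * f (ideal_of b)"
  using assms coprime_ideal_of[OF assms(2-4)] ideal_of_nonzero ideal_of_add[OF assms(2,3)]
  by (simp add: multiplicative_on_ideals_def)

lemma ideal_lambda_power: "I \<in> nonzero_ideals \<Longrightarrow> ideal_lambda k I = (ideal_lambda 1 I) powi k"
proof -
  have "exp (4 * \<i> * of_int k * of_real t) = exp (4 * \<i> * of_real t) powi k" for t :: real
  proof -
    have "4 * \<i> * of_int k * of_real t = of_int k * (4 * \<i> * of_real t)" by simp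
    then show ?thesis by (simp only: exp_power_int)
  qed
  then show ?thesis by (simp add: ideal_lambda_def)
qed

lemma norm_ideal_lambda: "norm (ideal_lambda k I) = 1"
  by (simp add: ideal_lambda_def)

text \<open>The units are fourth roots of unity, so the fourth power of z / |z| is the same for all
  generators. This replaces the normalised generator by an arbitrary one and makes multiplicativity
  evident.\<close>

lemma ideal_lambda_1_pid:
  assumes "z \<in> ZI" "z \<noteq> 0"
  shows "ideal_lambda 1 (pid z) = (sgn z) ^ 4"
proof -
  define w where "w = ideal_gen (pid z)"
  have w: "w \<in> ZI" "pid w = pid z" "w \<noteq> 0" using ideal_gen[OF pid_nonzero[OF assms]] by (auto simp: w_def)
  have "z \<in> pid w" "w \<in> pid z" using w mem_pid_self by auto
  then obtain a b where ab: "a \<in> ZI" "b \<in> ZI" "z = a * w" "w = b * z" unfolding pid_eq by blast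
  then have "(a * b) * z = z" by (metis mult.assoc)
  then have "a * b = 1" using assms(2) by simp
  then have "a \<in> {1, - 1, \<i>, - \<i>}" using gauss_ring_units ab by blast
  then have "a ^ 4 = 1" "norm a = 1" by (auto simp: power4_eq_xxxx)
  then have "(sgn z) ^ 4 = (sgn w) ^ 4" unfolding ab(3) sgn_mult power_mult_distrib by (simp add: sgn_eq)
  also have "sgn w = cis (Arg w)" using w by (simp add: cis_Arg)
  also have "cis (Arg w) ^ 4 = ideal_lambda 1 (pid z)"
    unfolding Complex.DeMoivre by (simp add: ideal_lambda_def ideal_arg_def w_def[symmetric] cis_conv_exp mult_ac)
  finally show ?thesis ..
qed

lemma ideal_lambda_ideal_of_add:
  assumes "set_mset a \<subseteq> prime_ideals" "set_mset b \<subseteq> prime_ideals"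
  shows "ideal_lambda k (ideal_of (a + b)) = ideal_lambda k (ideal_of a) * ideal_lambda k (ideal_of b)"
proof -
  have ab: "gprod a \<in> ZI" "gprod a \<noteq> 0" "gprod b \<in> ZI" "gprod b \<noteq> 0" using gprod_ZI assms by auto
  then have "ideal_lambda 1 (ideal_of (a + b)) = ideal_lambda 1 (ideal_of a) * ideal_lambda 1 (ideal_of b)"
    unfolding ideal_of_def gprod_simps
    by (subst (1 2 3) ideal_lambda_1_pid) (auto simp: sgn_mult power_mult_distrib)
  then show ?thesis
    using ideal_lambda_power[of "ideal_of (a + b)" k] ideal_lambda_power[of "ideal_of a" k] ideal_lambda_power[of "ideal_of b" k]
      ideal_of_nonzero[of "a + b"] ideal_of_nonzero[OF assms(1)] ideal_of_nonzero[OF assms(2)] assms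
    by (simp add: power_int_mult_distrib)
qed

section \<open>Lattice points in a quarter disc\<close>

text \<open>First coordinate at least 1 and second at least 0: the positive real axis is included
  and the imaginary axis excluded, matching the range of arguments from 0 to below pi/2. Every
  nonzero ideal has exactly one generator there.\<close>

definition FQ :: "nat \<Rightarrow> (nat \<times> nat) set" where
  "FQ n = {p. fst p \<ge> 1 \<and> (fst p)\<^sup>2 + (snd p)\<^sup>2 \<le> n}"

definition zpt :: "nat \<times> nat \<Rightarrow> complex" where
  "zpt p = Complex (of_nat (fst p)) (of_nat (snd p))"

text \<open>The predicate \<open>R\<close> on arguments is kept general, so that the total count and
  the counts in thin sectors follow from one bijection.\<close>

lemma bij_FQ:
  "bij_betw (\<lambda>p. pid (zpt p)) {p \<in> FQ n. R (Arg (zpt p))} {I \<in> nonzero_ideals. ideal_norm I \<le> n \<and> R (ideal_arg I)}"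
proof -
  have z: "zpt p \<in> ZI" "zpt p \<noteq> 0" "0 \<le> Arg (zpt p)" "Arg (zpt p) < pi / 2" if "fst p \<ge> 1" for p
  proof -
    show "zpt p \<in> ZI" by (simp add: zpt_def ZI_iff)
    show 0: "zpt p \<noteq> 0" using that by (simp add: zpt_def complex_eq_iff)
    have "0 < Re (zpt p) \<and> 0 \<le> Im (zpt p)" using that by (simp add: zpt_def)
    then show "0 \<le> Arg (zpt p)" "Arg (zpt p) < pi / 2" using Arg_quarter_iff[OF 0] by auto
  qed
  have gen: "ideal_gen (pid (zpt p)) = zpt p" if "fst p \<ge> 1" for p using ideal_gen_pid z[OF that] by blast
  have nrm: "(cmod (zpt p))\<^sup>2 = real ((fst p)\<^sup>2 + (snd p)\<^sup>2)" for p by (simp add: zpt_def cmod_power2)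
  have nrm': "ideal_norm (pid (zpt p)) = (fst p)\<^sup>2 + (snd p)\<^sup>2" if "fst p \<ge> 1" for p
    using ideal_norm_pid[OF z(1,2)[OF that]] unfolding nrm by (simp only: of_nat_eq_iff)
  show ?thesis
  proof (rule bij_betwI')
    fix x y assume "x \<in> {p \<in> FQ n. R (Arg (zpt p))}" "y \<in> {p \<in> FQ n. R (Arg (zpt p))}"
    then have xy: "fst x \<ge> 1" "fst y \<ge> 1" by (auto simp: FQ_def)
    show "pid (zpt x) = pid (zpt y) \<longleftrightarrow> x = y"
    proof
      assume "pid (zpt x) = pid (zpt y)"
      then have "zpt x = zpt y" using gen xy by metis
      then show "x = y" by (simp add: zpt_def prod_eq_iff)
    qed simp
  next
    fix x assume "x \<in> {p \<in> FQ n. R (Arg (zpt p))}"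
    then show "pid (zpt x) \<in> {I \<in> nonzero_ideals. ideal_norm I \<le> n \<and> R (ideal_arg I)}"
      using pid_nonzero z nrm' gen by (auto simp: FQ_def ideal_arg_def)
  next
    fix I assume I: "I \<in> {I \<in> nonzero_ideals. ideal_norm I \<le> n \<and> R (ideal_arg I)}"
    note g = ideal_gen[of I]
    have "0 < Re (ideal_gen I) \<and> 0 \<le> Im (ideal_gen I)" using Arg_quarter_iff[of "ideal_gen I"] g I by auto
    moreover obtain u v :: int where uv: "Re (ideal_gen I) = u" "Im (ideal_gen I) = v"
      using g(1) I by (auto simp: ZI_iff elim!: Ints_cases)
    ultimately have "u \<ge> 1" "v \<ge> 0" by auto
    then have zp: "zpt (nat u, nat v) = ideal_gen I" using uv by (simp add: zpt_def complex_eq_iff)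
    have f1: "fst (nat u, nat v) \<ge> 1" using \<open>u \<ge> 1\<close> by (simp add: Suc_le_eq)
    have "pid (zpt (nat u, nat v)) = I" using zp g I by simp
    then show "\<exists>x\<in>{p \<in> FQ n. R (Arg (zpt p))}. I = pid (zpt x)"
      using I f1 nrm'[OF f1] zp by (intro bexI[of _ "(nat u, nat v)"]) (auto simp: FQ_def ideal_arg_def)
  qed
qed

lemma card_ideals_FQ:
  "card {I \<in> nonzero_ideals. ideal_norm I \<le> n \<and> R (ideal_arg I)} = card {p \<in> FQ n. R (Arg (zpt p))}"
  using bij_betw_same_card[OF bij_FQ] by simp

text \<open>The area pi / 4 of a quarter of the unit disc. The maximum with 0 extends the height
  function by zero beyond the disc, which permits summation over all columns up to n.\<close>

definition quarter_disc :: real where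
  "quarter_disc = integral {0..1} (\<lambda>t. sqrt (max 0 (1 - t\<^sup>2)))"

text \<open>The height function is decreasing, so sum and integral differ by at most its value sqrt
  n at 0. Scaling by sqrt n reduces the integral to the unit disc.\<close>

lemma sum_sqrt_integral:
  assumes "n \<ge> (1::nat)"
  shows "quarter_disc * n \<le> (\<Sum>a\<le>n. sqrt (max 0 (real n - (real a)\<^sup>2)))"
    "(\<Sum>a\<le>n. sqrt (max 0 (real n - (real a)\<^sup>2))) \<le> quarter_disc * n + sqrt n"
proof -
  define \<phi> where "\<phi> t = sqrt (max 0 (real n - t\<^sup>2))" for t :: real
  interpret antimono_fun_sum_integral_diff \<phi>
  proof
    show "continuous_on {0..} \<phi>" unfolding \<phi>_def[abs_def] by (intro continuous_intros)
    fix x y :: real assume xy: "0 \<le> x" "x \<le> y"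
    then have "x\<^sup>2 \<le> y\<^sup>2" by (simp add: power_mono)
    then show "\<phi> y \<le> \<phi> x" unfolding \<phi>_def by (intro real_sqrt_le_mono max.mono) auto
  qed (simp add: \<phi>_def)
  define s where "s = sqrt (real n)"
  have s: "s \<ge> 1" "s\<^sup>2 = n" "s \<le> n" using assms by (auto simp: s_def intro!: real_le_lsqrt simp: power2_eq_square)
  have cont: "continuous_on X \<phi>" for X unfolding \<phi>_def[abs_def] by (intro continuous_intros)
  define \<psi> where "\<psi> t = sqrt (max 0 (1 - t\<^sup>2))" for t :: real
  have contp: "continuous_on X \<psi>" for X unfolding \<psi>_def[abs_def] by (intro continuous_intros)
  have "(\<psi> has_integral quarter_disc) {0..1}"
    unfolding quarter_disc_def \<psi>_def[symmetric] by (intro integrable_integral integrable_continuous_real contp)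
  then have "(\<psi> has_integral quarter_disc) (cbox 0 1)" by simp
  then have "((\<lambda>t. \<psi> ((1 / s) *\<^sub>R t + 0)) has_integral (1 / \<bar>1 / s\<bar> ^ DIM(real)) *\<^sub>R quarter_disc)
      ((\<lambda>x. (1 / (1 / s)) *\<^sub>R x + - ((1 / (1 / s)) *\<^sub>R 0)) ` cbox 0 1)"
    by (rule has_integral_affinity) (use s in auto)
  moreover have "(\<lambda>x. (1 / (1 / s)) *\<^sub>R x + - ((1 / (1 / s)) *\<^sub>R 0)) ` cbox 0 1 = {0..s}"
  proof -
    have "(\<lambda>x. (1 / (1 / s)) *\<^sub>R x + - ((1 / (1 / s)) *\<^sub>R 0)) = (\<lambda>x. s * x)" by auto
    then show ?thesis using s image_mult_atLeastAtMost[of s 0 1] by simp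
  qed
  ultimately have "((\<lambda>t. \<psi> (t / s)) has_integral s * quarter_disc) {0..s}" using s by simp
  then have "((\<lambda>t. s * \<psi> (t / s)) has_integral s * (s * quarter_disc)) {0..s}" by (rule has_integral_mult_right)
  moreover have "s * \<psi> (t / s) = \<phi> t" for t
  proof -
    have "real n - t\<^sup>2 = s\<^sup>2 * (1 - (t / s)\<^sup>2)" using s by (simp add: power_divide field_simps)
    then have "max 0 (real n - t\<^sup>2) = s\<^sup>2 * max 0 (1 - (t / s)\<^sup>2)" using s by (simp add: max_def mult_le_0_iff zero_le_mult_iff)
    then have "\<phi> t = sqrt (s\<^sup>2) * \<psi> t'" if "t' = t / s" for t'
      unfolding \<phi>_def \<psi>_def that by (simp only: real_sqrt_mult)
    then show ?thesis using s(1) by simp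
  qed
  ultimately have "(\<phi> has_integral quarter_disc * n) {0..s}" using s by (simp add: power2_eq_square mult_ac)
  moreover have "(\<phi> has_integral 0) {s..real n}"
  proof (rule has_integral_is_0)
    fix t assume "t \<in> {s..real n}"
    then have "s\<^sup>2 \<le> t\<^sup>2" using s by (intro power_mono) auto
    then show "\<phi> t = 0" using s by (simp add: \<phi>_def)
  qed
  ultimately have "(\<phi> has_integral quarter_disc * n + 0) {0..real n}"
    using s by (intro has_integral_combine[of 0 s "real n"]) auto
  then have int: "integral {0..real n} \<phi> = quarter_disc * n" by (simp add: integral_unique)
  show "quarter_disc * n \<le> (\<Sum>a\<le>n. sqrt (max 0 (real n - (real a)\<^sup>2)))"
    using sum_integral_diff_series_nonneg[of n] int by (simp add: sum_integral_diff_series_def \<phi>_def)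
  show "(\<Sum>a\<le>n. sqrt (max 0 (real n - (real a)\<^sup>2))) \<le> quarter_disc * n + sqrt n"
    using sum_integral_diff_series_antimono[of 0 n] int by (simp add: sum_integral_diff_series_def \<phi>_def)
qed

lemma quarter_disc_pos: "quarter_disc > 0"
proof -
  have "((\<lambda>t::real. 1 / 2 :: real) has_integral (1 / 4)) {0..1 / 2}"
    using has_integral_const_real[of "1 / 2 :: real" 0 "1 / 2"] by simp
  moreover have "(\<lambda>t. sqrt (max 0 (1 - t\<^sup>2))) integrable_on {0..1 / 2 :: real}"
    by (intro integrable_continuous_real continuous_intros)
  ultimately have "1 / 4 \<le> integral {0..1 / 2} (\<lambda>t::real. sqrt (max 0 (1 - t\<^sup>2)))"
  proof (rule has_integral_le[OF _ integrable_integral])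
    fix t :: real assume t: "t \<in> {0..1 / 2}"
    then have "t\<^sup>2 \<le> (1 / 2)\<^sup>2" by (intro power_mono) auto
    then have "(1 / 2)\<^sup>2 \<le> max 0 (1 - t\<^sup>2)" by (simp add: power2_eq_square)
    then show "1 / 2 \<le> sqrt (max 0 (1 - t\<^sup>2))" by (rule real_le_rsqrt)
  qed
  also have "\<dots> \<le> quarter_disc"
    unfolding quarter_disc_def by (intro integral_subset_le integrable_continuous_real continuous_intros) auto
  finally show ?thesis by simp
qed

text \<open>The column over a holds the ordinates from 0 to the floor of the height, so its size
  lies between the height and the height plus 1, and at most sqrt n columns are nonempty. The
  missing column a = 0 offsets the sqrt n lost in comparing with the integral, so the error constant
  is 1 on either side.\<close>

lemma card_FQ: "\<bar>real (card (FQ n)) - quarter_disc * n\<bar> \<le> sqrt n"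
proof (cases "n \<ge> 1")
  case False
  then have "n = 0" by simp
  moreover from this have "FQ n = {}" by (auto simp: FQ_def)
  ultimately show ?thesis by simp
next
  case True
  define \<phi> where "\<phi> a = sqrt (max 0 (real n - (real a)\<^sup>2))" for a :: nat
  define C where "C a = {b. a\<^sup>2 + b\<^sup>2 \<le> n}" for a :: nat
  have C: "C a = (if a\<^sup>2 \<le> n then {..nat \<lfloor>\<phi> a\<rfloor>} else {})" for a
  proof (cases "a\<^sup>2 \<le> n")
    case le: True
    then have r: "(real a)\<^sup>2 \<le> real n" by (simp only: of_nat_power[symmetric] of_nat_le_iff)
    have "b \<in> C a \<longleftrightarrow> b \<le> nat \<lfloor>\<phi> a\<rfloor>" for b
    proof -
      have "b \<in> C a \<longleftrightarrow> real (a\<^sup>2 + b\<^sup>2) \<le> real n" unfolding C_def of_nat_le_iff by simp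
      also have "\<dots> \<longleftrightarrow> (real b)\<^sup>2 \<le> real n - (real a)\<^sup>2" by auto
      also have "\<dots> \<longleftrightarrow> real b \<le> \<phi> a" using r unfolding \<phi>_def
        using real_sqrt_le_iff[of "(real b)\<^sup>2" "real n - (real a)\<^sup>2"] by simp
      also have "\<dots> \<longleftrightarrow> b \<le> nat \<lfloor>\<phi> a\<rfloor>" using r by (simp add: le_nat_iff le_floor_iff \<phi>_def)
      finally show ?thesis .
    qed
    then show ?thesis using le by auto
  qed (auto simp: C_def)
  have FQ: "FQ n = (SIGMA a:{1..n}. C a)"
  proof -
    have "a \<le> n" if "a\<^sup>2 + b\<^sup>2 \<le> n" for a b
    proof -
      have "a \<le> a\<^sup>2" by (cases a) (auto simp: power2_eq_square)
      then show ?thesis using that by linarith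
    qed
    then show ?thesis by (auto simp: FQ_def C_def)
  qed
  have finC: "finite (C a)" for a by (simp add: C)
  have card_eq: "real (card (FQ n)) = (\<Sum>a=1..n. real (card (C a)))"
    unfolding FQ by (subst card_SigmaI) (auto simp: finC)
  have lo: "\<phi> a \<le> real (card (C a))" for a
  proof (cases "a\<^sup>2 \<le> n")
    case False
    then have "real n < (real a)\<^sup>2" by (simp only: not_le of_nat_power[symmetric] of_nat_less_iff)
    then show ?thesis by (simp add: C \<phi>_def)
  next
    case le: True
    have "\<phi> a \<ge> 0" by (simp add: \<phi>_def)
    then have "\<phi> a \<le> real (nat \<lfloor>\<phi> a\<rfloor>) + 1" by linarith
    then show ?thesis using le by (simp add: C)
  qed
  have hi: "real (card (C a)) \<le> \<phi> a + (if a \<le> nat \<lfloor>sqrt n\<rfloor> then 1 else 0)" for a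
  proof (cases "a\<^sup>2 \<le> n")
    case le: True
    have "\<phi> a \<ge> 0" by (simp add: \<phi>_def)
    moreover have "real a \<le> sqrt n"
      by (rule real_le_rsqrt) (use le in \<open>simp only: of_nat_power[symmetric] of_nat_le_iff\<close>)
    then have "a \<le> nat \<lfloor>sqrt n\<rfloor>" by (simp add: le_nat_floor)
    ultimately show ?thesis using le by (simp add: C)
  qed (simp add: C \<phi>_def)
  have split0: "(\<Sum>a\<le>n. \<phi> a) = sqrt n + (\<Sum>a=1..n. \<phi> a)"
  proof -
    have "{..n} = insert 0 {1..n}" by auto
    then show ?thesis by (simp add: \<phi>_def)
  qed
  note S = sum_sqrt_integral[OF True, folded \<phi>_def, unfolded split0]
  have "(\<Sum>a=1..n. \<phi> a) \<le> real (card (FQ n))" unfolding card_eq by (intro sum_mono lo)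
  moreover have "real (card (FQ n)) \<le> (\<Sum>a=1..n. \<phi> a) + sqrt n"
  proof -
    have "real (card (FQ n)) \<le> (\<Sum>a=1..n. \<phi> a + (if a \<le> nat \<lfloor>sqrt n\<rfloor> then 1 else 0))" unfolding card_eq by (intro sum_mono hi)
    also have "\<dots> = (\<Sum>a=1..n. \<phi> a) + real (card ({1..n} \<inter> {a. a \<le> nat \<lfloor>sqrt n\<rfloor>}))"
      by (simp add: sum.distrib sum.If_cases)
    finally have 1: "real (card (FQ n)) \<le> (\<Sum>a=1..n. \<phi> a) + real (card ({1..n} \<inter> {a. a \<le> nat \<lfloor>sqrt n\<rfloor>}))" .
    have "card ({1..n} \<inter> {a. a \<le> nat \<lfloor>sqrt n\<rfloor>}) \<le> card {1..nat \<lfloor>sqrt n\<rfloor>}" by (intro card_mono) auto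
    then have "real (card ({1..n} \<inter> {a. a \<le> nat \<lfloor>sqrt n\<rfloor>})) \<le> real (nat \<lfloor>sqrt n\<rfloor>)"
      by (simp only: of_nat_le_iff card_atLeastAtMost diff_Suc_1)
    also have "\<dots> \<le> sqrt n" by simp
    finally show ?thesis using 1 by linarith
  qed
  ultimately show ?thesis using S by linarith
qed

section \<open>Lattice points in thin sectors\<close>

lemma card_nat_interval:
  fixes u v :: real
  assumes "u \<le> v"
  shows "finite {b::nat. u \<le> b \<and> b \<le> v} \<and> real (card {b::nat. u \<le> b \<and> b \<le> v}) \<le> v - u + 1"
proof (cases "{b::nat. u \<le> b \<and> b \<le> v} = {}")
  case False
  define m where "m = (LEAST b::nat. u \<le> b \<and> b \<le> v)"
  have ex: "\<exists>b::nat. u \<le> b \<and> b \<le> v" using False by blast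
  have m: "u \<le> m \<and> m \<le> v" unfolding m_def by (rule LeastI_ex[OF ex])
  have sub: "{b::nat. u \<le> b \<and> b \<le> v} \<subseteq> {m..nat \<lfloor>v\<rfloor>}"
  proof
    fix b assume "b \<in> {b::nat. u \<le> b \<and> b \<le> v}"
    then have b: "u \<le> b \<and> b \<le> v" by simp
    have "m \<le> b" unfolding m_def by (rule Least_le[of "\<lambda>b::nat. u \<le> b \<and> b \<le> v", OF b])
    moreover have "b \<le> nat \<lfloor>v\<rfloor>" using b by (intro le_nat_floor) simp
    ultimately show "b \<in> {m..nat \<lfloor>v\<rfloor>}" by simp
  qed
  have "card {b::nat. u \<le> b \<and> b \<le> v} \<le> card {m..nat \<lfloor>v\<rfloor>}" using sub by (intro card_mono) auto
  also have "\<dots> = Suc (nat \<lfloor>v\<rfloor>) - m" by simp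
  finally have "real (card {b::nat. u \<le> b \<and> b \<le> v}) \<le> real (Suc (nat \<lfloor>v\<rfloor>) - m)" by simp
  also have "\<dots> = real (nat \<lfloor>v\<rfloor>) + 1 - m" using m by (simp add: le_nat_floor of_nat_diff le_SucI)
  also have "\<dots> \<le> v - u + 1" using m by linarith
  finally show ?thesis using sub finite_subset by blast
next
  case True
  then show ?thesis using assms by (simp only: finite.emptyI card.empty) simp
qed

text \<open>A strip around a line through the origin meets each column in an interval of length 2 w
  / c, at most 4 w as soon as the line is not too steep; the condition on c is the measure of
  steepness.\<close>

lemma card_strip:
  fixes c s w x :: real and Y :: "(nat \<times> nat) set"
  assumes c: "c \<ge> 1 / 2" and w: "w \<ge> 0" and x: "x \<ge> 0"
    and Y: "\<And>p. p \<in> Y \<Longrightarrow> real (fst p) \<le> x \<and> \<bar>real (snd p) * c - real (fst p) * s\<bar> \<le> w"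
  shows "real (card Y) \<le> (x + 1) * (4 * w + 1)"
proof -
  define T where "T a = {b::nat. (a * s - w) / c \<le> b \<and> b \<le> (a * s + w) / c}" for a :: nat
  have "(a * s - w) / c \<le> (a * s + w) / c" for a :: nat using c w by (intro divide_right_mono) auto
  then have T: "finite (T a)" "real (card (T a)) \<le> (a * s + w) / c - (a * s - w) / c + 1" for a
    using card_nat_interval unfolding T_def by blast+
  have T': "real (card (T a)) \<le> 4 * w + 1" for a
  proof -
    have "(a * s + w) / c - (a * s - w) / c = 2 * w / c" by (simp add: diff_divide_distrib add_divide_distrib)
    also have "\<dots> \<le> 2 * w / (1 / 2)" using c w by (intro divide_left_mono) auto
    finally show ?thesis using T(2)[of a] by simp
  qed
  have "Y \<subseteq> (SIGMA a:{..nat \<lfloor>x\<rfloor>}. T a)"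
  proof
    fix p assume p: "p \<in> Y"
    obtain a b where ab: "p = (a, b)" by (cases p)
    have "real a \<le> x" "\<bar>real b * c - real a * s\<bar> \<le> w" using Y[OF p] ab by auto
    then have "a \<le> nat \<lfloor>x\<rfloor>" "a * s - w \<le> b * c" "b * c \<le> a * s + w" by (auto simp: le_nat_floor abs_le_iff)
    then show "p \<in> (SIGMA a:{..nat \<lfloor>x\<rfloor>}. T a)" using ab c by (auto simp: T_def field_simps)
  qed
  then have "card Y \<le> card (SIGMA a:{..nat \<lfloor>x\<rfloor>}. T a)" by (intro card_mono finite_SigmaI T) auto
  also have "\<dots> = (\<Sum>a\<le>nat \<lfloor>x\<rfloor>. card (T a))" by (rule card_SigmaI) (auto simp: T)
  finally have "real (card Y) \<le> (\<Sum>a\<le>nat \<lfloor>x\<rfloor>. real (card (T a)))" by (simp flip: of_nat_sum)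
  also have "\<dots> \<le> (\<Sum>a\<le>nat \<lfloor>x\<rfloor>. 4 * w + 1)" by (intro sum_mono T')
  also have "\<dots> = (real (nat \<lfloor>x\<rfloor>) + 1) * (4 * w + 1)" by simp
  also have "\<dots> \<le> (x + 1) * (4 * w + 1)" using x w by (intro mult_right_mono) auto
  finally show ?thesis .
qed

text \<open>A sector of half-opening \<delta> in the disc of radius sqrt n lies in the strip of
  half-width \<delta> sqrt n around its axis. If cos \<theta> < 1/2 then sin \<theta> \<ge> 1/2, and
  exchanging the coordinates reduces to the other case.\<close>

lemma card_sector:
  assumes \<theta>: "0 \<le> \<theta>" "\<theta> \<le> pi / 2" and \<delta>: "\<delta> \<ge> 0"
  shows "real (card {p \<in> FQ n. \<bar>Arg (zpt p) - \<theta>\<bar> \<le> \<delta>}) \<le> (sqrt n + 1) * (4 * (\<delta> * sqrt n) + 1)"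
proof -
  define Y where "Y = {p \<in> FQ n. \<bar>Arg (zpt p) - \<theta>\<bar> \<le> \<delta>}"
  have Y: "real (fst p) \<le> sqrt n \<and> real (snd p) \<le> sqrt n \<and> \<bar>real (snd p) * cos \<theta> - real (fst p) * sin \<theta>\<bar> \<le> \<delta> * sqrt n"
    if "p \<in> Y" for p
  proof -
    have p: "(fst p)\<^sup>2 + (snd p)\<^sup>2 \<le> n" "\<bar>Arg (zpt p) - \<theta>\<bar> \<le> \<delta>" using that by (auto simp: Y_def FQ_def)
    have "(cmod (zpt p))\<^sup>2 = real ((fst p)\<^sup>2 + (snd p)\<^sup>2)" by (simp add: zpt_def cmod_power2)
    also have "\<dots> \<le> real n" using p(1) by (simp only: of_nat_le_iff)
    finally have le: "cmod (zpt p) \<le> sqrt n" by (rule real_le_rsqrt)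
    have "real (fst p) \<le> cmod (zpt p)" "real (snd p) \<le> cmod (zpt p)"
      using complex_Re_le_cmod[of "zpt p"] abs_Im_le_cmod[of "zpt p"] by (auto simp: zpt_def)
    moreover have "\<bar>real (snd p) * cos \<theta> - real (fst p) * sin \<theta>\<bar> \<le> \<delta> * sqrt n"
    proof -
      have "zpt p * cis (- \<theta>) = of_real (cmod (zpt p)) * (cis (Arg (zpt p)) * cis (- \<theta>))"
        using rcis_cmod_Arg[of "zpt p"] by (simp only: rcis_def mult.assoc[symmetric])
      also have "\<dots> = of_real (cmod (zpt p)) * cis (Arg (zpt p) - \<theta>)" by (simp add: cis_mult)
      finally have "Im (zpt p * cis (- \<theta>)) = cmod (zpt p) * sin (Arg (zpt p) - \<theta>)" by simp
      moreover have "Im (zpt p * cis (- \<theta>)) = real (snd p) * cos \<theta> - real (fst p) * sin \<theta>" by (simp add: zpt_def)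
      ultimately have eq: "real (snd p) * cos \<theta> - real (fst p) * sin \<theta> = cmod (zpt p) * sin (Arg (zpt p) - \<theta>)"
        by linarith
      have "\<bar>real (snd p) * cos \<theta> - real (fst p) * sin \<theta>\<bar> = cmod (zpt p) * \<bar>sin (Arg (zpt p) - \<theta>)\<bar>"
        unfolding eq abs_mult by simp
      also have "\<dots> \<le> sqrt n * \<delta>"
        using le p(2) abs_sin_x_le_abs_x[of "Arg (zpt p) - \<theta>"] by (intro mult_mono) auto
      finally show ?thesis by (simp add: mult.commute)
    qed
    ultimately show ?thesis using le by linarith
  qed
  have "real (card Y) \<le> (sqrt n + 1) * (4 * (\<delta> * sqrt n) + 1)"
  proof (cases "cos \<theta> \<ge> 1 / 2")
    case True
    show ?thesis by (rule card_strip[OF True]) (use Y \<delta> in auto)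
  next
    case False
    have c0: "cos \<theta> \<ge> 0" "sin \<theta> \<ge> 0" using \<theta> by (auto intro!: cos_ge_zero sin_ge_zero)
    have "sin \<theta> \<ge> 1 / 2"
    proof (rule ccontr)
      assume "\<not> sin \<theta> \<ge> 1 / 2"
      then have "(sin \<theta>)\<^sup>2 \<le> (1 / 2)\<^sup>2" "(cos \<theta>)\<^sup>2 \<le> (1 / 2)\<^sup>2" using False c0 by (auto intro!: power_mono)
      then show False using sin_cos_squared_add[of \<theta>] by (simp add: power2_eq_square)
    qed
    then have "real (card (prod.swap ` Y)) \<le> (sqrt n + 1) * (4 * (\<delta> * sqrt n) + 1)"
      by (rule card_strip[where s = "cos \<theta>"]) (use Y \<delta> in \<open>auto simp: abs_minus_commute\<close>)
    then show ?thesis by (simp add: card_image)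
  qed
  then show ?thesis by (simp add: Y_def)
qed

section \<open>Equidistribution of arguments\<close>

definition ideals_le :: "nat \<Rightarrow> complex set set" where
  "ideals_le n = {I \<in> nonzero_ideals. ideal_norm I \<le> n}"

lemma finite_ideals_le_nat: "finite (ideals_le n)"
  using finite_ideals_le[of "real n"] by (simp add: ideals_le_def)

lemma bij_ideal_of:
  "bij_betw ideal_of {m. set_mset m \<subseteq> prime_ideals \<and> prod_mset (image_mset ideal_norm m) \<le> n} (ideals_le n)"
proof (rule bij_betwI')
  fix m m' assume "m \<in> {m. set_mset m \<subseteq> prime_ideals \<and> prod_mset (image_mset ideal_norm m) \<le> n}"
    "m' \<in> {m. set_mset m \<subseteq> prime_ideals \<and> prod_mset (image_mset ideal_norm m) \<le> n}"
  then show "ideal_of m = ideal_of m' \<longleftrightarrow> m = m'" using ideal_of_inj[of m m'] by auto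
next
  fix m assume "m \<in> {m. set_mset m \<subseteq> prime_ideals \<and> prod_mset (image_mset ideal_norm m) \<le> n}"
  then show "ideal_of m \<in> ideals_le n" using ideal_of_nonzero[of m] ideal_norm_ideal_of[of m] by (auto simp: ideals_le_def)
next
  fix I assume I: "I \<in> ideals_le n"
  then obtain m where "set_mset m \<subseteq> prime_ideals" "ideal_of m = I" using ideal_of_surj[of I] by (auto simp: ideals_le_def)
  then show "\<exists>m\<in>{m. set_mset m \<subseteq> prime_ideals \<and> prod_mset (image_mset ideal_norm m) \<le> n}. I = ideal_of m"
    using ideal_norm_ideal_of[of m] I by (intro bexI[of _ m]) (auto simp: ideals_le_def)
qed

lemma card_ideals_le: "card (ideals_le n) = card (FQ n)"
  using card_ideals_FQ[of n "\<lambda>_. True"] by (simp add: ideals_le_def)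

interpretation gp: normed_primes prime_ideals ideal_norm quarter_disc 1
proof
  fix p assume p: "p \<in> prime_ideals"
  define g where "g = ideal_gen p"
  have g: "g \<in> ZI" "pid g = p" "g \<noteq> 0" using ideal_gen[of p] prime_idealsD[OF p] by (auto simp: g_def)
  have "(cmod g)\<^sup>2 > 1"
  proof (rule ccontr)
    assume "\<not> (cmod g)\<^sup>2 > 1"
    then have "(cmod g)\<^sup>2 \<le> 1" by simp
    then have "cnj g * g = 1" by (rule norm_1_unit[OF g(1) _ g(3)])
    moreover have "cnj g * g \<in> pid g" unfolding pid_eq using g by blast
    ultimately show False using prime_idealsD[OF p] g by simp
  qed
  then show "ideal_norm p \<ge> 2" using ideal_norm_pid[OF g(1,3)] g by simp
next
  show "quarter_disc > 0" by (rule quarter_disc_pos)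
next
  fix n
  show "finite {m. set_mset m \<subseteq> prime_ideals \<and> prod_mset (image_mset ideal_norm m) \<le> n}"
    using bij_betw_finite[OF bij_ideal_of] finite_ideals_le_nat by simp
  show "\<bar>real (card {m. set_mset m \<subseteq> prime_ideals \<and> prod_mset (image_mset ideal_norm m) \<le> n}) - quarter_disc * real n\<bar> \<le> 1 * sqrt (real n)"
    using card_FQ[of n] bij_betw_same_card[OF bij_ideal_of[of n]] by (simp add: card_ideals_le)
qed simp

lemma sum_MSle: "(\<Sum>m\<in>gp.MSle n. F (ideal_of m)) = (\<Sum>I\<in>ideals_le n. F I)"
  using sum.reindex_bij_betw[OF bij_ideal_of[of n], of F] by (simp add: gp.MSle_def gp.MS_def gp.nm_def)

text \<open>The hypothesis bounds a minimum over |t| \<le> log x from below, and the abstract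
  theorem wants one cutoff good for all |t| \<le> T. Any y \<ge> exp T at which the minimum exceeds
  K serves.\<close>

lemma halasz_ideals:
  assumes f: "multiplicative_on_ideals f" and f_le: "\<And>I. I \<in> nonzero_ideals \<Longrightarrow> norm (f I) \<le> 1"
    and lim: "filterlim (min_distance f k) at_top at_top"
  shows "(\<lambda>n. (\<Sum>I\<in>ideals_le n. f I * ideal_lambda k I) / of_nat n) \<longlonglongrightarrow> 0"
proof -
  define F where "F m = f (ideal_of m) * ideal_lambda k (ideal_of m)" for m
  have "(\<lambda>n. (\<Sum>m\<in>gp.MSle n. F m) / of_nat n) \<longlonglongrightarrow> 0"
  proof (rule gp.halasz_multiplicative)
    have "ideal_lambda 1 ZI = 1" using ideal_lambda_1_pid[of 1] by (simp add: pid_1)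
    then have "ideal_lambda k ZI = 1" using ideal_lambda_power[of ZI k] pid_nonzero[of 1] by (simp add: pid_1)
    then show "F {#} = 1" using f by (simp add: F_def ideal_of_def pid_1 multiplicative_on_ideals_def)
  next
    fix a b assume "a \<in> gp.MS" "b \<in> gp.MS" "set_mset a \<inter> set_mset b = {}"
    then show "F (a + b) = F a * F b"
      using ideal_of_multiplicative[OF f, of a b] ideal_lambda_ideal_of_add[of a b k] by (simp add: F_def gp.MS_def)
  next
    fix m assume "m \<in> gp.MS"
    then show "norm (F m) \<le> 1" using f_le[OF ideal_of_nonzero[of m]] by (simp add: F_def gp.MS_def norm_mult norm_ideal_lambda)
  next
    fix K T :: real
    have "eventually (\<lambda>x. min_distance f k x \<ge> K) at_top" using lim by (simp add: filterlim_at_top)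
    then obtain x0 where x0: "\<And>x. x \<ge> x0 \<Longrightarrow> min_distance f k x \<ge> K" by (auto simp: eventually_at_top_linorder)
    \<comment> \<open>The three lower bounds give a large minimum, the range |t| \<le> T inside |t|
      \<le> ln y, and the condition under which the minimum is attained.\<close>
    define y where "y = nat \<lceil>max (max x0 (exp T)) 1\<rceil>"
    have y: "real y \<ge> x0" "real y \<ge> exp T" "real y \<ge> 1" unfolding y_def by linarith+
    have lny: "T \<le> ln (real y)" using y by (subst ln_ge_iff) auto
    show "\<exists>y. \<forall>t. \<bar>t\<bar> \<le> T \<longrightarrow> K \<le> (\<Sum>p | p \<in> prime_ideals \<and> ideal_norm p \<le> y.
        (1 - Re (F {#p#} * exp (- \<i> * of_real (ln (real (ideal_norm p)) * t)))) / real (ideal_norm p))"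
    proof (intro exI[of _ y] allI impI)
      fix t assume t: "\<bar>t\<bar> \<le> T"
      have "K \<le> min_distance f k y" by (rule x0[OF y(1)])
      also have "\<dots> \<le> pretentious_sum f k y t"
        using min_distance_attained[OF y(3), of f k] t lny by force
      also have "\<dots> = (\<Sum>p | p \<in> prime_ideals \<and> ideal_norm p \<le> y.
        (1 - Re (F {#p#} * exp (- \<i> * of_real (ln (real (ideal_norm p)) * t)))) / real (ideal_norm p))"
        unfolding pretentious_sum_def of_nat_le_iff
      proof (rule sum.cong[OF refl])
        fix p assume "p \<in> {P \<in> prime_ideals. ideal_norm P \<le> y}"
        then have p: "p \<in> prime_ideals" by simp
        have "of_nat (ideal_norm p) powr (- (\<i> * of_real t)) = exp (- \<i> * of_real (ln (real (ideal_norm p)) * t))"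
          using gp.N_ge_2[OF p] Ln_of_nat[of "ideal_norm p"] by (simp add: powr_def mult_ac)
        then show "(1 - Re (f p * ideal_lambda k p * of_nat (ideal_norm p) powr (- (\<i> * of_real t)))) / real (ideal_norm p)
            = (1 - Re (F {#p#} * exp (- \<i> * of_real (ln (real (ideal_norm p)) * t)))) / real (ideal_norm p)"
          by (simp add: F_def ideal_of_single[OF p])
      qed
      finally show "K \<le> (\<Sum>p | p \<in> prime_ideals \<and> ideal_norm p \<le> y.
        (1 - Re (F {#p#} * exp (- \<i> * of_real (ln (real (ideal_norm p)) * t)))) / real (ideal_norm p))" .
    qed
  qed
  then show ?thesis unfolding F_def sum_MSle[where F = "\<lambda>I. f I * ideal_lambda k I"] .
qed

section \<open>Laurent polynomials on the unit circle\<close>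

inductive trig :: "(complex \<Rightarrow> complex) \<Rightarrow> bool" where
  trig_mono: "trig (\<lambda>w. c * w powi k)"
| trig_add: "trig \<phi> \<Longrightarrow> trig \<psi> \<Longrightarrow> trig (\<lambda>w. \<phi> w + \<psi> w)"

text \<open>Integer exponents add only away from 0, so the product is matched by a Laurent
  polynomial on the circle instead of as a function on the plane.\<close>

lemma trig_mult:
  assumes "trig \<phi>" "trig \<psi>"
  shows "\<exists>\<xi>. trig \<xi> \<and> (\<forall>w. norm w = 1 \<longrightarrow> \<xi> w = \<phi> w * \<psi> w)"
  using assms
proof (induction arbitrary: \<psi>)
  case (trig_mono c k)
  from trig_mono show ?case
  proof induction
    case (trig_mono d l)
    show ?case
    proof (intro exI[of _ "\<lambda>w. (c * d) * w powi (k + l)"] conjI trig.trig_mono allI impI)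
      fix w :: complex assume "norm w = 1"
      then have "w \<noteq> 0" by auto
      then show "c * d * w powi (k + l) = c * w powi k * (d * w powi l)" by (simp add: power_int_add)
    qed
  next
    case (trig_add \<phi> \<psi>)
    then obtain \<xi> \<zeta> where "trig \<xi>" "trig \<zeta>" "\<forall>w. norm w = 1 \<longrightarrow> \<xi> w = c * w powi k * \<phi> w"
      "\<forall>w. norm w = 1 \<longrightarrow> \<zeta> w = c * w powi k * \<psi> w" by blast
    then show ?case
      by (intro exI[of _ "\<lambda>w. \<xi> w + \<zeta> w"] conjI trig.trig_add) (auto simp: distrib_left)
  qed
next
  case (trig_add \<phi> \<eta>)
  obtain \<xi> \<zeta> where "trig \<xi>" "trig \<zeta>" "\<forall>w. norm w = 1 \<longrightarrow> \<xi> w = \<phi> w * \<psi> w"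
      "\<forall>w. norm w = 1 \<longrightarrow> \<zeta> w = \<eta> w * \<psi> w" using trig_add.IH[OF trig_add.prems] by blast
  then show ?case
    by (intro exI[of _ "\<lambda>w. \<xi> w + \<zeta> w"] conjI trig.trig_add) (auto simp: distrib_right)
qed

text \<open>On the circle the conjugate is the inverse, so Re w and Im w are (w + 1/w) / 2 and (w -
  1/w) / (2 i). Stone--Weierstrass provides real polynomials in these coordinates.\<close>

lemma real_polynomial_trig:
  fixes p :: "complex \<Rightarrow> real"
  assumes "real_polynomial_function p"
  shows "\<exists>\<xi>. trig \<xi> \<and> (\<forall>w. norm w = 1 \<longrightarrow> \<xi> w = of_real (p w))"
  using assms
proof induction
  case (linear h)
  interpret bounded_linear h by (rule linear)
  define a b where "a = complex_of_real (h 1)" and "b = complex_of_real (h \<i>)"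
  have "(a / 2 + b / (2 * \<i>)) * w powi 1 + (a / 2 - b / (2 * \<i>)) * w powi (-1) = of_real (h w)" if w: "norm w = 1" for w
  proof -
    have "w = Re w *\<^sub>R 1 + Im w *\<^sub>R \<i>" by (simp add: complex_eq_iff)
    then have hw: "h w = Re w * h 1 + Im w * h \<i>" by (metis add real_scaleR_def scale)
    have "w * cnj w = 1" using w complex_norm_square[of w] by simp
    then have "inverse w = cnj w" by (rule inverse_unique)
    then have i: "w powi (-1) = cnj w" by (simp add: power_int_minus)
    have "(a / 2 + b / (2 * \<i>)) * w + (a / 2 - b / (2 * \<i>)) * cnj w = a * ((w + cnj w) / 2) + b * ((w - cnj w) / (2 * \<i>))"
      by (simp add: field_simps)
    also have "(w + cnj w) / 2 = of_real (Re w)" by (simp add: complex_add_cnj)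
    also have "(w - cnj w) / (2 * \<i>) = of_real (Im w)"
      by (simp add: complex_diff_cnj) (simp add: complex_eq_iff)
    finally show ?thesis unfolding i hw by (simp add: a_def b_def mult.commute)
  qed
  then show ?case
    by (intro exI[of _ "\<lambda>w. (a / 2 + b / (2 * \<i>)) * w powi 1 + (a / 2 - b / (2 * \<i>)) * w powi (-1)"] conjI trig_add trig_mono) auto
next
  case (const c)
  show ?case by (intro exI[of _ "\<lambda>w. of_real c * w powi 0"] conjI trig_mono) auto
next
  case (add f g)
  then obtain \<xi> \<zeta> where "trig \<xi>" "trig \<zeta>" "\<forall>w. norm w = 1 \<longrightarrow> \<xi> w = of_real (f w)"
      "\<forall>w. norm w = 1 \<longrightarrow> \<zeta> w = of_real (g w)" by blast
  then show ?case by (intro exI[of _ "\<lambda>w. \<xi> w + \<zeta> w"] conjI trig_add) auto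
next
  case (mult f g)
  then obtain \<xi> \<zeta> where x: "trig \<xi>" "trig \<zeta>" "\<forall>w. norm w = 1 \<longrightarrow> \<xi> w = of_real (f w)"
      "\<forall>w. norm w = 1 \<longrightarrow> \<zeta> w = of_real (g w)" by blast
  obtain \<eta> where "trig \<eta>" "\<forall>w. norm w = 1 \<longrightarrow> \<eta> w = \<xi> w * \<zeta> w" using trig_mult[OF x(1,2)] by blast
  then show ?case using x by (intro exI[of _ \<eta>]) auto
qed

lemma ideal_lambda_1_cis: "ideal_lambda 1 I = cis (4 * ideal_arg I)"
  by (simp add: ideal_lambda_def cis_conv_exp mult_ac)

text \<open>\<open>c0\<close> is the constant coefficient. It is characterised by the integral over
  a period, so that it can later be compared with the length of the arc; both assertions are linear
  and pass through the induction together.\<close>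

lemma trig_mean:
  assumes "trig \<phi>" and lim: "\<And>k. k \<noteq> 0 \<Longrightarrow> (\<lambda>n. (\<Sum>I\<in>ideals_le n. f I * ideal_lambda k I) / of_nat n) \<longlonglongrightarrow> 0"
  shows "\<exists>c0. ((\<lambda>\<theta>. \<phi> (cis (4 * \<theta>))) has_integral c0 * of_real (pi / 2)) {0..pi / 2} \<and>
    (\<lambda>n. (\<Sum>I\<in>ideals_le n. f I * \<phi> (ideal_lambda 1 I)) / of_nat n - c0 * ((\<Sum>I\<in>ideals_le n. f I) / of_nat n)) \<longlonglongrightarrow> 0"
  using assms(1)
proof induction
  case (trig_mono c k)
  have s: "(\<Sum>I\<in>ideals_le n. f I * (c * (ideal_lambda 1 I) powi k)) = c * (\<Sum>I\<in>ideals_le n. f I * ideal_lambda k I)" for n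
    unfolding sum_distrib_left using ideal_lambda_power[of _ k]
    by (intro sum.cong refl) (auto simp: ideals_le_def mult_ac)
  show ?case
  proof (cases "k = 0")
    case True
    have "((\<lambda>\<theta>. c) has_integral (pi / 2) *\<^sub>R c) {0..pi / 2}" using has_integral_const_real[of c 0 "pi / 2"] by simp
    then have "((\<lambda>\<theta>. c * cis (4 * \<theta>) powi k) has_integral c * of_real (pi / 2)) {0..pi / 2}"
      using True by (simp add: scaleR_conv_of_real mult.commute)
    moreover have "(\<lambda>n. c * (\<Sum>I\<in>ideals_le n. f I * ideal_lambda k I) / of_nat n - c * ((\<Sum>I\<in>ideals_le n. f I) / of_nat n)) = (\<lambda>n. 0)"
      using True by (simp add: ideal_lambda_def)
    ultimately show ?thesis unfolding s by (intro exI[of _ c] conjI) simp_all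
  next
    case False
    define r where "r = 4 * real_of_int k"
    have r: "r \<noteq> 0" using False by (simp add: r_def)
    have eq: "c * cis (4 * \<theta>) powi k = c * cis (r * \<theta>)" for \<theta> :: real
      by (simp add: cis_power_int r_def mult_ac)
    have "((\<lambda>\<theta>. c * cis (r * \<theta>)) has_integral
        (c * cis (r * (pi / 2)) / (\<i> * r) - c * cis (r * 0) / (\<i> * r))) {0..pi / 2}"
    proof (rule fundamental_theorem_of_calculus)
      fix x :: real
      have "((\<lambda>z. c * exp (\<i> * of_real r * z) / (\<i> * of_real r)) has_field_derivative c * exp (\<i> * of_real r * of_real x)) (at (of_real x))"
        using r by (auto intro!: derivative_eq_intros simp: field_simps)
      from has_vector_derivative_real_field[OF this]
      show "((\<lambda>\<theta>. c * cis (r * \<theta>) / (\<i> * r)) has_vector_derivative c * cis (r * x)) (at x within {0..pi / 2})"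
        by (simp add: cis_conv_exp mult_ac)
    qed simp
    \<comment> \<open>The interval from 0 to pi/2 is a full period of the fourfold angle, so
      nonconstant monomials integrate to 0.\<close>
    moreover have "cis (r * (pi / 2)) = 1"
    proof -
      have "r * (pi / 2) = 2 * pi * of_int k" by (simp add: r_def)
      then show ?thesis by (simp only: cis_multiple_2pi Ints_of_int)
    qed
    ultimately have "((\<lambda>\<theta>. c * cis (4 * \<theta>) powi k) has_integral 0 * of_real (pi / 2)) {0..pi / 2}"
      by (simp add: eq)
    moreover have "(\<lambda>n. c * ((\<Sum>I\<in>ideals_le n. f I * ideal_lambda k I) / of_nat n)) \<longlonglongrightarrow> c * 0"
      by (intro tendsto_mult tendsto_const lim False)
    ultimately show ?thesis unfolding s by (intro exI[of _ 0]) simp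
  qed
next
  case (trig_add \<phi> \<psi>)
  then obtain c d where c: "((\<lambda>\<theta>. \<phi> (cis (4 * \<theta>))) has_integral c * of_real (pi / 2)) {0..pi / 2}"
      "(\<lambda>n. (\<Sum>I\<in>ideals_le n. f I * \<phi> (ideal_lambda 1 I)) / of_nat n - c * ((\<Sum>I\<in>ideals_le n. f I) / of_nat n)) \<longlonglongrightarrow> 0"
    and d: "((\<lambda>\<theta>. \<psi> (cis (4 * \<theta>))) has_integral d * of_real (pi / 2)) {0..pi / 2}"
      "(\<lambda>n. (\<Sum>I\<in>ideals_le n. f I * \<psi> (ideal_lambda 1 I)) / of_nat n - d * ((\<Sum>I\<in>ideals_le n. f I) / of_nat n)) \<longlonglongrightarrow> 0"
    by blast
  have "((\<lambda>\<theta>. \<phi> (cis (4 * \<theta>)) + \<psi> (cis (4 * \<theta>))) has_integral (c + d) * of_real (pi / 2)) {0..pi / 2}"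
    using has_integral_add[OF c(1) d(1)] by (simp only: distrib_right)
  moreover have "(\<lambda>n. (\<Sum>I\<in>ideals_le n. f I * (\<phi> (ideal_lambda 1 I) + \<psi> (ideal_lambda 1 I))) / of_nat n - (c + d) * ((\<Sum>I\<in>ideals_le n. f I) / of_nat n)) \<longlonglongrightarrow> 0"
    using tendsto_add[OF c(2) d(2)] by (simp add: distrib_left sum.distrib add_divide_distrib distrib_right algebra_simps)
  ultimately show ?case by blast
qed

section \<open>Restriction to a sector\<close>

lemma ideal_arg_range:
  assumes "I \<in> nonzero_ideals"
  shows "0 \<le> ideal_arg I" "ideal_arg I < pi / 2"
  using theI'[OF ideal_gen_unique[OF assms]] by (auto simp: ideal_arg_def ideal_gen_def)

lemma card_ideals_le_bound: "real (card (ideals_le n)) \<le> (quarter_disc + 1) * real n"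
proof -
  have "sqrt (real n) \<le> real n"
    by (rule real_le_lsqrt) (simp_all add: power2_eq_square flip: of_nat_mult)
  then show ?thesis using card_FQ[of n] unfolding card_ideals_le by (simp add: distrib_right abs_le_iff)
qed

lemma card_ideals_near:
  assumes "0 \<le> \<theta>" "\<theta> \<le> pi / 2" "0 \<le> \<delta>" "\<delta> \<le> 1" "n \<ge> 1"
  shows "real (card {I \<in> ideals_le n. \<bar>ideal_arg I - \<theta>\<bar> \<le> \<delta>}) \<le> 4 * \<delta> * real n + 6 * sqrt (real n)"
proof -
  have "{I \<in> ideals_le n. \<bar>ideal_arg I - \<theta>\<bar> \<le> \<delta>} = {I \<in> nonzero_ideals. ideal_norm I \<le> n \<and> \<bar>ideal_arg I - \<theta>\<bar> \<le> \<delta>}"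
    by (auto simp: ideals_le_def)
  then have "real (card {I \<in> ideals_le n. \<bar>ideal_arg I - \<theta>\<bar> \<le> \<delta>}) \<le> (sqrt n + 1) * (4 * (\<delta> * sqrt n) + 1)"
    using card_ideals_FQ[of n "\<lambda>t. \<bar>t - \<theta>\<bar> \<le> \<delta>"] card_sector[OF assms(1-3), of n] by simp
  also have "\<dots> = 4 * \<delta> * (sqrt n * sqrt n) + sqrt n + 4 * (\<delta> * sqrt n) + 1" by (simp add: algebra_simps)
  also have "\<dots> \<le> 4 * \<delta> * real n + sqrt n + 4 * (1 * sqrt n) + sqrt n"
    using assms by (intro add_mono mult_left_mono mult_right_mono) auto
  finally show ?thesis by simp
qed

text \<open>Urysohn's lemma on the circle between the images of the complement of (a, b) and of the
  interval shortened by \<delta>. The fourfold angle identifies only 0 and pi/2, neither of which is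
  interior to (a, b), so the two images stay disjoint.\<close>

lemma arc_cutoff:
  assumes "0 \<le> a" "b \<le> pi / 2" "0 < \<delta>"
  obtains \<psi> :: "complex \<Rightarrow> real" where "continuous_on UNIV \<psi>" "\<And>w. 0 \<le> \<psi> w \<and> \<psi> w \<le> 1"
    "\<And>\<theta>. 0 \<le> \<theta> \<Longrightarrow> \<theta> \<le> pi / 2 \<Longrightarrow> \<theta> \<le> a \<or> b \<le> \<theta> \<Longrightarrow> \<psi> (cis (4 * \<theta>)) = 0"
    "\<And>\<theta>. a + \<delta> \<le> \<theta> \<Longrightarrow> \<theta> \<le> b - \<delta> \<Longrightarrow> \<psi> (cis (4 * \<theta>)) = 1"
proof -
  define S where "S = (\<lambda>\<theta>. cis (4 * \<theta>)) ` ({0..pi / 2} \<inter> ({..a} \<union> {b..}))"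
  define T where "T = (\<lambda>\<theta>. cis (4 * \<theta>)) ` {a + \<delta>..b - \<delta>}"
  have cont: "continuous_on A (\<lambda>\<theta>. cis (4 * \<theta>))" for A unfolding cis_conv_exp by (intro continuous_intros)
  have "compact ({0..pi / 2} \<inter> ({..a} \<union> {b..}))" by (rule compact_Int_closed) (auto intro: closed_Un)
  then have "closed S" unfolding S_def by (intro compact_imp_closed compact_continuous_image cont)
  moreover have "closed T" unfolding T_def
    by (intro compact_imp_closed compact_continuous_image cont) auto
  moreover have "S \<inter> T = {}"
  proof (rule ccontr)
    assume "S \<inter> T \<noteq> {}"
    then obtain w where "w \<in> S" "w \<in> T" by blast
    then obtain \<theta> \<phi> where "\<theta> \<in> {0..pi / 2} \<inter> ({..a} \<union> {b..})" "\<phi> \<in> {a + \<delta>..b - \<delta>}"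
      and eq: "cis (4 * \<theta>) = cis (4 * \<phi>)" unfolding S_def T_def by blast
    then have \<theta>: "0 \<le> \<theta>" "\<theta> \<le> pi / 2" "\<theta> \<le> a \<or> b \<le> \<theta>" and \<phi>: "a + \<delta> \<le> \<phi>" "\<phi> \<le> b - \<delta>" by auto
    from eq have "sin (4 * \<theta>) = sin (4 * \<phi>) \<and> cos (4 * \<theta>) = cos (4 * \<phi>)" by (simp add: complex_eq_iff)
    then obtain k :: int where k: "4 * \<theta> = 4 * \<phi> + 2 * pi * of_int k" unfolding sin_cos_eq_iff by blast
    \<comment> \<open>\<phi> keeps the distance \<delta> from both ends of the quarter period, so 4
      \<theta> and 4 \<phi> differ by less than a full turn.\<close>
    have "pi * of_int k < pi * 1" "pi * (- 1) < pi * of_int k" using k \<theta> \<phi> assms by linarith+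
    then have "real_of_int k < 1" "- 1 < real_of_int k" by (simp_all only: mult_less_cancel_left_pos[OF pi_gt_zero])
    then have "k = 0" by linarith
    then show False using k \<theta> \<phi> assms by auto
  qed
  ultimately obtain \<psi> :: "complex \<Rightarrow> real" where \<psi>: "continuous_on UNIV \<psi>" "\<And>w. \<psi> w \<in> closed_segment 0 1"
    "\<And>w. w \<in> S \<Longrightarrow> \<psi> w = 0" "\<And>w. w \<in> T \<Longrightarrow> \<psi> w = 1"
    using Urysohn[of S T "0 :: real" 1] by metis
  show ?thesis
  proof (rule that[OF \<psi>(1)])
    show "0 \<le> \<psi> w \<and> \<psi> w \<le> 1" for w using \<psi>(2)[of w] by (simp add: closed_segment_eq_real_ivl)
    show "\<psi> (cis (4 * \<theta>)) = 0" if "0 \<le> \<theta>" "\<theta> \<le> pi / 2" "\<theta> \<le> a \<or> b \<le> \<theta>" for \<theta>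
      using that by (intro \<psi>(3)) (auto simp: S_def)
    show "\<psi> (cis (4 * \<theta>)) = 1" if "a + \<delta> \<le> \<theta>" "\<theta> \<le> b - \<delta>" for \<theta>
      using that by (intro \<psi>(4)) (auto simp: T_def)
  qed
qed

lemma has_integral_step:
  assumes "0 \<le> u" "u \<le> v" "v \<le> (c :: real)"
  shows "((\<lambda>t. if t \<in> {u..v} then 1 else 0) has_integral (v - u)) {0..c}"
proof -
  have sub: "{u..v} \<subseteq> {0..c}" using assms by auto
  have "((\<lambda>t. 1 :: real) has_integral (v - u)) {u..v}" using has_integral_const_real[of "1 :: real" u v] assms by simp
  then show ?thesis by (subst has_integral_restrict[OF sub])
qed

text \<open>The cutoff lies between the indicators of the shortened and the full interval, so its
  integral is within 2 \<delta> of b - a. The polynomial approximation adds at most \<delta> times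
  the length of the period.\<close>

lemma arc_approximation:
  assumes ab: "0 \<le> a" "b \<le> pi / 2" and \<delta>: "0 < \<delta>" "2 * \<delta> < b - a"
  obtains \<psi> :: "complex \<Rightarrow> real" and \<xi> where "trig \<xi>" "\<And>w. norm w = 1 \<Longrightarrow> norm (of_real (\<psi> w) - \<xi> w) \<le> \<delta>"
    "\<And>w. 0 \<le> \<psi> w \<and> \<psi> w \<le> 1"
    "\<And>\<theta>. 0 \<le> \<theta> \<Longrightarrow> \<theta> \<le> pi / 2 \<Longrightarrow> \<theta> \<le> a \<or> b \<le> \<theta> \<Longrightarrow> \<psi> (cis (4 * \<theta>)) = 0"
    "\<And>\<theta>. a + \<delta> \<le> \<theta> \<Longrightarrow> \<theta> \<le> b - \<delta> \<Longrightarrow> \<psi> (cis (4 * \<theta>)) = 1"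
    "\<And>c0. ((\<lambda>\<theta>. \<xi> (cis (4 * \<theta>))) has_integral c0 * of_real (pi / 2)) {0..pi / 2} \<Longrightarrow>
       norm (c0 - of_real ((b - a) / (pi / 2))) \<le> 3 * \<delta>"
proof -
  obtain \<psi> :: "complex \<Rightarrow> real" where \<psi>: "continuous_on UNIV \<psi>" "\<And>w. 0 \<le> \<psi> w \<and> \<psi> w \<le> 1"
    "\<And>\<theta>. 0 \<le> \<theta> \<Longrightarrow> \<theta> \<le> pi / 2 \<Longrightarrow> \<theta> \<le> a \<or> b \<le> \<theta> \<Longrightarrow> \<psi> (cis (4 * \<theta>)) = 0"
    "\<And>\<theta>. a + \<delta> \<le> \<theta> \<Longrightarrow> \<theta> \<le> b - \<delta> \<Longrightarrow> \<psi> (cis (4 * \<theta>)) = 1"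
    using arc_cutoff[OF ab \<delta>(1)] by metis
  obtain p where p: "real_polynomial_function p" "\<And>w. w \<in> sphere 0 1 \<Longrightarrow> \<bar>\<psi> w - p w\<bar> < \<delta>"
    using Stone_Weierstrass_real_polynomial_function[OF compact_sphere continuous_on_subset[OF \<psi>(1)] \<delta>(1)] by (metis subset_UNIV)
  obtain \<xi> where \<xi>: "trig \<xi>" "\<And>w. norm w = 1 \<Longrightarrow> \<xi> w = of_real (p w)"
    using real_polynomial_trig[OF p(1)] by blast
  have close: "norm (of_real (\<psi> w) - \<xi> w) \<le> \<delta>" if "norm w = 1" for w
  proof -
    have "of_real (\<psi> w) - \<xi> w = of_real (\<psi> w - p w)" using \<xi>(2)[OF that] by simp
    then show ?thesis using p(2)[of w] that by (simp only: norm_of_real) simp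
  qed
  have c0: "norm (c0 - of_real ((b - a) / (pi / 2))) \<le> 3 * \<delta>"
    if h: "((\<lambda>\<theta>. \<xi> (cis (4 * \<theta>))) has_integral c0 * of_real (pi / 2)) {0..pi / 2}" for c0
  proof -
    define J where "J = integral {0..pi / 2} (\<lambda>\<theta>. \<psi> (cis (4 * \<theta>)))"
    have "continuous_on {0..pi / 2} (\<lambda>\<theta>. \<psi> (cis (4 * \<theta>)))"
    proof (rule continuous_on_compose2[OF \<psi>(1)])
      show "continuous_on {0..pi / 2} (\<lambda>\<theta>. cis (4 * \<theta>))" unfolding cis_conv_exp by (intro continuous_intros)
    qed simp
    then have J: "((\<lambda>\<theta>. \<psi> (cis (4 * \<theta>))) has_integral J) {0..pi / 2}"
      unfolding J_def by (intro integrable_integral integrable_continuous_real)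
    have "J \<le> b - a"
    proof (rule has_integral_le[OF J has_integral_step[of a b]])
      show "\<psi> (cis (4 * \<theta>)) \<le> (if \<theta> \<in> {a..b} then 1 else 0)" if "\<theta> \<in> {0..pi / 2}" for \<theta>
        using \<psi>(2)[of "cis (4 * \<theta>)"] \<psi>(3)[of \<theta>] that by auto
    qed (use ab \<delta> in auto)
    moreover have "(b - \<delta>) - (a + \<delta>) \<le> J"
    proof (rule has_integral_le[OF has_integral_step[of "a + \<delta>" "b - \<delta>"] J])
      show "(if \<theta> \<in> {a + \<delta>..b - \<delta>} then 1 else 0) \<le> \<psi> (cis (4 * \<theta>))" for \<theta>
        using \<psi>(2)[of "cis (4 * \<theta>)"] \<psi>(4)[of \<theta>] by auto
    qed (use ab \<delta> in auto)
    ultimately have Jb: "\<bar>J - (b - a)\<bar> \<le> 2 * \<delta>" using \<delta> by linarith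
    have "((\<lambda>\<theta>. complex_of_real (\<psi> (cis (4 * \<theta>)))) has_integral of_real J) {0..pi / 2}"
      using has_integral_linear[OF J bounded_linear_of_real] by (simp only: o_def)
    from has_integral_diff[OF this h]
    have "((\<lambda>\<theta>. of_real (\<psi> (cis (4 * \<theta>))) - \<xi> (cis (4 * \<theta>))) has_integral of_real J - c0 * of_real (pi / 2)) (cbox 0 (pi / 2))"
      by (simp only: cbox_interval)
    from has_integral_bound[OF _ this, of \<delta>]
    have "norm (of_real J - c0 * of_real (pi / 2)) \<le> \<delta> * (pi / 2)" using \<delta> close by simp
    moreover have "norm (of_real J - of_real (b - a) :: complex) \<le> 2 * \<delta>"
      using Jb by (simp only: norm_of_real of_real_diff[symmetric])
    moreover have eq: "c0 * of_real (pi / 2) - of_real (b - a)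
        = (of_real J - of_real (b - a)) - (of_real J - c0 * of_real (pi / 2))" by simp
    ultimately have "norm (c0 * of_real (pi / 2) - of_real (b - a)) \<le> \<delta> * (pi / 2) + 2 * \<delta>"
      unfolding eq using norm_triangle_ineq4[of "of_real J - of_real (b - a)" "of_real J - c0 * of_real (pi / 2)"] by linarith
    \<comment> \<open>2 \<delta> is at most 2 \<delta> (pi / 2), because pi / 2 exceeds 1.\<close>
    also have "\<dots> \<le> 3 * \<delta> * (pi / 2)" using pi_gt3 \<delta> by (simp add: algebra_simps)
    finally have *: "norm (c0 * of_real (pi / 2) - of_real (b - a)) \<le> 3 * \<delta> * (pi / 2)" .
    have "c0 * of_real (pi / 2) - of_real (b - a) = (c0 - of_real ((b - a) / (pi / 2))) * of_real (pi / 2)"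
      by (simp add: field_simps)
    then have "norm (c0 - of_real ((b - a) / (pi / 2))) * (pi / 2) \<le> 3 * \<delta> * (pi / 2)"
      using * by (simp only: norm_mult norm_of_real) simp
    then show ?thesis by (rule mult_right_le_imp_le) simp
  qed
  show ?thesis by (rule that[OF \<xi>(1) close \<psi>(2-4) c0])
qed

text \<open>As f is complex, the indicator cannot be squeezed between a majorant and a minorant. Its
  difference from the cutoff is instead bounded in absolute value, by the number of ideals with
  argument within \<delta> of an endpoint; this is the purpose of the sector count.\<close>

lemma equidistribution:
  fixes f :: "complex set \<Rightarrow> complex"
  assumes f_le: "\<And>I. I \<in> nonzero_ideals \<Longrightarrow> norm (f I) \<le> 1" and ab: "0 \<le> a" "a < b" "b \<le> pi / 2"
    and lim: "\<And>k. k \<noteq> 0 \<Longrightarrow> (\<lambda>n. (\<Sum>I\<in>ideals_le n. f I * ideal_lambda k I) / of_nat n) \<longlonglongrightarrow> 0"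
    and e: "e > 0"
  shows "\<exists>n0. \<forall>n\<ge>n0. norm ((\<Sum>I | I \<in> ideals_le n \<and> ideal_arg I \<in> {a..<b}. f I)
    - of_real ((b - a) / (pi / 2)) * (\<Sum>I\<in>ideals_le n. f I)) \<le> e * real n"
proof -
  define C where "C = quarter_disc + 1"
  have C: "C > 0" using quarter_disc_pos by (simp add: C_def)
  \<comment> \<open>The four errors are 8 \<delta> n + 12 sqrt n near the endpoints, C \<delta> n
    from the approximation, \<delta> n from the limit, and 3 C \<delta> n from the mean: altogether
    (9 + 4 C) \<delta> n + 12 sqrt n. The bound by (b - a) / 3 keeps the shortened interval
    nonempty.\<close>
  define \<delta> where "\<delta> = min (min 1 ((b - a) / 3)) (e / (2 * (9 + 4 * C)))"
  have \<delta>0: "0 < \<delta>" using ab e C by (simp add: \<delta>_def)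
  have "\<delta> \<le> (b - a) / 3" unfolding \<delta>_def by (intro min.coboundedI1 min.cobounded2)
  then have \<delta>ab: "2 * \<delta> < b - a" using \<delta>0 by argo
  have "\<delta> \<le> 1" "\<delta> \<le> e / (2 * (9 + 4 * C))" by (simp_all add: \<delta>_def min_le_iff_disj)
  then have \<delta>: "0 < \<delta>" "\<delta> \<le> 1" "2 * \<delta> < b - a" "\<delta> \<le> e / (2 * (9 + 4 * C))"
    using \<delta>0 \<delta>ab by simp_all
  have \<delta>e: "(9 + 4 * C) * \<delta> \<le> e / 2" using \<delta>(4) C by (simp add: field_simps)
  obtain \<psi> :: "complex \<Rightarrow> real" and \<xi> where \<xi>: "trig \<xi>" "\<And>w. norm w = 1 \<Longrightarrow> norm (of_real (\<psi> w) - \<xi> w) \<le> \<delta>"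
    and \<psi>: "\<And>w. 0 \<le> \<psi> w \<and> \<psi> w \<le> 1"
      "\<And>\<theta>. 0 \<le> \<theta> \<Longrightarrow> \<theta> \<le> pi / 2 \<Longrightarrow> \<theta> \<le> a \<or> b \<le> \<theta> \<Longrightarrow> \<psi> (cis (4 * \<theta>)) = 0"
      "\<And>\<theta>. a + \<delta> \<le> \<theta> \<Longrightarrow> \<theta> \<le> b - \<delta> \<Longrightarrow> \<psi> (cis (4 * \<theta>)) = 1"
    and mean: "\<And>c0. ((\<lambda>\<theta>. \<xi> (cis (4 * \<theta>))) has_integral c0 * of_real (pi / 2)) {0..pi / 2} \<Longrightarrow>
       norm (c0 - of_real ((b - a) / (pi / 2))) \<le> 3 * \<delta>"
  proof (rule arc_approximation[OF ab(1,3) \<delta>(1,3)], goal_cases)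
    case (1 \<psi> \<xi>)
    show ?case by (rule 1(1)[OF 1(2-7)])
  qed
  obtain c0 where c0: "((\<lambda>\<theta>. \<xi> (cis (4 * \<theta>))) has_integral c0 * of_real (pi / 2)) {0..pi / 2}"
    and c0_lim: "(\<lambda>n. (\<Sum>I\<in>ideals_le n. f I * \<xi> (ideal_lambda 1 I)) / of_nat n - c0 * ((\<Sum>I\<in>ideals_le n. f I) / of_nat n)) \<longlonglongrightarrow> 0"
    using trig_mean[OF \<xi>(1) lim] by blast
  define d :: complex where "d = of_real ((b - a) / (pi / 2))"
  have c0d: "norm (c0 - d) \<le> 3 * \<delta>" unfolding d_def by (rule mean[OF c0])
  obtain n1 where n1: "\<And>n. n \<ge> n1 \<Longrightarrow>
      norm ((\<Sum>I\<in>ideals_le n. f I * \<xi> (ideal_lambda 1 I)) / of_nat n - c0 * ((\<Sum>I\<in>ideals_le n. f I) / of_nat n)) < \<delta>"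
    using LIMSEQ_D[OF c0_lim \<delta>(1)] by auto
  \<comment> \<open>From here on 24 / e \<le> sqrt n, which makes 12 sqrt n at most e n / 2.\<close>
  define n2 where "n2 = nat \<lceil>(24 / e)\<^sup>2\<rceil>"
  have "norm ((\<Sum>I | I \<in> ideals_le n \<and> ideal_arg I \<in> {a..<b}. f I) - d * (\<Sum>I\<in>ideals_le n. f I)) \<le> e * real n"
    if n: "n \<ge> max 1 (max n1 n2)" for n
  proof -
    define A where "A = ideals_le n"
    define S where "S = (\<Sum>I\<in>A. f I)"
    define W where "W = (\<Sum>I\<in>A. f I * \<xi> (ideal_lambda 1 I))"
    define u where "u I = ideal_lambda 1 I" for I
    define ch :: "complex set \<Rightarrow> real" where "ch I = (if ideal_arg I \<in> {a..<b} then 1 else 0)" for I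
    define near :: "real \<Rightarrow> complex set \<Rightarrow> real" where "near t I = (if \<bar>ideal_arg I - t\<bar> \<le> \<delta> then 1 else 0)" for t I
    have finA: "finite A" unfolding A_def by (rule finite_ideals_le_nat)
    have AI: "I \<in> nonzero_ideals" if "I \<in> A" for I using that by (simp add: A_def ideals_le_def)
    have cardA: "real (card A) \<le> C * real n" unfolding A_def C_def by (rule card_ideals_le_bound)
    have u: "u I = cis (4 * ideal_arg I)" "norm (u I) = 1" for I by (simp_all add: u_def ideal_lambda_1_cis)
    have "(\<Sum>I | I \<in> A \<and> ideal_arg I \<in> {a..<b}. f I) = (\<Sum>I\<in>A. if ideal_arg I \<in> {a..<b} then f I else 0)"
      using sum.inter_filter[OF finA, of f "\<lambda>I. ideal_arg I \<in> {a..<b}"] by simp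
    also have "\<dots> = (\<Sum>I\<in>A. f I * of_real (ch I))" by (intro sum.cong) (auto simp: ch_def)
    also have "\<dots> = (\<Sum>I\<in>A. f I * of_real (ch I - \<psi> (u I))) + (\<Sum>I\<in>A. f I * (of_real (\<psi> (u I)) - \<xi> (u I))) + W"
      unfolding W_def u_def sum.distrib[symmetric] by (intro sum.cong) (auto simp: algebra_simps)
    finally have split: "(\<Sum>I | I \<in> A \<and> ideal_arg I \<in> {a..<b}. f I) - d * S =
        (\<Sum>I\<in>A. f I * of_real (ch I - \<psi> (u I))) + (\<Sum>I\<in>A. f I * (of_real (\<psi> (u I)) - \<xi> (u I))) + (W - c0 * S) + (c0 - d) * S"
      by (simp add: algebra_simps)
    have near: "(\<Sum>I\<in>A. near t I) \<le> 4 * \<delta> * real n + 6 * sqrt (real n)" if "0 \<le> t" "t \<le> pi / 2" for t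
    proof -
      have "(\<Sum>I\<in>A. near t I) = real (card {I \<in> A. \<bar>ideal_arg I - t\<bar> \<le> \<delta>})"
        unfolding near_def using sum.inter_filter[OF finA, of "\<lambda>_. 1 :: real" "\<lambda>I. \<bar>ideal_arg I - t\<bar> \<le> \<delta>"] by simp
      then show ?thesis using card_ideals_near[OF that, of \<delta> n] \<delta> n by (simp add: A_def)
    qed
    have "norm (\<Sum>I\<in>A. f I * of_real (ch I - \<psi> (u I))) \<le> (\<Sum>I\<in>A. near a I + near b I)"
    proof (rule sum_norm_le)
      fix I assume I: "I \<in> A"
      have r: "0 \<le> ideal_arg I" "ideal_arg I \<le> pi / 2" using ideal_arg_range[OF AI[OF I]] by auto
      have "\<bar>ch I - \<psi> (u I)\<bar> \<le> near a I + near b I"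
      \<comment> \<open>Inside the two windows indicator and cutoff both lie in [0, 1]; outside they
        coincide. The windows are closed and contain the endpoints.\<close>
      proof (cases "\<bar>ideal_arg I - a\<bar> \<le> \<delta> \<or> \<bar>ideal_arg I - b\<bar> \<le> \<delta>")
        case True
        then show ?thesis using \<psi>(1)[of "u I"] by (auto simp: near_def ch_def)
      next
        case False
        show ?thesis
        proof (cases "ideal_arg I \<in> {a..<b}")
          case True
          then have "a + \<delta> \<le> ideal_arg I" "ideal_arg I \<le> b - \<delta>" using False by auto
          then show ?thesis using \<psi>(3)[of "ideal_arg I"] True by (simp add: u near_def ch_def)
        next
          case out: False
          then have "ideal_arg I \<le> a \<or> b \<le> ideal_arg I" by auto
          then show ?thesis using \<psi>(2)[OF r] out by (simp add: u near_def ch_def)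
        qed
      qed
      moreover have "norm (f I) * \<bar>ch I - \<psi> (u I)\<bar> \<le> 1 * \<bar>ch I - \<psi> (u I)\<bar>"
        using f_le[OF AI[OF I]] by (intro mult_right_mono) auto
      ultimately show "norm (f I * of_real (ch I - \<psi> (u I))) \<le> near a I + near b I"
        unfolding norm_mult norm_of_real mult_1_left by (rule order_trans[rotated])
    qed
    also have "\<dots> \<le> 8 * \<delta> * real n + 12 * sqrt (real n)"
      using near[of a] near[of b] ab by (simp add: sum.distrib)
    finally have 1: "norm (\<Sum>I\<in>A. f I * of_real (ch I - \<psi> (u I))) \<le> 8 * \<delta> * real n + 12 * sqrt (real n)" .
    have "norm (\<Sum>I\<in>A. f I * (of_real (\<psi> (u I)) - \<xi> (u I))) \<le> real (card A) * \<delta>"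
    proof (rule sum_norm_bound)
      fix I assume I: "I \<in> A"
      have "norm (f I) * norm (of_real (\<psi> (u I)) - \<xi> (u I)) \<le> 1 * \<delta>"
        using f_le[OF AI[OF I]] \<xi>(2)[OF u(2), of I] by (intro mult_mono) auto
      then show "norm (f I * (of_real (\<psi> (u I)) - \<xi> (u I))) \<le> \<delta>" by (simp only: norm_mult)
    qed
    also have "\<dots> \<le> C * real n * \<delta>" using cardA \<delta> by (intro mult_right_mono) auto
    finally have 2: "norm (\<Sum>I\<in>A. f I * (of_real (\<psi> (u I)) - \<xi> (u I))) \<le> C * real n * \<delta>" .
    have "W - c0 * S = of_nat n * (W / of_nat n - c0 * (S / of_nat n))" using n by (simp add: field_simps)
    then have "norm (W - c0 * S) = real n * norm (W / of_nat n - c0 * (S / of_nat n))" by (simp only: norm_mult norm_of_nat)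
    also have "\<dots> \<le> real n * \<delta>" using n1[of n] n by (intro mult_left_mono) (auto simp: W_def S_def A_def)
    finally have 3: "norm (W - c0 * S) \<le> real n * \<delta>" .
    have "norm S \<le> real (card A) * 1" unfolding S_def by (rule sum_norm_bound) (rule f_le[OF AI])
    then have "norm S \<le> C * real n" using cardA by simp
    then have 4: "norm ((c0 - d) * S) \<le> 3 * \<delta> * (C * real n)"
      unfolding norm_mult using c0d \<delta> by (intro mult_mono) auto
    have "(24 / e)\<^sup>2 \<le> real n" using n unfolding n2_def by linarith
    then have "24 / e \<le> sqrt (real n)" by (rule real_le_rsqrt)
    then have "24 / e * sqrt (real n) \<le> sqrt (real n) * sqrt (real n)" by (intro mult_right_mono) auto
    then have sq: "12 * sqrt (real n) \<le> e / 2 * real n" using e by (simp add: field_simps)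
    have "norm ((\<Sum>I | I \<in> A \<and> ideal_arg I \<in> {a..<b}. f I) - d * S)
        \<le> (8 * \<delta> * real n + 12 * sqrt (real n)) + C * real n * \<delta> + real n * \<delta> + 3 * \<delta> * (C * real n)"
      unfolding split by (intro norm_triangle_mono 1 2 3 4)
    also have "\<dots> = (9 + 4 * C) * \<delta> * real n + 12 * sqrt (real n)" by (simp add: algebra_simps)
    also have "\<dots> \<le> e / 2 * real n + e / 2 * real n" by (intro add_mono mult_right_mono \<delta>e sq) auto
    finally show ?thesis by (simp add: S_def A_def)
  qed
  then show ?thesis unfolding d_def by blast
qed

section \<open>Passage from integers to real x and conclusion\<close>

lemma smallo_floor:
  fixes F :: "nat \<Rightarrow> complex" and G :: "real \<Rightarrow> complex"
  assumes "\<And>e. e > 0 \<Longrightarrow> \<exists>n0. \<forall>n\<ge>n0. norm (F n) \<le> e * real n"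
    and G: "\<And>x. x \<ge> 0 \<Longrightarrow> G x = F (nat \<lfloor>x\<rfloor>)"
  shows "G \<in> o[at_top](\<lambda>x. of_real x)"
proof (rule landau_o.smallI)
  fix c :: real assume c: "c > 0"
  then obtain n0 where n0: "\<And>n. n \<ge> n0 \<Longrightarrow> norm (F n) \<le> c * real n" using assms(1) by blast
  show "eventually (\<lambda>x. norm (G x) \<le> c * norm (of_real x :: complex)) at_top"
  proof (rule eventually_at_top_linorderI[of "real n0"])
    fix x assume x: "real n0 \<le> x"
    then have x0: "x \<ge> 0" using of_nat_0_le_iff[of n0] by linarith
    have "norm (G x) \<le> c * real (nat \<lfloor>x\<rfloor>)" unfolding G[OF x0] by (rule n0) (rule le_nat_floor[OF x])
    also have "\<dots> \<le> c * x" using c of_nat_floor[OF x0] by (intro mult_left_mono) auto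
    finally show "norm (G x) \<le> c * norm (of_real x :: complex)" using x0 by simp
  qed
qed

lemma ideals_le_floor:
  assumes "x \<ge> 0"
  shows "I \<in> nonzero_ideals \<and> real (ideal_norm I) \<le> x \<longleftrightarrow> I \<in> ideals_le (nat \<lfloor>x\<rfloor>)"
proof -
  have "real m \<le> x \<longleftrightarrow> m \<le> nat \<lfloor>x\<rfloor>" for m
  proof
    show "m \<le> nat \<lfloor>x\<rfloor>" if "real m \<le> x" using that by (rule le_nat_floor)
    show "real m \<le> x" if "m \<le> nat \<lfloor>x\<rfloor>" using that of_nat_floor[OF assms] by linarith
  qed
  then show ?thesis by (simp add: ideals_le_def)
qed

theorem theorem1p7:
  fixes f :: "complex set \<Rightarrow> complex" and \<theta>\<^sub>1 \<theta>\<^sub>2 :: real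
  assumes "multiplicative_on_ideals f"
    and "\<And>I. I \<in> nonzero_ideals \<Longrightarrow> norm (f I) \<le> 1"
    and "0 \<le> \<theta>\<^sub>1" and "\<theta>\<^sub>1 \<le> \<theta>\<^sub>2" and "\<theta>\<^sub>2 \<le> pi / 2"
    and "\<And>m::int. m \<noteq> 0 \<Longrightarrow> filterlim (min_distance f m) at_top at_top"
  shows "(\<lambda>x::real.
            (\<Sum>I | I \<in> nonzero_ideals \<and> real (ideal_norm I) \<le> x \<and> ideal_arg I \<in> {\<theta>\<^sub>1..<\<theta>\<^sub>2}. f I)
            - of_real ((\<theta>\<^sub>2 - \<theta>\<^sub>1) / (pi / 2))
              * (\<Sum>I | I \<in> nonzero_ideals \<and> real (ideal_norm I) \<le> x. f I))
           \<in> o[at_top](\<lambda>x. of_real x)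
         \<and> (filterlim (min_distance f 0) at_top at_top \<longrightarrow>
             (\<lambda>x::real. \<Sum>I | I \<in> nonzero_ideals \<and> real (ideal_norm I) \<le> x. f I)
               \<in> o[at_top](\<lambda>x. of_real x)
           \<and> (\<lambda>x::real. \<Sum>I | I \<in> nonzero_ideals \<and> real (ideal_norm I) \<le> x
                              \<and> ideal_arg I \<in> {\<theta>\<^sub>1..<\<theta>\<^sub>2}. f I)
               \<in> o[at_top](\<lambda>x. of_real x))"
proof -
  define d :: complex where "d = of_real ((\<theta>\<^sub>2 - \<theta>\<^sub>1) / (pi / 2))"
  define GJ where "GJ x = (\<Sum>I | I \<in> nonzero_ideals \<and> real (ideal_norm I) \<le> x \<and> ideal_arg I \<in> {\<theta>\<^sub>1..<\<theta>\<^sub>2}. f I)" for x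
  define G where "G x = (\<Sum>I | I \<in> nonzero_ideals \<and> real (ideal_norm I) \<le> x. f I)" for x
  have G: "G x = (\<Sum>I\<in>ideals_le (nat \<lfloor>x\<rfloor>). f I)" if "x \<ge> 0" for x
    unfolding G_def ideals_le_floor[OF that] by simp
  have GJ: "GJ x = (\<Sum>I | I \<in> ideals_le (nat \<lfloor>x\<rfloor>) \<and> ideal_arg I \<in> {\<theta>\<^sub>1..<\<theta>\<^sub>2}. f I)" if "x \<ge> 0" for x
    unfolding GJ_def ideals_le_floor[OF that, symmetric] by (simp only: conj_assoc)
  have lim: "(\<lambda>n. (\<Sum>I\<in>ideals_le n. f I * ideal_lambda k I) / of_nat n) \<longlonglongrightarrow> 0"
    if "filterlim (min_distance f k) at_top at_top" for k
    by (rule halasz_ideals[OF assms(1,2) that])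
  have first: "(\<lambda>x. GJ x - d * G x) \<in> o[at_top](\<lambda>x. of_real x)"
  \<comment> \<open>An empty arc makes both terms zero; \<open>equidistribution\<close> assumes a
    nondegenerate one.\<close>
  proof (cases "\<theta>\<^sub>1 = \<theta>\<^sub>2")
    case True
    then show ?thesis by (simp add: GJ_def d_def)
  next
    case False
    then have less: "\<theta>\<^sub>1 < \<theta>\<^sub>2" using assms(4) by simp
    show ?thesis
    proof (rule smallo_floor)
      fix e :: real assume "e > 0"
      then show "\<exists>n0. \<forall>n\<ge>n0. norm ((\<Sum>I | I \<in> ideals_le n \<and> ideal_arg I \<in> {\<theta>\<^sub>1..<\<theta>\<^sub>2}. f I) - d * (\<Sum>I\<in>ideals_le n. f I)) \<le> e * real n"
        unfolding d_def by (intro equidistribution assms(2,3,5) less lim assms(6))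
    qed (simp add: G GJ)
  qed
  have second: "G \<in> o[at_top](\<lambda>x. of_real x)" if m0: "filterlim (min_distance f 0) at_top at_top"
  proof (rule smallo_floor[where F = "\<lambda>n. \<Sum>I\<in>ideals_le n. f I"])
    fix e :: real assume e: "e > 0"
    have "(\<lambda>n. (\<Sum>I\<in>ideals_le n. f I) / of_nat n) \<longlonglongrightarrow> 0" using lim[OF m0] by (simp add: ideal_lambda_def)
    from LIMSEQ_D[OF this e] obtain n0 where n0: "\<And>n. n \<ge> n0 \<Longrightarrow> norm ((\<Sum>I\<in>ideals_le n. f I) / of_nat n) < e" by auto
    have "norm (\<Sum>I\<in>ideals_le n. f I) \<le> e * real n" if "n \<ge> max 1 n0" for n
      using n0[of n] that by (simp add: norm_divide field_simps)
    then show "\<exists>n0. \<forall>n\<ge>n0. norm (\<Sum>I\<in>ideals_le n. f I) \<le> e * real n" by blast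
  qed (rule G)
  \<comment> \<open>The sector sum is its discrepancy plus a constant multiple of the full sum, and
    both are o(x).\<close>
  have third: "GJ \<in> o[at_top](\<lambda>x. of_real x)" if G0: "G \<in> o[at_top](\<lambda>x. of_real x)"
  proof -
    have "(\<lambda>x. d * G x) \<in> o[at_top](\<lambda>x. of_real x)" using G0 by (cases "d = 0") simp_all
    from sum_in_smallo(1)[OF first this] show ?thesis by simp
  qed
  show ?thesis using first second third unfolding GJ_def G_def d_def by blast
qed

end
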